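(* Let $G$ be a finite group and let $R$ be a $G$-Tambara functor such that the ring $R(G/e)$ is Noetherian. Then there exists an isomorphism of $G$-Tambara functors $$R\cong \prod_{H\subset G}\mathrm{Coind}_H^G R_H,$$ the product being indexed by subgroups $H$ of $G$, such that each $R_H$ is a clarified $H$-Tambara functor.
   Context: Rings are commutative with unit; a $G$-ring is a ring with an action of $G$ by ring automorphisms. Let $\mathrm{bispan}(G\text{-}\mathrm{Set}^{\mathrm{fin}})$ be the category whose objects are finite $G$-sets and whose morphisms from $X$ to $Y$ are isomorphism classes of diagrams $X\leftarrow A\to B\to Y$ of finite $G$-sets, with the usual composition of bispans (polynomials), defined via pullbacks and exponential diagrams. A $G$-Tambara functor is a product-preserving functor $R:\mathrm{bispan}(G\text{-}\mathrm{Set}^{\mathrm{fin}})\to \mathrm{Set}$ such that the additive monoid $R(X)$ is a group for each finite $G$-set $X$; morphisms are natural transformations. Transfer (image of $X\sqcup X= X\sqcup X= X\sqcup X\to X$) and norm (image of $X\sqcup X= X\sqcup X\to X= X$) along the fold map give addition and multiplication, making $R(X)$ a commutative ring. $R(G/e)$ is a $G$-ring via $\mathrm{Aut}_G(G/e)\cong G$. Products of Tambara functors are computed levelwise. The same definitions apply to every finite group. The zero Tambara functor is allowed. For $H\subset G$ and an $H$-Tambara functor $T$, $\mathrm{Coind}_H^G T := T\circ \mathrm{res}_H^G$, i.e. $(\mathrm{Coind}_H^G T)(X)=T(\mathrm{res}_H^G X)$, where $\mathrm{res}_H^G$ sends a $G$-set to its underlying $H$-set. An idempotent $d$ of a $G$-ring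 is of type $K$ (for a subgroup $K\subset G$) if its isotropy group is $K$ and $d\cdot gd=0$ whenever $g\notin K$. A $G$-ring is clarified if it contains no idempotent of type $K$ for any proper subgroup $K$ of $G$. A $G$-Tambara functor $R$ is clarified if the $G$-ring $R(G/e)$ is clarified (and similarly for $H$-Tambara functors, using $H/e$ and proper subgroups of $H$). *)

theory Defs
  imports "HOL-Algebra.Group_Action" "HOL-Algebra.Ring_Divisibility" "HOL-Library.FSet"
begin

section \<open>Finite \<open>G\<close>-sets\<close>

text \<open>
  The points of all \<open>G\<close>-sets are taken from one type, which contains the elements of \<open>G\<close> and is
  closed under pairs, tagging (for disjoint unions) and graphs of functions between finite sets
  (for dependent products). This type is infinite, so every finite \<open>G\<close>-set is isomorphic to one
  with points in it.
\<close>

datatype 'g pt =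
    Elt 'g
  | Tup (pfst: "'g pt") (psnd: "'g pt")
  | In1 "'g pt"
  | In2 "'g pt"
  | Graph (edges: "('g pt \<times> 'g pt) fset")

record 'g gset =
  pts :: "'g pt set"
  act :: "'g \<Rightarrow> 'g pt \<Rightarrow> 'g pt"

text \<open>
  The values \<open>act X g\<close> for \<open>g\<close> outside the carrier are irrelevant. Consequently a \<open>G\<close>-set, read over
  \<open>G\<lparr>carrier := H\<rparr>\<close>, is its own restriction to the subgroup \<open>H\<close>.
\<close>

definition fin_gset :: "('g, 'b) monoid_scheme \<Rightarrow> 'g gset \<Rightarrow> bool" where
  "fin_gset G X \<longleftrightarrow> finite (pts X) \<and> group_action G (pts X) (act X)"

definition gmap :: "('g, 'b) monoid_scheme \<Rightarrow> 'g gset \<Rightarrow> 'g gset \<Rightarrow> ('g pt \<Rightarrow> 'g pt) \<Rightarrow> bool" where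
  "gmap G X Y f \<longleftrightarrow> f \<in> pts X \<rightarrow> pts Y \<and>
     (\<forall>g\<in>carrier G. \<forall>x\<in>pts X. f (act X g x) = act Y g (f x))"

text \<open>Actions are extensional on the points, as \<^const>\<open>BijGroup\<close> demands.\<close>

definition mk_gset :: "'g pt set \<Rightarrow> ('g \<Rightarrow> 'g pt \<Rightarrow> 'g pt) \<Rightarrow> 'g gset" where
  "mk_gset S a = \<lparr>pts = S, act = (\<lambda>g. \<lambda>x\<in>S. a g x)\<rparr>"

definition empty_gset :: "'g gset" where
  "empty_gset = mk_gset {} (\<lambda>g x. x)"

fun sum_act :: "('g \<Rightarrow> 'g pt \<Rightarrow> 'g pt) \<Rightarrow> ('g \<Rightarrow> 'g pt \<Rightarrow> 'g pt) \<Rightarrow> 'g \<Rightarrow> 'g pt \<Rightarrow> 'g pt" where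
  "sum_act a b g (In1 x) = In1 (a g x)"
| "sum_act a b g (In2 y) = In2 (b g y)"
| "sum_act a b g z = z"

definition sum_gset :: "'g gset \<Rightarrow> 'g gset \<Rightarrow> 'g gset" where
  "sum_gset X Y = mk_gset (In1 ` pts X \<union> In2 ` pts Y) (sum_act (act X) (act Y))"

fun fold_map :: "'g pt \<Rightarrow> 'g pt" where
  "fold_map (In1 x) = x"
| "fold_map (In2 x) = x"
| "fold_map z = z"

definition pullback :: "'g gset \<Rightarrow> ('g pt \<Rightarrow> 'g pt) \<Rightarrow> 'g gset \<Rightarrow> ('g pt \<Rightarrow> 'g pt) \<Rightarrow> 'g gset" where
  "pullback X f Y k = mk_gset {Tup x y | x y. x \<in> pts X \<and> y \<in> pts Y \<and> f x = k y}
     (\<lambda>g z. Tup (act X g (pfst z)) (act Y g (psnd z)))"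

definition graph_on :: "'g pt set \<Rightarrow> ('g pt \<Rightarrow> 'g pt) \<Rightarrow> 'g pt" where
  "graph_on S \<sigma> = Graph (Abs_fset ((\<lambda>c. (c, \<sigma> c)) ` S))"

definition app :: "'g pt \<Rightarrow> 'g pt \<Rightarrow> 'g pt" where
  "app s c = (THE e. (c, e) |\<in>| edges s)"

text \<open>
  For \<open>p : E \<rightarrow> C\<close> and \<open>t : C \<rightarrow> D\<close>, the dependent product \<open>\<Pi>\<^sub>t E\<close>: pairs of a point \<open>d\<close> of \<open>D\<close> and
  a section of \<open>p\<close> over the fibre of \<open>t\<close> at \<open>d\<close>, with \<open>G\<close> acting by conjugation on sections. The
  exponential diagram of \<open>p\<close> and \<open>t\<close> is
  \<open>C \<leftarrow> E \<leftarrow> \<Pi>\<^sub>t E \<times>\<^sub>D C \<rightarrow> \<Pi>\<^sub>t E \<rightarrow> D\<close>, whose second map is evaluation.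
\<close>

definition dep_prod ::
  "'g gset \<Rightarrow> 'g gset \<Rightarrow> 'g gset \<Rightarrow> ('g pt \<Rightarrow> 'g pt) \<Rightarrow> ('g pt \<Rightarrow> 'g pt) \<Rightarrow> 'g gset" where
  "dep_prod E C D p t = mk_gset
     {Tup d (graph_on {c \<in> pts C. t c = d} \<sigma>) | d \<sigma>.
        d \<in> pts D \<and> (\<forall>c\<in>pts C. t c = d \<longrightarrow> \<sigma> c \<in> pts E \<and> p (\<sigma> c) = c)}
     (\<lambda>g z. Tup (act D g (pfst z))
        (Graph ((\<lambda>(c, e). (act C g c, act E g e)) |`| edges (psnd z))))"

definition eval_map :: "'g pt \<Rightarrow> 'g pt" where
  "eval_map z = app (psnd (pfst z)) (psnd z)"

text \<open>The \<open>G\<close>-set \<open>G/e\<close>, and the automorphism \<open>x \<mapsto> x g\<close> of it.\<close>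

definition free_orbit :: "('g, 'b) monoid_scheme \<Rightarrow> 'g gset" where
  "free_orbit G = mk_gset (Elt ` carrier G) (\<lambda>g z. case z of Elt x \<Rightarrow> Elt (g \<otimes>\<^bsub>G\<^esub> x) | _ \<Rightarrow> z)"

definition right_mult :: "('g, 'b) monoid_scheme \<Rightarrow> 'g \<Rightarrow> 'g pt \<Rightarrow> 'g pt" where
  "right_mult G g z = (case z of Elt x \<Rightarrow> Elt (x \<otimes>\<^bsub>G\<^esub> g) | _ \<Rightarrow> z)"


section \<open>The category of bispans\<close>

text \<open>A diagram \<open>X \<leftarrow> A \<rightarrow> B \<rightarrow> Y\<close>.\<close>

record 'g bispan =
  bX :: "'g gset"
  bA :: "'g gset"
  bB :: "'g gset"
  bY :: "'g gset"
  bres :: "'g pt \<Rightarrow> 'g pt"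
  bnorm :: "'g pt \<Rightarrow> 'g pt"
  btr :: "'g pt \<Rightarrow> 'g pt"

definition is_bispan :: "('g, 'b) monoid_scheme \<Rightarrow> 'g bispan \<Rightarrow> bool" where
  "is_bispan G P \<longleftrightarrow>
     fin_gset G (bX P) \<and> fin_gset G (bA P) \<and> fin_gset G (bB P) \<and> fin_gset G (bY P) \<and>
     gmap G (bA P) (bX P) (bres P) \<and> gmap G (bA P) (bB P) (bnorm P) \<and>
     gmap G (bB P) (bY P) (btr P)"

definition bispan_iso :: "('g, 'b) monoid_scheme \<Rightarrow> 'g bispan \<Rightarrow> 'g bispan \<Rightarrow> bool" where
  "bispan_iso G P Q \<longleftrightarrow> bX P = bX Q \<and> bY P = bY Q \<and>
     (\<exists>\<alpha> \<beta>. gmap G (bA P) (bA Q) \<alpha> \<and> bij_betw \<alpha> (pts (bA P)) (pts (bA Q)) \<and>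
            gmap G (bB P) (bB Q) \<beta> \<and> bij_betw \<beta> (pts (bB P)) (pts (bB Q)) \<and>
            (\<forall>a\<in>pts (bA P). bres Q (\<alpha> a) = bres P a \<and> bnorm Q (\<alpha> a) = \<beta> (bnorm P a)) \<and>
            (\<forall>b\<in>pts (bB P). btr Q (\<beta> b) = btr P b))"

definition bispan_rel :: "('g, 'b) monoid_scheme \<Rightarrow> ('g bispan \<times> 'g bispan) set" where
  "bispan_rel G = {(P, Q). is_bispan G P \<and> is_bispan G Q \<and> bispan_iso G P Q}"

definition bclass :: "('g, 'b) monoid_scheme \<Rightarrow> 'g bispan \<Rightarrow> 'g bispan set" where
  "bclass G P = bispan_rel G `` {P}"

definition bhom :: "('g, 'b) monoid_scheme \<Rightarrow> 'g gset \<Rightarrow> 'g gset \<Rightarrow> 'g bispan set set" where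
  "bhom G X Y = {P. is_bispan G P \<and> bX P = X \<and> bY P = Y} // bispan_rel G"

definition res_bispan :: "'g gset \<Rightarrow> 'g gset \<Rightarrow> ('g pt \<Rightarrow> 'g pt) \<Rightarrow> 'g bispan" where
  "res_bispan X Y f =
     \<lparr>bX = Y, bA = X, bB = X, bY = X, bres = f, bnorm = (\<lambda>x. x), btr = (\<lambda>x. x)\<rparr>"

definition norm_bispan :: "'g gset \<Rightarrow> 'g gset \<Rightarrow> ('g pt \<Rightarrow> 'g pt) \<Rightarrow> 'g bispan" where
  "norm_bispan X Y f =
     \<lparr>bX = X, bA = X, bB = Y, bY = Y, bres = (\<lambda>x. x), bnorm = f, btr = (\<lambda>x. x)\<rparr>"

definition tr_bispan :: "'g gset \<Rightarrow> 'g gset \<Rightarrow> ('g pt \<Rightarrow> 'g pt) \<Rightarrow> 'g bispan" where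
  "tr_bispan X Y f =
     \<lparr>bX = X, bA = X, bB = X, bY = Y, bres = (\<lambda>x. x), bnorm = (\<lambda>x. x), btr = f\<rparr>"

definition id_bispan :: "'g gset \<Rightarrow> 'g bispan" where
  "id_bispan X =
     \<lparr>bX = X, bA = X, bB = X, bY = X, bres = (\<lambda>x. x), bnorm = (\<lambda>x. x), btr = (\<lambda>x. x)\<rparr>"

text \<open>
  The composite \<open>Q \<circ> P\<close> of \<open>P = (X \<leftarrow> A \<rightarrow> B \<rightarrow> Y)\<close> and \<open>Q = (Y \<leftarrow> C \<rightarrow> D \<rightarrow> Z)\<close> is
  \<open>X \<leftarrow> A \<times>\<^sub>B F \<rightarrow> D' \<rightarrow> Z\<close>, where \<open>E = B \<times>\<^sub>Y C\<close>, \<open>D' = \<Pi>\<^sub>D E\<close> is the dependent product of \<open>E\<close> along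
  \<open>C \<rightarrow> D\<close>, \<open>F = D' \<times>\<^sub>D C\<close>, and the map \<open>F \<rightarrow> B\<close> is evaluation \<open>F \<rightarrow> E\<close> followed by the projection.
\<close>

definition bispan_comp :: "'g bispan \<Rightarrow> 'g bispan \<Rightarrow> 'g bispan" where
  "bispan_comp Q P =
     (let E = pullback (bB P) (btr P) (bA Q) (bres Q);
          D' = dep_prod E (bA Q) (bB Q) psnd (bnorm Q);
          F = pullback D' pfst (bA Q) (bnorm Q);
          A' = pullback (bA P) (bnorm P) F (\<lambda>z. pfst (eval_map z))
      in \<lparr>bX = bX P, bA = A', bB = D', bY = bY Q,
          bres = (\<lambda>w. bres P (pfst w)),
          bnorm = (\<lambda>w. pfst (psnd w)),
          btr = (\<lambda>z. btr Q (pfst z))\<rparr>)"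

definition bcomp :: "('g, 'b) monoid_scheme \<Rightarrow> 'g bispan set \<Rightarrow> 'g bispan set \<Rightarrow> 'g bispan set" where
  "bcomp G n m = (\<Union>Q\<in>n. \<Union>P\<in>m. bclass G (bispan_comp Q P))"

definition is_terminal :: "('g, 'b) monoid_scheme \<Rightarrow> 'g gset \<Rightarrow> bool" where
  "is_terminal G T \<longleftrightarrow> fin_gset G T \<and> (\<forall>W. fin_gset G W \<longrightarrow> (\<exists>!m. m \<in> bhom G W T))"

definition is_product :: "('g, 'b) monoid_scheme \<Rightarrow> 'g gset \<Rightarrow> 'g gset \<Rightarrow> 'g gset \<Rightarrow>
    'g bispan set \<Rightarrow> 'g bispan set \<Rightarrow> bool" where
  "is_product G X Y Z p q \<longleftrightarrow>
     fin_gset G X \<and> fin_gset G Y \<and> fin_gset G Z \<and> p \<in> bhom G Z X \<and> q \<in> bhom G Z Y \<and>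
     (\<forall>W m n. fin_gset G W \<and> m \<in> bhom G W X \<and> n \<in> bhom G W Y \<longrightarrow>
        (\<exists>!h. h \<in> bhom G W Z \<and> bcomp G p h = m \<and> bcomp G q h = n))"


section \<open>Tambara functors\<close>

text \<open>Functors from bispans to sets with elements of type \<open>'r\<close>.\<close>

record ('g, 'r) bifunctor =
  obj :: "'g gset \<Rightarrow> 'r set"
  mor :: "'g bispan set \<Rightarrow> 'r \<Rightarrow> 'r"

definition is_functor :: "('g, 'b) monoid_scheme \<Rightarrow> ('g, 'r) bifunctor \<Rightarrow> bool" where
  "is_functor G R \<longleftrightarrow>
     (\<forall>X Y m. fin_gset G X \<and> fin_gset G Y \<and> m \<in> bhom G X Y \<longrightarrow> mor R m \<in> obj R X \<rightarrow> obj R Y) \<and>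
     (\<forall>X. fin_gset G X \<longrightarrow> (\<forall>x\<in>obj R X. mor R (bclass G (id_bispan X)) x = x)) \<and>
     (\<forall>X Y Z m n. fin_gset G X \<and> fin_gset G Y \<and> fin_gset G Z \<and>
        m \<in> bhom G X Y \<and> n \<in> bhom G Y Z \<longrightarrow>
        (\<forall>x\<in>obj R X. mor R (bcomp G n m) x = mor R n (mor R m x)))"

definition product_preserving :: "('g, 'b) monoid_scheme \<Rightarrow> ('g, 'r) bifunctor \<Rightarrow> bool" where
  "product_preserving G R \<longleftrightarrow>
     (\<forall>T. is_terminal G T \<longrightarrow> (\<exists>x. obj R T = {x})) \<and>
     (\<forall>X Y Z p q. is_product G X Y Z p q \<longrightarrow>
        bij_betw (\<lambda>z. (mor R p z, mor R q z)) (obj R Z) (obj R X \<times> obj R Y))"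

text \<open>The element of \<open>R(X \<squnion> X)\<close> that corresponds to \<open>(a, b)\<close>, and the element of \<open>R(\<emptyset>)\<close>.\<close>

definition copair :: "('g, 'b) monoid_scheme \<Rightarrow> ('g, 'r) bifunctor \<Rightarrow> 'g gset \<Rightarrow> 'r \<Rightarrow> 'r \<Rightarrow> 'r" where
  "copair G R X a b = (THE z. z \<in> obj R (sum_gset X X) \<and>
     mor R (bclass G (res_bispan X (sum_gset X X) In1)) z = a \<and>
     mor R (bclass G (res_bispan X (sum_gset X X) In2)) z = b)"

definition base_pt :: "('g, 'r) bifunctor \<Rightarrow> 'r" where
  "base_pt R = (THE z. z \<in> obj R empty_gset)"

definition tambara_ring :: "('g, 'b) monoid_scheme \<Rightarrow> ('g, 'r) bifunctor \<Rightarrow> 'g gset \<Rightarrow> 'r ring" where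
  "tambara_ring G R X =
     \<lparr>carrier = obj R X,
      monoid.mult = (\<lambda>a b. mor R (bclass G (norm_bispan (sum_gset X X) X fold_map)) (copair G R X a b)),
      one = mor R (bclass G (norm_bispan empty_gset X (\<lambda>x. x))) (base_pt R),
      zero = mor R (bclass G (tr_bispan empty_gset X (\<lambda>x. x))) (base_pt R),
      add = (\<lambda>a b. mor R (bclass G (tr_bispan (sum_gset X X) X fold_map)) (copair G R X a b))\<rparr>"

definition tambara_functor :: "('g, 'b) monoid_scheme \<Rightarrow> ('g, 'r) bifunctor \<Rightarrow> bool" where
  "tambara_functor G R \<longleftrightarrow> is_functor G R \<and> product_preserving G R \<and>
     (\<forall>X. fin_gset G X \<longrightarrow> group (add_monoid (tambara_ring G R X)))"

definition natural_trans ::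
  "('g, 'b) monoid_scheme \<Rightarrow> ('g, 'r) bifunctor \<Rightarrow> ('g, 's) bifunctor \<Rightarrow> ('g gset \<Rightarrow> 'r \<Rightarrow> 's) \<Rightarrow> bool" where
  "natural_trans G R S \<eta> \<longleftrightarrow>
     (\<forall>X. fin_gset G X \<longrightarrow> \<eta> X \<in> obj R X \<rightarrow> obj S X) \<and>
     (\<forall>X Y m. fin_gset G X \<and> fin_gset G Y \<and> m \<in> bhom G X Y \<longrightarrow>
        (\<forall>x\<in>obj R X. \<eta> Y (mor R m x) = mor S m (\<eta> X x)))"

definition tambara_iso ::
  "('g, 'b) monoid_scheme \<Rightarrow> ('g, 'r) bifunctor \<Rightarrow> ('g, 's) bifunctor \<Rightarrow> bool" where
  "tambara_iso G R S \<longleftrightarrow> (\<exists>\<eta> \<theta>. natural_trans G R S \<eta> \<and> natural_trans G S R \<theta> \<and>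
     (\<forall>X. fin_gset G X \<longrightarrow>
        (\<forall>x\<in>obj R X. \<theta> X (\<eta> X x) = x) \<and> (\<forall>y\<in>obj S X. \<eta> X (\<theta> X y) = y)))"

definition tambara_prod :: "'i set \<Rightarrow> ('i \<Rightarrow> ('g, 'r) bifunctor) \<Rightarrow> ('g, 'i \<Rightarrow> 'r) bifunctor" where
  "tambara_prod I F =
     \<lparr>obj = (\<lambda>X. \<Pi>\<^sub>E i\<in>I. obj (F i) X), mor = (\<lambda>m z. \<lambda>i\<in>I. mor (F i) m (z i))\<rparr>"

text \<open>
  Restriction of a bispan to \<open>H\<close> does not change the diagram, but the isomorphism class of the
  restriction is formed with respect to \<open>H\<close>-equivariant maps.
\<close>

definition res_class ::
  "('g, 'b) monoid_scheme \<Rightarrow> 'g set \<Rightarrow> 'g bispan set \<Rightarrow> 'g bispan set" where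
  "res_class G H m = (\<Union>P\<in>m. bclass (G\<lparr>carrier := H\<rparr>) P)"

definition coind :: "('g, 'b) monoid_scheme \<Rightarrow> 'g set \<Rightarrow> ('g, 'r) bifunctor \<Rightarrow> ('g, 'r) bifunctor" where
  "coind G H T = \<lparr>obj = (\<lambda>X. obj T X), mor = (\<lambda>m. mor T (res_class G H m))\<rparr>"


section \<open>Clarified Tambara functors\<close>

definition idempotent_of_type ::
  "('g, 'b) monoid_scheme \<Rightarrow> ('r, 'c) ring_scheme \<Rightarrow> ('g \<Rightarrow> 'r \<Rightarrow> 'r) \<Rightarrow> 'g set \<Rightarrow> 'r \<Rightarrow> bool" where
  "idempotent_of_type G S \<phi> K d \<longleftrightarrow>
     d \<in> carrier S \<and> d \<otimes>\<^bsub>S\<^esub> d = d \<and> stabilizer G \<phi> d = K \<and>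
     (\<forall>g\<in>carrier G - K. d \<otimes>\<^bsub>S\<^esub> \<phi> g d = \<zero>\<^bsub>S\<^esub>)"

definition clarified_gring ::
  "('g, 'b) monoid_scheme \<Rightarrow> ('r, 'c) ring_scheme \<Rightarrow> ('g \<Rightarrow> 'r \<Rightarrow> 'r) \<Rightarrow> bool" where
  "clarified_gring G S \<phi> \<longleftrightarrow>
     \<not> (\<exists>K d. subgroup K G \<and> K \<noteq> carrier G \<and> idempotent_of_type G S \<phi> K d)"

text \<open>
  The action of \<open>g\<close> on \<open>R(G/e)\<close> is restriction along \<open>x \<mapsto> x g\<close>, equivalently transfer along
  \<open>x \<mapsto> x g\<inverse>\<close>; this is a left action.
\<close>

definition orbit_action :: "('g, 'b) monoid_scheme \<Rightarrow> ('g, 'r) bifunctor \<Rightarrow> 'g \<Rightarrow> 'r \<Rightarrow> 'r" where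
  "orbit_action G R g =
     mor R (bclass G (res_bispan (free_orbit G) (free_orbit G) (right_mult G g)))"

definition clarified :: "('g, 'b) monoid_scheme \<Rightarrow> ('g, 'r) bifunctor \<Rightarrow> bool" where
  "clarified G R \<longleftrightarrow> clarified_gring G (tambara_ring G R (free_orbit G)) (orbit_action G R)"

end

theory Submission
  imports Defs
begin

text \<open>
  Write \<open>T\<close> for the \<open>G\<close>-set of all left cosets of all subgroups of \<open>G\<close>. The theorem holds because
  \<open>R\<close> can be recovered from its restriction to the \<open>G\<close>-sets \<open>T \<times> X\<close>, cut down by a suitable
  idempotent \<open>D \<in> R(T)\<close>: restriction along \<open>T \<times> X \<rightarrow> X\<close> followed by multiplication with \<open>D\<close> is inverse
  to transfer. As \<open>T \<times> X\<close> is the disjoint union of the \<open>G\<close>-sets \<open>G \<times>\<^sub>H X\<close>, this identifies \<open>R(X)\<close> with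
  the product over all \<open>H\<close> of the ideals \<open>D R(G \<times>\<^sub>H X)\<close>, and \<open>X \<mapsto> D R(G \<times>\<^sub>H X)\<close>, now for \<open>H\<close>-sets
  \<open>X\<close>, is the functor \<open>R\<^sub>H\<close>.

  The idempotent \<open>D\<close> comes from ring theory. A Noetherian ring has finitely many primitive
  idempotents, with sum \<open>1\<close>, and \<open>G\<close> permutes those of \<open>R(G/e)\<close>. Choose one in each orbit and let
  \<open>d\<^sub>H\<close> be the sum of the chosen ones with isotropy group \<open>H\<close>. The translates \<open>g d\<^sub>H\<close>, one for every
  coset \<open>g H\<close>, are orthogonal with sum \<open>1\<close>, and every idempotent below \<open>d\<^sub>H\<close> is fixed by \<open>H\<close>
  (\<open>equivariant_idempotents\<close>). The last property makes \<open>R\<^sub>H\<close> clarified, since \<open>R\<^sub>H(H/e)\<close> is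
  \<open>d\<^sub>H R(G/e)\<close>.

  To pass from \<open>R(G/e)\<close> to \<open>R(T)\<close>, idempotents are lifted by norms. Call an idempotent \<open>z \<in> R(X)\<close>
  good if it is the norm of its restriction to \<open>G/e \<times> X\<close>. Good idempotents are determined by their
  germs, which are their restrictions to \<open>G/e\<close> along the maps \<open>g \<mapsto> g x\<close> (\<open>good_eqI\<close>), and they are
  stable under restrictions, norms and products. So every identity between good idempotents can be
  checked in the ring \<open>R(G/e)\<close>, where a norm is a product over a fibre. That the translates \<open>g d\<^sub>H\<close>
  are the germs of a good \<open>D\<close> with transfer \<open>1\<close> is shown by taking the norm of the equation that says
  that they add up to \<open>1\<close> (\<open>idempotent_realisation\<close>). Orthogonality of the germs gives the inverse
  property of the transfer (\<open>tr_DD_rs\<close> and \<open>DD_rs_tr\<close>). Comparison of germs also shows that \<open>D\<close>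
  absorbs the norm of its restriction (\<open>DD_absorbs_norm\<close>), which makes \<open>R\<^sub>H\<close> functorial.

  All relations between restrictions, norms and transfers come from the composition of bispans. They
  are obtained from a criterion that recognises a composite by its points (locale \<open>composite\<close>). It
  also yields the associativity of composition; this is needed because the product cones that \<open>R\<^sub>H\<close>
  has to preserve are arbitrary, while only disjoint unions can be computed directly.
\<close>

section \<open>Finite G-sets and equivariant maps\<close>

lemma pts_mk_gset [simp]: "pts (mk_gset S a) = S"
  by (simp add: mk_gset_def)

lemma act_mk_gset [simp]: "x \<in> S \<Longrightarrow> act (mk_gset S a) g x = a g x"
  by (simp add: mk_gset_def)

definition gset_map ::
  "('g, 'b) monoid_scheme \<Rightarrow> 'g gset \<Rightarrow> 'g gset \<Rightarrow> ('g pt \<Rightarrow> 'g pt) \<Rightarrow> bool" where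
  "gset_map G X Y f \<longleftrightarrow> fin_gset G X \<and> fin_gset G Y \<and> gmap G X Y f"

lemma gset_mapI:
  assumes "fin_gset G X" and "fin_gset G Y"
    and "\<And>x. x \<in> pts X \<Longrightarrow> f x \<in> pts Y"
    and "\<And>g x. g \<in> carrier G \<Longrightarrow> x \<in> pts X \<Longrightarrow> f (act X g x) = act Y g (f x)"
  shows "gset_map G X Y f"
  using assms by (auto simp: gset_map_def gmap_def)

lemma gset_map_in: "gset_map G X Y f \<Longrightarrow> x \<in> pts X \<Longrightarrow> f x \<in> pts Y"
  and gset_map_act: "gset_map G X Y f \<Longrightarrow> g \<in> carrier G \<Longrightarrow> x \<in> pts X \<Longrightarrow>
    f (act X g x) = act Y g (f x)"
  and gset_map_dom: "gset_map G X Y f \<Longrightarrow> fin_gset G X"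
  and gset_map_cod: "gset_map G X Y f \<Longrightarrow> fin_gset G Y"
  by (auto simp: gset_map_def gmap_def)

lemma gset_map_id: "fin_gset G X \<Longrightarrow> gset_map G X X (\<lambda>x. x)"
  by (auto simp: gset_map_def gmap_def)

lemma gset_map_comp:
  "gset_map G X Y f \<Longrightarrow> gset_map G Y Z k \<Longrightarrow> gset_map G X Z (\<lambda>x. k (f x))"
  by (rule gset_mapI) (auto simp: gset_map_act gset_map_in dest: gset_map_dom gset_map_cod)

lemma gset_map_cong:
  "gset_map G X Y f \<Longrightarrow> (\<And>x. x \<in> pts X \<Longrightarrow> f' x = f x) \<Longrightarrow>
    (\<And>g x. g \<in> carrier G \<Longrightarrow> x \<in> pts X \<Longrightarrow> act X g x \<in> pts X) \<Longrightarrow> gset_map G X Y f'"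
  by (rule gset_mapI) (auto simp: gset_map_act gset_map_in dest: gset_map_dom gset_map_cod)

lemma is_bispan_iff:
  "is_bispan G P \<longleftrightarrow> gset_map G (bA P) (bX P) (bres P) \<and> gset_map G (bA P) (bB P) (bnorm P) \<and>
     gset_map G (bB P) (bY P) (btr P)"
  by (auto simp: is_bispan_def gset_map_def)

context group begin

lemma fin_gset_finite: "fin_gset G X \<Longrightarrow> finite (pts X)"
  by (simp add: fin_gset_def)

lemma act_closed: "fin_gset G X \<Longrightarrow> g \<in> carrier G \<Longrightarrow> x \<in> pts X \<Longrightarrow> act X g x \<in> pts X"
  unfolding fin_gset_def by (metis group_action.element_image)

lemma act_one: "fin_gset G X \<Longrightarrow> x \<in> pts X \<Longrightarrow> act X \<one> x = x"
  unfolding fin_gset_def by (metis group_action.id_eq_one restrict_apply')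

lemma act_mult: "fin_gset G X \<Longrightarrow> g \<in> carrier G \<Longrightarrow> h \<in> carrier G \<Longrightarrow> x \<in> pts X \<Longrightarrow>
    act X (g \<otimes> h) x = act X g (act X h x)"
  unfolding fin_gset_def by (metis group_action.composition_rule)

lemma act_inv1: "fin_gset G X \<Longrightarrow> g \<in> carrier G \<Longrightarrow> x \<in> pts X \<Longrightarrow> act X (inv g) (act X g x) = x"
  by (metis act_mult act_one inv_closed l_inv)

lemma act_inv2: "fin_gset G X \<Longrightarrow> g \<in> carrier G \<Longrightarrow> x \<in> pts X \<Longrightarrow> act X g (act X (inv g) x) = x"
  by (metis act_mult act_one inv_closed r_inv)

text \<open>
  The action on a \<open>G\<close>-set takes values in the group of extensional bijections, which
  the restriction in \<^const>\<open>mk_gset\<close> provides for.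
\<close>

lemma fin_gset_mk_gset:
  assumes fin: "finite S"
    and cl: "\<And>g x. g \<in> carrier G \<Longrightarrow> x \<in> S \<Longrightarrow> a g x \<in> S"
    and one: "\<And>x. x \<in> S \<Longrightarrow> a \<one> x = x"
    and mult: "\<And>g h x. g \<in> carrier G \<Longrightarrow> h \<in> carrier G \<Longrightarrow> x \<in> S \<Longrightarrow> a (g \<otimes> h) x = a g (a h x)"
  shows "fin_gset G (mk_gset S a)"
proof -
  have inv: "a g (a (inv g) x) = x \<and> a (inv g) (a g x) = x" if "g \<in> carrier G" "x \<in> S" for g x
    using that mult[of g "inv g" x] mult[of "inv g" g x] one by simp
  have bij: "(\<lambda>x\<in>S. a g x) \<in> Bij S" if g: "g \<in> carrier G" for g
  proof -
    have "bij_betw (\<lambda>x\<in>S. a g x) S S"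
      by (rule bij_betw_byWitness[where f' = "a (inv g)"]) (use g inv cl in auto)
    then show ?thesis
      by (simp add: Bij_def)
  qed
  have "(\<lambda>g. \<lambda>x\<in>S. a g x) \<in> hom G (BijGroup S)"
  proof (rule homI)
    fix g h assume gh: "g \<in> carrier G" "h \<in> carrier G"
    show "(\<lambda>x\<in>S. a (g \<otimes> h) x) = (\<lambda>x\<in>S. a g x) \<otimes>\<^bsub>BijGroup S\<^esub> (\<lambda>x\<in>S. a h x)"
      using gh bij[OF gh(1)] bij[OF gh(2)] cl mult
      by (auto simp: BijGroup_def compose_def fun_eq_iff)
  qed (auto simp: BijGroup_def bij)
  then show ?thesis
    using fin group_BijGroup
    by (auto simp: fin_gset_def group_action_def group_hom_def group_hom_axioms_def mk_gset_def
        is_group)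
qed

lemma gmap_inv_into:
  assumes "gset_map G X Y f" and "bij_betw f (pts X) (pts Y)"
  shows "gset_map G Y X (inv_into (pts X) f)"
proof (rule gset_mapI)
  fix g y assume g: "g \<in> carrier G" and y: "y \<in> pts Y"
  obtain x where x: "x \<in> pts X" "y = f x"
    using assms(2) y by (auto simp: bij_betw_def)
  have "inv_into (pts X) f (act Y g y) = inv_into (pts X) f (f (act X g x))"
    using assms(1) g x by (simp add: gset_map_act)
  also have "\<dots> = act X g x"
    using assms g x by (meson act_closed bij_betw_inv_into_left gset_map_dom)
  finally show "inv_into (pts X) f (act Y g y) = act X g (inv_into (pts X) f y)"
    using assms(2) x by (simp add: bij_betw_inv_into_left)
qed (use assms in \<open>auto simp: bij_betw_def inv_into_into dest: gset_map_dom gset_map_cod\<close>)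

text \<open>
  Isomorphisms between representatives of a composite arise as relations whose conditions are
  symmetric in both sides; this form avoids proving bijectivity of an explicit map.
\<close>

lemma gset_iso_of_correspondence:
  assumes X: "fin_gset G X" and Y: "fin_gset G Y"
    and total: "\<And>x. x \<in> pts X \<Longrightarrow> \<exists>y\<in>pts Y. r x y" "\<And>y. y \<in> pts Y \<Longrightarrow> \<exists>x\<in>pts X. r x y"
    and unique: "\<And>x y y'. x \<in> pts X \<Longrightarrow> y \<in> pts Y \<Longrightarrow> y' \<in> pts Y \<Longrightarrow> r x y \<Longrightarrow> r x y' \<Longrightarrow> y = y'"
      "\<And>x x' y. x \<in> pts X \<Longrightarrow> x' \<in> pts X \<Longrightarrow> y \<in> pts Y \<Longrightarrow> r x y \<Longrightarrow> r x' y \<Longrightarrow> x = x'"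
    and act: "\<And>g x y. g \<in> carrier G \<Longrightarrow> x \<in> pts X \<Longrightarrow> y \<in> pts Y \<Longrightarrow> r x y \<Longrightarrow> r (act X g x) (act Y g y)"
  shows "\<exists>f. gset_map G X Y f \<and> bij_betw f (pts X) (pts Y) \<and> (\<forall>x\<in>pts X. r x (f x))"
proof -
  obtain f where f: "\<And>x. x \<in> pts X \<Longrightarrow> f x \<in> pts Y \<and> r x (f x)"
    using total(1) by metis
  have "gset_map G X Y f"
  proof (rule gset_mapI[OF X Y])
    fix g x assume "g \<in> carrier G" "x \<in> pts X"
    then show "f (act X g x) = act Y g (f x)"
      using f act unique(1)[of "act X g x"] act_closed X Y by metis
  qed (use f in auto)
  moreover have "inj_on f (pts X)"
    using f unique(2) by (metis inj_onI)
  moreover have "y \<in> f ` pts X" if "y \<in> pts Y" for y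
    using total(2)[OF that] that f unique(1) by blast
  then have "f ` pts X = pts Y"
    using f by blast
  ultimately show ?thesis
    using f by (auto simp: bij_betw_def)
qed

end


section \<open>Isomorphism classes of bispans\<close>

definition bispan_isos ::
  "('g, 'b) monoid_scheme \<Rightarrow> 'g bispan \<Rightarrow> 'g bispan \<Rightarrow> ('g pt \<Rightarrow> 'g pt) \<Rightarrow> ('g pt \<Rightarrow> 'g pt) \<Rightarrow> bool"
  where "bispan_isos G P Q \<alpha> \<beta> \<longleftrightarrow> bX P = bX Q \<and> bY P = bY Q \<and>
    gset_map G (bA P) (bA Q) \<alpha> \<and> bij_betw \<alpha> (pts (bA P)) (pts (bA Q)) \<and>
    gset_map G (bB P) (bB Q) \<beta> \<and> bij_betw \<beta> (pts (bB P)) (pts (bB Q)) \<and>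
    (\<forall>a\<in>pts (bA P). bres Q (\<alpha> a) = bres P a \<and> bnorm Q (\<alpha> a) = \<beta> (bnorm P a)) \<and>
    (\<forall>b\<in>pts (bB P). btr Q (\<beta> b) = btr P b)"

lemma bispan_rel_iff:
  "(P, Q) \<in> bispan_rel G \<longleftrightarrow> is_bispan G P \<and> is_bispan G Q \<and> (\<exists>\<alpha> \<beta>. bispan_isos G P Q \<alpha> \<beta>)"
  by (auto simp: bispan_rel_def bispan_isos_def bispan_iso_def gset_map_def is_bispan_def)

context group begin

lemma bispan_isos_refl: "is_bispan G P \<Longrightarrow> bispan_isos G P P (\<lambda>x. x) (\<lambda>x. x)"
  by (auto simp: bispan_isos_def is_bispan_def gset_map_id bij_betw_def)

lemma bispan_isos_trans:
  assumes "bispan_isos G P Q \<alpha> \<beta>" and "bispan_isos G Q S \<alpha>' \<beta>'"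
  shows "bispan_isos G P S (\<lambda>x. \<alpha>' (\<alpha> x)) (\<lambda>x. \<beta>' (\<beta> x))"
  using assms unfolding bispan_isos_def
  by (auto intro: gset_map_comp bij_betw_trans[unfolded comp_def] simp: gset_map_in)

lemma bispan_isos_sym:
  assumes P: "is_bispan G P" and i: "bispan_isos G P Q \<alpha> \<beta>"
  shows "bispan_isos G Q P (inv_into (pts (bA P)) \<alpha>) (inv_into (pts (bB P)) \<beta>)"
proof -
  have a: "gset_map G (bA P) (bA Q) \<alpha>" "bij_betw \<alpha> (pts (bA P)) (pts (bA Q))"
    and b: "gset_map G (bB P) (bB Q) \<beta>" "bij_betw \<beta> (pts (bB P)) (pts (bB Q))"
    using i by (auto simp: bispan_isos_def)
  have "bres P (inv_into (pts (bA P)) \<alpha> x) = bres Q x \<and>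
     bnorm P (inv_into (pts (bA P)) \<alpha> x) = inv_into (pts (bB P)) \<beta> (bnorm Q x)"
    if x: "x \<in> pts (bA Q)" for x
  proof -
    obtain y where y: "y \<in> pts (bA P)" "x = \<alpha> y"
      using a x by (auto simp: bij_betw_def)
    have "bnorm P y \<in> pts (bB P)"
      using P y by (auto simp: is_bispan_iff gset_map_in)
    then show ?thesis
      using i y a b by (simp add: bispan_isos_def bij_betw_inv_into_left)
  qed
  moreover have "btr P (inv_into (pts (bB P)) \<beta> x) = btr Q x" if x: "x \<in> pts (bB Q)" for x
  proof -
    obtain y where y: "y \<in> pts (bB P)" "x = \<beta> y"
      using b x by (auto simp: bij_betw_def)
    then show ?thesis
      using i b by (simp add: bispan_isos_def bij_betw_inv_into_left)
  qed
  ultimately show ?thesis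
    using i a b gmap_inv_into by (auto simp: bispan_isos_def bij_betw_inv_into)
qed

lemma equiv_bispan_rel: "equiv {P. is_bispan G P} (bispan_rel G)"
proof (rule equivI)
  show "refl_on {P. is_bispan G P} (bispan_rel G)"
    unfolding refl_on_def bispan_rel_iff using bispan_isos_refl by blast
  show "sym (bispan_rel G)"
    unfolding sym_def bispan_rel_iff using bispan_isos_sym by blast
  show "trans (bispan_rel G)"
    unfolding trans_def bispan_rel_iff using bispan_isos_trans by blast
qed (auto simp: bispan_rel_def)

lemma bclass_eq_iff:
  "is_bispan G P \<Longrightarrow> is_bispan G Q \<Longrightarrow>
    bclass G P = bclass G Q \<longleftrightarrow> (\<exists>\<alpha> \<beta>. bispan_isos G P Q \<alpha> \<beta>)"
  unfolding bclass_def
  using eq_equiv_class_iff[OF equiv_bispan_rel, of P Q] by (simp add: bispan_rel_iff)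

lemma bclass_self: "is_bispan G P \<Longrightarrow> P \<in> bclass G P"
  using bispan_isos_refl by (auto simp: bclass_def bispan_rel_iff)

lemma in_bclass: "Q \<in> bclass G P \<longleftrightarrow> is_bispan G P \<and> is_bispan G Q \<and> (\<exists>\<alpha> \<beta>. bispan_isos G P Q \<alpha> \<beta>)"
  by (simp add: bclass_def bispan_rel_iff)

lemma bhom_iff: "m \<in> bhom G X Y \<longleftrightarrow> (\<exists>P. is_bispan G P \<and> bX P = X \<and> bY P = Y \<and> m = bclass G P)"
  by (auto simp: bhom_def quotient_def bclass_def)

lemma bclass_in_bhom: "is_bispan G P \<Longrightarrow> bclass G P \<in> bhom G (bX P) (bY P)"
  by (auto simp: bhom_iff)

text \<open>
  The maps of a bispan are functions on the type of all points; two of them may be exchanged when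
  they agree on the relevant \<open>G\<close>-set.
\<close>

lemma bclass_cong:
  assumes "is_bispan G P"
    and "bX P = bX Q" "bA P = bA Q" "bB P = bB Q" "bY P = bY Q"
    and "\<And>a. a \<in> pts (bA P) \<Longrightarrow> bres P a = bres Q a \<and> bnorm P a = bnorm Q a"
    and "\<And>b. b \<in> pts (bB P) \<Longrightarrow> btr P b = btr Q b"
  shows "bclass G P = bclass G Q"
proof -
  have "is_bispan G Q"
    unfolding is_bispan_iff assms(2-5)[symmetric]
  proof (intro conjI)
    have P: "gset_map G (bA P) (bX P) (bres P)" "gset_map G (bA P) (bB P) (bnorm P)"
      "gset_map G (bB P) (bY P) (btr P)"
      using assms(1) by (auto simp: is_bispan_iff)
    show "gset_map G (bA P) (bX P) (bres Q)"
      using P(1) by (rule gset_map_cong) (use assms(6) P in \<open>auto intro: act_closed dest: gset_map_dom\<close>)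
    show "gset_map G (bA P) (bB P) (bnorm Q)"
      using P(2) by (rule gset_map_cong) (use assms(6) P in \<open>auto intro: act_closed dest: gset_map_dom\<close>)
    show "gset_map G (bB P) (bY P) (btr Q)"
      using P(3) by (rule gset_map_cong) (use assms(7) P in \<open>auto intro: act_closed dest: gset_map_dom\<close>)
  qed
  moreover have "bispan_isos G P Q (\<lambda>x. x) (\<lambda>x. x)"
    using bispan_isos_refl[OF assms(1)] assms by (auto simp: bispan_isos_def)
  ultimately show ?thesis
    using assms(1) bclass_eq_iff by blast
qed

end


section \<open>Recognising composites of bispans\<close>

text \<open>
  A bispan \<open>S\<close> represents the composite of \<open>P = (X \<leftarrow> A \<rightarrow> B \<rightarrow> Y)\<close> and \<open>Q = (Y \<leftarrow> C \<rightarrow> D \<rightarrow> Z)\<close>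
  as soon as its points behave like those of the dependent product and of the pullback: a point
  over \<open>D\<close> is the same as a section into \<open>B\<close> of its fibre in \<open>C\<close> (\<open>base\<close> and \<open>ev\<close> are the two
  components), and a point over \<open>A\<close> is the same as a point of \<open>A\<close>, a section, and an argument at
  which this section takes the value prescribed by the point of \<open>A\<close>. All identities between
  bispans below are instances of this criterion, so that the explicit encoding of sections by
  graphs has to be inspected only once.
\<close>

locale composite = group G for G :: "('g, 'b) monoid_scheme" (structure) +
  fixes P Q S :: "'g bispan" and base :: "'g pt \<Rightarrow> 'g pt" and ev :: "'g pt \<Rightarrow> 'g pt \<Rightarrow> 'g pt"
    and argA argC :: "'g pt \<Rightarrow> 'g pt"
  assumes P: "is_bispan G P" and Q: "is_bispan G Q" and S: "is_bispan G S"
    and objs: "bY P = bX Q" "bX S = bX P" "bY S = bY Q"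
    and base: "gset_map G (bB S) (bB Q) base"
    and ev_in: "\<And>b c. b \<in> pts (bB S) \<Longrightarrow> c \<in> pts (bA Q) \<Longrightarrow> bnorm Q c = base b \<Longrightarrow>
        ev b c \<in> pts (bB P)"
    and ev_over: "\<And>b c. b \<in> pts (bB S) \<Longrightarrow> c \<in> pts (bA Q) \<Longrightarrow> bnorm Q c = base b \<Longrightarrow>
        btr P (ev b c) = bres Q c"
    and ev_act: "\<And>g b c. g \<in> carrier G \<Longrightarrow> b \<in> pts (bB S) \<Longrightarrow> c \<in> pts (bA Q) \<Longrightarrow>
        bnorm Q c = base b \<Longrightarrow> ev (act (bB S) g b) (act (bA Q) g c) = act (bB P) g (ev b c)"
    and section_ex: "\<And>d \<sigma>. d \<in> pts (bB Q) \<Longrightarrow>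
        (\<And>c. c \<in> pts (bA Q) \<Longrightarrow> bnorm Q c = d \<Longrightarrow> \<sigma> c \<in> pts (bB P) \<and> btr P (\<sigma> c) = bres Q c) \<Longrightarrow>
        \<exists>b\<in>pts (bB S). base b = d \<and> (\<forall>c\<in>pts (bA Q). bnorm Q c = d \<longrightarrow> ev b c = \<sigma> c)"
    and section_unique: "\<And>b b'. b \<in> pts (bB S) \<Longrightarrow> b' \<in> pts (bB S) \<Longrightarrow> base b = base b' \<Longrightarrow>
        (\<And>c. c \<in> pts (bA Q) \<Longrightarrow> bnorm Q c = base b \<Longrightarrow> ev b c = ev b' c) \<Longrightarrow> b = b'"
    and argA: "gset_map G (bA S) (bA P) argA" and argC: "gset_map G (bA S) (bA Q) argC"
    and arg_base: "\<And>a. a \<in> pts (bA S) \<Longrightarrow> bnorm Q (argC a) = base (bnorm S a)"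
    and arg_ev: "\<And>a. a \<in> pts (bA S) \<Longrightarrow> bnorm P (argA a) = ev (bnorm S a) (argC a)"
    and arg_ex: "\<And>a b c. a \<in> pts (bA P) \<Longrightarrow> b \<in> pts (bB S) \<Longrightarrow> c \<in> pts (bA Q) \<Longrightarrow>
        bnorm Q c = base b \<Longrightarrow> bnorm P a = ev b c \<Longrightarrow>
        \<exists>a'\<in>pts (bA S). argA a' = a \<and> argC a' = c \<and> bnorm S a' = b"
    and arg_unique: "\<And>a a'. a \<in> pts (bA S) \<Longrightarrow> a' \<in> pts (bA S) \<Longrightarrow> argA a = argA a' \<Longrightarrow>
        argC a = argC a' \<Longrightarrow> bnorm S a = bnorm S a' \<Longrightarrow> a = a'"
    and res_eq: "\<And>a. a \<in> pts (bA S) \<Longrightarrow> bres S a = bres P (argA a)"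
    and tr_eq: "\<And>b. b \<in> pts (bB S) \<Longrightarrow> btr S b = btr Q (base b)"
begin

lemma maps:
  "gset_map G (bA P) (bX P) (bres P)" "gset_map G (bA P) (bB P) (bnorm P)"
  "gset_map G (bB P) (bY P) (btr P)"
  "gset_map G (bA Q) (bX Q) (bres Q)" "gset_map G (bA Q) (bB Q) (bnorm Q)"
  "gset_map G (bB Q) (bY Q) (btr Q)"
  "gset_map G (bA S) (bX S) (bres S)" "gset_map G (bA S) (bB S) (bnorm S)"
  "gset_map G (bB S) (bY S) (btr S)"
  using P Q S by (auto simp: is_bispan_iff)

lemma fins:
  "fin_gset G (bA P)" "fin_gset G (bB P)" "fin_gset G (bA Q)" "fin_gset G (bB Q)"
  "fin_gset G (bA S)" "fin_gset G (bB S)"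
  using P Q S by (auto simp: is_bispan_def)

text \<open>
  A composite of two bispans also represents the composite of isomorphic ones, because only \<open>base\<close>,
  \<open>ev\<close> and the two arguments have to be moved along the isomorphisms. Composition of isomorphism
  classes is therefore independent of representatives.
\<close>

lemma transport:
  assumes "is_bispan G P'" and "is_bispan G Q'"
    and p: "bispan_isos G P P' pA pB" and q: "bispan_isos G Q Q' qA qB"
  shows "composite G P' Q' S (\<lambda>b. qB (base b))
      (\<lambda>b c. pB (ev b (inv_into (pts (bA Q)) qA c))) (\<lambda>a. pA (argA a)) (\<lambda>a. qA (argC a))"
proof -
  let ?i = "inv_into (pts (bA Q)) qA"
  have p': "gset_map G (bA P) (bA P') pA" "bij_betw pA (pts (bA P)) (pts (bA P'))"
    "gset_map G (bB P) (bB P') pB" "bij_betw pB (pts (bB P)) (pts (bB P'))"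
    "bX P = bX P'" "bY P = bY P'"
    "\<And>a. a \<in> pts (bA P) \<Longrightarrow> bres P' (pA a) = bres P a"
    "\<And>a. a \<in> pts (bA P) \<Longrightarrow> bnorm P' (pA a) = pB (bnorm P a)"
    "\<And>b. b \<in> pts (bB P) \<Longrightarrow> btr P' (pB b) = btr P b"
    using p by (auto simp: bispan_isos_def)
  have q': "gset_map G (bA Q) (bA Q') qA" "bij_betw qA (pts (bA Q)) (pts (bA Q'))"
    "gset_map G (bB Q) (bB Q') qB" "bij_betw qB (pts (bB Q)) (pts (bB Q'))"
    "bX Q = bX Q'" "bY Q = bY Q'"
    "\<And>a. a \<in> pts (bA Q) \<Longrightarrow> bres Q' (qA a) = bres Q a"
    "\<And>a. a \<in> pts (bA Q) \<Longrightarrow> bnorm Q' (qA a) = qB (bnorm Q a)"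
    "\<And>b. b \<in> pts (bB Q) \<Longrightarrow> btr Q' (qB b) = btr Q b"
    using q by (auto simp: bispan_isos_def)
  have i: "?i (qA c) = c" if "c \<in> pts (bA Q)" for c
    using that q' by (simp add: bij_betw_inv_into_left)
  have qB_inj: "qB d = qB d' \<longleftrightarrow> d = d'" if "d \<in> pts (bB Q)" "d' \<in> pts (bB Q)" for d d'
    using that q'(4) by (metis bij_betw_inv_into_left)
  have pB_inj: "pB d = pB d' \<longleftrightarrow> d = d'" if "d \<in> pts (bB P)" "d' \<in> pts (bB P)" for d d'
    using that p'(4) by (metis bij_betw_inv_into_left)
  have pA_inj: "pA d = pA d' \<longleftrightarrow> d = d'" if "d \<in> pts (bA P)" "d' \<in> pts (bA P)" for d d'
    using that p'(2) by (metis bij_betw_inv_into_left)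
  have qA_inj: "qA d = qA d' \<longleftrightarrow> d = d'" if "d \<in> pts (bA Q)" "d' \<in> pts (bA Q)" for d d'
    using that q'(2) by (metis bij_betw_inv_into_left)
  have surj: "\<exists>c0\<in>pts (bA Q). c = qA c0" if "c \<in> pts (bA Q')" for c
    using that q'(2) by (auto simp: bij_betw_def)
  have surjB: "\<exists>c0\<in>pts (bB Q). c = qB c0" if "c \<in> pts (bB Q')" for c
    using that q'(4) by (auto simp: bij_betw_def)
  have surjP: "\<exists>c0\<in>pts (bA P). c = pA c0" if "c \<in> pts (bA P')" for c
    using that p'(2) by (auto simp: bij_betw_def)
  have surjPB: "\<exists>c0\<in>pts (bB P). c = pB c0" if "c \<in> pts (bB P')" for c
    using that p'(4) by (auto simp: bij_betw_def)
  have fibre: "bnorm Q' (qA c) = qB d \<longleftrightarrow> bnorm Q c = d" if "c \<in> pts (bA Q)" "d \<in> pts (bB Q)" for c d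
    using that q' qB_inj maps gset_map_in by metis
  note b_in = gset_map_in[OF base]
  show ?thesis
  proof (rule composite.intro, rule is_group, rule composite_axioms.intro, goal_cases)
    case 7 show ?case using gset_map_comp[OF base q'(3)] .
  next
    case (8 b c) then show ?case
      using surj[of c] fibre ev_in b_in i p'(3) by (auto simp: gset_map_in)
  next
    case (9 b c) then show ?case
      using surj[of c] fibre ev_in ev_over b_in i p' q' by (auto simp: gset_map_in)
  next
    case (10 g b c)
    then obtain c0 where c0: "c0 \<in> pts (bA Q)" "c = qA c0" using surj by blast
    then have n: "bnorm Q c0 = base b" using 10 fibre b_in by auto
    have "act (bA Q') g c = qA (act (bA Q) g c0)"
      using c0 10 q'(1) by (simp add: gset_map_act)
    then show ?case
      using 10 c0 n i p'(3) fins by (simp add: ev_act act_closed ev_in gset_map_act)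
  next
    case (11 d \<sigma>)
    obtain d0 where d0: "d0 \<in> pts (bB Q)" "d = qB d0" using 11 surjB by blast
    let ?\<tau> = "\<lambda>c. inv_into (pts (bB P)) pB (\<sigma> (qA c))"
    have \<tau>: "?\<tau> c \<in> pts (bB P) \<and> btr P (?\<tau> c) = bres Q c \<and> pB (?\<tau> c) = \<sigma> (qA c)"
      if c: "c \<in> pts (bA Q)" "bnorm Q c = d0" for c
    proof -
      have s: "\<sigma> (qA c) \<in> pts (bB P')" "btr P' (\<sigma> (qA c)) = bres Q' (qA c)"
        using 11(2)[of "qA c"] c d0 q'(1,8) by (auto simp: gset_map_in)
      then obtain b0 where "b0 \<in> pts (bB P)" "\<sigma> (qA c) = pB b0"
        using surjPB by blast
      then show ?thesis
        using s c p' q' by (simp add: bij_betw_inv_into_left)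
    qed
    obtain b where "b \<in> pts (bB S)" "base b = d0"
      "\<forall>c\<in>pts (bA Q). bnorm Q c = d0 \<longrightarrow> ev b c = ?\<tau> c"
      using section_ex[of d0 ?\<tau>] d0 \<tau> by metis
    then show ?case
      using d0 \<tau> fibre i surj by (intro bexI[of _ b]) force+
  next
    case (12 b b')
    show ?case
    proof (rule section_unique)
      show e: "base b = base b'"
        using 12 b_in qB_inj by blast
      fix c assume c: "c \<in> pts (bA Q)" "bnorm Q c = base b"
      show "ev b c = ev b' c"
        using 12(4)[of "qA c"] 12(1,2) c e i pB_inj ev_in q' by (auto simp: gset_map_in)
    qed (use 12 in auto)
  next
    case (13) show ?case using gset_map_comp[OF argA p'(1)] .
  next
    case (14) show ?case using gset_map_comp[OF argC q'(1)] .
  next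
    case (15 a) then show ?case
      using q' argC arg_base by (simp add: gset_map_in)
  next
    case (16 a) then show ?case
      using p' argC argA arg_ev i by (simp add: gset_map_in)
  next
    case (17 a b c)
    obtain a0 where a0: "a0 \<in> pts (bA P)" "a = pA a0" using 17 surjP by blast
    obtain c0 where c0: "c0 \<in> pts (bA Q)" "c = qA c0" using 17 surj by blast
    have n: "bnorm Q c0 = base b" using 17 c0 fibre b_in by auto
    have "pB (bnorm P a0) = pB (ev b c0)"
      using 17 a0 c0 i p' by simp
    then have "bnorm P a0 = ev b c0"
      using pB_inj a0 ev_in[OF 17(2) c0(1) n] maps(2) gset_map_in by blast
    then show ?case
      using arg_ex[OF a0(1) 17(2) c0(1) n] a0 c0 by blast
  next
    case (18 a a') then show ?case
      using arg_unique[of a a'] pA_inj qA_inj argA argC by (auto simp: gset_map_in)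
  qed (use assms objs S res_eq tr_eq p' q' argA in \<open>auto simp: gset_map_in b_in\<close>)
qed

text \<open>
  Two representatives of the same composite are compared by matching the points with the same
  sections; the matching is bijective because it is symmetric in the two representatives.
\<close>

lemma comparison:
  assumes "composite G P Q S' base' ev' argA' argC'"
  shows "\<exists>\<alpha> \<beta>. bispan_isos G S S' \<alpha> \<beta>"
proof -
  interpret c: composite G P Q S' base' ev' argA' argC' by fact
  define rB where "rB b b' \<longleftrightarrow> b \<in> pts (bB S) \<and> b' \<in> pts (bB S') \<and> base' b' = base b \<and>
      (\<forall>c\<in>pts (bA Q). bnorm Q c = base b \<longrightarrow> ev' b' c = ev b c)" for b b'
  have ex: "\<exists>b'. rB b b'" if "b \<in> pts (bB S)" for b
    using c.section_ex[of "base b" "ev b"] that ev_in[of b] ev_over[of b] gset_map_in[OF base]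
    unfolding rB_def by metis
  have ex': "\<exists>b. rB b b'" if "b' \<in> pts (bB S')" for b'
    using section_ex[of "base' b'" "ev' b'"] that c.ev_in[of b'] c.ev_over[of b'] gset_map_in[OF c.base]
    unfolding rB_def by metis
  have un: "b' = b''" if "rB b b'" "rB b b''" for b b' b''
    using that c.section_unique[of b' b''] unfolding rB_def by simp
  have un': "b = b''" if "rB b b'" "rB b'' b'" for b b' b''
    using that section_unique[of b b''] unfolding rB_def by simp
  have rB_act: "rB (act (bB S) g b) (act (bB S') g b')" if r: "rB b b'" and g: "g \<in> carrier G" for g b b'
    unfolding rB_def
  proof (intro conjI ballI impI)
    have m: "b \<in> pts (bB S)" "b' \<in> pts (bB S')" "base' b' = base b"
      using r by (auto simp: rB_def)
    show "act (bB S) g b \<in> pts (bB S)" "act (bB S') g b' \<in> pts (bB S')"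
      using m g by (auto simp: act_closed fins c.fins)
    show "base' (act (bB S') g b') = base (act (bB S) g b)"
      using m g by (simp add: gset_map_act[OF base] gset_map_act[OF c.base])
    fix x assume x: "x \<in> pts (bA Q)" "bnorm Q x = base (act (bB S) g b)"
    define y where "y = act (bA Q) (inv g) x"
    have y: "y \<in> pts (bA Q)" "x = act (bA Q) g y"
      using x g by (auto simp: y_def act_closed fins act_inv2)
    have "bnorm Q y = base b"
      using x g m unfolding y_def
      by (simp add: gset_map_act[OF maps(5)] gset_map_act[OF base] act_inv1 fins gset_map_in[OF base])
    then show "ev' (act (bB S') g b') x = ev (act (bB S) g b) x"
      using y m g r by (simp add: c.ev_act ev_act rB_def)
  qed
  have "\<exists>\<beta>. gset_map G (bB S) (bB S') \<beta> \<and> bij_betw \<beta> (pts (bB S)) (pts (bB S')) \<and>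
      (\<forall>b\<in>pts (bB S). rB b (\<beta> b))"
  proof (rule gset_iso_of_correspondence)
    show "\<exists>y\<in>pts (bB S'). rB x y" if "x \<in> pts (bB S)" for x
      using ex[OF that] by (auto simp: rB_def)
    show "\<exists>x\<in>pts (bB S). rB x y" if "y \<in> pts (bB S')" for y
      using ex'[OF that] by (auto simp: rB_def)
  qed (use un un' rB_act fins c.fins in auto)
  then obtain \<beta> where \<beta>map: "gset_map G (bB S) (bB S') \<beta>"
    and \<beta>bij: "bij_betw \<beta> (pts (bB S)) (pts (bB S'))"
    and \<beta>: "\<And>b. b \<in> pts (bB S) \<Longrightarrow> rB b (\<beta> b)"
    by auto
  define rA where "rA a a' \<longleftrightarrow> a \<in> pts (bA S) \<and> a' \<in> pts (bA S') \<and> argA' a' = argA a \<and>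
      argC' a' = argC a \<and> bnorm S' a' = \<beta> (bnorm S a)" for a a'
  have nS: "bnorm S a \<in> pts (bB S)" if "a \<in> pts (bA S)" for a
    using that maps gset_map_in by blast
  have Aex: "\<exists>a'. rA a a'" if a: "a \<in> pts (bA S)" for a
  proof -
    have "rB (bnorm S a) (\<beta> (bnorm S a))" using \<beta> nS a by blast
    then show ?thesis
      using c.arg_ex[of "argA a" "\<beta> (bnorm S a)" "argC a"] arg_base[OF a] arg_ev[OF a] a
        gset_map_in[OF argA a] gset_map_in[OF argC a]
      unfolding rA_def rB_def by auto
  qed
  have Aex': "\<exists>a. rA a a'" if a: "a' \<in> pts (bA S')" for a'
  proof -
    have "bnorm S' a' \<in> pts (bB S')" using a c.maps gset_map_in by blast
    then obtain b where b: "b \<in> pts (bB S)" "bnorm S' a' = \<beta> b"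
      using \<beta>bij by (auto simp: bij_betw_def)
    then have "rB b (bnorm S' a')" using \<beta> by metis
    then show ?thesis
      using arg_ex[of "argA' a'" b "argC' a'"] c.arg_base[OF a] c.arg_ev[OF a] a b
        gset_map_in[OF c.argA a] gset_map_in[OF c.argC a]
      unfolding rA_def rB_def by auto
  qed
  have Aun: "a' = a''" if "rA a a'" "rA a a''" for a a' a''
    using that c.arg_unique[of a' a''] unfolding rA_def by simp
  have Aun': "a = a''" if "rA a a'" "rA a'' a'" for a a' a''
  proof -
    have "bnorm S a = bnorm S a''"
      using that \<beta>bij nS unfolding rA_def bij_betw_def inj_on_def by metis
    then show ?thesis
      using that arg_unique[of a a''] unfolding rA_def by simp
  qed
  have rA_act: "rA (act (bA S) g a) (act (bA S') g a')" if "rA a a'" "g \<in> carrier G" for g a a'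
    using that unfolding rA_def
    by (simp add: act_closed fins c.fins nS gset_map_act[OF argA] gset_map_act[OF argC]
        gset_map_act[OF c.argA] gset_map_act[OF c.argC] gset_map_act[OF maps(8)]
        gset_map_act[OF c.maps(8)] gset_map_act[OF \<beta>map])
  have "\<exists>\<alpha>. gset_map G (bA S) (bA S') \<alpha> \<and> bij_betw \<alpha> (pts (bA S)) (pts (bA S')) \<and>
      (\<forall>a\<in>pts (bA S). rA a (\<alpha> a))"
  proof (rule gset_iso_of_correspondence)
    show "\<exists>y\<in>pts (bA S'). rA x y" if "x \<in> pts (bA S)" for x
      using Aex[OF that] by (auto simp: rA_def)
    show "\<exists>x\<in>pts (bA S). rA x y" if "y \<in> pts (bA S')" for y
      using Aex'[OF that] by (auto simp: rA_def)
  qed (use Aun Aun' rA_act fins c.fins in auto)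
  then obtain \<alpha> where \<alpha>map: "gset_map G (bA S) (bA S') \<alpha>"
    and \<alpha>bij: "bij_betw \<alpha> (pts (bA S)) (pts (bA S'))"
    and \<alpha>: "\<And>a. a \<in> pts (bA S) \<Longrightarrow> rA a (\<alpha> a)"
    by auto
  have "bispan_isos G S S' \<alpha> \<beta>"
    unfolding bispan_isos_def
    using \<alpha>map \<alpha>bij \<beta>map \<beta>bij objs c.objs \<alpha> \<beta> res_eq c.res_eq tr_eq c.tr_eq
    unfolding rA_def rB_def by simp
  then show ?thesis by blast
qed

end


context composite begin

lemma ev_at:
  assumes "g \<in> carrier G" and "b \<in> pts (bB S)" and "c \<in> pts (bA Q)"
    and "bnorm Q c = act (bB Q) g (base b)"
  shows "act (bA Q) (inv g) c \<in> pts (bA Q)" and "bnorm Q (act (bA Q) (inv g) c) = base b"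
    and "ev (act (bB S) g b) c = act (bB P) g (ev b (act (bA Q) (inv g) c))"
proof -
  show 1: "act (bA Q) (inv g) c \<in> pts (bA Q)"
    using assms by (simp add: act_closed fins)
  show 2: "bnorm Q (act (bA Q) (inv g) c) = base b"
    using assms gset_map_in[OF base] by (simp add: gset_map_act[OF maps(5)] act_inv1 fins)
  show "ev (act (bB S) g b) c = act (bB P) g (ev b (act (bA Q) (inv g) c))"
    using ev_act[OF assms(1,2) 1 2] assms by (simp add: act_inv2 fins)
qed

end


subsection \<open>Dependent products\<close>

lemma app_graph_on: "finite S \<Longrightarrow> c \<in> S \<Longrightarrow> app (graph_on S \<sigma>) c = \<sigma> c"
  by (auto simp: app_def graph_on_def Abs_fset_inverse intro!: the_equality)

lemma graph_on_eq_iff: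
  assumes "finite S"
  shows "graph_on S \<sigma> = graph_on S \<tau> \<longleftrightarrow> (\<forall>c\<in>S. \<sigma> c = \<tau> c)"
proof
  assume "graph_on S \<sigma> = graph_on S \<tau>"
  then show "\<forall>c\<in>S. \<sigma> c = \<tau> c"
    using app_graph_on[OF assms] by metis
next
  assume "\<forall>c\<in>S. \<sigma> c = \<tau> c"
  then have "(\<lambda>c. (c, \<sigma> c)) ` S = (\<lambda>c. (c, \<tau> c)) ` S"
    by force
  then show "graph_on S \<sigma> = graph_on S \<tau>"
    by (simp add: graph_on_def)
qed

lemma image_graph_on:
  assumes "finite S" and "\<And>c. c \<in> S \<Longrightarrow> \<tau> (a c) = b (\<sigma> c)"
  shows "Graph ((\<lambda>(c, e). (a c, b e)) |`| edges (graph_on S \<sigma>)) = graph_on (a ` S) \<tau>"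
proof -
  have "(\<lambda>(c, e). (a c, b e)) ` (\<lambda>c. (c, \<sigma> c)) ` S = (\<lambda>c. (c, \<tau> c)) ` a ` S"
    using assms(2) by (force simp: image_image)
  then show ?thesis
    using assms(1) by (simp add: graph_on_def fset_inverse[symmetric] Abs_fset_inverse
        fimage.rep_eq fset_inject[symmetric])
qed

context group begin

lemma fin_gset_pullback:
  assumes f: "gset_map G X B f" and k: "gset_map G Y B k"
  shows "fin_gset G (pullback X f Y k)"
  unfolding pullback_def
proof (rule fin_gset_mk_gset)
  have "{Tup x y |x y. x \<in> pts X \<and> y \<in> pts Y \<and> f x = k y} \<subseteq> (\<lambda>(x, y). Tup x y) ` (pts X \<times> pts Y)"
    by auto
  then show "finite {Tup x y |x y. x \<in> pts X \<and> y \<in> pts Y \<and> f x = k y}"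
    by (rule finite_subset) (use f k fin_gset_finite gset_map_dom in blast)
qed (use f k in \<open>auto simp: act_closed act_one act_mult gset_map_act dest: gset_map_dom\<close>)

lemma Tup_in_pullback [simp]:
  "Tup x y \<in> pts (pullback X f Y k) \<longleftrightarrow> x \<in> pts X \<and> y \<in> pts Y \<and> f x = k y"
  by (simp add: pullback_def)

lemma pullbackE:
  assumes "z \<in> pts (pullback X f Y k)"
  obtains x y where "z = Tup x y" "x \<in> pts X" "y \<in> pts Y" "f x = k y"
  using assms by (auto simp: pullback_def)

lemma act_pullback:
  "x \<in> pts X \<Longrightarrow> y \<in> pts Y \<Longrightarrow> f x = k y \<Longrightarrow>
    act (pullback X f Y k) g (Tup x y) = Tup (act X g x) (act Y g y)"
  by (simp add: pullback_def)

end

locale dependent_product = group G for G :: "('g, 'b) monoid_scheme" (structure) +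
  fixes E C D :: "'g gset" and p t :: "'g pt \<Rightarrow> 'g pt"
  assumes p: "gset_map G E C p" and t: "gset_map G C D t"
begin

abbreviation "fibre d \<equiv> {c \<in> pts C. t c = d}"
abbreviation "is_section d \<sigma> \<equiv> \<forall>c\<in>pts C. t c = d \<longrightarrow> \<sigma> c \<in> pts E \<and> p (\<sigma> c) = c"

lemma finite_fibre: "finite (fibre d)"
  using t by (auto simp: fin_gset_finite dest: gset_map_dom)

lemma fins: "fin_gset G E" "fin_gset G C" "fin_gset G D"
  using p t by (auto dest: gset_map_dom gset_map_cod)

lemma in_dep_prod_iff:
  "z \<in> pts (dep_prod E C D p t) \<longleftrightarrow>
    (\<exists>d \<sigma>. z = Tup d (graph_on (fibre d) \<sigma>) \<and> d \<in> pts D \<and> is_section d \<sigma>)"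
  by (auto simp: dep_prod_def)

lemma image_fibre:
  assumes "g \<in> carrier G" and "d \<in> pts D"
  shows "act C g ` fibre d = fibre (act D g d)"
proof
  show "fibre (act D g d) \<subseteq> act C g ` fibre d"
  proof
    fix c assume c: "c \<in> fibre (act D g d)"
    then have "act C (inv g) c \<in> fibre d"
      using assms fins by (auto simp: act_closed gset_map_act[OF t] act_inv1)
    then have "act C g (act C (inv g) c) \<in> act C g ` fibre d"
      by (rule imageI)
    then show "c \<in> act C g ` fibre d"
      using c assms fins by (simp add: act_inv2)
  qed
qed (use assms fins in \<open>auto simp: act_closed gset_map_act[OF t]\<close>)

lemma act_dep_prod:
  assumes g: "g \<in> carrier G" and d: "d \<in> pts D" and \<sigma>: "is_section d \<sigma>"
  defines "\<tau> \<equiv> \<lambda>c. act E g (\<sigma> (act C (inv g) c))"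
  shows "act (dep_prod E C D p t) g (Tup d (graph_on (fibre d) \<sigma>)) =
      Tup (act D g d) (graph_on (fibre (act D g d)) \<tau>)"
    and "is_section (act D g d) \<tau>"
proof -
  have "Tup d (graph_on (fibre d) \<sigma>) \<in> pts (dep_prod E C D p t)"
    using d \<sigma> in_dep_prod_iff by blast
  then have "act (dep_prod E C D p t) g (Tup d (graph_on (fibre d) \<sigma>)) = Tup (act D g d)
      (Graph ((\<lambda>(c, e). (act C g c, act E g e)) |`| edges (graph_on (fibre d) \<sigma>)))"
    by (simp add: dep_prod_def)
  also have "Graph ((\<lambda>(c, e). (act C g c, act E g e)) |`| edges (graph_on (fibre d) \<sigma>)) =
      graph_on (act C g ` fibre d) \<tau>"
    by (rule image_graph_on) (use finite_fibre g fins in \<open>auto simp: \<tau>_def act_inv1\<close>)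
  finally show "act (dep_prod E C D p t) g (Tup d (graph_on (fibre d) \<sigma>)) =
      Tup (act D g d) (graph_on (fibre (act D g d)) \<tau>)"
    using image_fibre[OF g d] by simp
  show "is_section (act D g d) \<tau>"
  proof (intro ballI impI)
    fix c assume c: "c \<in> pts C" "t c = act D g d"
    have "act C (inv g) c \<in> fibre d"
      using c g d fins by (simp add: act_closed gset_map_act[OF t] act_inv1)
    then show "\<tau> c \<in> pts E \<and> p (\<tau> c) = c"
      using \<sigma> g c fins by (simp add: \<tau>_def act_closed gset_map_act[OF p] act_inv2)
  qed
qed

lemma fin_gset_dep_prod: "fin_gset G (dep_prod E C D p t)"
proof -
  let ?Pi = "dep_prod E C D p t"
  have "pts ?Pi \<subseteq> (\<Union>d\<in>pts D. (\<lambda>\<sigma>. Tup d (graph_on (fibre d) \<sigma>)) ` (fibre d \<rightarrow>\<^sub>E pts E))"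
  proof
    fix z assume "z \<in> pts ?Pi"
    then obtain d \<sigma> where z: "z = Tup d (graph_on (fibre d) \<sigma>)" "d \<in> pts D" "is_section d \<sigma>"
      using in_dep_prod_iff by blast
    have "graph_on (fibre d) \<sigma> = graph_on (fibre d) (restrict \<sigma> (fibre d))"
      using graph_on_eq_iff[OF finite_fibre] by auto
    moreover have "restrict \<sigma> (fibre d) \<in> fibre d \<rightarrow>\<^sub>E pts E"
      using z by auto
    ultimately show "z \<in> (\<Union>d\<in>pts D. (\<lambda>\<sigma>. Tup d (graph_on (fibre d) \<sigma>)) ` (fibre d \<rightarrow>\<^sub>E pts E))"
      using z by blast
  qed
  then have fin: "finite (pts ?Pi)"
    by (rule finite_subset)
      (use fins finite_fibre in \<open>auto simp: fin_gset_finite intro!: finite_PiE\<close>)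
  have cl: "act ?Pi g z \<in> pts ?Pi" if g: "g \<in> carrier G" and z: "z \<in> pts ?Pi" for g z
  proof -
    obtain d \<sigma> where z: "z = Tup d (graph_on (fibre d) \<sigma>)" "d \<in> pts D" "is_section d \<sigma>"
      using z in_dep_prod_iff by blast
    show ?thesis
      unfolding z(1) act_dep_prod(1)[OF g z(2,3)] in_dep_prod_iff
      using act_dep_prod(2)[OF g z(2,3)] g z(2) fins by (blast intro: act_closed)
  qed
  have one: "act ?Pi \<one> z = z" if z: "z \<in> pts ?Pi" for z
  proof -
    obtain d \<sigma> where z: "z = Tup d (graph_on (fibre d) \<sigma>)" "d \<in> pts D" "is_section d \<sigma>"
      using z in_dep_prod_iff by blast
    have "graph_on (fibre d) (\<lambda>c. act E \<one> (\<sigma> (act C (inv \<one>) c))) = graph_on (fibre d) \<sigma>"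
      using z fins by (subst graph_on_eq_iff[OF finite_fibre]) (auto simp: act_one)
    then show ?thesis
      using act_dep_prod(1)[OF one_closed z(2,3)] z fins by (simp add: act_one)
  qed
  have mult: "act ?Pi (g \<otimes> h) z = act ?Pi g (act ?Pi h z)"
    if g: "g \<in> carrier G" and h: "h \<in> carrier G" and z: "z \<in> pts ?Pi" for g h z
  proof -
    obtain d \<sigma> where z: "z = Tup d (graph_on (fibre d) \<sigma>)" "d \<in> pts D" "is_section d \<sigma>"
      using z in_dep_prod_iff by blast
    let ?\<tau> = "\<lambda>c. act E h (\<sigma> (act C (inv h) c))"
    have hd: "act D h d \<in> pts D" using h z fins act_closed by blast
    have gh: "act D (g \<otimes> h) d = act D g (act D h d)"
      using g h z fins by (simp add: act_mult)
    have e: "act E (g \<otimes> h) (\<sigma> (act C (inv (g \<otimes> h)) c)) =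
        act E g (act E h (\<sigma> (act C (inv h) (act C (inv g) c))))"
      if c: "c \<in> fibre (act D g (act D h d))" for c
    proof -
      have "act C (inv (g \<otimes> h)) c = act C (inv h) (act C (inv g) c)"
        using c g h fins by (simp add: inv_mult_group act_mult)
      moreover have "act C (inv h) (act C (inv g) c) \<in> fibre d"
        using c g h z hd fins by (simp add: act_closed gset_map_act[OF t] act_inv1)
      ultimately show ?thesis
        using g h z fins by (simp add: act_mult)
    qed
    show ?thesis
      unfolding z(1) act_dep_prod(1)[OF h z(2,3)] act_dep_prod(1)[OF m_closed[OF g h] z(2,3)]
        act_dep_prod(1)[OF g hd act_dep_prod(2)[OF h z(2,3)]] gh
      using e by (auto simp: graph_on_eq_iff[OF finite_fibre])
  qed
  have "fin_gset G (mk_gset (pts ?Pi) (act ?Pi))"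
    using fin cl one mult by (rule fin_gset_mk_gset)
  moreover have "mk_gset (pts ?Pi) (act ?Pi) = ?Pi"
    by (auto simp: mk_gset_def dep_prod_def restrict_def fun_eq_iff)
  ultimately show ?thesis by simp
qed

lemma gset_map_pfst: "gset_map G (dep_prod E C D p t) D pfst"
proof (rule gset_mapI)
  fix g z assume g: "g \<in> carrier G" and "z \<in> pts (dep_prod E C D p t)"
  then obtain d \<sigma> where z: "z = Tup d (graph_on (fibre d) \<sigma>)" "d \<in> pts D" "is_section d \<sigma>"
    using in_dep_prod_iff by blast
  then show "pfst (act (dep_prod E C D p t) g z) = act D g (pfst z)"
    using act_dep_prod(1)[OF g z(2,3)] by simp
qed (use fins fin_gset_dep_prod in \<open>auto simp: in_dep_prod_iff\<close>)

lemma app_dep_prod: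
  assumes "z \<in> pts (dep_prod E C D p t)" and "c \<in> pts C" and "t c = pfst z"
  shows "app (psnd z) c \<in> pts E" and "p (app (psnd z) c) = c"
    and "g \<in> carrier G \<Longrightarrow>
      app (psnd (act (dep_prod E C D p t) g z)) (act C g c) = act E g (app (psnd z) c)"
proof -
  obtain d \<sigma> where z: "z = Tup d (graph_on (fibre d) \<sigma>)" "d \<in> pts D" "is_section d \<sigma>"
    using assms in_dep_prod_iff by blast
  have c: "c \<in> fibre d" using z assms by simp
  then show "app (psnd z) c \<in> pts E" "p (app (psnd z) c) = c"
    using z by (simp_all add: app_graph_on[OF finite_fibre])
  assume g: "g \<in> carrier G"
  have "act C g c \<in> fibre (act D g d)"
    using c g image_fibre[OF g z(2)] by blast
  then show "app (psnd (act (dep_prod E C D p t) g z)) (act C g c) = act E g (app (psnd z) c)"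
    using act_dep_prod(1)[OF g z(2,3)] c g z fins
    by (simp add: app_graph_on[OF finite_fibre] act_inv1)
qed

lemma dep_prod_eqI:
  assumes "z \<in> pts (dep_prod E C D p t)" and "z' \<in> pts (dep_prod E C D p t)" and "pfst z = pfst z'"
    and "\<And>c. c \<in> pts C \<Longrightarrow> t c = pfst z \<Longrightarrow> app (psnd z) c = app (psnd z') c"
  shows "z = z'"
proof -
  obtain d \<sigma> where z: "z = Tup d (graph_on (fibre d) \<sigma>)" "d \<in> pts D"
    using assms in_dep_prod_iff by blast
  obtain d' \<sigma>' where z': "z' = Tup d' (graph_on (fibre d') \<sigma>')" "d' \<in> pts D"
    using assms in_dep_prod_iff by blast
  have "d = d'" using z z' assms by simp
  moreover have "\<forall>c\<in>fibre d. \<sigma> c = \<sigma>' c"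
    using assms(4) z z' \<open>d = d'\<close> by (auto simp: app_graph_on[OF finite_fibre])
  ultimately show ?thesis
    using z z' by (simp add: graph_on_eq_iff[OF finite_fibre])
qed

end


subsection \<open>Composition of classes\<close>

context group begin

text \<open>
  The points of the dependent product are pairs of a base point and the graph of a section, so
  evaluation of the graph is the map \<open>ev\<close> of the criterion.
\<close>

lemma composite_bispan_comp:
  assumes P: "is_bispan G P" and Q: "is_bispan G Q" and PQ: "bY P = bX Q"
  shows "composite G P Q (bispan_comp Q P) pfst (\<lambda>b c. pfst (app (psnd b) c)) pfst (\<lambda>w. psnd (psnd w))"
proof -
  define E where "E = pullback (bB P) (btr P) (bA Q) (bres Q)"
  define D' where "D' = dep_prod E (bA Q) (bB Q) psnd (bnorm Q)"
  define F where "F = pullback D' pfst (bA Q) (bnorm Q)"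
  define A' where "A' = pullback (bA P) (bnorm P) F (\<lambda>z. pfst (eval_map z))"
  define S where "S = bispan_comp Q P"
  have S: "bX S = bX P" "bA S = A'" "bB S = D'" "bY S = bY Q"
    "bres S = (\<lambda>w. bres P (pfst w))" "bnorm S = (\<lambda>w. pfst (psnd w))" "btr S = (\<lambda>z. btr Q (pfst z))"
    by (simp_all add: S_def bispan_comp_def Let_def E_def D'_def F_def A'_def)
  have m: "gset_map G (bA P) (bX P) (bres P)" "gset_map G (bA P) (bB P) (bnorm P)"
    "gset_map G (bB P) (bX Q) (btr P)" "gset_map G (bA Q) (bX Q) (bres Q)"
    "gset_map G (bA Q) (bB Q) (bnorm Q)" "gset_map G (bB Q) (bY Q) (btr Q)"
    using P Q PQ by (auto simp: is_bispan_iff)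
  note fins = m[THEN gset_map_dom] m[THEN gset_map_cod]
  have E: "fin_gset G E"
    unfolding E_def using m(3,4) by (rule fin_gset_pullback)
  have Emap: "gset_map G E (bA Q) psnd" "gset_map G E (bB P) pfst"
    using E fins by (auto intro!: gset_mapI simp: E_def act_pullback elim!: pullbackE)
  interpret d: dependent_product G E "bA Q" "bB Q" psnd "bnorm Q"
    using Emap(1) m(5) by unfold_locales
  have D': "gset_map G D' (bB Q) pfst" "fin_gset G D'"
    using d.gset_map_pfst d.fin_gset_dep_prod by (auto simp: D'_def)
  have F: "fin_gset G F"
    unfolding F_def using D'(1) m(5) by (rule fin_gset_pullback)
  have Fmap: "gset_map G F D' pfst" "gset_map G F (bA Q) psnd"
    using F D' fins by (auto intro!: gset_mapI simp: F_def act_pullback elim!: pullbackE)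
  have val: "gset_map G F (bB P) (\<lambda>z. pfst (eval_map z))"
  proof (rule gset_mapI[OF F])
    fix z assume "z \<in> pts F"
    then obtain b c where z: "z = Tup b c" "b \<in> pts D'" "c \<in> pts (bA Q)" "pfst b = bnorm Q c"
      by (auto simp: F_def elim!: pullbackE)
    then have e: "app (psnd b) c \<in> pts E"
      using d.app_dep_prod(1)[of b c] by (simp add: D'_def)
    then show "pfst (eval_map z) \<in> pts (bB P)"
      using z Emap gset_map_in by (fastforce simp: eval_map_def)
    fix g assume g: "g \<in> carrier G"
    have "act F g z = Tup (act D' g b) (act (bA Q) g c)"
      using z by (simp add: F_def act_pullback)
    then show "pfst (eval_map (act F g z)) = act (bB P) g (pfst (eval_map z))"
      using z g e d.app_dep_prod(3)[of b c g] Emap by (simp add: eval_map_def D'_def gset_map_act)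
  qed (use fins in auto)
  have A': "fin_gset G A'"
    unfolding A'_def using m(2) val by (rule fin_gset_pullback)
  have A'map: "gset_map G A' (bA P) pfst" "gset_map G A' F psnd"
    using F A' fins by (auto intro!: gset_mapI simp: A'_def act_pullback elim!: pullbackE)
  have norm: "gset_map G A' D' (\<lambda>w. pfst (psnd w))"
    using gset_map_comp[OF A'map(2) Fmap(1)] .
  have bS: "is_bispan G S"
    unfolding is_bispan_iff S
    using gset_map_comp[OF A'map(1) m(1)] norm gset_map_comp[OF D'(1) m(6)] by simp
  have ev: "app (psnd b) c \<in> pts E \<and> psnd (app (psnd b) c) = c"
    if "b \<in> pts D'" "c \<in> pts (bA Q)" "bnorm Q c = pfst b" for b c
    using that d.app_dep_prod(1,2)[of b c] by (simp add: D'_def)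
  have inE: "pfst e \<in> pts (bB P) \<and> btr P (pfst e) = bres Q (psnd e) \<and> e = Tup (pfst e) (psnd e)"
    if "e \<in> pts E" for e
    using that by (auto simp: E_def elim!: pullbackE)
  show ?thesis
    unfolding S_def[symmetric]
  proof (rule composite.intro, rule is_group, rule composite_axioms.intro, unfold S, goal_cases)
    case (8 b c) then show ?case using ev inE by blast
  next
    case (9 b c) then show ?case using ev inE by metis
  next
    case (10 g b c) then show ?case
      using ev[of b c] d.app_dep_prod(3)[of b c g] Emap(2) by (simp add: D'_def gset_map_act)
  next
    case (11 x \<sigma>)
    let ?z = "Tup x (graph_on {c \<in> pts (bA Q). bnorm Q c = x} (\<lambda>c. Tup (\<sigma> c) c))"
    have "?z \<in> pts D'"
      unfolding D'_def d.in_dep_prod_iff using 11 by (auto simp: E_def)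
    then show ?case
      using 11 by (intro bexI[of _ ?z]) (auto simp: app_graph_on[OF d.finite_fibre])
  next
    case (12 b b')
    show ?case
    proof (rule d.dep_prod_eqI)
      fix c assume c: "c \<in> pts (bA Q)" "bnorm Q c = pfst b"
      then show "app (psnd b) c = app (psnd b') c"
        using 12(4)[OF c] ev[OF 12(1) c] ev[of b' c] 12 inE by metis
    qed (use 12 in \<open>auto simp: D'_def\<close>)
  next
    case (14) show ?case using gset_map_comp[OF A'map(2) Fmap(2)] .
  next
    case (15 a) then show ?case by (auto simp: A'_def F_def elim!: pullbackE)
  next
    case (16 a) then show ?case by (auto simp: A'_def F_def eval_map_def elim!: pullbackE)
  next
    case (17 a b c) then show ?case
      by (intro bexI[of _ "Tup a (Tup b c)"]) (auto simp: A'_def F_def eval_map_def)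
  next
    case (18 a a') then show ?case by (auto simp: A'_def F_def elim!: pullbackE)
  qed (use P Q PQ bS D' A'map in auto)
qed

lemma bcomp_composite:
  assumes "composite G P Q S base ev argA argC"
  shows "bcomp G (bclass G Q) (bclass G P) = bclass G S"
proof -
  interpret c: composite G P Q S base ev argA argC by fact
  have "bclass G (bispan_comp Q' P') = bclass G S"
    if P': "P' \<in> bclass G P" and Q': "Q' \<in> bclass G Q" for P' Q'
  proof -
    obtain pA pB qA qB where iso: "bispan_isos G P P' pA pB" "bispan_isos G Q Q' qA qB"
      and b: "is_bispan G P'" "is_bispan G Q'"
      using P' Q' by (auto simp: in_bclass)
    have obj: "bY P' = bX Q'"
      using iso c.objs by (simp add: bispan_isos_def)
    interpret c1: composite G P' Q' "bispan_comp Q' P'" pfst "\<lambda>b c. pfst (app (psnd b) c)" pfst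
        "\<lambda>w. psnd (psnd w)"
      by (rule composite_bispan_comp) fact+
    show ?thesis
      using c1.comparison[OF c.transport[OF b iso]] c1.S c.S bclass_eq_iff by blast
  qed
  then show ?thesis
    unfolding bcomp_def using bclass_self c.P c.Q by blast
qed

lemma composite_exists:
  assumes "is_bispan G P" and "is_bispan G Q" and "bY P = bX Q"
  obtains S base ev argA argC where "composite G P Q S base ev argA argC"
  using composite_bispan_comp[OF assms] by blast

lemma bcomp_in_bhom:
  assumes "m \<in> bhom G X Y" and "n \<in> bhom G Y Z"
  shows "bcomp G n m \<in> bhom G X Z"
proof -
  obtain P Q where PQ: "is_bispan G P" "bX P = X" "bY P = Y" "m = bclass G P"
    "is_bispan G Q" "bX Q = Y" "bY Q = Z" "n = bclass G Q"
    using assms by (auto simp: bhom_iff)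
  then obtain S base ev argA argC where "composite G P Q S base ev argA argC"
    using composite_exists by metis
  then interpret composite G P Q S base ev argA argC .
  show ?thesis
    using bcomp_composite[OF composite_axioms] S objs PQ by (auto simp: bhom_iff)
qed

text \<open>
  Associativity is currying: a section over a fibre for \<open>P3\<close> with values in sections over fibres
  for \<open>P2\<close> is a section over the total space of these fibres.
\<close>

lemma composite_assoc:
  assumes 12: "composite G P1 P2 S12 base12 ev12 argA12 argC12"
    and 3: "composite G S12 P3 S base ev argA argC"
    and 23: "composite G P2 P3 S23 base23 ev23 argA23 argC23"
  shows "\<exists>base' ev' argA' argC'. composite G P1 S23 S base' ev' argA' argC'"
proof -
  interpret c12: composite G P1 P2 S12 base12 ev12 argA12 argC12 by fact
  interpret c3: composite G S12 P3 S base ev argA argC by fact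
  interpret c23: composite G P2 P3 S23 base23 ev23 argA23 argC23 by fact
  have "\<exists>b'\<in>pts (bB S23). base23 b' = base b \<and>
      (\<forall>c\<in>pts (bA P3). bnorm P3 c = base b \<longrightarrow> ev23 b' c = base12 (ev b c))"
    if b: "b \<in> pts (bB S)" for b
  proof (rule c23.section_ex)
    show "base b \<in> pts (bB P3)" using b c3.base gset_map_in by metis
    fix c assume c: "c \<in> pts (bA P3)" "bnorm P3 c = base b"
    have "ev b c \<in> pts (bB S12)" "btr S12 (ev b c) = bres P3 c"
      using c3.ev_in[OF b c] c3.ev_over[OF b c] .
    then show "base12 (ev b c) \<in> pts (bB P2) \<and> btr P2 (base12 (ev b c)) = bres P3 c"
      using c12.tr_eq[of "ev b c"] gset_map_in[OF c12.base] by simp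
  qed
  then obtain f where f: "\<And>b. b \<in> pts (bB S) \<Longrightarrow> f b \<in> pts (bB S23)"
    "\<And>b. b \<in> pts (bB S) \<Longrightarrow> base23 (f b) = base b"
    "\<And>b c. b \<in> pts (bB S) \<Longrightarrow> c \<in> pts (bA P3) \<Longrightarrow> bnorm P3 c = base b \<Longrightarrow>
      ev23 (f b) c = base12 (ev b c)"
    by metis
  have fmap: "gset_map G (bB S) (bB S23) f"
  proof (rule gset_mapI)
    fix g b assume g: "g \<in> carrier G" and b: "b \<in> pts (bB S)"
    have gb: "act (bB S) g b \<in> pts (bB S)" using b g c3.fins act_closed by blast
    have base_g: "base (act (bB S) g b) = act (bB P3) g (base b)"
      using g b by (simp add: gset_map_act[OF c3.base])
    show "f (act (bB S) g b) = act (bB S23) g (f b)"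
    proof (rule c23.section_unique)
      show "base23 (f (act (bB S) g b)) = base23 (act (bB S23) g (f b))"
        using g b f gb base_g by (simp add: gset_map_act[OF c23.base])
      fix c assume c: "c \<in> pts (bA P3)" "bnorm P3 c = base23 (f (act (bB S) g b))"
      then have n: "bnorm P3 c = act (bB P3) g (base b)" using f gb base_g by simp
      note e = c3.ev_at[OF g b c(1) n]
      note e' = c23.ev_at[OF g f(1)[OF b] c(1) n[folded f(2)[OF b]]]
      have "ev23 (f (act (bB S) g b)) c = base12 (ev (act (bB S) g b) c)"
        using f gb c by simp
      also have "\<dots> = act (bB P2) g (base12 (ev b (act (bA P3) (inv g) c)))"
        using e c3.ev_in[OF b e(1,2)] g by (simp add: gset_map_act[OF c12.base])
      also have "\<dots> = ev23 (act (bB S23) g (f b)) c"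
        using e e' f b by simp
      finally show "ev23 (f (act (bB S) g b)) c = ev23 (act (bB S23) g (f b)) c" .
    qed (use f g b gb c23.fins in \<open>auto simp: act_closed\<close>)
  qed (use f c3.fins c23.fins in auto)
  define ev' where "ev' b a = ev12 (ev b (argC23 a)) (argA23 a)" for b a
  have over: "argC23 a \<in> pts (bA P3)" "bnorm P3 (argC23 a) = base b"
    "ev b (argC23 a) \<in> pts (bB S12)" "argA23 a \<in> pts (bA P2)"
    "bnorm P2 (argA23 a) = base12 (ev b (argC23 a))"
    if b: "b \<in> pts (bB S)" and a: "a \<in> pts (bA S23)" and n: "bnorm S23 a = f b" for a b
  proof -
    show 1: "argC23 a \<in> pts (bA P3)" using a c23.argC gset_map_in by metis
    show 2: "bnorm P3 (argC23 a) = base b" using c23.arg_base[OF a] n f b by simp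
    show "ev b (argC23 a) \<in> pts (bB S12)" using c3.ev_in[OF b 1 2] .
    show "argA23 a \<in> pts (bA P2)" using a c23.argA gset_map_in by metis
    show "bnorm P2 (argA23 a) = base12 (ev b (argC23 a))"
      using c23.arg_ev[OF a] n f(3)[OF b 1 2] by simp
  qed
  have "\<exists>a'\<in>pts (bA S23). argA23 a' = argC12 (argA a) \<and> argC23 a' = argC a \<and>
      bnorm S23 a' = f (bnorm S a)" if a: "a \<in> pts (bA S)" for a
  proof (rule c23.arg_ex)
    have in12: "argA a \<in> pts (bA S12)" using a c3.argA gset_map_in by metis
    have n: "bnorm S a \<in> pts (bB S)" using a c3.maps(8) gset_map_in by metis
    show "argC12 (argA a) \<in> pts (bA P2)" using in12 c12.argC gset_map_in by metis
    show c: "argC a \<in> pts (bA P3)" using a c3.argC gset_map_in by metis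
    show "f (bnorm S a) \<in> pts (bB S23)" using f n by blast
    show "bnorm P3 (argC a) = base23 (f (bnorm S a))" using f n c3.arg_base[OF a] by simp
    show "bnorm P2 (argC12 (argA a)) = ev23 (f (bnorm S a)) (argC a)"
      using f(3)[OF n c c3.arg_base[OF a]] c12.arg_base[OF in12] c3.arg_ev[OF a] by simp
  qed
  then obtain k where k: "\<And>a. a \<in> pts (bA S) \<Longrightarrow> k a \<in> pts (bA S23) \<and> argA23 (k a) = argC12 (argA a) \<and>
      argC23 (k a) = argC a \<and> bnorm S23 (k a) = f (bnorm S a)"
    by metis
  have in12: "argA a \<in> pts (bA S12)" if "a \<in> pts (bA S)" for a
    using that c3.argA gset_map_in by metis
  have nS: "bnorm S a \<in> pts (bB S)" if "a \<in> pts (bA S)" for a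
    using that c3.maps(8) gset_map_in by metis
  have kmap: "gset_map G (bA S) (bA S23) k"
  proof (rule gset_mapI)
    fix g a assume g: "g \<in> carrier G" and a: "a \<in> pts (bA S)"
    have ga: "act (bA S) g a \<in> pts (bA S)" using a g c3.fins act_closed by blast
    show "k (act (bA S) g a) = act (bA S23) g (k a)"
      by (rule c23.arg_unique)
        (use g a ga k[OF a] k[OF ga] in12[OF a] nS[OF a] in \<open>auto simp: act_closed c23.fins gset_map_act[OF c23.argA]
            gset_map_act[OF c23.argC] gset_map_act[OF c3.argC] gset_map_act[OF c3.argA]
            gset_map_act[OF c12.argC] gset_map_act[OF c23.maps(8)] gset_map_act[OF c3.maps(8)]
            gset_map_act[OF fmap]\<close>)
  qed (use k c3.fins c23.fins in auto)
  have "composite G P1 S23 S f ev' (\<lambda>a. argA12 (argA a)) k"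
  proof (rule composite.intro, rule is_group, rule composite_axioms.intro, goal_cases)
    case (8 b a) then show ?case
      using c12.ev_in over[of b a] by (simp add: ev'_def)
  next
    case (9 b a) then show ?case
      using c12.ev_over over[of b a] c23.res_eq by (simp add: ev'_def)
  next
    case (10 g b a)
    note o = over[OF 10(2-4)]
    show ?case
      unfolding ev'_def gset_map_act[OF c23.argA 10(1,3)] gset_map_act[OF c23.argC 10(1,3)]
        c3.ev_act[OF 10(1,2) o(1,2)] c12.ev_act[OF 10(1) o(3,4,5)] ..
  next
    case (11 d \<sigma>)
    have d3: "base23 d \<in> pts (bB P3)" using gset_map_in[OF c23.base 11(1)] .
    have "\<exists>e\<in>pts (bB S12). base12 e = ev23 d c \<and>
        (\<forall>a\<in>pts (bA S23). argC23 a = c \<longrightarrow> bnorm S23 a = d \<longrightarrow> ev12 e (argA23 a) = \<sigma> a)"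
      if c: "c \<in> pts (bA P3)" "bnorm P3 c = base23 d" for c
    proof -
      define \<tau> where "\<tau> a2 = (SOME a. a \<in> pts (bA S23) \<and> argA23 a = a2 \<and> argC23 a = c \<and> bnorm S23 a = d)" for a2
      have \<tau>: "\<tau> a2 \<in> pts (bA S23) \<and> argA23 (\<tau> a2) = a2 \<and> argC23 (\<tau> a2) = c \<and> bnorm S23 (\<tau> a2) = d"
        if "a2 \<in> pts (bA P2)" "bnorm P2 a2 = ev23 d c" for a2
        unfolding \<tau>_def using c23.arg_ex[OF that(1) 11(1) c that(2)] unfolding Bex_def by (rule someI_ex)
      have "\<exists>e\<in>pts (bB S12). base12 e = ev23 d c \<and>
          (\<forall>a2\<in>pts (bA P2). bnorm P2 a2 = ev23 d c \<longrightarrow> ev12 e a2 = \<sigma> (\<tau> a2))"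
      proof (rule c12.section_ex)
        show "ev23 d c \<in> pts (bB P2)" using c23.ev_in[OF 11(1) c] .
        fix a2 assume a2: "a2 \<in> pts (bA P2)" "bnorm P2 a2 = ev23 d c"
        from \<tau>[OF a2] show "\<sigma> (\<tau> a2) \<in> pts (bB P1) \<and> btr P1 (\<sigma> (\<tau> a2)) = bres P2 a2"
          using 11(2)[of "\<tau> a2"] c23.res_eq[of "\<tau> a2"] by simp
      qed
      then obtain e where e: "e \<in> pts (bB S12)" "base12 e = ev23 d c"
        "\<And>a2. a2 \<in> pts (bA P2) \<Longrightarrow> bnorm P2 a2 = ev23 d c \<Longrightarrow> ev12 e a2 = \<sigma> (\<tau> a2)"
        by blast
      have "ev12 e (argA23 a) = \<sigma> a"
        if a: "a \<in> pts (bA S23)" "argC23 a = c" "bnorm S23 a = d" for a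
      proof -
        have a2: "argA23 a \<in> pts (bA P2)" "bnorm P2 (argA23 a) = ev23 d c"
          using gset_map_in[OF c23.argA a(1)] c23.arg_ev[OF a(1)] a by simp_all
        then have "\<tau> (argA23 a) = a"
          using \<tau>[OF a2] a by (auto intro!: c23.arg_unique[of "\<tau> (argA23 a)" a])
        then show ?thesis using e(3)[OF a2] by simp
      qed
      then show ?thesis using e by blast
    qed
    then obtain \<tau> where \<tau>: "\<And>c. c \<in> pts (bA P3) \<Longrightarrow> bnorm P3 c = base23 d \<Longrightarrow> \<tau> c \<in> pts (bB S12) \<and>
        base12 (\<tau> c) = ev23 d c \<and>
        (\<forall>a\<in>pts (bA S23). argC23 a = c \<longrightarrow> bnorm S23 a = d \<longrightarrow> ev12 (\<tau> c) (argA23 a) = \<sigma> a)"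
      by metis
    have "\<exists>b\<in>pts (bB S). base b = base23 d \<and>
        (\<forall>c\<in>pts (bA P3). bnorm P3 c = base23 d \<longrightarrow> ev b c = \<tau> c)"
      using d3
    proof (rule c3.section_ex)
      fix c assume c: "c \<in> pts (bA P3)" "bnorm P3 c = base23 d"
      then show "\<tau> c \<in> pts (bB S12) \<and> btr S12 (\<tau> c) = bres P3 c"
        using \<tau>[OF c] c12.tr_eq[of "\<tau> c"] c23.ev_over[OF 11(1) c] by simp
    qed
    then obtain b where b: "b \<in> pts (bB S)" "base b = base23 d"
      "\<And>c. c \<in> pts (bA P3) \<Longrightarrow> bnorm P3 c = base23 d \<Longrightarrow> ev b c = \<tau> c"
      by blast
    have "f b = d"
      by (rule c23.section_unique) (use f b 11(1) \<tau> in auto)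
    moreover have "ev' b a = \<sigma> a" if a: "a \<in> pts (bA S23)" "bnorm S23 a = d" for a
      using over(1,2)[OF b(1) a(1)] a b \<tau>[of "argC23 a"] \<open>f b = d\<close> by (simp add: ev'_def)
    ultimately show ?case using b by blast
  next
    case (12 b b')
    show ?case
    proof (rule c3.section_unique)
      show base_eq: "base b = base b'" using 12 f by metis
      fix c assume c: "c \<in> pts (bA P3)" "bnorm P3 c = base b"
      note c' = c(2)[unfolded base_eq]
      show "ev b c = ev b' c"
      proof (rule c12.section_unique)
        show "base12 (ev b c) = base12 (ev b' c)"
          using f(3)[OF 12(1) c] f(3)[OF 12(2) c(1) c'] 12(3) by simp
        fix a2 assume a2: "a2 \<in> pts (bA P2)" "bnorm P2 a2 = base12 (ev b c)"
        then have "bnorm P2 a2 = ev23 (f b) c" using f(3)[OF 12(1) c] by simp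
        then obtain a where a: "a \<in> pts (bA S23)" "argA23 a = a2" "argC23 a = c" "bnorm S23 a = f b"
          using c23.arg_ex[OF a2(1) f(1)[OF 12(1)] c(1)] c f(2) 12(1) by metis
        then show "ev12 (ev b c) a2 = ev12 (ev b' c) a2"
          using 12(4)[OF a(1,4)] by (simp add: ev'_def)
      qed (use c3.ev_in 12 c c' in auto)
    qed (use 12 in auto)
  next
    case (13) show ?case using gset_map_comp[OF c3.argA c12.argA] .
  next
    case (15 a) then show ?case using k by blast
  next
    case (16 a) then show ?case
      using k[OF 16] c12.arg_ev[OF in12[OF 16]] c3.arg_ev[OF 16] by (simp add: ev'_def)
  next
    case (17 a b a23)
    note o = over[OF 17(2,3,4)]
    obtain a12 where a12: "a12 \<in> pts (bA S12)" "argA12 a12 = a" "argC12 a12 = argA23 a23"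
      "bnorm S12 a12 = ev b (argC23 a23)"
      using c12.arg_ex[OF 17(1) o(3,4,5)] 17(5) by (auto simp: ev'_def)
    obtain a' where a': "a' \<in> pts (bA S)" "argA a' = a12" "argC a' = argC23 a23" "bnorm S a' = b"
      using c3.arg_ex[OF a12(1) 17(2) o(1,2) a12(4)] by blast
    have "k a' = a23"
      by (rule c23.arg_unique) (use k[OF a'(1)] a' a12 17 in auto)
    then show ?case using a' a12 by blast
  next
    case (18 a a')
    have eq: "argC12 (argA a) = argC12 (argA a')" "argC a = argC a'"
      using k[OF 18(1)] k[OF 18(2)] 18(4) by auto
    have "bnorm S12 (argA a) = bnorm S12 (argA a')"
      using c3.arg_ev[OF 18(1)] c3.arg_ev[OF 18(2)] eq 18(5) by simp
    then have "argA a = argA a'"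
      using c12.arg_unique in12 18 eq by blast
    then show ?case
      using c3.arg_unique 18 eq by blast
  next
    case (19 a) then show ?case
      using c3.res_eq c12.res_eq in12 by simp
  next
    case (20 b) then show ?case
      using c3.tr_eq c23.tr_eq f by simp
  qed (use c12.P c23.S c3.S c12.objs c3.objs c23.objs fmap kmap in auto)
  then show ?thesis by blast
qed

lemma bcomp_assoc:
  assumes "l \<in> bhom G W X" and "m \<in> bhom G X Y" and "n \<in> bhom G Y Z"
  shows "bcomp G n (bcomp G m l) = bcomp G (bcomp G n m) l"
proof -
  obtain P1 P2 P3 where P: "is_bispan G P1" "bY P1 = X" "l = bclass G P1"
    "is_bispan G P2" "bX P2 = X" "bY P2 = Y" "m = bclass G P2"
    "is_bispan G P3" "bX P3 = Y" "n = bclass G P3"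
    using assms by (auto simp: bhom_iff)
  obtain S12 b12 e12 a12 c12 where 12: "composite G P1 P2 S12 b12 e12 a12 c12"
    using composite_exists P by metis
  obtain S23 b23 e23 a23 c23 where 23: "composite G P2 P3 S23 b23 e23 a23 c23"
    using composite_exists P by metis
  have "is_bispan G S12" "bY S12 = bX P3"
    using composite.S[OF 12] composite.objs[OF 12] P by simp_all
  then obtain S b e a c where 3: "composite G S12 P3 S b e a c"
    using composite_exists P by metis
  obtain b' e' a' c' where "composite G P1 S23 S b' e' a' c'"
    using composite_assoc[OF 12 3 23] by blast
  then show ?thesis
    using bcomp_composite[OF 12] bcomp_composite[OF 23] bcomp_composite[OF 3] bcomp_composite P
    by metis
qed

lemma bcomp_id:
  assumes "m \<in> bhom G X Y"
  shows "bcomp G m (bclass G (id_bispan X)) = m"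
proof -
  obtain Q where Q: "is_bispan G Q" "bX Q = X" "m = bclass G Q"
    using assms by (auto simp: bhom_iff)
  have X: "fin_gset G X" using Q by (auto simp: is_bispan_def)
  have m: "gset_map G (bA Q) X (bres Q)" "gset_map G (bA Q) (bB Q) (bnorm Q)"
    "gset_map G (bB Q) (bY Q) (btr Q)"
    using Q by (auto simp: is_bispan_iff)
  have id: "is_bispan G (id_bispan X)"
    using X by (simp add: is_bispan_iff id_bispan_def gset_map_id)
  have "composite G (id_bispan X) Q Q (\<lambda>b. b) (\<lambda>b c. bres Q c) (bres Q) (\<lambda>a. a)"
    using Q id m
    by (intro composite.intro is_group composite_axioms.intro)
      (auto simp: id_bispan_def gset_map_in gset_map_act[OF m(1)] intro: gset_map_id dest: gset_map_dom)
  then show ?thesis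
    using bcomp_composite Q by simp
qed

end


section \<open>Products in the category of bispans\<close>

definition sub_gset :: "'g gset \<Rightarrow> 'g pt set \<Rightarrow> 'g gset" where
  "sub_gset X S = mk_gset S (act X)"

definition is_coproduct :: "('g, 'b) monoid_scheme \<Rightarrow> 'g gset \<Rightarrow> 'g gset \<Rightarrow> 'g gset \<Rightarrow>
    ('g pt \<Rightarrow> 'g pt) \<Rightarrow> ('g pt \<Rightarrow> 'g pt) \<Rightarrow> bool" where
  "is_coproduct G X Y Z i j \<longleftrightarrow> gset_map G X Z i \<and> gset_map G Y Z j \<and>
     inj_on i (pts X) \<and> inj_on j (pts Y) \<and>
     i ` pts X \<inter> j ` pts Y = {} \<and> i ` pts X \<union> j ` pts Y = pts Z"

lemma pts_sub_gset [simp]: "pts (sub_gset X S) = S"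
  by (simp add: sub_gset_def)

lemma act_sub_gset [simp]: "x \<in> S \<Longrightarrow> act (sub_gset X S) g x = act X g x"
  by (simp add: sub_gset_def)

lemma is_bispan_simps [simp]:
  "is_bispan G (res_bispan X Y f) \<longleftrightarrow> gset_map G X Y f"
  "is_bispan G (norm_bispan X Y f) \<longleftrightarrow> gset_map G X Y f"
  "is_bispan G (tr_bispan X Y f) \<longleftrightarrow> gset_map G X Y f"
  "is_bispan G (id_bispan X) \<longleftrightarrow> fin_gset G X"
  by (auto simp: is_bispan_iff res_bispan_def norm_bispan_def tr_bispan_def id_bispan_def
      intro: gset_map_id dest: gset_map_dom gset_map_cod)

lemma bispan_sel [simp]:
  "bX (res_bispan X Y f) = Y" "bA (res_bispan X Y f) = X" "bB (res_bispan X Y f) = X"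
  "bY (res_bispan X Y f) = X" "bres (res_bispan X Y f) = f" "bnorm (res_bispan X Y f) = (\<lambda>x. x)"
  "btr (res_bispan X Y f) = (\<lambda>x. x)"
  "bX (norm_bispan X Y f) = X" "bA (norm_bispan X Y f) = X" "bB (norm_bispan X Y f) = Y"
  "bY (norm_bispan X Y f) = Y" "bres (norm_bispan X Y f) = (\<lambda>x. x)" "bnorm (norm_bispan X Y f) = f"
  "btr (norm_bispan X Y f) = (\<lambda>x. x)"
  "bX (tr_bispan X Y f) = X" "bA (tr_bispan X Y f) = X" "bB (tr_bispan X Y f) = X"
  "bY (tr_bispan X Y f) = Y" "bres (tr_bispan X Y f) = (\<lambda>x. x)" "bnorm (tr_bispan X Y f) = (\<lambda>x. x)"
  "btr (tr_bispan X Y f) = f"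
  "bX (id_bispan X) = X" "bY (id_bispan X) = X"
  by (simp_all add: res_bispan_def norm_bispan_def tr_bispan_def id_bispan_def)

lemma sum_gset_simps [simp]:
  "In1 x \<in> pts (sum_gset X Y) \<longleftrightarrow> x \<in> pts X"
  "In2 y \<in> pts (sum_gset X Y) \<longleftrightarrow> y \<in> pts Y"
  "x \<in> pts X \<Longrightarrow> act (sum_gset X Y) g (In1 x) = In1 (act X g x)"
  "y \<in> pts Y \<Longrightarrow> act (sum_gset X Y) g (In2 y) = In2 (act Y g y)"
  by (auto simp: sum_gset_def)

lemma sum_gsetE:
  assumes "z \<in> pts (sum_gset X Y)"
  obtains x where "z = In1 x" "x \<in> pts X" | y where "z = In2 y" "y \<in> pts Y"
  using assms by (auto simp: sum_gset_def)

lemma pts_empty_gset [simp]: "pts empty_gset = {}"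
  by (simp add: empty_gset_def)

text \<open>The composite of a bispan with the restriction to a part \<open>i : X \<rightarrow> Z\<close> of its target.\<close>

definition bispan_over :: "'g bispan \<Rightarrow> 'g gset \<Rightarrow> ('g pt \<Rightarrow> 'g pt) \<Rightarrow> 'g bispan" where
  "bispan_over H X i =
    \<lparr>bX = bX H, bA = sub_gset (bA H) {a \<in> pts (bA H). btr H (bnorm H a) \<in> i ` pts X},
     bB = sub_gset (bB H) {b \<in> pts (bB H). btr H b \<in> i ` pts X}, bY = X,
     bres = bres H, bnorm = bnorm H, btr = (\<lambda>b. inv_into (pts X) i (btr H b))\<rparr>"

lemma bispan_over_simps [simp]:
  "bX (bispan_over H X i) = bX H" "bY (bispan_over H X i) = X"
  "bA (bispan_over H X i) = sub_gset (bA H) {a \<in> pts (bA H). btr H (bnorm H a) \<in> i ` pts X}"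
  "bB (bispan_over H X i) = sub_gset (bB H) {b \<in> pts (bB H). btr H b \<in> i ` pts X}"
  "bres (bispan_over H X i) = bres H" "bnorm (bispan_over H X i) = bnorm H"
  "btr (bispan_over H X i) = (\<lambda>b. inv_into (pts X) i (btr H b))"
  by (simp_all add: bispan_over_def)

context group begin

lemma bhom_simps:
  "gset_map G X Y f \<Longrightarrow> bclass G (res_bispan X Y f) \<in> bhom G Y X"
  "gset_map G X Y f \<Longrightarrow> bclass G (norm_bispan X Y f) \<in> bhom G X Y"
  "gset_map G X Y f \<Longrightarrow> bclass G (tr_bispan X Y f) \<in> bhom G X Y"
  "fin_gset G X \<Longrightarrow> bclass G (id_bispan X) \<in> bhom G X X"
  using bclass_in_bhom[of "res_bispan X Y f"] bclass_in_bhom[of "norm_bispan X Y f"]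
    bclass_in_bhom[of "tr_bispan X Y f"] bclass_in_bhom[of "id_bispan X"]
  by simp_all

lemma fin_gset_sub_gset:
  "fin_gset G X \<Longrightarrow> S \<subseteq> pts X \<Longrightarrow> (\<And>g x. g \<in> carrier G \<Longrightarrow> x \<in> S \<Longrightarrow> act X g x \<in> S) \<Longrightarrow>
    fin_gset G (sub_gset X S)"
  unfolding sub_gset_def
  by (rule fin_gset_mk_gset) (auto simp: act_one act_mult subset_iff intro: finite_subset fin_gset_finite)

lemma fin_gset_sum_gset: "fin_gset G X \<Longrightarrow> fin_gset G Y \<Longrightarrow> fin_gset G (sum_gset X Y)"
  unfolding sum_gset_def
  by (rule fin_gset_mk_gset) (auto simp: fin_gset_finite act_closed act_one act_mult)

lemma fin_gset_empty: "fin_gset G empty_gset"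
  unfolding empty_gset_def by (rule fin_gset_mk_gset) auto

lemma gset_map_of_empty: "fin_gset G X \<Longrightarrow> fin_gset G Y \<Longrightarrow> pts X = {} \<Longrightarrow> gset_map G X Y f"
  by (rule gset_mapI) auto

lemma coproduct_sum_gset:
  "fin_gset G X \<Longrightarrow> fin_gset G Y \<Longrightarrow> is_coproduct G X Y (sum_gset X Y) In1 In2"
  by (auto simp: is_coproduct_def inj_on_def fin_gset_sum_gset intro!: gset_mapI elim: sum_gsetE)

lemma gset_map_fold: "fin_gset G X \<Longrightarrow> gset_map G (sum_gset X X) X fold_map"
  by (rule gset_mapI) (auto simp: fin_gset_sum_gset elim: sum_gsetE)

lemma gset_map_inv_into_image:
  assumes i: "gset_map G X Z i" "inj_on i (pts X)"
    and f: "gset_map G W Z f" and im: "f ` pts W \<subseteq> i ` pts X"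
  shows "gset_map G W X (\<lambda>w. inv_into (pts X) i (f w))"
proof (rule gset_mapI)
  fix g w assume g: "g \<in> carrier G" and w: "w \<in> pts W"
  obtain x where x: "x \<in> pts X" "f w = i x" using im w by blast
  have "f (act W g w) = i (act X g x)"
    using g w x by (simp add: gset_map_act[OF f] gset_map_act[OF i(1)])
  then show "inv_into (pts X) i (f (act W g w)) = act X g (inv_into (pts X) i (f w))"
    using x g i by (simp add: inv_into_f_f act_closed gset_map_dom)
qed (use i f im in \<open>auto intro!: inv_into_into dest: gset_map_dom gset_map_cod\<close>)

lemma composite_bispan_over:
  assumes H: "is_bispan G H" and i: "gset_map G X (bY H) i" "inj_on i (pts X)"
  shows "composite G H (res_bispan X (bY H) i) (bispan_over H X i)
    (\<lambda>b. inv_into (pts X) i (btr H b)) (\<lambda>b c. b) (\<lambda>a. a)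
    (\<lambda>a. inv_into (pts X) i (btr H (bnorm H a)))"
proof -
  have m: "gset_map G (bA H) (bX H) (bres H)" "gset_map G (bA H) (bB H) (bnorm H)"
    "gset_map G (bB H) (bY H) (btr H)"
    using H by (auto simp: is_bispan_iff)
  let ?A = "sub_gset (bA H) {a \<in> pts (bA H). btr H (bnorm H a) \<in> i ` pts X}"
  let ?B = "sub_gset (bB H) {b \<in> pts (bB H). btr H b \<in> i ` pts X}"
  have im: "act (bY H) g z \<in> i ` pts X" if gz: "g \<in> carrier G" "z \<in> i ` pts X" for g z
  proof -
    obtain x where x: "x \<in> pts X" "z = i x" using gz by blast
    then have "act (bY H) g z = i (act X g x)"
      using gz gset_map_act[OF i(1)] by simp
    then show ?thesis
      using x gz act_closed[OF gset_map_dom[OF i(1)]] by blast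
  qed
  have A: "fin_gset G ?A"
    by (rule fin_gset_sub_gset)
      (use m im in \<open>auto simp: act_closed gset_map_act[OF m(2)] gset_map_act[OF m(3)] gset_map_in dest: gset_map_dom\<close>)
  have B: "fin_gset G ?B"
    by (rule fin_gset_sub_gset)
      (use m im in \<open>auto simp: act_closed gset_map_act[OF m(3)] dest: gset_map_dom\<close>)
  have Ai: "gset_map G ?A (bA H) (\<lambda>a. a)" and Bi: "gset_map G ?B (bB H) (\<lambda>a. a)"
    using A B m by (auto intro!: gset_mapI dest: gset_map_dom)
  have n: "gset_map G ?A ?B (bnorm H)"
    using A B m(2) by (intro gset_mapI) (auto simp: gset_map_in gset_map_act)
  have t: "gset_map G ?B X (\<lambda>b. inv_into (pts X) i (btr H b))"
    by (rule gset_map_inv_into_image[OF i gset_map_comp[OF Bi m(3)]]) auto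
  have S: "is_bispan G (bispan_over H X i)"
    using gset_map_comp[OF Ai m(1)] n t by (simp add: is_bispan_iff)
  have inv: "i (inv_into (pts X) i z) = z" if "z \<in> i ` pts X" for z
    using that by (rule f_inv_into_f)
  show ?thesis
  proof (rule composite.intro, rule is_group, rule composite_axioms.intro, goal_cases)
    case (14) show ?case using gset_map_comp[OF n t] by simp
  qed (use H i S t Ai inv in auto)
qed

text \<open>Used to reassemble an isomorphism of bispans from its parts over the two summands.\<close>

lemma glue_iso:
  assumes X: "fin_gset G X" "U \<union> V = pts X" "U \<inter> V = {}"
    and X': "fin_gset G X'" "U' \<union> V' = pts X'" "U' \<inter> V' = {}"
    and f: "gset_map G (sub_gset X U) (sub_gset X' U') f" "bij_betw f U U'"
    and k: "gset_map G (sub_gset X V) (sub_gset X' V') k" "bij_betw k V V'"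
  shows "gset_map G X X' (\<lambda>x. if x \<in> U then f x else k x)"
    and "bij_betw (\<lambda>x. if x \<in> U then f x else k x) (pts X) (pts X')"
proof -
  have U: "act X g x \<in> U \<and> f (act X g x) = act X' g (f x) \<and> f x \<in> U'"
    if "g \<in> carrier G" "x \<in> U" for g x
    using that gset_map_act[OF f(1)] gset_map_in[OF f(1)] act_closed[OF gset_map_dom[OF f(1)]] by auto
  have V: "act X g x \<in> V \<and> k (act X g x) = act X' g (k x) \<and> k x \<in> V'"
    if "g \<in> carrier G" "x \<in> V" for g x
    using that gset_map_act[OF k(1)] gset_map_in[OF k(1)] act_closed[OF gset_map_dom[OF k(1)]] by auto
  let ?h = "\<lambda>x. if x \<in> U then f x else k x"
  show "gset_map G X X' ?h"
  proof (rule gset_mapI)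
    fix x assume "x \<in> pts X"
    then show "?h x \<in> pts X'"
      using U[OF one_closed, of x] V[OF one_closed, of x] unfolding X(2)[symmetric] X'(2)[symmetric] by auto
  next
    fix g x assume g: "g \<in> carrier G" and "x \<in> pts X"
    then consider "x \<in> U" | "x \<notin> U" "x \<in> V"
      using X(2) by blast
    then show "?h (act X g x) = act X' g (?h x)"
    proof cases
      case 1 then show ?thesis using U[OF g] by simp
    next
      case 2
      then have "act X g x \<notin> U" using V[OF g] X(3) by blast
      then show ?thesis using 2 V[OF g] by simp
    qed
  qed (use X X' in auto)
  have "bij_betw ?h U U'"
    using f(2) by (simp add: bij_betw_cong[of U ?h f])
  moreover have "bij_betw ?h V V'"
    using k(2) X(3) by (subst bij_betw_cong[of V ?h k]) auto
  ultimately show "bij_betw ?h (pts X) (pts X')"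
    unfolding X(2)[symmetric] X'(2)[symmetric] using X'(3) by (rule bij_betw_combine)
qed

text \<open>
  A bispan into a disjoint union consists of a bispan into each summand. Thus disjoint unions are
  products in the category of bispans, with the restrictions along the inclusions as projections.
\<close>

lemma coproduct_is_product:
  assumes c: "is_coproduct G X Y Z i j"
  shows "is_product G X Y Z (bclass G (res_bispan X Z i)) (bclass G (res_bispan Y Z j))"
proof -
  have i: "gset_map G X Z i" "inj_on i (pts X)" and j: "gset_map G Y Z j" "inj_on j (pts Y)"
    and disj: "i ` pts X \<inter> j ` pts Y = {}" and cover: "i ` pts X \<union> j ` pts Y = pts Z"
    using c by (auto simp: is_coproduct_def)
  let ?p = "bclass G (res_bispan X Z i)" and ?q = "bclass G (res_bispan Y Z j)"
  have pq: "?p \<in> bhom G Z X" "?q \<in> bhom G Z Y"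
    using i j by (simp_all add: bhom_simps)
  have ex: "\<exists>h. h \<in> bhom G W Z \<and> bcomp G ?p h = m \<and> bcomp G ?q h = n"
    if m: "m \<in> bhom G W X" and n: "n \<in> bhom G W Y" for W m n
  proof -
    obtain P where P: "is_bispan G P" "bX P = W" "bY P = X" "m = bclass G P"
      using m by (auto simp: bhom_iff)
    obtain Q where Q: "is_bispan G Q" "bX Q = W" "bY Q = Y" "n = bclass G Q"
      using n by (auto simp: bhom_iff)
    have mP: "gset_map G (bA P) W (bres P)" "gset_map G (bA P) (bB P) (bnorm P)"
      "gset_map G (bB P) X (btr P)"
      and mQ: "gset_map G (bA Q) W (bres Q)" "gset_map G (bA Q) (bB Q) (bnorm Q)"
      "gset_map G (bB Q) Y (btr Q)"
      using P Q by (auto simp: is_bispan_iff)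
    note fins = mP[THEN gset_map_dom] mP[THEN gset_map_cod] mQ[THEN gset_map_dom] mQ[THEN gset_map_cod]
      i(1)[THEN gset_map_cod]
    define H where "H = \<lparr>bX = W, bA = sum_gset (bA P) (bA Q), bB = sum_gset (bB P) (bB Q), bY = Z,
      bres = (\<lambda>z. case z of In1 a \<Rightarrow> bres P a | In2 a \<Rightarrow> bres Q a | _ \<Rightarrow> z),
      bnorm = (\<lambda>z. case z of In1 a \<Rightarrow> In1 (bnorm P a) | In2 a \<Rightarrow> In2 (bnorm Q a) | _ \<Rightarrow> z),
      btr = (\<lambda>z. case z of In1 b \<Rightarrow> i (btr P b) | In2 b \<Rightarrow> j (btr Q b) | _ \<Rightarrow> z)\<rparr>"
    have H: "is_bispan G H"
      unfolding is_bispan_iff H_def using fins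
      by (auto intro!: gset_mapI fin_gset_sum_gset elim!: sum_gsetE
          simp: gset_map_in[OF mP(1)] gset_map_act[OF mP(1)] gset_map_in[OF mP(2)] gset_map_act[OF mP(2)]
            gset_map_in[OF mP(3)] gset_map_act[OF mP(3)] gset_map_in[OF mQ(1)] gset_map_act[OF mQ(1)]
            gset_map_in[OF mQ(2)] gset_map_act[OF mQ(2)] gset_map_in[OF mQ(3)] gset_map_act[OF mQ(3)]
            gset_map_in[OF i(1)] gset_map_act[OF i(1)] gset_map_in[OF j(1)] gset_map_act[OF j(1)])
    have ij: "i x \<noteq> j y" "j y \<noteq> i x" if "x \<in> pts X" "y \<in> pts Y" for x y
      using that disj by auto
    have eq: "i x = i x' \<longleftrightarrow> x = x'" if "x \<in> pts X" "x' \<in> pts X" for x x'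
      using that i by (auto simp: inj_on_eq_iff)
    have eqj: "j x = j x' \<longleftrightarrow> x = x'" if "x \<in> pts Y" "x' \<in> pts Y" for x x'
      using that j by (auto simp: inj_on_eq_iff)
    have In1: "gset_map G (bA P) (sum_gset (bA P) (bA Q)) In1"
      and In2: "gset_map G (bA Q) (sum_gset (bA P) (bA Q)) In2"
      using fins by (auto intro!: gset_mapI fin_gset_sum_gset)
    have "composite G H (res_bispan X Z i) P (btr P) (\<lambda>b c. In1 b) In1 (\<lambda>a. btr P (bnorm P a))"
      by (rule composite.intro, rule is_group, rule composite_axioms.intro)
        (use H P(1) i mP In1 gset_map_comp[OF mP(2,3)] in \<open>auto simp: H_def P(2,3) ij eq gset_map_in[OF mP(3)]
          gset_map_in[OF mQ(3)] elim!: sum_gsetE\<close>)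
    moreover have "composite G H (res_bispan Y Z j) Q (btr Q) (\<lambda>b c. In2 b) In2 (\<lambda>a. btr Q (bnorm Q a))"
      by (rule composite.intro, rule is_group, rule composite_axioms.intro)
        (use H Q(1) j mQ In2 gset_map_comp[OF mQ(2,3)] in \<open>auto simp: H_def Q(2,3) ij eqj gset_map_in[OF mP(3)]
          gset_map_in[OF mQ(3)] elim!: sum_gsetE\<close>)
    ultimately have "bcomp G ?p (bclass G H) = m" "bcomp G ?q (bclass G H) = n"
      using bcomp_composite P Q by simp_all
    then show ?thesis
      using bclass_in_bhom[OF H] by (auto simp: H_def)
  qed
  have un: "h = h'"
    if h: "h \<in> bhom G W Z" "h' \<in> bhom G W Z"
      and e: "bcomp G ?p h = bcomp G ?p h'" "bcomp G ?q h = bcomp G ?q h'" for W h h'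
  proof -
    obtain H where H: "is_bispan G H" "bX H = W" "bY H = Z" "h = bclass G H"
      using h by (auto simp: bhom_iff)
    obtain H' where H': "is_bispan G H'" "bX H' = W" "bY H' = Z" "h' = bclass G H'"
      using h by (auto simp: bhom_iff)
    have iH: "gset_map G X (bY H) i" "gset_map G X (bY H') i" "gset_map G Y (bY H) j" "gset_map G Y (bY H') j"
      using i j H H' by auto
    note ci = composite_bispan_over[OF H(1) iH(1) i(2)] composite_bispan_over[OF H'(1) iH(2) i(2)]
    note cj = composite_bispan_over[OF H(1) iH(3) j(2)] composite_bispan_over[OF H'(1) iH(4) j(2)]
    have "bclass G (bispan_over H X i) = bclass G (bispan_over H' X i)"
      using bcomp_composite[OF ci(1)] bcomp_composite[OF ci(2)] e H H' by simp
    then obtain a1 b1 where 1: "bispan_isos G (bispan_over H X i) (bispan_over H' X i) a1 b1"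
      using bclass_eq_iff ci[THEN composite.S] by blast
    have "bclass G (bispan_over H Y j) = bclass G (bispan_over H' Y j)"
      using bcomp_composite[OF cj(1)] bcomp_composite[OF cj(2)] e H H' by simp
    then obtain a2 b2 where 2: "bispan_isos G (bispan_over H Y j) (bispan_over H' Y j) a2 b2"
      using bclass_eq_iff cj[THEN composite.S] by blast
    have m: "\<And>a. a \<in> pts (bA H) \<Longrightarrow> bnorm H a \<in> pts (bB H)"
      "\<And>b. b \<in> pts (bB H) \<Longrightarrow> btr H b \<in> pts Z"
      using H by (auto simp: is_bispan_iff gset_map_in)
    have m': "\<And>a. a \<in> pts (bA H') \<Longrightarrow> bnorm H' a \<in> pts (bB H')"
      "\<And>b. b \<in> pts (bB H') \<Longrightarrow> btr H' b \<in> pts Z"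
      using H' by (auto simp: is_bispan_iff gset_map_in)
    let ?U = "{a \<in> pts (bA H). btr H (bnorm H a) \<in> i ` pts X}"
    let ?V = "{a \<in> pts (bA H). btr H (bnorm H a) \<in> j ` pts Y}"
    let ?U' = "{a \<in> pts (bA H'). btr H' (bnorm H' a) \<in> i ` pts X}"
    let ?V' = "{a \<in> pts (bA H'). btr H' (bnorm H' a) \<in> j ` pts Y}"
    let ?R = "{b \<in> pts (bB H). btr H b \<in> i ` pts X}" and ?S = "{b \<in> pts (bB H). btr H b \<in> j ` pts Y}"
    let ?R' = "{b \<in> pts (bB H'). btr H' b \<in> i ` pts X}" and ?S' = "{b \<in> pts (bB H'). btr H' b \<in> j ` pts Y}"
    let ?\<alpha> = "\<lambda>a. if a \<in> ?U then a1 a else a2 a" and ?\<beta> = "\<lambda>b. if b \<in> ?R then b1 b else b2 b"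
    have finA: "fin_gset G (bA H)" "fin_gset G (bA H')" "fin_gset G (bB H)" "fin_gset G (bB H')"
      using H H' by (auto simp: is_bispan_def)
    have split: "{a \<in> A. f a \<in> i ` pts X} \<union> {a \<in> A. f a \<in> j ` pts Y} = A"
      "{a \<in> A. f a \<in> i ` pts X} \<inter> {a \<in> A. f a \<in> j ` pts Y} = {}"
      if "\<forall>a\<in>A. f a \<in> pts Z" for A f
      using that disj unfolding cover[symmetric] by auto
    have in_Z: "\<forall>a\<in>pts (bA H). btr H (bnorm H a) \<in> pts Z" "\<forall>a\<in>pts (bA H'). btr H' (bnorm H' a) \<in> pts Z"
      "\<forall>b\<in>pts (bB H). btr H b \<in> pts Z" "\<forall>b\<in>pts (bB H'). btr H' b \<in> pts Z"
      using m m' by blast+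
    note sA = split[OF in_Z(1)] split[OF in_Z(2)] and sB = split[OF in_Z(3)] split[OF in_Z(4)]
    have gA: "gset_map G (sub_gset (bA H) ?U) (sub_gset (bA H') ?U') a1" "bij_betw a1 ?U ?U'"
      "gset_map G (sub_gset (bA H) ?V) (sub_gset (bA H') ?V') a2" "bij_betw a2 ?V ?V'"
      and gB: "gset_map G (sub_gset (bB H) ?R) (sub_gset (bB H') ?R') b1" "bij_betw b1 ?R ?R'"
      "gset_map G (sub_gset (bB H) ?S) (sub_gset (bB H') ?S') b2" "bij_betw b2 ?S ?S'"
      using 1 2 by (simp_all add: bispan_isos_def)
    have inv: "z = z'" if "z \<in> i ` pts X" "z' \<in> i ` pts X" "inv_into (pts X) i z = inv_into (pts X) i z'" for z z'
      using that by (metis f_inv_into_f)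
    have inv': "z = z'" if "z \<in> j ` pts Y" "z' \<in> j ` pts Y" "inv_into (pts Y) j z = inv_into (pts Y) j z'" for z z'
      using that by (metis f_inv_into_f)
    have A1: "bres H' (a1 a) = bres H a \<and> bnorm H' (a1 a) = b1 (bnorm H a)" if "a \<in> ?U" for a
      using 1 that by (simp add: bispan_isos_def)
    have A2: "bres H' (a2 a) = bres H a \<and> bnorm H' (a2 a) = b2 (bnorm H a)" if "a \<in> ?V" for a
      using 2 that by (simp add: bispan_isos_def)
    have B1: "btr H' (b1 b) = btr H b" if b: "b \<in> ?R" for b
    proof (rule inv)
      have "b1 b \<in> ?R'" using gset_map_in[OF gB(1)] b by simp
      then show "btr H' (b1 b) \<in> i ` pts X" by simp
      show "inv_into (pts X) i (btr H' (b1 b)) = inv_into (pts X) i (btr H b)"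
        using 1 b by (simp add: bispan_isos_def)
    qed (use b in simp)
    have B2: "btr H' (b2 b) = btr H b" if b: "b \<in> ?S" for b
    proof (rule inv')
      have "b2 b \<in> ?S'" using gset_map_in[OF gB(3)] b by simp
      then show "btr H' (b2 b) \<in> j ` pts Y" by simp
      show "inv_into (pts Y) j (btr H' (b2 b)) = inv_into (pts Y) j (btr H b)"
        using 2 b by (simp add: bispan_isos_def)
    qed (use b in simp)
    have \<alpha>: "?\<alpha> a = a1 a" if "a \<in> ?U" for a
      using that by (rule if_P)
    have \<alpha>': "?\<alpha> a = a2 a" if "a \<in> ?V" for a
      using that sA(2) by (intro if_not_P) blast
    have \<beta>: "?\<beta> b = b1 b" if "b \<in> ?R" for b
      using that by (rule if_P)
    have \<beta>': "?\<beta> b = b2 b" if "b \<in> ?S" for b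
      using that sB(2) by (intro if_not_P) blast
    have resp: "bres H' (?\<alpha> a) = bres H a \<and> bnorm H' (?\<alpha> a) = ?\<beta> (bnorm H a)"
      if a: "a \<in> pts (bA H)" for a
    proof -
      consider "a \<in> ?U" | "a \<in> ?V" using a sA(1) by blast
      then show ?thesis
      proof cases
        case 1
        then have "bnorm H a \<in> ?R" using m by blast
        show ?thesis unfolding \<alpha>[OF 1] \<beta>[OF \<open>bnorm H a \<in> ?R\<close>] by (rule A1[OF 1])
      next
        case 2
        then have "bnorm H a \<in> ?S" using m by blast
        show ?thesis unfolding \<alpha>'[OF 2] \<beta>'[OF \<open>bnorm H a \<in> ?S\<close>] by (rule A2[OF 2])
      qed
    qed
    have respB: "btr H' (?\<beta> b) = btr H b" if b: "b \<in> pts (bB H)" for b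
    proof -
      consider "b \<in> ?R" | "b \<in> ?S" using b sB(1) by blast
      then show ?thesis
      proof cases
        case 1 show ?thesis unfolding \<beta>[OF 1] by (rule B1[OF 1])
      next
        case 2 show ?thesis unfolding \<beta>'[OF 2] by (rule B2[OF 2])
      qed
    qed
    note glueA = glue_iso[OF finA(1) sA(1,2) finA(2) sA(3,4) gA]
    note glueB = glue_iso[OF finA(3) sB(1,2) finA(4) sB(3,4) gB]
    have "bispan_isos G H H' ?\<alpha> ?\<beta>"
      unfolding bispan_isos_def
      by (intro conjI ballI glueA glueB resp[THEN conjunct1] resp[THEN conjunct2] respB)
        (simp_all only: H(2,3) H'(2,3))
    then show ?thesis
      using H H' bclass_eq_iff by blast
  qed
  show ?thesis
    unfolding is_product_def
  proof (intro conjI allI impI)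
    fix W m n assume W: "fin_gset G W \<and> m \<in> bhom G W X \<and> n \<in> bhom G W Y"
    then obtain h where h: "h \<in> bhom G W Z \<and> bcomp G ?p h = m \<and> bcomp G ?q h = n"
      using ex by blast
    show "\<exists>!h. h \<in> bhom G W Z \<and> bcomp G ?p h = m \<and> bcomp G ?q h = n"
    proof (rule ex1I[of _ h])
      fix h' assume h': "h' \<in> bhom G W Z \<and> bcomp G ?p h' = m \<and> bcomp G ?q h' = n"
      show "h' = h" by (rule un[of h' W h]) (use h h' in auto)
    qed (rule h)
  qed (use i(1) j(1) pq gset_map_dom gset_map_cod in blast)+
qed

text \<open>
  Bispans from the empty set to \<open>Z\<close> are \<open>G\<close>-sets over \<open>Z\<close>; the empty one and \<open>Z\<close> itself are isomorphic
  only if \<open>Z\<close> is empty.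
\<close>

lemma terminal_iff: "is_terminal G Z \<longleftrightarrow> fin_gset G Z \<and> pts Z = {}"
proof
  assume t: "is_terminal G Z"
  let ?P = "\<lambda>B. \<lparr>bX = empty_gset, bA = empty_gset, bB = B, bY = Z,
    bres = (\<lambda>x. x), bnorm = (\<lambda>x. x), btr = (\<lambda>x. x)\<rparr>"
  have Z: "fin_gset G Z" using t by (simp add: is_terminal_def)
  have P: "is_bispan G (?P Z)" "is_bispan G (?P empty_gset)"
    using Z by (simp_all add: is_bispan_iff fin_gset_empty gset_map_of_empty gset_map_id)
  have "bclass G (?P Z) = bclass G (?P empty_gset)"
  proof -
    have "\<exists>!m. m \<in> bhom G empty_gset Z"
      using t fin_gset_empty by (simp add: is_terminal_def)
    moreover have "bclass G (?P Z) \<in> bhom G empty_gset Z" "bclass G (?P empty_gset) \<in> bhom G empty_gset Z"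
      using bclass_in_bhom[OF P(1)] bclass_in_bhom[OF P(2)] by simp_all
    ultimately show ?thesis by blast
  qed
  then obtain \<alpha> \<beta> where "bispan_isos G (?P Z) (?P empty_gset) \<alpha> \<beta>"
    using P bclass_eq_iff by blast
  then show "fin_gset G Z \<and> pts Z = {}"
    using Z unfolding bispan_isos_def bij_betw_def by simp
next
  assume Z: "fin_gset G Z \<and> pts Z = {}"
  have "\<exists>!m. m \<in> bhom G W Z" if W: "fin_gset G W" for W
  proof -
    let ?P = "\<lparr>bX = W, bA = Z, bB = Z, bY = Z,
      bres = (\<lambda>x. x), bnorm = (\<lambda>x. x), btr = (\<lambda>x. x)\<rparr>"
    have P: "is_bispan G ?P"
      using Z W by (simp add: is_bispan_iff gset_map_of_empty)
    have "bclass G Q = bclass G ?P" if Q: "is_bispan G Q" "bX Q = W" "bY Q = Z" for Q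
    proof -
      have mQ: "gset_map G (bA Q) (bB Q) (bnorm Q)" "gset_map G (bB Q) Z (btr Q)"
        using Q by (auto simp: is_bispan_iff)
      have e: "pts (bB Q) = {}"
        using gset_map_in[OF mQ(2)] Z by blast
      moreover have "pts (bA Q) = {}"
        using gset_map_in[OF mQ(1)] e by blast
      moreover have "fin_gset G (bA Q)" "fin_gset G (bB Q)"
        using mQ by (auto dest: gset_map_dom)
      ultimately have "bispan_isos G Q ?P (\<lambda>x. x) (\<lambda>x. x)"
        using Q Z unfolding bispan_isos_def bij_betw_def by (simp add: gset_map_of_empty)
      then show ?thesis
        using Q P bclass_eq_iff by blast
    qed
    then have "m = bclass G ?P" if "m \<in> bhom G W Z" for m
      using that unfolding bhom_iff by blast
    moreover have "bclass G ?P \<in> bhom G W Z"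
      using bclass_in_bhom[OF P] by simp
    ultimately show ?thesis by blast
  qed
  then show "is_terminal G Z"
    using Z by (simp add: is_terminal_def)
qed

text \<open>Products being unique up to isomorphism, preserving the disjoint unions is enough.\<close>

lemma product_preservingI:
  assumes T: "is_functor G T"
    and empty: "\<And>Z. fin_gset G Z \<Longrightarrow> pts Z = {} \<Longrightarrow> \<exists>x. obj T Z = {x}"
    and sum: "\<And>X Y. fin_gset G X \<Longrightarrow> fin_gset G Y \<Longrightarrow>
      bij_betw (\<lambda>z. (mor T (bclass G (res_bispan X (sum_gset X Y) In1)) z,
        mor T (bclass G (res_bispan Y (sum_gset X Y) In2)) z))
        (obj T (sum_gset X Y)) (obj T X \<times> obj T Y)"
  shows "product_preserving G T"
  unfolding product_preserving_def
proof (intro conjI allI impI)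
  fix Z assume "is_terminal G Z"
  then show "\<exists>x. obj T Z = {x}" using empty terminal_iff by blast
next
  fix X Y Z p q assume prod: "is_product G X Y Z p q"
  then have fin: "fin_gset G X" "fin_gset G Y" "fin_gset G Z"
    and pq: "p \<in> bhom G Z X" "q \<in> bhom G Z Y" by (auto simp: is_product_def)
  let ?S = "sum_gset X Y"
  define r1 where "r1 = bclass G (res_bispan X ?S In1)"
  define r2 where "r2 = bclass G (res_bispan Y ?S In2)"
  have sprod: "is_product G X Y ?S r1 r2"
    unfolding r1_def r2_def using coproduct_is_product coproduct_sum_gset fin by blast
  then have finS: "fin_gset G ?S" and r: "r1 \<in> bhom G ?S X" "r2 \<in> bhom G ?S Y"
    by (auto simp: is_product_def)
  have "\<exists>!h. h \<in> bhom G Z ?S \<and> bcomp G r1 h = p \<and> bcomp G r2 h = q"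
    using sprod pq fin unfolding is_product_def by simp
  then obtain h where h: "h \<in> bhom G Z ?S" "bcomp G r1 h = p" "bcomp G r2 h = q"
    by blast
  have "\<exists>!k. k \<in> bhom G ?S Z \<and> bcomp G p k = r1 \<and> bcomp G q k = r2"
    using prod r finS unfolding is_product_def by simp
  then obtain k where k: "k \<in> bhom G ?S Z" "bcomp G p k = r1" "bcomp G q k = r2"
    by blast
  have kh: "bcomp G k h \<in> bhom G Z Z" using bcomp_in_bhom[OF h(1) k(1)] .
  have id: "bclass G (id_bispan Z) \<in> bhom G Z Z"
    using fin by (simp add: bhom_simps)
  have "bcomp G p (bcomp G k h) = p" "bcomp G q (bcomp G k h) = q"
    using bcomp_assoc[OF h(1) k(1) pq(1)] bcomp_assoc[OF h(1) k(1) pq(2)] h k by simp_all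
  moreover have "bcomp G p (bclass G (id_bispan Z)) = p" "bcomp G q (bclass G (id_bispan Z)) = q"
    using bcomp_id pq by auto
  moreover have "\<exists>!e. e \<in> bhom G Z Z \<and> bcomp G p e = p \<and> bcomp G q e = q"
    using prod pq fin unfolding is_product_def by simp
  ultimately have kh_id: "bcomp G k h = bclass G (id_bispan Z)"
    using kh id by blast
  have F: "mor T m \<in> obj T A \<rightarrow> obj T B" if "fin_gset G A" "fin_gset G B" "m \<in> bhom G A B" for A B m
    using T that unfolding is_functor_def by blast
  have FF: "mor T (bcomp G n m) x = mor T n (mor T m x)"
    if "fin_gset G A" "fin_gset G B" "fin_gset G C" "m \<in> bhom G A B" "n \<in> bhom G B C" "x \<in> obj T A"
    for A B C m n x
    using T that unfolding is_functor_def by blast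
  have bij: "bij_betw (\<lambda>z. (mor T r1 z, mor T r2 z)) (obj T ?S) (obj T X \<times> obj T Y)"
    unfolding r1_def r2_def using sum fin by blast
  have hz: "mor T h z \<in> obj T ?S" "mor T r1 (mor T h z) = mor T p z" "mor T r2 (mor T h z) = mor T q z"
    "mor T k (mor T h z) = z" if z: "z \<in> obj T Z" for z
  proof -
    show "mor T h z \<in> obj T ?S" using F[OF fin(3) finS h(1)] z by blast
    show "mor T r1 (mor T h z) = mor T p z" "mor T r2 (mor T h z) = mor T q z"
      using FF[OF fin(3) finS fin(1) h(1) r(1) z] FF[OF fin(3) finS fin(2) h(1) r(2) z] h by simp_all
    show "mor T k (mor T h z) = z"
      using FF[OF fin(3) finS fin(3) h(1) k(1) z] kh_id T fin z unfolding is_functor_def by simp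
  qed
  have ks: "mor T k s \<in> obj T Z" "mor T p (mor T k s) = mor T r1 s" "mor T q (mor T k s) = mor T r2 s"
    if s: "s \<in> obj T ?S" for s
  proof -
    show "mor T k s \<in> obj T Z" using F[OF finS fin(3) k(1)] s by blast
    show "mor T p (mor T k s) = mor T r1 s" "mor T q (mor T k s) = mor T r2 s"
      using FF[OF finS fin(3,1) k(1) pq(1) s] FF[OF finS fin(3,2) k(1) pq(2) s] k by simp_all
  qed
  have inj: "inj_on (\<lambda>z. (mor T p z, mor T q z)) (obj T Z)"
  proof (rule inj_onI)
    fix z z' assume z: "z \<in> obj T Z" "z' \<in> obj T Z" "(mor T p z, mor T q z) = (mor T p z', mor T q z')"
    then have "mor T h z = mor T h z'"
      using bij hz by (auto simp: bij_betw_def inj_on_def)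
    then show "z = z'" using hz(4) z by metis
  qed
  have "(\<lambda>z. (mor T p z, mor T q z)) ` obj T Z = obj T X \<times> obj T Y"
  proof
    show "obj T X \<times> obj T Y \<subseteq> (\<lambda>z. (mor T p z, mor T q z)) ` obj T Z"
    proof
      fix w assume "w \<in> obj T X \<times> obj T Y"
      then obtain s where s: "s \<in> obj T ?S" "w = (mor T r1 s, mor T r2 s)"
        using bij by (auto simp: bij_betw_def image_iff)
      then show "w \<in> (\<lambda>z. (mor T p z, mor T q z)) ` obj T Z"
        using ks by (intro image_eqI[of _ _ "mor T k s"]) auto
    qed
    show "(\<lambda>z. (mor T p z, mor T q z)) ` obj T Z \<subseteq> obj T X \<times> obj T Y"
      using funcset_mem[OF F[OF fin(3,1) pq(1)]] funcset_mem[OF F[OF fin(3,2) pq(2)]] by auto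
  qed
  then show "bij_betw (\<lambda>z. (mor T p z, mor T q z)) (obj T Z) (obj T X \<times> obj T Y)"
    using inj by (simp add: bij_betw_def)
qed

end


section \<open>Restrictions, norms and transfers\<close>

definition is_pullback :: "('g, 'b) monoid_scheme \<Rightarrow> 'g gset \<Rightarrow> 'g gset \<Rightarrow> 'g gset \<Rightarrow> 'g gset \<Rightarrow>
    ('g pt \<Rightarrow> 'g pt) \<Rightarrow> ('g pt \<Rightarrow> 'g pt) \<Rightarrow> ('g pt \<Rightarrow> 'g pt) \<Rightarrow> ('g pt \<Rightarrow> 'g pt) \<Rightarrow> bool" where
  "is_pullback G A X Y B p q f k \<longleftrightarrow>
     gset_map G A X p \<and> gset_map G A Y q \<and> gset_map G X B f \<and> gset_map G Y B k \<and>
     (\<forall>a\<in>pts A. f (p a) = k (q a)) \<and>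
     (\<forall>x\<in>pts X. \<forall>y\<in>pts Y. f x = k y \<longrightarrow> (\<exists>a\<in>pts A. p a = x \<and> q a = y)) \<and>
     (\<forall>a\<in>pts A. \<forall>a'\<in>pts A. p a = p a' \<longrightarrow> q a = q a' \<longrightarrow> a = a')"

lemma is_pullbackI:
  assumes "gset_map G A X p" "gset_map G A Y q" "gset_map G X B f" "gset_map G Y B k"
    and "\<And>a. a \<in> pts A \<Longrightarrow> f (p a) = k (q a)"
    and "\<And>x y. x \<in> pts X \<Longrightarrow> y \<in> pts Y \<Longrightarrow> f x = k y \<Longrightarrow> \<exists>a\<in>pts A. p a = x \<and> q a = y"
    and "\<And>a a'. a \<in> pts A \<Longrightarrow> a' \<in> pts A \<Longrightarrow> p a = p a' \<Longrightarrow> q a = q a' \<Longrightarrow> a = a'"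
  shows "is_pullback G A X Y B p q f k"
  using assms by (simp add: is_pullback_def)

lemma coproductD:
  assumes "is_coproduct G X Y Z i j"
  shows "gset_map G X Z i" and "gset_map G Y Z j"
    and "x \<in> pts X \<Longrightarrow> x' \<in> pts X \<Longrightarrow> i x = i x' \<longleftrightarrow> x = x'"
    and "y \<in> pts Y \<Longrightarrow> y' \<in> pts Y \<Longrightarrow> j y = j y' \<longleftrightarrow> y = y'"
    and "x \<in> pts X \<Longrightarrow> y \<in> pts Y \<Longrightarrow> i x \<noteq> j y"
    and "x \<in> pts X \<Longrightarrow> y \<in> pts Y \<Longrightarrow> j y \<noteq> i x"
    and "z \<in> pts Z \<Longrightarrow> (\<exists>x\<in>pts X. z = i x) \<or> (\<exists>y\<in>pts Y. z = j y)"
proof -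
  note c = assms[unfolded is_coproduct_def]
  show "gset_map G X Z i" "gset_map G Y Z j" using c by blast+
  show "i x = i x' \<longleftrightarrow> x = x'" if "x \<in> pts X" "x' \<in> pts X"
    using c that inj_on_eq_iff[of i "pts X" x x'] by simp
  show "j y = j y' \<longleftrightarrow> y = y'" if "y \<in> pts Y" "y' \<in> pts Y"
    using c that inj_on_eq_iff[of j "pts Y" y y'] by simp
  have disj: "i ` pts X \<inter> j ` pts Y = {}" and cover: "pts Z = i ` pts X \<union> j ` pts Y"
    using c by blast+
  show "i x \<noteq> j y" "j y \<noteq> i x" if "x \<in> pts X" "y \<in> pts Y"
    using disj that by blast+
  show "(\<exists>x\<in>pts X. z = i x) \<or> (\<exists>y\<in>pts Y. z = j y)" if "z \<in> pts Z"
    using that unfolding cover by blast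
qed

definition is_partition :: "('g, 'b) monoid_scheme \<Rightarrow> 'k set \<Rightarrow> ('k \<Rightarrow> 'g gset) \<Rightarrow> 'g gset \<Rightarrow>
    ('k \<Rightarrow> 'g pt \<Rightarrow> 'g pt) \<Rightarrow> bool" where
  "is_partition G I W Z i \<longleftrightarrow> finite I \<and> fin_gset G Z \<and>
     (\<forall>k\<in>I. gset_map G (W k) Z (i k) \<and> inj_on (i k) (pts (W k))) \<and>
     (\<forall>k\<in>I. \<forall>l\<in>I. k \<noteq> l \<longrightarrow> i k ` pts (W k) \<inter> i l ` pts (W l) = {}) \<and>
     pts Z = (\<Union>k\<in>I. i k ` pts (W k))"

lemma (in group) gset_map_comp_eq:
  assumes "gset_map G X Y f" and "gset_map G Y Z k" and "\<And>x. x \<in> pts X \<Longrightarrow> h x = k (f x)"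
  shows "gset_map G X Z h"
  using gset_map_comp[OF assms(1,2)] assms(3)
  by (rule gset_map_cong) (auto intro: act_closed gset_map_dom[OF assms(1)])

locale tambara = group G for G :: "('g, 'b) monoid_scheme" (structure) +
  fixes R :: "('g, 'r) bifunctor"
  assumes finite_G: "finite (carrier G)" and tambara_functor: "tambara_functor G R"
begin

abbreviation rs :: "'g gset \<Rightarrow> 'g gset \<Rightarrow> ('g pt \<Rightarrow> 'g pt) \<Rightarrow> 'r \<Rightarrow> 'r" where
  "rs X Y f \<equiv> mor R (bclass G (res_bispan X Y f))"

abbreviation nm :: "'g gset \<Rightarrow> 'g gset \<Rightarrow> ('g pt \<Rightarrow> 'g pt) \<Rightarrow> 'r \<Rightarrow> 'r" where
  "nm X Y f \<equiv> mor R (bclass G (norm_bispan X Y f))"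

abbreviation tr :: "'g gset \<Rightarrow> 'g gset \<Rightarrow> ('g pt \<Rightarrow> 'g pt) \<Rightarrow> 'r \<Rightarrow> 'r" where
  "tr X Y f \<equiv> mor R (bclass G (tr_bispan X Y f))"

lemma mor_closed:
  assumes "is_bispan G P" and "x \<in> obj R (bX P)"
  shows "mor R (bclass G P) x \<in> obj R (bY P)"
proof -
  have "fin_gset G (bX P)" "fin_gset G (bY P)"
    using assms by (auto simp: is_bispan_def)
  then have "mor R (bclass G P) \<in> obj R (bX P) \<rightarrow> obj R (bY P)"
    using tambara_functor bclass_in_bhom[OF assms(1)]
    unfolding tambara_functor_def is_functor_def by blast
  then show ?thesis using assms(2) by blast
qed

lemma mor_composite:
  assumes "composite G P Q S base ev argA argC" and "x \<in> obj R (bX P)"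
  shows "mor R (bclass G Q) (mor R (bclass G P) x) = mor R (bclass G S) x"
proof -
  interpret c: composite G P Q S base ev argA argC by fact
  have m: "bclass G P \<in> bhom G (bX P) (bY P)" "bclass G Q \<in> bhom G (bY P) (bY Q)"
    using bclass_in_bhom[OF c.P] bclass_in_bhom[OF c.Q] c.objs by simp_all
  have fin: "fin_gset G (bX P)" "fin_gset G (bY P)" "fin_gset G (bY Q)"
    using c.P c.Q by (auto simp: is_bispan_def)
  have "\<forall>X Y Z m n. fin_gset G X \<and> fin_gset G Y \<and> fin_gset G Z \<and> m \<in> bhom G X Y \<and> n \<in> bhom G Y Z \<longrightarrow>
      (\<forall>x\<in>obj R X. mor R (bcomp G n m) x = mor R n (mor R m x))"
    using tambara_functor unfolding tambara_functor_def is_functor_def by blast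
  then have "mor R (bcomp G (bclass G Q) (bclass G P)) x = mor R (bclass G Q) (mor R (bclass G P) x)"
    using fin m assms(2) by blast
  then show ?thesis
    using bcomp_composite[OF assms(1)] by simp
qed

lemma mor_id:
  "fin_gset G X \<Longrightarrow> x \<in> obj R X \<Longrightarrow> mor R (bclass G (id_bispan X)) x = x"
  using tambara_functor unfolding tambara_functor_def is_functor_def by blast

lemma rs_closed: "gset_map G X Y f \<Longrightarrow> z \<in> obj R Y \<Longrightarrow> rs X Y f z \<in> obj R X"
  using mor_closed[of "res_bispan X Y f"] by simp

lemma nm_closed: "gset_map G X Y f \<Longrightarrow> z \<in> obj R X \<Longrightarrow> nm X Y f z \<in> obj R Y"
  using mor_closed[of "norm_bispan X Y f"] by simp

lemma tr_closed: "gset_map G X Y f \<Longrightarrow> z \<in> obj R X \<Longrightarrow> tr X Y f z \<in> obj R Y"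
  using mor_closed[of "tr_bispan X Y f"] by simp

lemma rs_id: "fin_gset G X \<Longrightarrow> z \<in> obj R X \<Longrightarrow> rs X X (\<lambda>x. x) z = z"
  and nm_id: "fin_gset G X \<Longrightarrow> z \<in> obj R X \<Longrightarrow> nm X X (\<lambda>x. x) z = z"
  and tr_id: "fin_gset G X \<Longrightarrow> z \<in> obj R X \<Longrightarrow> tr X X (\<lambda>x. x) z = z"
  using mor_id[of X z] by (simp_all add: id_bispan_def res_bispan_def norm_bispan_def tr_bispan_def)

lemma rs_rs:
  assumes f: "gset_map G X Y f" and k: "gset_map G Y Z k"
    and h: "\<And>x. x \<in> pts X \<Longrightarrow> h x = k (f x)" and z: "z \<in> obj R Z"
  shows "rs X Y f (rs Y Z k z) = rs X Z h z"
proof -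
  have "gset_map G X Z h"
    using f k h by (rule gset_map_comp_eq)
  then have "composite G (res_bispan Y Z k) (res_bispan X Y f) (res_bispan X Z h) (\<lambda>b. b) (\<lambda>b c. f c) f (\<lambda>a. a)"
    by (intro composite.intro is_group composite_axioms.intro)
      (use f k in \<open>auto simp: h gset_map_in gset_map_act intro: gset_map_id dest: gset_map_dom\<close>)
  then show ?thesis using mor_composite z by fastforce
qed

lemma nm_nm:
  assumes f: "gset_map G X Y f" and k: "gset_map G Y Z k"
    and h: "\<And>x. x \<in> pts X \<Longrightarrow> h x = k (f x)" and z: "z \<in> obj R X"
  shows "nm Y Z k (nm X Y f z) = nm X Z h z"
proof -
  have "gset_map G X Z h"
    using f k h by (rule gset_map_comp_eq)
  then have "composite G (norm_bispan X Y f) (norm_bispan Y Z k) (norm_bispan X Z h) (\<lambda>b. b) (\<lambda>b c. c) (\<lambda>a. a) f"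
    by (intro composite.intro is_group composite_axioms.intro)
      (use f k in \<open>auto simp: h gset_map_in gset_map_act intro: gset_map_id dest: gset_map_dom gset_map_cod\<close>)
  then show ?thesis using mor_composite z by fastforce
qed

lemma tr_tr:
  assumes f: "gset_map G X Y f" and k: "gset_map G Y Z k"
    and h: "\<And>x. x \<in> pts X \<Longrightarrow> h x = k (f x)" and z: "z \<in> obj R X"
  shows "tr Y Z k (tr X Y f z) = tr X Z h z"
proof -
  have "gset_map G X Z h"
    using f k h by (rule gset_map_comp_eq)
  then have "composite G (tr_bispan X Y f) (tr_bispan Y Z k) (tr_bispan X Z h) f (\<lambda>b c. b) (\<lambda>a. a) f"
    by (intro composite.intro is_group composite_axioms.intro)
      (use f k in \<open>auto simp: h gset_map_in gset_map_act intro: gset_map_id dest: gset_map_dom gset_map_cod\<close>)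
  then show ?thesis using mor_composite z by fastforce
qed

text \<open>
  Because of this factorisation, a property of all morphisms follows from the properties of
  restrictions, norms and transfers.
\<close>

lemma mor_bispan:
  assumes P: "is_bispan G P" and x: "x \<in> obj R (bX P)"
  shows "mor R (bclass G P) x =
    tr (bB P) (bY P) (btr P) (nm (bA P) (bB P) (bnorm P) (rs (bA P) (bX P) (bres P) x))"
proof -
  have m: "gset_map G (bA P) (bX P) (bres P)" "gset_map G (bA P) (bB P) (bnorm P)"
    "gset_map G (bB P) (bY P) (btr P)"
    using P by (auto simp: is_bispan_iff)
  define N where "N = \<lparr>bX = bX P, bA = bA P, bB = bB P, bY = bB P, bres = bres P, bnorm = bnorm P, btr = (\<lambda>x. x)\<rparr>"
  have N: "is_bispan G N"
    using m by (auto simp: N_def is_bispan_iff intro: gset_map_id dest: gset_map_dom)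
  have "composite G (res_bispan (bA P) (bX P) (bres P)) (norm_bispan (bA P) (bB P) (bnorm P)) N
      (\<lambda>b. b) (\<lambda>b c. c) (\<lambda>a. a) (\<lambda>a. a)"
    by (intro composite.intro is_group composite_axioms.intro)
      (use m N in \<open>auto simp: N_def intro: gset_map_id dest: gset_map_dom gset_map_cod\<close>)
  then have 1: "nm (bA P) (bB P) (bnorm P) (rs (bA P) (bX P) (bres P) x) = mor R (bclass G N) x"
    using mor_composite x by fastforce
  have sel: "bX N = bX P" "bA N = bA P" "bB N = bB P" "bY N = bB P" "bres N = bres P"
    "bnorm N = bnorm P" "btr N = (\<lambda>x. x)"
    by (simp_all add: N_def)
  have ids: "gset_map G (bA P) (bA P) (\<lambda>x. x)" "gset_map G (bB P) (bB P) (\<lambda>x. x)"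
    using m by (auto intro: gset_map_id dest: gset_map_dom)
  have "composite G N (tr_bispan (bB P) (bY P) (btr P)) P (\<lambda>b. b) (\<lambda>b c. b) (\<lambda>a. a) (bnorm P)"
  proof (rule composite.intro, rule is_group, rule composite_axioms.intro, unfold bispan_sel sel, goal_cases)
    case (11 d \<sigma>) then show ?case by blast
  next
    case (12 b b') then show ?case by blast
  next
    case (17 a b c) then show ?case by blast
  next
    case (18 a a') then show ?case by blast
  qed (use m N P ids gset_map_in[OF m(2)] in \<open>auto simp: sel\<close>)
  then have "tr (bB P) (bY P) (btr P) (mor R (bclass G N) x) = mor R (bclass G P) x"
    by (rule mor_composite) (use x in \<open>simp add: N_def\<close>)
  then show ?thesis using 1 by simp
qed

lemma rs_nm:
  assumes pb: "is_pullback G A X Y B p q f k" and z: "z \<in> obj R X"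
  shows "rs Y B k (nm X B f z) = nm A Y q (rs A X p z)"
proof -
  have m: "gset_map G A X p" "gset_map G A Y q" "gset_map G X B f" "gset_map G Y B k"
    and com: "\<And>a. a \<in> pts A \<Longrightarrow> f (p a) = k (q a)"
    and ex: "\<And>x y. x \<in> pts X \<Longrightarrow> y \<in> pts Y \<Longrightarrow> f x = k y \<Longrightarrow> \<exists>a\<in>pts A. p a = x \<and> q a = y"
    and un: "\<And>a a'. a \<in> pts A \<Longrightarrow> a' \<in> pts A \<Longrightarrow> p a = p a' \<Longrightarrow> q a = q a' \<Longrightarrow> a = a'"
    using pb by (auto simp: is_pullback_def)
  define S where "S = \<lparr>bX = X, bA = A, bB = Y, bY = Y, bres = p, bnorm = q, btr = (\<lambda>x. x)\<rparr>"
  have S: "is_bispan G S"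
    using m by (auto simp: S_def is_bispan_iff intro: gset_map_id dest: gset_map_dom)
  have "composite G (norm_bispan X B f) (res_bispan Y B k) S (\<lambda>b. b) (\<lambda>b c. k c) p q"
    by (intro composite.intro is_group composite_axioms.intro)
      (use m S com un ex in \<open>auto simp: S_def gset_map_in gset_map_act intro: gset_map_id dest: gset_map_dom\<close>)
  then have "rs Y B k (nm X B f z) = mor R (bclass G S) z"
    using mor_composite z by fastforce
  also have "\<dots> = nm A Y q (rs A X p z)"
    using mor_bispan[OF S] z m by (simp add: S_def tr_id nm_closed rs_closed gset_map_dom)
  finally show ?thesis .
qed

lemma rs_tr:
  assumes pb: "is_pullback G A X Y B p q f k" and z: "z \<in> obj R X"
  shows "rs Y B k (tr X B f z) = tr A Y q (rs A X p z)"
proof -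
  have m: "gset_map G A X p" "gset_map G A Y q" "gset_map G X B f" "gset_map G Y B k"
    and com: "\<And>a. a \<in> pts A \<Longrightarrow> f (p a) = k (q a)"
    and ex: "\<And>x y. x \<in> pts X \<Longrightarrow> y \<in> pts Y \<Longrightarrow> f x = k y \<Longrightarrow> \<exists>a\<in>pts A. p a = x \<and> q a = y"
    and un: "\<And>a a'. a \<in> pts A \<Longrightarrow> a' \<in> pts A \<Longrightarrow> p a = p a' \<Longrightarrow> q a = q a' \<Longrightarrow> a = a'"
    using pb by (auto simp: is_pullback_def)
  define S where "S = \<lparr>bX = X, bA = A, bB = A, bY = Y, bres = p, bnorm = (\<lambda>x. x), btr = q\<rparr>"
  have S: "is_bispan G S"
    using m by (auto simp: S_def is_bispan_iff intro: gset_map_id dest: gset_map_dom)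
  have "composite G (tr_bispan X B f) (res_bispan Y B k) S q (\<lambda>b c. p b) p q"
  proof (rule composite.intro, rule is_group, rule composite_axioms.intro, goal_cases)
    case (11 d \<sigma>)
    then have "\<sigma> d \<in> pts X" "f (\<sigma> d) = k d" by auto
    then obtain a where "a \<in> pts A" "p a = \<sigma> d" "q a = d" using ex 11(1) by auto
    then show ?case by (auto simp: S_def)
  next
    case (12 b b')
    then show ?case using un[of b b'] gset_map_in[OF m(2)] by (auto simp: S_def)
  qed (use m S com un in \<open>auto simp: S_def gset_map_in gset_map_act intro: gset_map_id dest: gset_map_dom\<close>)
  then have "rs Y B k (tr X B f z) = mor R (bclass G S) z"
    using mor_composite z by fastforce
  also have "\<dots> = tr A Y q (rs A X p z)"
    using mor_bispan[OF S] z m by (simp add: S_def nm_id rs_closed gset_map_dom)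
  finally show ?thesis .
qed

lemma coproduct_bij:
  assumes "is_coproduct G X Y Z i j"
  shows "bij_betw (\<lambda>z. (rs X Z i z, rs Y Z j z)) (obj R Z) (obj R X \<times> obj R Y)"
  using coproduct_is_product[OF assms] tambara_functor
  unfolding tambara_functor_def product_preserving_def by blast

lemma coproduct_eqI:
  assumes "is_coproduct G X Y Z i j" and "z \<in> obj R Z" and "z' \<in> obj R Z"
    and "rs X Z i z = rs X Z i z'" and "rs Y Z j z = rs Y Z j z'"
  shows "z = z'"
  using inj_onD[OF bij_betw_imp_inj_on[OF coproduct_bij[OF assms(1)]]] assms(2-5) by blast

lemma coproduct_ex:
  assumes "is_coproduct G X Y Z i j" and "a \<in> obj R X" and "b \<in> obj R Y"
  shows "\<exists>z\<in>obj R Z. rs X Z i z = a \<and> rs Y Z j z = b"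
proof -
  have "(a, b) \<in> (\<lambda>z. (rs X Z i z, rs Y Z j z)) ` obj R Z"
    using bij_betw_imp_surj_on[OF coproduct_bij[OF assms(1)]] assms by simp
  then show ?thesis by auto
qed

lemma obj_of_empty: "fin_gset G Z \<Longrightarrow> pts Z = {} \<Longrightarrow> \<exists>x. obj R Z = {x}"
  using tambara_functor terminal_iff unfolding tambara_functor_def product_preserving_def by blast

lemma base_pt: "obj R empty_gset = {base_pt R}"
proof -
  obtain x where "obj R empty_gset = {x}"
    using obj_of_empty[OF fin_gset_empty] by auto
  then show ?thesis by (simp add: base_pt_def)
qed

lemma copair:
  assumes "fin_gset G X" and "a \<in> obj R X" and "b \<in> obj R X"
  shows "copair G R X a b \<in> obj R (sum_gset X X)"
    and "rs X (sum_gset X X) In1 (copair G R X a b) = a"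
    and "rs X (sum_gset X X) In2 (copair G R X a b) = b"
proof -
  note c = coproduct_sum_gset[OF assms(1,1)]
  obtain z where z: "z \<in> obj R (sum_gset X X)" "rs X (sum_gset X X) In1 z = a"
    "rs X (sum_gset X X) In2 z = b"
    using coproduct_ex[OF c assms(2,3)] by blast
  have "copair G R X a b = z"
    unfolding copair_def by (rule the_equality) (use z coproduct_eqI[OF c] in auto)
  then show "copair G R X a b \<in> obj R (sum_gset X X)"
    "rs X (sum_gset X X) In1 (copair G R X a b) = a" "rs X (sum_gset X X) In2 (copair G R X a b) = b"
    using z by auto
qed

lemma copair_eqI:
  assumes "fin_gset G X" and "z \<in> obj R (sum_gset X X)"
    and "rs X (sum_gset X X) In1 z = a" and "rs X (sum_gset X X) In2 z = b"
  shows "copair G R X a b = z"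
  unfolding copair_def
  by (rule the_equality) (use assms coproduct_eqI[OF coproduct_sum_gset] in auto)

text \<open>
  A finite partition is split off one part at a time, which reduces statements about partitions to
  binary disjoint unions.
\<close>

lemma partition_step:
  assumes fam: "is_partition G (insert k I) W Z i" and k: "k \<notin> I"
  defines "Z' \<equiv> sub_gset Z (\<Union>l\<in>I. i l ` pts (W l))"
  shows "is_coproduct G (W k) Z' Z (i k) (\<lambda>x. x)" and "is_partition G I W Z' i"
proof -
  have Z: "fin_gset G Z" and I: "finite I" and ik: "gset_map G (W k) Z (i k)" "inj_on (i k) (pts (W k))"
    and il: "\<And>l. l \<in> I \<Longrightarrow> gset_map G (W l) Z (i l)" "\<And>l. l \<in> I \<Longrightarrow> inj_on (i l) (pts (W l))"
    and cover: "pts Z = i k ` pts (W k) \<union> (\<Union>l\<in>I. i l ` pts (W l))"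
    using fam unfolding is_partition_def by simp_all
  have disj: "\<And>l m. l \<in> insert k I \<Longrightarrow> m \<in> insert k I \<Longrightarrow> l \<noteq> m \<Longrightarrow> i l ` pts (W l) \<inter> i m ` pts (W m) = {}"
    using fam unfolding is_partition_def by blast
  have dk: "i k ` pts (W k) \<inter> (\<Union>l\<in>I. i l ` pts (W l)) = {}"
    using disj[of k] k by blast
  have im: "act Z g (i l x) = i l (act (W l) g x) \<and> act (W l) g x \<in> pts (W l)"
    if "g \<in> carrier G" "l \<in> I" "x \<in> pts (W l)" for g l x
    using that gset_map_act[OF il(1)] act_closed[OF gset_map_dom[OF il(1)]] by auto
  have Z': "fin_gset G Z'"
    unfolding Z'_def
  proof (rule fin_gset_sub_gset[OF Z])
    show "(\<Union>l\<in>I. i l ` pts (W l)) \<subseteq> pts Z" using cover by blast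
    fix g x assume g: "g \<in> carrier G" and "x \<in> (\<Union>l\<in>I. i l ` pts (W l))"
    then obtain l y where "l \<in> I" "y \<in> pts (W l)" "x = i l y" by blast
    then show "act Z g x \<in> (\<Union>l\<in>I. i l ` pts (W l))"
      using im[OF g] by blast
  qed
  have inc: "gset_map G Z' Z (\<lambda>x. x)"
    by (rule gset_mapI) (use Z Z' cover in \<open>auto simp: Z'_def\<close>)
  show "is_coproduct G (W k) Z' Z (i k) (\<lambda>x. x)"
    unfolding is_coproduct_def using ik inc dk cover by (auto simp: Z'_def)
  have il': "gset_map G (W l) Z' (i l)" if "l \<in> I" for l
  proof (rule gset_mapI)
    show "i l x \<in> pts Z'" if "x \<in> pts (W l)" for x
      using that \<open>l \<in> I\<close> by (auto simp: Z'_def)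
    show "i l (act (W l) g x) = act Z' g (i l x)" if "g \<in> carrier G" "x \<in> pts (W l)" for g x
    proof -
      have "i l x \<in> (\<Union>l\<in>I. i l ` pts (W l))" using that \<open>l \<in> I\<close> by blast
      then show ?thesis using im[OF that(1) \<open>l \<in> I\<close> that(2)] by (simp add: Z'_def)
    qed
  qed (use il(1)[OF that] Z' gset_map_dom in blast)+
  show "is_partition G I W Z' i"
    unfolding is_partition_def using I Z' il' il(2) disj by (auto simp: Z'_def)
qed

lemma partition_eqI:
  assumes "is_partition G I W Z i" and "z \<in> obj R Z" and "z' \<in> obj R Z"
    and "\<And>k. k \<in> I \<Longrightarrow> rs (W k) Z (i k) z = rs (W k) Z (i k) z'"
  shows "z = z'"
proof -
  have "finite I" using assms(1) by (simp add: is_partition_def)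
  then show ?thesis
    using assms
  proof (induction I arbitrary: Z z z' rule: finite_induct)
    case empty
    then have "pts Z = {}" "fin_gset G Z" by (auto simp: is_partition_def)
    then obtain x where "obj R Z = {x}" using obj_of_empty by blast
    then show ?case using empty by simp
  next
    case (insert k I)
    let ?Z' = "sub_gset Z (\<Union>l\<in>I. i l ` pts (W l))"
    note st = partition_step[OF insert.prems(1) insert.hyps(2)]
    note inc = coproductD(2)[OF st(1)]
    have il: "gset_map G (W l) ?Z' (i l)" if "l \<in> I" for l
      using st(2) that by (simp add: is_partition_def)
    have "rs ?Z' Z (\<lambda>x. x) z = rs ?Z' Z (\<lambda>x. x) z'"
    proof (rule insert.IH[OF st(2)])
      fix l assume l: "l \<in> I"
      show "rs (W l) ?Z' (i l) (rs ?Z' Z (\<lambda>x. x) z) = rs (W l) ?Z' (i l) (rs ?Z' Z (\<lambda>x. x) z')"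
        using rs_rs[OF il[OF l] inc, of "i l"] insert.prems l by simp
    qed (use insert.prems rs_closed[OF inc] in auto)
    then show ?case
      using coproduct_eqI[OF st(1)] insert.prems by blast
  qed
qed

lemma partition_ex:
  assumes "is_partition G I W Z i" and "\<And>k. k \<in> I \<Longrightarrow> y k \<in> obj R (W k)"
  shows "\<exists>z\<in>obj R Z. \<forall>k\<in>I. rs (W k) Z (i k) z = y k"
proof -
  have "finite I" using assms(1) by (simp add: is_partition_def)
  then show ?thesis
    using assms
  proof (induction I arbitrary: Z rule: finite_induct)
    case empty
    then have "pts Z = {}" "fin_gset G Z" by (auto simp: is_partition_def)
    then show ?case using obj_of_empty by blast
  next
    case (insert k I)
    let ?Z' = "sub_gset Z (\<Union>l\<in>I. i l ` pts (W l))"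
    note st = partition_step[OF insert.prems(1) insert.hyps(2)]
    note inc = coproductD(2)[OF st(1)]
    have il: "gset_map G (W l) ?Z' (i l)" if "l \<in> I" for l
      using st(2) that by (simp add: is_partition_def)
    obtain z' where z': "z' \<in> obj R ?Z'" "\<forall>l\<in>I. rs (W l) ?Z' (i l) z' = y l"
      using insert.IH[OF st(2)] insert.prems by blast
    obtain z where z: "z \<in> obj R Z" "rs (W k) Z (i k) z = y k" "rs ?Z' Z (\<lambda>x. x) z = z'"
      using coproduct_ex[OF st(1) _ z'(1)] insert.prems by blast
    have "rs (W l) Z (i l) z = y l" if "l \<in> I" for l
      using rs_rs[OF il[OF that] inc _ z(1), of "i l"] z(3) z'(2) that by simp
    then show ?case using z by blast
  qed
qed

end


subsection \<open>Addition and multiplication\<close>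

text \<open>
  Transfers and norms are both functorial and commute with restrictions in pullback squares. These
  properties alone make the operation along the fold map a commutative monoid structure, for which
  restrictions and the operation itself are homomorphisms, and they express the operation along a
  map out of a disjoint union as a product over the summands.
\<close>

locale tambara_push = tambara G R for G :: "('g, 'b) monoid_scheme" (structure)
    and R :: "('g, 'r) bifunctor" +
  fixes F :: "'g gset \<Rightarrow> 'g gset \<Rightarrow> ('g pt \<Rightarrow> 'g pt) \<Rightarrow> 'r \<Rightarrow> 'r"
  assumes F_closed: "gset_map G X Y f \<Longrightarrow> z \<in> obj R X \<Longrightarrow> F X Y f z \<in> obj R Y"
    and F_id: "fin_gset G X \<Longrightarrow> z \<in> obj R X \<Longrightarrow> F X X (\<lambda>x. x) z = z"
    and F_F: "gset_map G X Y f \<Longrightarrow> gset_map G Y Z k \<Longrightarrow> (\<And>x. x \<in> pts X \<Longrightarrow> h x = k (f x)) \<Longrightarrow>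
      z \<in> obj R X \<Longrightarrow> F Y Z k (F X Y f z) = F X Z h z"
    and rs_F: "is_pullback G A X Y B p q f k \<Longrightarrow> z \<in> obj R X \<Longrightarrow>
      rs Y B k (F X B f z) = F A Y q (rs A X p z)"
begin

definition M :: "'g gset \<Rightarrow> 'r monoid" where
  "M X = \<lparr>carrier = obj R X, monoid.mult = (\<lambda>a b. F (sum_gset X X) X fold_map (copair G R X a b)),
     one = F empty_gset X (\<lambda>x. x) (base_pt R)\<rparr>"

lemma carrier_M [simp]: "carrier (M X) = obj R X"
  by (simp add: M_def)

lemma F_cong:
  "gset_map G X Y f \<Longrightarrow> (\<And>x. x \<in> pts X \<Longrightarrow> h x = f x) \<Longrightarrow> z \<in> obj R X \<Longrightarrow> F X Y h z = F X Y f z"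
  using F_F[of X Y f Y "\<lambda>x. x" h z] F_id F_closed gset_map_id gset_map_cod by metis

lemma F_rs_iso:
  assumes f: "gset_map G X Y f" "bij_betw f (pts X) (pts Y)" and z: "z \<in> obj R Y"
  shows "F X Y f (rs X Y f z) = z"
proof -
  have Y: "fin_gset G Y" using f gset_map_cod by blast
  have "is_pullback G X Y Y Y f f (\<lambda>x. x) (\<lambda>x. x)"
  proof (rule is_pullbackI[OF f(1) f(1) gset_map_id[OF Y] gset_map_id[OF Y]])
    fix x y assume xy: "x \<in> pts Y" "x = y"
    then have "x \<in> f ` pts X" using bij_betw_imp_surj_on[OF f(2)] by simp
    then obtain a where "a \<in> pts X" "f a = x" by blast
    then show "\<exists>a\<in>pts X. f a = x \<and> f a = y" using xy(2) by blast
  qed (use f(2) in \<open>auto simp: bij_betw_def inj_on_eq_iff\<close>)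
  from rs_F[OF this z] show ?thesis
    using F_id rs_id Y z by simp
qed

text \<open>
  The distinguished element of \<open>R\<close> at the empty set is determined by \<^const>\<open>empty_gset\<close>, but empty
  \<open>G\<close>-sets with other action functions occur as well.
\<close>

lemma F_of_empty:
  assumes "fin_gset G Z" and "pts Z = {}" and "fin_gset G W" and "z \<in> obj R Z"
  shows "F Z W f z = one (M W)"
proof -
  have 1: "gset_map G Z empty_gset (\<lambda>x. x)" "gset_map G empty_gset W (\<lambda>x. x)"
    using assms fin_gset_empty by (auto intro: gset_map_of_empty)
  have "F Z empty_gset (\<lambda>x. x) z = base_pt R"
    using F_closed[OF 1(1) assms(4)] base_pt by simp
  then show ?thesis
    using F_F[OF 1, of f z] assms by (simp add: M_def)
qed

text \<open>
  The map \<open>f\<close> factors through a map \<open>u : Z \<rightarrow> W \<squnion> W\<close> that preserves the summands, followed by the fold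
  map. By base change along the two inclusions, the components of the image under \<open>u\<close> are the two
  factors.
\<close>

lemma F_coproduct:
  assumes c: "is_coproduct G X Y Z i j" and f: "gset_map G Z W f" and z: "z \<in> obj R Z"
  shows "F Z W f z = F X W (\<lambda>x. f (i x)) (rs X Z i z) \<otimes>\<^bsub>M W\<^esub> F Y W (\<lambda>y. f (j y)) (rs Y Z j z)"
proof -
  note i = coproductD(1)[OF c] and j = coproductD(2)[OF c]
  have fins: "fin_gset G X" "fin_gset G Y" "fin_gset G Z" "fin_gset G W"
    using i j f by (auto dest: gset_map_dom gset_map_cod)
  note fi = gset_map_comp[OF i f] and fj = gset_map_comp[OF j f]
  let ?S = "sum_gset W W"
  define u where "u z = (if z \<in> i ` pts X then In1 (f z) else In2 (f z))" for z
  have ui: "u (i x) = In1 (f (i x))" if "x \<in> pts X" for x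
    using that by (simp add: u_def)
  have uj: "u (j y) = In2 (f (j y))" if y: "y \<in> pts Y" for y
  proof -
    have "j y \<notin> i ` pts X" using coproductD(6)[OF c _ y] by blast
    then show ?thesis by (simp add: u_def)
  qed
  have u: "gset_map G Z ?S u"
  proof (rule gset_mapI)
    fix z assume "z \<in> pts Z"
    then show "u z \<in> pts ?S"
      using gset_map_in[OF f] by (simp add: u_def)
  next
    fix g z assume g: "g \<in> carrier G" and z: "z \<in> pts Z"
    have fz: "f z \<in> pts W" using z gset_map_in[OF f] by blast
    from coproductD(7)[OF c z] show "u (act Z g z) = act ?S g (u z)"
    proof (elim disjE bexE)
      fix x assume x: "x \<in> pts X" "z = i x"
      have "act Z g z = i (act X g x)" using g x by (simp add: gset_map_act[OF i])
      then show ?thesis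
        using x g fz act_closed[OF fins(1) g] by (simp add: ui gset_map_act[OF fi])
    next
      fix y assume y: "y \<in> pts Y" "z = j y"
      have "act Z g z = j (act Y g y)" using g y by (simp add: gset_map_act[OF j])
      then show ?thesis
        using y g fz act_closed[OF fins(2) g] by (simp add: uj gset_map_act[OF fj])
    qed
  qed (use fins fin_gset_sum_gset in auto)
  note s = coproduct_sum_gset[OF fins(4,4)]
  have "is_pullback G X Z W ?S i (\<lambda>x. f (i x)) u In1"
  proof (rule is_pullbackI[OF i fi u coproductD(1)[OF s]])
    fix z w assume z: "z \<in> pts Z" "w \<in> pts W" "u z = In1 w"
    from coproductD(7)[OF c z(1)] show "\<exists>a\<in>pts X. i a = z \<and> f (i a) = w"
      using z ui uj by auto
  qed (use ui coproductD(3)[OF c] in auto)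
  note pb1 = rs_F[OF this z]
  have "is_pullback G Y Z W ?S j (\<lambda>y. f (j y)) u In2"
  proof (rule is_pullbackI[OF j fj u coproductD(2)[OF s]])
    fix z w assume z: "z \<in> pts Z" "w \<in> pts W" "u z = In2 w"
    from coproductD(7)[OF c z(1)] show "\<exists>a\<in>pts Y. j a = z \<and> f (j a) = w"
      using z ui uj by auto
  qed (use uj coproductD(4)[OF c] in auto)
  note pb2 = rs_F[OF this z]
  have "copair G R W (F X W (\<lambda>x. f (i x)) (rs X Z i z)) (F Y W (\<lambda>y. f (j y)) (rs Y Z j z)) = F Z ?S u z"
    by (rule copair_eqI) (use fins F_closed[OF u z] pb1 pb2 in auto)
  moreover have "F ?S W fold_map (F Z ?S u z) = F Z W f z"
    by (rule F_F) (use u gset_map_fold fins z in \<open>auto simp: u_def\<close>)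
  ultimately show ?thesis by (simp add: M_def)
qed

lemma F_sum:
  assumes "fin_gset G X" and "gset_map G (sum_gset X X) W f" and "a \<in> obj R X" and "b \<in> obj R X"
  shows "F (sum_gset X X) W f (copair G R X a b) =
    F X W (\<lambda>x. f (In1 x)) a \<otimes>\<^bsub>M W\<^esub> F X W (\<lambda>x. f (In2 x)) b"
  using F_coproduct[OF coproduct_sum_gset[OF assms(1,1)] assms(2) copair(1)[OF assms(1,3,4)]]
    copair[OF assms(1,3,4)] by simp

lemma M_comm_monoid:
  assumes X: "fin_gset G X"
  shows "comm_monoid (M X)"
proof (rule comm_monoidI)
  let ?S = "sum_gset X X"
  note fold = gset_map_fold[OF X] and finS = fin_gset_sum_gset[OF X X]
  note s = coproduct_sum_gset[OF X X]
  fix a b c assume abc: "a \<in> carrier (M X)" "b \<in> carrier (M X)" "c \<in> carrier (M X)"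
  then have abc': "a \<in> obj R X" "b \<in> obj R X" "c \<in> obj R X" by simp_all
  show "a \<otimes>\<^bsub>M X\<^esub> b \<in> carrier (M X)"
    using F_closed[OF fold copair(1)[OF X]] abc' by (simp add: M_def)
  have "is_coproduct G X X ?S In2 In1"
    using s by (auto simp: is_coproduct_def)
  from F_coproduct[OF this fold copair(1)[OF X abc'(1,2)]]
  have "F ?S X fold_map (copair G R X a b) = b \<otimes>\<^bsub>M X\<^esub> a"
    using copair[OF X abc'(1,2)] F_id X abc' by simp
  then show "a \<otimes>\<^bsub>M X\<^esub> b = b \<otimes>\<^bsub>M X\<^esub> a"
    by (simp add: M_def)
  \<comment> \<open>Both bracketings are the operation along \<open>X \<squnion> (X \<squnion> X) \<rightarrow> X\<close>, computed for two different
    decompositions of its source.\<close>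
  let ?T = "sum_gset X ?S"
  note t = coproduct_sum_gset[OF X finS]
  obtain z where z: "z \<in> obj R ?T" "rs X ?T In1 z = a" "rs ?S ?T In2 z = copair G R X b c"
    using coproduct_ex[OF t abc'(1) copair(1)[OF X abc'(2,3)]] by blast
  define f where "f w = (case w of In2 v \<Rightarrow> fold_map v | _ \<Rightarrow> fold_map w)" for w :: "'g pt"
  have f: "gset_map G ?T X f"
    by (rule gset_mapI) (use X finS fin_gset_sum_gset[OF X finS] in \<open>auto simp: f_def elim!: sum_gsetE\<close>)
  have "F ?T X f z = a \<otimes>\<^bsub>M X\<^esub> F ?S X fold_map (copair G R X b c)"
    using F_coproduct[OF t f z(1)] z abc' X by (simp add: f_def F_id)
  then have 1: "F ?T X f z = a \<otimes>\<^bsub>M X\<^esub> (b \<otimes>\<^bsub>M X\<^esub> c)"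
    by (simp add: M_def)
  define k where "k w = (case w of In2 v \<Rightarrow> In2 (In1 v) | _ \<Rightarrow> w)" for w :: "'g pt"
  have k: "gset_map G ?S ?T k" and l: "gset_map G X ?T (\<lambda>x. In2 (In2 x))"
    by (rule gset_mapI; use X finS fin_gset_sum_gset[OF X finS] in \<open>auto simp: k_def elim!: sum_gsetE\<close>)+
  have kl: "is_coproduct G ?S X ?T k (\<lambda>x. In2 (In2 x))"
    unfolding is_coproduct_def
  proof (intro conjI k l)
    show "inj_on k (pts ?S)"
      by (auto simp: inj_on_def k_def elim!: sum_gsetE)
    show "k ` pts ?S \<inter> (\<lambda>x. In2 (In2 x)) ` pts X = {}"
      by (auto simp: k_def elim!: sum_gsetE)
    show "k ` pts ?S \<union> (\<lambda>x. In2 (In2 x)) ` pts X = pts ?T"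
    proof (intro equalityI subsetI)
      fix w assume "w \<in> pts ?T"
      then consider x where "x \<in> pts X" "w = In1 x" | x where "x \<in> pts X" "w = In2 (In1 x)"
        | x where "x \<in> pts X" "w = In2 (In2 x)"
        by (auto elim!: sum_gsetE)
      then show "w \<in> k ` pts ?S \<union> (\<lambda>x. In2 (In2 x)) ` pts X"
      proof cases
        case (1 x)
        then have "w = k (In1 x)" "In1 x \<in> pts ?S" by (simp_all add: k_def)
        then show ?thesis by blast
      next
        case (2 x)
        then have "w = k (In2 x)" "In2 x \<in> pts ?S" by (simp_all add: k_def)
        then show ?thesis by blast
      qed blast
    qed (auto simp: k_def elim!: sum_gsetE)
  qed (auto simp: inj_on_def)
  note in2 = coproductD(2)[OF t] and s1 = coproductD(1)[OF s] and s2 = coproductD(2)[OF s]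
  have "copair G R X a b = rs ?S ?T k z"
  proof (rule copair_eqI[OF X rs_closed[OF k z(1)]])
    show "rs X ?S In1 (rs ?S ?T k z) = a"
      using rs_rs[OF s1 k, of In1] z by (simp add: k_def)
    have "rs X ?S In2 (rs ?S ?T k z) = rs X ?T (\<lambda>x. In2 (In1 x)) z"
      using rs_rs[OF s2 k, of "\<lambda>x. In2 (In1 x)"] z by (simp add: k_def)
    also have "\<dots> = rs X ?S In1 (rs ?S ?T In2 z)"
      using rs_rs[OF s1 in2 _ z(1), of "\<lambda>x. In2 (In1 x)"] by simp
    finally show "rs X ?S In2 (rs ?S ?T k z) = b"
      using z copair[OF X abc'(2,3)] by simp
  qed
  moreover have "rs X ?T (\<lambda>x. In2 (In2 x)) z = rs X ?S In2 (rs ?S ?T In2 z)"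
    using rs_rs[OF s2 in2 _ z(1), of "\<lambda>x. In2 (In2 x)"] by simp
  then have "rs X ?T (\<lambda>x. In2 (In2 x)) z = c"
    using z copair[OF X abc'(2,3)] by simp
  moreover have "F ?S X (\<lambda>x. f (k x)) (rs ?S ?T k z) = F ?S X fold_map (rs ?S ?T k z)"
    by (rule F_cong[OF fold _ rs_closed[OF k z(1)]]) (auto simp: f_def k_def elim!: sum_gsetE)
  ultimately have "F ?T X f z = F ?S X fold_map (copair G R X a b) \<otimes>\<^bsub>M X\<^esub> c"
    using F_coproduct[OF kl f z(1)] abc' X by (simp add: f_def F_id)
  then show "(a \<otimes>\<^bsub>M X\<^esub> b) \<otimes>\<^bsub>M X\<^esub> c = a \<otimes>\<^bsub>M X\<^esub> (b \<otimes>\<^bsub>M X\<^esub> c)"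
    using 1 by (simp add: M_def)
next
  note X' = fin_gset_empty
  have e: "gset_map G empty_gset X (\<lambda>x. x)"
    using gset_map_of_empty[OF X' X] by simp
  show 1: "\<one>\<^bsub>M X\<^esub> \<in> carrier (M X)"
    using F_closed[OF e] base_pt by (simp add: M_def)
  fix a assume "a \<in> carrier (M X)"
  then have a: "a \<in> obj R X" by simp
  have "is_coproduct G empty_gset X X (\<lambda>x. x) (\<lambda>x. x)"
    using e X by (simp add: is_coproduct_def gset_map_id)
  from F_coproduct[OF this gset_map_id[OF X] a] show "\<one>\<^bsub>M X\<^esub> \<otimes>\<^bsub>M X\<^esub> a = a"
    using F_id[OF X] rs_id[OF X] a F_of_empty[OF X' _ X rs_closed[OF e a]] by simp
qed

lemma F_mult:
  assumes f: "gset_map G X Y f" and "a \<in> obj R X" "b \<in> obj R X"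
  shows "F X Y f (a \<otimes>\<^bsub>M X\<^esub> b) = F X Y f a \<otimes>\<^bsub>M Y\<^esub> F X Y f b"
proof -
  have X: "fin_gset G X" using f gset_map_dom by blast
  note ff = gset_map_comp[OF gset_map_fold[OF X] f]
  have "F X Y f (a \<otimes>\<^bsub>M X\<^esub> b) = F (sum_gset X X) Y (\<lambda>x. f (fold_map x)) (copair G R X a b)"
    using F_F[OF gset_map_fold[OF X] f _ copair(1)[OF X assms(2,3)]] by (simp add: M_def)
  also have "\<dots> = F X Y f a \<otimes>\<^bsub>M Y\<^esub> F X Y f b"
    using F_sum[OF X ff assms(2,3)] by simp
  finally show ?thesis .
qed

lemma F_one:
  assumes f: "gset_map G X Y f"
  shows "F X Y f \<one>\<^bsub>M X\<^esub> = \<one>\<^bsub>M Y\<^esub>"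
proof -
  have X: "fin_gset G X" "fin_gset G Y" using f gset_map_dom gset_map_cod by blast+
  have e: "gset_map G empty_gset X (\<lambda>x. x)"
    using gset_map_of_empty[OF fin_gset_empty X(1)] by simp
  have "F X Y f \<one>\<^bsub>M X\<^esub> = F empty_gset Y f (base_pt R)"
    using F_F[OF e f, of f] base_pt by (simp add: M_def)
  then show ?thesis
    using F_of_empty[OF fin_gset_empty _ X(2)] base_pt by simp
qed

lemma rs_mult:
  assumes f: "gset_map G X Y f" and ab: "a \<in> obj R Y" "b \<in> obj R Y"
  shows "rs X Y f (a \<otimes>\<^bsub>M Y\<^esub> b) = rs X Y f a \<otimes>\<^bsub>M X\<^esub> rs X Y f b"
proof -
  have X: "fin_gset G X" and Y: "fin_gset G Y" using f gset_map_dom gset_map_cod by blast+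
  let ?S = "sum_gset X X" and ?T = "sum_gset Y Y"
  define u where "u z = (case z of In1 x \<Rightarrow> In1 (f x) | In2 x \<Rightarrow> In2 (f x) | _ \<Rightarrow> z)" for z
  have u: "gset_map G ?S ?T u"
    by (rule gset_mapI) (use X Y f fin_gset_sum_gset in
        \<open>auto simp: u_def gset_map_in[OF f] gset_map_act[OF f] elim!: sum_gsetE\<close>)
  have "is_pullback G ?S ?T X Y u fold_map fold_map f"
  proof (rule is_pullbackI[OF u gset_map_fold[OF X] gset_map_fold[OF Y] f])
    fix z x assume z: "z \<in> pts ?T" and x: "x \<in> pts X" "fold_map z = f x"
    from z show "\<exists>a\<in>pts ?S. u a = z \<and> fold_map a = x"
    proof (cases rule: sum_gsetE)
      case (1 y) then show ?thesis using x by (intro bexI[of _ "In1 x"]) (auto simp: u_def)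
    next
      case (2 y) then show ?thesis using x by (intro bexI[of _ "In2 x"]) (auto simp: u_def)
    qed
  qed (auto simp: u_def elim!: sum_gsetE)
  from rs_F[OF this copair(1)[OF Y ab]]
  have "rs X Y f (a \<otimes>\<^bsub>M Y\<^esub> b) = F ?S X fold_map (rs ?S ?T u (copair G R Y a b))"
    by (simp add: M_def)
  moreover have "copair G R X (rs X Y f a) (rs X Y f b) = rs ?S ?T u (copair G R Y a b)"
  proof (rule copair_eqI[OF X rs_closed[OF u copair(1)[OF Y ab]]])
    note s = coproduct_sum_gset[OF X X] and t = coproduct_sum_gset[OF Y Y]
    have "rs X ?S In1 (rs ?S ?T u (copair G R Y a b)) = rs X ?T (\<lambda>x. In1 (f x)) (copair G R Y a b)"
      using rs_rs[OF coproductD(1)[OF s] u, of "\<lambda>x. In1 (f x)"] copair[OF Y ab] by (simp add: u_def)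
    also have "\<dots> = rs X Y f (rs Y ?T In1 (copair G R Y a b))"
      using rs_rs[OF f coproductD(1)[OF t] _ copair(1)[OF Y ab], of "\<lambda>x. In1 (f x)"] by simp
    finally show "rs X ?S In1 (rs ?S ?T u (copair G R Y a b)) = rs X Y f a"
      using copair[OF Y ab] by simp
    have "rs X ?S In2 (rs ?S ?T u (copair G R Y a b)) = rs X ?T (\<lambda>x. In2 (f x)) (copair G R Y a b)"
      using rs_rs[OF coproductD(2)[OF s] u, of "\<lambda>x. In2 (f x)"] copair[OF Y ab] by (simp add: u_def)
    also have "\<dots> = rs X Y f (rs Y ?T In2 (copair G R Y a b))"
      using rs_rs[OF f coproductD(2)[OF t] _ copair(1)[OF Y ab], of "\<lambda>x. In2 (f x)"] by simp
    finally show "rs X ?S In2 (rs ?S ?T u (copair G R Y a b)) = rs X Y f b"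
      using copair[OF Y ab] by simp
  qed
  ultimately show ?thesis by (simp add: M_def)
qed

lemma rs_one:
  assumes f: "gset_map G X Y f"
  shows "rs X Y f \<one>\<^bsub>M Y\<^esub> = \<one>\<^bsub>M X\<^esub>"
proof -
  have X: "fin_gset G X" and Y: "fin_gset G Y" using f gset_map_dom gset_map_cod by blast+
  have e: "gset_map G empty_gset X (\<lambda>x. x)" "gset_map G empty_gset Y (\<lambda>x. x)"
    using gset_map_of_empty[OF fin_gset_empty] X Y by simp_all
  have "is_pullback G empty_gset empty_gset X Y (\<lambda>x. x) (\<lambda>x. x) (\<lambda>x. x) f"
    by (rule is_pullbackI) (use e f gset_map_id[OF fin_gset_empty] in auto)
  from rs_F[OF this] show ?thesis
    using base_pt rs_id[OF fin_gset_empty] by (simp add: M_def)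
qed

lemma F_partition:
  assumes "is_partition G I W Z i" and "gset_map G Z V f" and "z \<in> obj R Z"
  shows "F Z V f z = finprod (M V) (\<lambda>k. F (W k) V (\<lambda>x. f (i k x)) (rs (W k) Z (i k) z)) I"
proof -
  have V: "fin_gset G V" using assms gset_map_cod by blast
  interpret m: comm_monoid "M V" using M_comm_monoid[OF V] .
  have "finite I" using assms(1) by (simp add: is_partition_def)
  then show ?thesis
    using assms
  proof (induction I arbitrary: Z z rule: finite_induct)
    case empty
    then have "pts Z = {}" "fin_gset G Z" by (auto simp: is_partition_def)
    then show ?case using F_of_empty V empty by simp
  next
    case (insert k I)
    let ?Z' = "sub_gset Z (\<Union>l\<in>I. i l ` pts (W l))"
    let ?t = "\<lambda>l. F (W l) V (\<lambda>x. f (i l x)) (rs (W l) Z (i l) z)"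
    note st = partition_step[OF insert.prems(1) insert.hyps(2)]
    note inc = coproductD(2)[OF st(1)]
    have il: "gset_map G (W l) ?Z' (i l)" if "l \<in> I" for l
      using st(2) that by (simp add: is_partition_def)
    have iZ: "gset_map G (W l) Z (i l)" if "l \<in> insert k I" for l
      using insert.prems(1) that unfolding is_partition_def by blast
    have t: "?t l \<in> obj R V" if "l \<in> insert k I" for l
      using F_closed[OF gset_map_comp[OF iZ[OF that] insert.prems(2)] rs_closed[OF iZ[OF that] insert.prems(3)]] .
    have "F ?Z' V f (rs ?Z' Z (\<lambda>x. x) z) =
        finprod (M V) (\<lambda>l. F (W l) V (\<lambda>x. f (i l x)) (rs (W l) ?Z' (i l) (rs ?Z' Z (\<lambda>x. x) z))) I"
      using insert.IH[OF st(2) gset_map_comp[OF inc insert.prems(2)] rs_closed[OF inc insert.prems(3)]] .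
    also have "\<dots> = finprod (M V) ?t I"
    proof (rule m.finprod_cong')
      fix l assume l: "l \<in> I"
      show "F (W l) V (\<lambda>x. f (i l x)) (rs (W l) ?Z' (i l) (rs ?Z' Z (\<lambda>x. x) z)) = ?t l"
        using rs_rs[OF il[OF l] inc, of "i l"] insert.prems by simp
    qed (use t in auto)
    finally have "F Z V f z = ?t k \<otimes>\<^bsub>M V\<^esub> finprod (M V) ?t I"
      using F_coproduct[OF st(1) insert.prems(2,3)] by simp
    then show ?case
      using m.finprod_insert[of I k ?t] insert.hyps t by auto
  qed
qed

end


sublocale tambara \<subseteq> add: tambara_push G R "\<lambda>X Y f. mor R (bclass G (tr_bispan X Y f))"
  by unfold_locales (rule tr_closed tr_id tr_tr rs_tr; simp)+

sublocale tambara \<subseteq> mul: tambara_push G R "\<lambda>X Y f. mor R (bclass G (norm_bispan X Y f))"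
  by unfold_locales (rule nm_closed nm_id nm_nm rs_nm; simp)+

context tambara begin

abbreviation Rg :: "'g gset \<Rightarrow> 'r ring" where
  "Rg X \<equiv> tambara_ring G R X"

lemma carrier_Rg [simp]: "carrier (Rg X) = obj R X"
  by (simp add: tambara_ring_def)

lemma add_M: "add.M X = add_monoid (Rg X)"
  by (simp add: add.M_def tambara_ring_def)

lemma mul_M [simp]: "monoid.mult (mul.M X) = monoid.mult (Rg X)" "one (mul.M X) = one (Rg X)"
  by (simp_all add: mul.M_def tambara_ring_def)

lemma finprod_mul_M: "finprod (mul.M X) f A = finprod (Rg X) f A"
  by (simp add: finprod_def)

lemma finsum_add_M: "finprod (add.M X) f A = finsum (Rg X) f A"
  by (simp add: finsum_def add_M)

lemmas tr_add = add.F_mult[unfolded add_M, simplified]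
  and tr_zero = add.F_one[unfolded add_M, simplified]
  and nm_mult = mul.F_mult[unfolded mul_M]
  and nm_one = mul.F_one[unfolded mul_M]
  and rs_add = add.rs_mult[unfolded add_M, simplified]
  and rs_zero = add.rs_one[unfolded add_M, simplified]
  and rs_mult = mul.rs_mult[unfolded mul_M]
  and rs_one = mul.rs_one[unfolded mul_M]
  and tr_of_empty = add.F_of_empty[unfolded add_M, simplified]
  and tr_coproduct = add.F_coproduct[unfolded add_M, simplified]

text \<open>
  Multiplying a transfer is transferring a product. In terms of bispans this is the exponential
  diagram for the fold map of \<open>Y\<close> and \<open>f : X \<rightarrow> Y\<close> on the second summand: a section over the fibre
  of \<open>y\<close> consists of \<open>y\<close> itself and a point of \<open>X\<close> above it.
\<close>

lemma frobenius:
  assumes f: "gset_map G X Y f" and a: "a \<in> obj R Y" and b: "b \<in> obj R X"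
  shows "a \<otimes>\<^bsub>Rg Y\<^esub> tr X Y f b = tr X Y f (rs X Y f a \<otimes>\<^bsub>Rg X\<^esub> b)"
proof -
  have X: "fin_gset G X" and Y: "fin_gset G Y" using f gset_map_dom gset_map_cod by blast+
  let ?YX = "sum_gset Y X" and ?YY = "sum_gset Y Y" and ?XX = "sum_gset X X"
  have fins: "fin_gset G ?YX" "fin_gset G ?YY" "fin_gset G ?XX"
    using X Y fin_gset_sum_gset by auto
  define h where "h z = (case z of In2 x \<Rightarrow> In2 (f x) | _ \<Rightarrow> z)" for z
  define u where "u z = (case z of In1 x \<Rightarrow> In1 (f x) | _ \<Rightarrow> z)" for z
  define v where "v z = (case z of In1 x \<Rightarrow> In1 (f x) | In2 x \<Rightarrow> In2 (f x) | _ \<Rightarrow> z)" for z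
  note fs = gset_map_in[OF f] gset_map_act[OF f]
  have h: "gset_map G ?YX ?YY h"
    by (rule gset_mapI) (use fins fs in \<open>auto simp: h_def elim!: sum_gsetE\<close>)
  have u: "gset_map G ?XX ?YX u"
    by (rule gset_mapI) (use fins fs in \<open>auto simp: u_def elim!: sum_gsetE\<close>)
  have v: "gset_map G ?XX ?YY v"
    by (rule gset_mapI) (use fins fs in \<open>auto simp: v_def elim!: sum_gsetE\<close>)
  define S where "S = \<lparr>bX = ?YX, bA = ?XX, bB = X, bY = Y, bres = u, bnorm = fold_map, btr = f\<rparr>"
  have sel: "bX S = ?YX" "bA S = ?XX" "bB S = X" "bY S = Y" "bres S = u" "bnorm S = fold_map" "btr S = f"
    by (simp_all add: S_def)
  have S: "is_bispan G S"
    using u gset_map_fold[OF X] f by (simp add: is_bispan_iff sel)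
  define ev where "ev b c = (case c of In1 _ \<Rightarrow> In1 (f b) | _ \<Rightarrow> In2 b)" for b c :: "'g pt"
  have "composite G (tr_bispan ?YX ?YY h) (norm_bispan ?YY Y fold_map) S f ev u v"
  proof (rule composite.intro, rule is_group, rule composite_axioms.intro, unfold bispan_sel sel, goal_cases)
    case (11 d \<sigma>)
    have s: "\<sigma> (In1 d) \<in> pts ?YX \<and> h (\<sigma> (In1 d)) = In1 d" "\<sigma> (In2 d) \<in> pts ?YX \<and> h (\<sigma> (In2 d)) = In2 d"
      using 11(2)[of "In1 d"] 11(2)[of "In2 d"] 11(1) by simp_all
    then have "\<sigma> (In1 d) = In1 d"
      by (auto simp: h_def elim!: sum_gsetE)
    moreover obtain x where "\<sigma> (In2 d) = In2 x" "x \<in> pts X" "f x = d"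
      using s(2) by (auto simp: h_def elim!: sum_gsetE)
    ultimately show ?case
      by (intro bexI[of _ x]) (auto simp: ev_def elim!: sum_gsetE)
  next
    case (12 b b')
    then show ?case
      using 12(4)[of "In2 (f b)"] fs(1) by (simp add: ev_def)
  next
    case (17 a b c)
    from 17(3) show ?case
    proof (cases rule: sum_gsetE)
      case (1 y) then show ?thesis
        using 17 by (intro bexI[of _ "In1 b"]) (auto simp: u_def v_def ev_def)
    next
      case (2 y) then show ?thesis
        using 17 by (intro bexI[of _ "In2 b"]) (auto simp: u_def v_def ev_def)
    qed
  next
    case (18 a a') then show ?case
      by (elim sum_gsetE) (auto simp: u_def v_def)
  qed (use S h u v f fins fs gset_map_fold[OF Y] in
      \<open>auto simp: h_def u_def v_def ev_def elim!: sum_gsetE\<close>)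
  note comp = mor_composite[OF this, unfolded bispan_sel]
  note c = coproduct_sum_gset[OF Y X]
  obtain z where z: "z \<in> obj R ?YX" "rs Y ?YX In1 z = a" "rs X ?YX In2 z = b"
    using coproduct_ex[OF c a b] by blast
  note cy = coproduct_sum_gset[OF Y Y] and cx = coproduct_sum_gset[OF X X]
  have "is_pullback G Y ?YX Y ?YY In1 (\<lambda>x. x) h In1"
    by (rule is_pullbackI) (use h coproductD(1)[OF c] coproductD(1)[OF cy] gset_map_id[OF Y] in
        \<open>auto simp: h_def elim!: sum_gsetE\<close>)
  from rs_tr[OF this z(1)] have t1: "rs Y ?YY In1 (tr ?YX ?YY h z) = a"
    using z a Y by (simp add: tr_id)
  have "is_pullback G X ?YX Y ?YY In2 f h In2"
    by (rule is_pullbackI) (use h coproductD(2)[OF c] coproductD(2)[OF cy] f in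
        \<open>auto simp: h_def elim!: sum_gsetE\<close>)
  from rs_tr[OF this z(1)] have t2: "rs Y ?YY In2 (tr ?YX ?YY h z) = tr X Y f b"
    using z by simp
  have "copair G R Y a (tr X Y f b) = tr ?YX ?YY h z"
    by (rule copair_eqI[OF Y tr_closed[OF h z(1)] t1 t2])
  then have "a \<otimes>\<^bsub>Rg Y\<^esub> tr X Y f b = mor R (bclass G S) z"
    using comp[OF z(1)] by (simp add: tambara_ring_def)
  also have "\<dots> = tr X Y f (nm ?XX X fold_map (rs ?XX ?YX u z))"
    using mor_bispan[OF S] z by (simp add: sel)
  also have "rs ?XX ?YX u z = copair G R X (rs X Y f a) b"
  proof (rule copair_eqI[OF X rs_closed[OF u z(1)], symmetric])
    have "rs X ?XX In1 (rs ?XX ?YX u z) = rs X ?YX (\<lambda>x. In1 (f x)) z"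
      by (rule rs_rs[OF coproductD(1)[OF cx] u _ z(1)]) (simp add: u_def)
    also have "\<dots> = rs X Y f (rs Y ?YX In1 z)"
      by (rule rs_rs[OF f coproductD(1)[OF c] _ z(1), symmetric]) simp
    finally show "rs X ?XX In1 (rs ?XX ?YX u z) = rs X Y f a" using z by simp
    have "rs X ?XX In2 (rs ?XX ?YX u z) = rs X ?YX In2 z"
      by (rule rs_rs[OF coproductD(2)[OF cx] u _ z(1)]) (simp add: u_def)
    then show "rs X ?XX In2 (rs ?XX ?YX u z) = b" using z by simp
  qed
  finally show ?thesis by (simp add: tambara_ring_def)
qed

lemma cring_Rg:
  assumes X: "fin_gset G X"
  shows "cring (Rg X)"
proof (rule cringI)
  interpret a: comm_monoid "add_monoid (Rg X)"
    using add.M_comm_monoid[OF X] by (simp add: add_M)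
  interpret g: group "add_monoid (Rg X)"
    using tambara_functor X by (auto simp: tambara_functor_def)
  interpret m: comm_monoid "mul.M X"
    using mul.M_comm_monoid[OF X] .
  have acl: "x \<oplus>\<^bsub>Rg X\<^esub> y \<in> obj R X" if "x \<in> obj R X" "y \<in> obj R X" for x y
    using a.m_closed[of x y] that by simp
  have mcl: "x \<otimes>\<^bsub>Rg X\<^esub> y \<in> obj R X" if "x \<in> obj R X" "y \<in> obj R X" for x y
    using m.m_closed[of x y] that by simp
  have mcomm: "x \<otimes>\<^bsub>Rg X\<^esub> y = y \<otimes>\<^bsub>Rg X\<^esub> x" if "x \<in> obj R X" "y \<in> obj R X" for x y
    using m.m_comm[of x y] that by simp
  show "abelian_group (Rg X)"
  proof (rule abelian_groupI)
    fix x y z assume xyz: "x \<in> carrier (Rg X)" "y \<in> carrier (Rg X)" "z \<in> carrier (Rg X)"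
    show "x \<oplus>\<^bsub>Rg X\<^esub> y \<in> carrier (Rg X)" using acl xyz by simp
    show "x \<oplus>\<^bsub>Rg X\<^esub> y \<oplus>\<^bsub>Rg X\<^esub> z = x \<oplus>\<^bsub>Rg X\<^esub> (y \<oplus>\<^bsub>Rg X\<^esub> z)"
      using a.m_assoc[of x y z] xyz by simp
    show "x \<oplus>\<^bsub>Rg X\<^esub> y = y \<oplus>\<^bsub>Rg X\<^esub> x" using a.m_comm[of x y] xyz by simp
  next
    show "\<zero>\<^bsub>Rg X\<^esub> \<in> carrier (Rg X)" using a.one_closed by simp
    fix x assume x: "x \<in> carrier (Rg X)"
    show "\<zero>\<^bsub>Rg X\<^esub> \<oplus>\<^bsub>Rg X\<^esub> x = x" using a.l_one[of x] x by simp
    show "\<exists>y\<in>carrier (Rg X). y \<oplus>\<^bsub>Rg X\<^esub> x = \<zero>\<^bsub>Rg X\<^esub>"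
      using g.l_inv[of x] g.inv_closed[of x] x by auto
  qed
  show "comm_monoid (Rg X)"
  proof (rule comm_monoidI)
    fix x y z assume xyz: "x \<in> carrier (Rg X)" "y \<in> carrier (Rg X)" "z \<in> carrier (Rg X)"
    show "x \<otimes>\<^bsub>Rg X\<^esub> y \<in> carrier (Rg X)" using mcl xyz by simp
    show "x \<otimes>\<^bsub>Rg X\<^esub> y \<otimes>\<^bsub>Rg X\<^esub> z = x \<otimes>\<^bsub>Rg X\<^esub> (y \<otimes>\<^bsub>Rg X\<^esub> z)"
      using m.m_assoc[of x y z] xyz by simp
    show "x \<otimes>\<^bsub>Rg X\<^esub> y = y \<otimes>\<^bsub>Rg X\<^esub> x" using mcomm xyz by simp
  next
    show "\<one>\<^bsub>Rg X\<^esub> \<in> carrier (Rg X)" using m.one_closed by simp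
    fix x assume x: "x \<in> carrier (Rg X)"
    show "\<one>\<^bsub>Rg X\<^esub> \<otimes>\<^bsub>Rg X\<^esub> x = x" using m.l_one[of x] x by simp
  qed
  fix x y z assume "x \<in> carrier (Rg X)" "y \<in> carrier (Rg X)" "z \<in> carrier (Rg X)"
  then have xyz: "x \<in> obj R X" "y \<in> obj R X" "z \<in> obj R X" by simp_all
  let ?S = "sum_gset X X"
  note fold = gset_map_fold[OF X]
  have "rs X X (\<lambda>x. x) z = z" using rs_id X xyz by simp
  note s = coproduct_sum_gset[OF X X]
  \<comment> \<open>The Frobenius formula for the fold map, along which the sum of \<open>x\<close> and \<open>y\<close> is transferred.\<close>
  let ?z = "rs ?S X fold_map z" and ?xy = "copair G R X x y"
  have z': "?z \<in> obj R ?S" using rs_closed[OF fold] xyz by simp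
  have xy: "?xy \<in> obj R ?S" using copair[OF X] xyz by simp
  have r: "rs X ?S In1 ?z = z" "rs X ?S In2 ?z = z"
    using rs_rs[OF coproductD(1)[OF s] fold, of "\<lambda>x. x" z] rs_rs[OF coproductD(2)[OF s] fold, of "\<lambda>x. x" z]
      rs_id[OF X] xyz by simp_all
  interpret ms: comm_monoid "mul.M ?S"
    using mul.M_comm_monoid[OF fin_gset_sum_gset[OF X X]] .
  have p: "?z \<otimes>\<^bsub>Rg ?S\<^esub> ?xy \<in> obj R ?S"
    using ms.m_closed[of ?z ?xy] z' xy by simp
  have "z \<otimes>\<^bsub>Rg X\<^esub> (x \<oplus>\<^bsub>Rg X\<^esub> y) = z \<otimes>\<^bsub>Rg X\<^esub> tr ?S X fold_map ?xy"
    by (simp add: tambara_ring_def)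
  also have "\<dots> = tr ?S X fold_map (?z \<otimes>\<^bsub>Rg ?S\<^esub> ?xy)"
    by (rule frobenius[OF fold xyz(3) xy])
  also have "?z \<otimes>\<^bsub>Rg ?S\<^esub> ?xy = copair G R X (z \<otimes>\<^bsub>Rg X\<^esub> x) (z \<otimes>\<^bsub>Rg X\<^esub> y)"
    by (rule copair_eqI[symmetric])
      (use X p r rs_mult[OF coproductD(1)[OF s] z' xy] rs_mult[OF coproductD(2)[OF s] z' xy]
        copair[OF X xyz(1,2)] in simp_all)
  also have "tr ?S X fold_map \<dots> = z \<otimes>\<^bsub>Rg X\<^esub> x \<oplus>\<^bsub>Rg X\<^esub> z \<otimes>\<^bsub>Rg X\<^esub> y"
    by (simp add: tambara_ring_def)
  finally show "(x \<oplus>\<^bsub>Rg X\<^esub> y) \<otimes>\<^bsub>Rg X\<^esub> z = x \<otimes>\<^bsub>Rg X\<^esub> z \<oplus>\<^bsub>Rg X\<^esub> y \<otimes>\<^bsub>Rg X\<^esub> z"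
    using mcomm[of z] xyz acl by simp
qed

text \<open>
  Zero is a transfer from the empty set, and over a nonempty fibre there is no section into the
  empty set. As no fibre of \<open>f\<close> is empty, the dependent product is empty, and the norm of zero is again
  a transfer from the empty set.
\<close>

lemma nm_zero:
  assumes f: "gset_map G X Y f" and surj: "\<And>y. y \<in> pts Y \<Longrightarrow> \<exists>x\<in>pts X. f x = y"
  shows "nm X Y f \<zero>\<^bsub>Rg X\<^esub> = \<zero>\<^bsub>Rg Y\<^esub>"
proof -
  have X: "fin_gset G X" and Y: "fin_gset G Y" using f gset_map_dom gset_map_cod by blast+
  note E = fin_gset_empty
  have e: "gset_map G empty_gset X (\<lambda>x. x)" "gset_map G empty_gset Y (\<lambda>x. x)"
    using gset_map_of_empty[OF E] X Y by simp_all
  note ie = gset_map_id[OF E]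
  define S where "S = \<lparr>bX = empty_gset, bA = empty_gset, bB = empty_gset, bY = Y,
    bres = (\<lambda>x. x), bnorm = (\<lambda>x. x), btr = (\<lambda>x. x)\<rparr>"
  have S: "is_bispan G S"
    using e ie by (simp add: is_bispan_iff S_def)
  have "composite G (tr_bispan empty_gset X (\<lambda>x. x)) (norm_bispan X Y f) S (\<lambda>x. x) (\<lambda>b c. b) (\<lambda>x. x) (\<lambda>x. x)"
  proof (rule composite.intro, rule is_group, rule composite_axioms.intro, goal_cases)
    case (11 d \<sigma>) then show ?case using surj[of d] by auto
  qed (use S e f ie in \<open>auto simp: S_def\<close>)
  from mor_composite[OF this, of "base_pt R"] show ?thesis
    using base_pt mor_bispan[OF S, of "base_pt R"]
    by (simp add: tambara_ring_def S_def rs_id[OF E] nm_id[OF E])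
qed


section \<open>Germs\<close>

text \<open>
  The restriction of \<open>z \<in> R(X)\<close> along \<open>g \<mapsto> g x\<close> is an element of \<open>R(G/e)\<close>. On these germs
  restrictions, norms and transfers are computed pointwise.
\<close>

abbreviation "Fr \<equiv> free_orbit G"

definition orbit_map :: "'g gset \<Rightarrow> 'g pt \<Rightarrow> 'g pt \<Rightarrow> 'g pt" where
  "orbit_map X x z = (case z of Elt g \<Rightarrow> act X g x | _ \<Rightarrow> z)"

definition germ :: "'g gset \<Rightarrow> 'r \<Rightarrow> 'g pt \<Rightarrow> 'r" where
  "germ X z x = rs Fr X (orbit_map X x) z"

lemma free_orbit_simps [simp]:
  "pts Fr = Elt ` carrier G"
  "x \<in> carrier G \<Longrightarrow> act Fr g (Elt x) = Elt (g \<otimes> x)"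
  by (simp_all add: free_orbit_def)

lemma fin_gset_free_orbit: "fin_gset G Fr"
  unfolding free_orbit_def
  by (rule fin_gset_mk_gset) (auto simp: finite_G m_assoc)

lemma gset_map_orbit_map:
  "fin_gset G X \<Longrightarrow> x \<in> pts X \<Longrightarrow> gset_map G Fr X (orbit_map X x)"
  by (rule gset_mapI) (auto simp: fin_gset_free_orbit orbit_map_def act_closed act_mult)

lemma germ_closed: "fin_gset G X \<Longrightarrow> x \<in> pts X \<Longrightarrow> z \<in> obj R X \<Longrightarrow> germ X z x \<in> obj R Fr"
  unfolding germ_def using rs_closed[OF gset_map_orbit_map] by blast

lemma rs_cong:
  assumes "gset_map G X Y f" and "\<And>x. x \<in> pts X \<Longrightarrow> h x = f x" and "z \<in> obj R Y"
  shows "rs X Y h z = rs X Y f z"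
proof -
  have "gset_map G X X (\<lambda>x. x)" using assms gset_map_id gset_map_dom by blast
  from rs_rs[OF this assms(1,2,3)] show ?thesis
    using rs_id[OF gset_map_dom[OF assms(1)] rs_closed[OF assms(1,3)]] by simp
qed

lemma germ_rs:
  assumes f: "gset_map G X Y f" and x: "x \<in> pts X" and z: "z \<in> obj R Y"
  shows "germ X (rs X Y f z) x = germ Y z (f x)"
  unfolding germ_def
  by (rule rs_rs[OF gset_map_orbit_map[OF gset_map_dom[OF f] x] f _ z])
    (use x in \<open>auto simp: orbit_map_def gset_map_act[OF f]\<close>)

lemma germ_act:
  assumes X: "fin_gset G X" and g: "g \<in> carrier G" and x: "x \<in> pts X" and z: "z \<in> obj R X"
  shows "germ X z (act X g x) = orbit_action G R g (germ X z x)"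
proof -
  have r: "gset_map G Fr Fr (right_mult G g)"
    by (rule gset_mapI) (use g in \<open>auto simp: fin_gset_free_orbit right_mult_def m_assoc\<close>)
  show ?thesis
    unfolding germ_def orbit_action_def
    by (rule rs_rs[OF r gset_map_orbit_map[OF X x] _ z, symmetric])
      (use X g x in \<open>auto simp: orbit_map_def right_mult_def act_mult\<close>)
qed

lemma germ_free_orbit:
  assumes z: "z \<in> obj R Fr"
  shows "germ Fr z (Elt \<one>) = z"
proof -
  have "rs Fr Fr (orbit_map Fr (Elt \<one>)) z = rs Fr Fr (\<lambda>x. x) z"
    by (rule rs_cong[OF gset_map_id[OF fin_gset_free_orbit] _ z]) (auto simp: orbit_map_def)
  then show ?thesis
    using rs_id[OF fin_gset_free_orbit z] by (simp add: germ_def)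
qed

lemma germ_mult:
  "fin_gset G X \<Longrightarrow> x \<in> pts X \<Longrightarrow> a \<in> obj R X \<Longrightarrow> b \<in> obj R X \<Longrightarrow>
    germ X (a \<otimes>\<^bsub>Rg X\<^esub> b) x = germ X a x \<otimes>\<^bsub>Rg Fr\<^esub> germ X b x"
  unfolding germ_def using rs_mult[OF gset_map_orbit_map] by blast

lemma germ_zero: "fin_gset G X \<Longrightarrow> x \<in> pts X \<Longrightarrow> germ X \<zero>\<^bsub>Rg X\<^esub> x = \<zero>\<^bsub>Rg Fr\<^esub>"
  unfolding germ_def using rs_zero[OF gset_map_orbit_map] by blast

end

text \<open>
  The pullback of \<open>f\<close> along the orbit map of \<open>y\<close> is a disjoint union of copies of \<open>G/e\<close> indexed by the
  fibre of \<open>y\<close>: the copy of \<open>x\<close> consists of the points \<open>(g x, g)\<close>.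
\<close>

lemma (in tambara_push) germ_F:
  assumes f: "gset_map G X Y f" and z: "z \<in> obj R X" and y: "y \<in> pts Y"
  shows "germ Y (F X Y f z) y = finprod (M Fr) (germ X z) {x \<in> pts X. f x = y}"
proof -
  note O = fin_gset_free_orbit
  have X: "fin_gset G X" and Y: "fin_gset G Y" using f gset_map_dom gset_map_cod by blast+
  let ?I = "{x \<in> pts X. f x = y}"
  note oy = gset_map_orbit_map[OF Y y]
  let ?P = "pullback X f Fr (orbit_map Y y)"
  have P: "fin_gset G ?P" using fin_gset_pullback[OF f oy] .
  have p: "gset_map G ?P X pfst" "gset_map G ?P Fr psnd"
    using P X O by (auto intro!: gset_mapI simp: act_pullback elim!: pullbackE)
  have "is_pullback G ?P X Fr Y pfst psnd f (orbit_map Y y)"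
  proof (rule is_pullbackI[OF p f oy])
    fix x w assume "x \<in> pts X" "w \<in> pts Fr" "f x = orbit_map Y y w"
    then show "\<exists>a\<in>pts ?P. pfst a = x \<and> psnd a = w"
      by (intro bexI[of _ "Tup x w"]) auto
  qed (auto elim!: pullbackE)
  from rs_F[OF this z] have 1: "germ Y (F X Y f z) y = F ?P Fr psnd (rs ?P X pfst z)"
    by (simp add: germ_def)
  define i where "i x w = (case w of Elt g \<Rightarrow> Tup (act X g x) (Elt g) | _ \<Rightarrow> w)" for x w :: "'g pt"
  have i: "gset_map G Fr ?P (i x)" if x: "x \<in> ?I" for x
    by (rule gset_mapI)
      (use x O P X gset_map_act[OF f] in
        \<open>auto simp: i_def act_closed act_mult orbit_map_def act_pullback\<close>)
  have part: "is_partition G ?I (\<lambda>_. Fr) ?P i"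
    unfolding is_partition_def
  proof (intro conjI ballI impI)
    show "finite ?I" using fin_gset_finite[OF X] by simp
    show "inj_on (i x) (pts Fr)" for x by (auto simp: inj_on_def i_def)
    show "i x ` pts Fr \<inter> i x' ` pts Fr = {}" if "x \<in> ?I" "x' \<in> ?I" "x \<noteq> x'" for x x'
    proof (rule equals0I)
      fix w assume "w \<in> i x ` pts Fr \<inter> i x' ` pts Fr"
      then obtain g where g: "g \<in> carrier G" "act X g x = act X g x'"
        by (auto simp: i_def)
      have "act X (inv g) (act X g x) = x" "act X (inv g) (act X g x') = x'"
        using that g(1) X by (auto intro: act_inv1)
      then show False using g(2) that(3) by simp
    qed
    show "pts ?P = (\<Union>x\<in>?I. i x ` pts Fr)"
    proof (intro equalityI subsetI)
      fix w assume "w \<in> pts ?P"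
      then obtain x g where w: "w = Tup x (Elt g)" "x \<in> pts X" "g \<in> carrier G" "f x = act Y g y"
        by (auto simp: orbit_map_def elim!: pullbackE)
      have "act X (inv g) x \<in> ?I"
        using w X Y y by (simp add: act_closed gset_map_act[OF f] act_inv1)
      moreover have "w = i (act X (inv g) x) (Elt g)" "Elt g \<in> pts Fr"
        using w X by (simp_all add: i_def act_inv2)
      ultimately show "w \<in> (\<Union>x\<in>?I. i x ` pts Fr)"
        by (intro UN_I[of "act X (inv g) x"] image_eqI[of w _ "Elt g"])
    next
      fix w assume "w \<in> (\<Union>x\<in>?I. i x ` pts Fr)"
      then show "w \<in> pts ?P" using gset_map_in[OF i] by blast
    qed
  qed (use P i in auto)
  interpret m: comm_monoid "M Fr" using M_comm_monoid[OF O] .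
  have "F ?P Fr psnd (rs ?P X pfst z) =
      finprod (M Fr) (\<lambda>x. F Fr Fr (\<lambda>w. psnd (i x w)) (rs Fr ?P (i x) (rs ?P X pfst z))) ?I"
    by (rule F_partition[OF part p(2) rs_closed[OF p(1) z]])
  also have "\<dots> = finprod (M Fr) (germ X z) ?I"
  proof (rule m.finprod_cong')
    show "germ X z \<in> ?I \<rightarrow> carrier (M Fr)"
      using germ_closed[OF X _ z] by auto
    fix x assume x: "x \<in> ?I"
    have r: "rs Fr ?P (i x) (rs ?P X pfst z) = germ X z x"
      unfolding germ_def by (rule rs_rs[OF i[OF x] p(1) _ z]) (auto simp: i_def orbit_map_def)
    have g: "germ X z x \<in> obj R Fr" using germ_closed X z x by blast
    have "F Fr Fr (\<lambda>w. psnd (i x w)) (germ X z x) = F Fr Fr (\<lambda>w. w) (germ X z x)"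
      by (rule F_cong[OF gset_map_id[OF O] _ g]) (auto simp: i_def)
    then show "F Fr Fr (\<lambda>w. psnd (i x w)) (rs Fr ?P (i x) (rs ?P X pfst z)) = germ X z x"
      using F_id[OF O g] r by simp
  qed simp
  finally show ?thesis using 1 by simp
qed

context tambara begin

lemmas germ_tr = add.germ_F[unfolded finsum_add_M]
  and germ_nm = mul.germ_F[unfolded finprod_mul_M]

end


section \<open>Norm-determined idempotents\<close>

definition point :: "'g gset" where
  "point = mk_gset {Graph {||}} (\<lambda>g x. x)"

abbreviation to_point :: "'g pt \<Rightarrow> 'g pt" where
  "to_point \<equiv> (\<lambda>_. Graph {||})"

definition prod_gset :: "'g gset \<Rightarrow> 'g gset \<Rightarrow> 'g gset" where
  "prod_gset X Y = pullback X to_point Y to_point"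

lemma is_pullback_sym: "is_pullback G A X Y B p q f k \<Longrightarrow> is_pullback G A Y X B q p k f"
  unfolding is_pullback_def by metis

lemma pts_prod_gset: "pts (prod_gset X Y) = (\<lambda>(x, y). Tup x y) ` (pts X \<times> pts Y)"
  by (auto simp: prod_gset_def pullback_def)

lemma Tup_in_prod_gset [simp]: "Tup x y \<in> pts (prod_gset X Y) \<longleftrightarrow> x \<in> pts X \<and> y \<in> pts Y"
  by (auto simp: pts_prod_gset)

lemma prod_gsetE:
  assumes "z \<in> pts (prod_gset X Y)"
  obtains x y where "z = Tup x y" "x \<in> pts X" "y \<in> pts Y"
  using assms by (auto simp: pts_prod_gset)

lemma (in comm_monoid) finprod_idempotent:
  assumes "finite A" and "A \<noteq> {}" and "e \<in> carrier G" and "e \<otimes> e = e"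
    and "\<And>a. a \<in> A \<Longrightarrow> f a = e"
  shows "finprod G f A = e"
  using assms(1,2,5)
proof (induction A rule: finite_ne_induct)
  case (singleton a) then show ?case using assms(3) by simp
next
  case (insert a A)
  then have "finprod G f (insert a A) = f a \<otimes> finprod G f A"
    using assms(3) by (intro finprod_insert) auto
  then show ?case using insert assms(4) by simp
qed

lemma (in cring) finprod_eq_zero:
  assumes "finite A" and "a \<in> A" and "b \<in> A" and "a \<noteq> b" and "f \<in> A \<rightarrow> carrier R" and "f a \<otimes> f b = \<zero>"
  shows "finprod R f A = \<zero>"
proof -
  define B where "B = A - {a, b}"
  have A: "A = insert a (insert b B)" "finite B" "a \<notin> insert b B" "b \<notin> B"
    using assms by (auto simp: B_def)
  have f: "f a \<in> carrier R" "f b \<in> carrier R" "f \<in> B \<rightarrow> carrier R"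
    using assms by (auto simp: B_def)
  have c: "finprod R f B \<in> carrier R" using f(3) by (rule finprod_closed)
  have "finprod R f A = f a \<otimes> (f b \<otimes> finprod R f B)"
    unfolding A(1) using A(2-4) f by (simp add: Pi_iff)
  also have "\<dots> = \<zero>"
    using assms(6) f c by (simp add: m_assoc[symmetric])
  finally show ?thesis .
qed

context group begin

lemma fin_gset_point: "fin_gset G point"
  unfolding point_def by (rule fin_gset_mk_gset) auto

lemma pts_point [simp]: "pts point = {Graph {||}}"
  by (simp add: point_def)

lemma gset_map_to_point: "fin_gset G X \<Longrightarrow> gset_map G X point to_point"
  by (rule gset_mapI) (auto simp: fin_gset_point, simp add: point_def)

lemma fin_gset_prod_gset: "fin_gset G X \<Longrightarrow> fin_gset G Y \<Longrightarrow> fin_gset G (prod_gset X Y)"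
  unfolding prod_gset_def using fin_gset_pullback gset_map_to_point by blast

lemma act_prod_gset [simp]:
  "x \<in> pts X \<Longrightarrow> y \<in> pts Y \<Longrightarrow> act (prod_gset X Y) g (Tup x y) = Tup (act X g x) (act Y g y)"
  by (simp add: prod_gset_def act_pullback)

lemma gset_map_prod_projections:
  assumes "fin_gset G X" and "fin_gset G Y"
  shows "gset_map G (prod_gset X Y) X pfst" and "gset_map G (prod_gset X Y) Y psnd"
  by (rule gset_mapI; use assms fin_gset_prod_gset in \<open>auto elim!: prod_gsetE\<close>)+

lemma gset_map_prod_map:
  assumes "gset_map G X X' f" and "gset_map G Y Y' k"
  shows "gset_map G (prod_gset X Y) (prod_gset X' Y') (\<lambda>z. Tup (f (pfst z)) (k (psnd z)))"
proof (rule gset_mapI)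
  show "fin_gset G (prod_gset X Y)" "fin_gset G (prod_gset X' Y')"
    using assms fin_gset_prod_gset gset_map_dom gset_map_cod by blast+
qed (use assms in \<open>auto simp: gset_map_in gset_map_act elim!: prod_gsetE\<close>)

end

context tambara begin

text \<open>
  The copy of \<open>G/e\<close> in \<open>G/e \<times> X\<close> that belongs to \<open>x\<close> is the orbit of \<open>(e, x)\<close>. Hence an element of
  \<open>R(G/e \<times> X)\<close> is the same as a function from \<open>X\<close> to \<open>R(G/e)\<close>, namely that of its germs at the points
  \<open>(e, x)\<close>.
\<close>

lemma free_partition:
  assumes X: "fin_gset G X"
  shows "is_partition G (pts X) (\<lambda>_. Fr) (prod_gset Fr X) (\<lambda>x. orbit_map (prod_gset Fr X) (Tup (Elt \<one>) x))"
proof -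
  let ?P = "prod_gset Fr X"
  have P: "fin_gset G ?P" using fin_gset_prod_gset fin_gset_free_orbit X by blast
  define i where "i x = orbit_map ?P (Tup (Elt \<one>) x)" for x
  have e: "i x (Elt g) = Tup (Elt g) (act X g x)" if "g \<in> carrier G" "x \<in> pts X" for g x
    using that by (simp add: i_def orbit_map_def)
  have im: "i x ` pts Fr = {Tup (Elt g) (act X g x) | g. g \<in> carrier G}" if "x \<in> pts X" for x
    using e[OF _ that] by (auto simp: image_iff)
  show ?thesis
    unfolding is_partition_def i_def[symmetric]
  proof (intro conjI ballI impI)
    fix x assume x: "x \<in> pts X"
    show "gset_map G Fr ?P (i x)"
      unfolding i_def using gset_map_orbit_map[OF P] x by simp
    show "inj_on (i x) (pts Fr)"
      using e[OF _ x] by (auto simp: inj_on_def)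
    fix y assume y: "y \<in> pts X" "x \<noteq> y"
    have "act X g x \<noteq> act X g y" if "g \<in> carrier G" for g
      using act_inv1[OF X that x] act_inv1[OF X that y(1)] y(2) by metis
    then show "i x ` pts Fr \<inter> i y ` pts Fr = {}"
      unfolding im[OF x] im[OF y(1)] by auto
  next
    show "pts ?P = (\<Union>x\<in>pts X. i x ` pts Fr)"
    proof (intro equalityI subsetI)
      fix w assume "w \<in> pts ?P"
      then obtain g x where w: "w = Tup (Elt g) x" "g \<in> carrier G" "x \<in> pts X"
        by (auto elim!: prod_gsetE)
      have "w = i (act X (inv g) x) (Elt g)" "act X (inv g) x \<in> pts X" "Elt g \<in> pts Fr"
        using w X by (simp_all add: e act_closed act_inv2)
      then show "w \<in> (\<Union>x\<in>pts X. i x ` pts Fr)"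
        by (intro UN_I[of "act X (inv g) x"] image_eqI[of w _ "Elt g"])
    next
      fix w assume "w \<in> (\<Union>x\<in>pts X. i x ` pts Fr)"
      then obtain x where "x \<in> pts X" "w \<in> i x ` pts Fr" by blast
      then show "w \<in> pts ?P" using im X by (auto simp: act_closed)
    qed
  qed (use X P fin_gset_finite in auto)
qed

lemma free_eqI:
  assumes X: "fin_gset G X" and "z \<in> obj R (prod_gset Fr X)" and "z' \<in> obj R (prod_gset Fr X)"
    and "\<And>x. x \<in> pts X \<Longrightarrow> germ (prod_gset Fr X) z (Tup (Elt \<one>) x) = germ (prod_gset Fr X) z' (Tup (Elt \<one>) x)"
  shows "z = z'"
  by (rule partition_eqI[OF free_partition[OF X] assms(2,3)]) (use assms(4) in \<open>simp add: germ_def\<close>)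

lemma free_ex:
  assumes X: "fin_gset G X" and "\<And>x. x \<in> pts X \<Longrightarrow> y x \<in> obj R Fr"
  shows "\<exists>z\<in>obj R (prod_gset Fr X). \<forall>x\<in>pts X. germ (prod_gset Fr X) z (Tup (Elt \<one>) x) = y x"
  using partition_ex[OF free_partition[OF X], of y] assms(2) by (simp add: germ_def)

abbreviation cover :: "'g gset \<Rightarrow> 'g gset" where
  "cover X \<equiv> prod_gset Fr X"

lemma fin_gset_cover: "fin_gset G X \<Longrightarrow> fin_gset G (cover X)"
  using fin_gset_prod_gset fin_gset_free_orbit by blast

lemma gset_map_cover: "fin_gset G X \<Longrightarrow> gset_map G (cover X) X psnd"
  using gset_map_prod_projections fin_gset_free_orbit by blast

text \<open>
  An idempotent is called good if it is the norm of its restriction to \<open>G/e \<times> X\<close>. Good idempotents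
  are stable under restriction, norm and product because these operations commute with the
  restriction and norm along \<open>G/e \<times> X \<rightarrow> X\<close>; and they are determined by their germs because the
  restriction to \<open>G/e \<times> X\<close> is.
\<close>

definition good :: "'g gset \<Rightarrow> 'r \<Rightarrow> bool" where
  "good X z \<longleftrightarrow> z \<in> obj R X \<and> z \<otimes>\<^bsub>Rg X\<^esub> z = z \<and>
    nm (cover X) X psnd (rs (cover X) X psnd z) = z"

lemma good_closed: "good X z \<Longrightarrow> z \<in> obj R X"
  by (simp add: good_def)

lemma good_eqI:
  assumes X: "fin_gset G X" and z: "good X z" "good X z'"
    and germs: "\<And>x. x \<in> pts X \<Longrightarrow> germ X z x = germ X z' x"
  shows "z = z'"
proof -
  note p = gset_map_cover[OF X]
  have o: "z \<in> obj R X" "z' \<in> obj R X" using z by (auto simp: good_def)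
  have "rs (cover X) X psnd z = rs (cover X) X psnd z'"
  proof (rule free_eqI[OF X rs_closed[OF p o(1)] rs_closed[OF p o(2)]])
    fix x assume x: "x \<in> pts X"
    then have "Tup (Elt \<one>) x \<in> pts (cover X)" by simp
    from germ_rs[OF p this o(1)] germ_rs[OF p this o(2)] germs[OF x]
    show "germ (cover X) (rs (cover X) X psnd z) (Tup (Elt \<one>) x) =
        germ (cover X) (rs (cover X) X psnd z') (Tup (Elt \<one>) x)"
      by simp
  qed
  then show ?thesis using z by (auto simp: good_def)
qed

lemma cover_pullback:
  assumes f: "gset_map G X Y f"
  shows "is_pullback G (cover X) (cover Y) X Y (\<lambda>z. Tup (pfst z) (f (psnd z))) psnd psnd f"
proof -
  have X: "fin_gset G X" and Y: "fin_gset G Y" using f gset_map_dom gset_map_cod by blast+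
  show ?thesis
  proof (rule is_pullbackI)
    show "gset_map G (cover X) (cover Y) (\<lambda>z. Tup (pfst z) (f (psnd z)))"
      using gset_map_prod_map[OF gset_map_id[OF fin_gset_free_orbit] f] .
    fix w x assume "w \<in> pts (cover Y)" "x \<in> pts X" "psnd w = f x"
    then show "\<exists>a\<in>pts (cover X). Tup (pfst a) (f (psnd a)) = w \<and> psnd a = x"
      by (intro bexI[of _ "Tup (pfst w) x"]) (auto elim!: prod_gsetE)
  qed (use f gset_map_cover[OF X] gset_map_cover[OF Y] in \<open>auto elim!: prod_gsetE\<close>)
qed

lemma good_rs:
  assumes f: "gset_map G X Y f" and z: "good Y z"
  shows "good X (rs X Y f z)"
proof -
  have X: "fin_gset G X" and Y: "fin_gset G Y" using f gset_map_dom gset_map_cod by blast+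
  have zo: "z \<in> obj R Y" and zz: "z \<otimes>\<^bsub>Rg Y\<^esub> z = z" and
    up: "nm (cover Y) Y psnd (rs (cover Y) Y psnd z) = z"
    using z by (auto simp: good_def)
  let ?c = "\<lambda>z. Tup (pfst z) (f (psnd z))"
  note pX = gset_map_cover[OF X] and pY = gset_map_cover[OF Y]
  note pb = cover_pullback[OF f]
  have c: "gset_map G (cover X) (cover Y) ?c" using pb by (simp add: is_pullback_def)
  have "rs (cover X) X psnd (rs X Y f z) = rs (cover X) Y (\<lambda>w. f (psnd w)) z"
    by (rule rs_rs[OF pX f _ zo]) simp
  also have "\<dots> = rs (cover X) (cover Y) ?c (rs (cover Y) Y psnd z)"
    by (rule rs_rs[OF c pY _ zo, symmetric]) simp
  finally have "nm (cover X) X psnd (rs (cover X) X psnd (rs X Y f z)) = rs X Y f z"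
    using rs_nm[OF pb rs_closed[OF pY zo]] up by simp
  then show ?thesis
    using rs_closed[OF f zo] rs_mult[OF f zo zo] zz by (simp add: good_def)
qed

lemma good_nm:
  assumes f: "gset_map G X Y f" and z: "good X z"
  shows "good Y (nm X Y f z)"
proof -
  have X: "fin_gset G X" and Y: "fin_gset G Y" using f gset_map_dom gset_map_cod by blast+
  have zo: "z \<in> obj R X" and zz: "z \<otimes>\<^bsub>Rg X\<^esub> z = z" and
    up: "nm (cover X) X psnd (rs (cover X) X psnd z) = z"
    using z by (auto simp: good_def)
  let ?c = "\<lambda>z. Tup (pfst z) (f (psnd z))"
  note pX = gset_map_cover[OF X] and pY = gset_map_cover[OF Y]
  note pb = cover_pullback[OF f]
  have c: "gset_map G (cover X) (cover Y) ?c" using pb by (simp add: is_pullback_def)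
  note zX = rs_closed[OF pX zo]
  have "nm (cover Y) Y psnd (rs (cover Y) Y psnd (nm X Y f z)) =
      nm (cover Y) Y psnd (nm (cover X) (cover Y) ?c (rs (cover X) X psnd z))"
    using rs_nm[OF is_pullback_sym[OF pb] zo] by simp
  also have "\<dots> = nm (cover X) Y (\<lambda>w. f (psnd w)) (rs (cover X) X psnd z)"
    by (rule nm_nm[OF c pY _ zX]) simp
  also have "\<dots> = nm X Y f (nm (cover X) X psnd (rs (cover X) X psnd z))"
    by (rule nm_nm[OF pX f _ zX, symmetric]) simp
  finally show ?thesis
    using up nm_closed[OF f zo] nm_mult[OF f zo zo] zz by (simp add: good_def)
qed

lemma good_mult:
  assumes X: "fin_gset G X" and "good X z" and "good X w"
  shows "good X (z \<otimes>\<^bsub>Rg X\<^esub> w)"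
proof -
  interpret cring "Rg X" using cring_Rg[OF X] .
  note p = gset_map_cover[OF X]
  have z: "z \<in> carrier (Rg X)" "z \<otimes>\<^bsub>Rg X\<^esub> z = z" and w: "w \<in> carrier (Rg X)" "w \<otimes>\<^bsub>Rg X\<^esub> w = w"
    and up: "nm (cover X) X psnd (rs (cover X) X psnd z) = z" "nm (cover X) X psnd (rs (cover X) X psnd w) = w"
    using assms by (auto simp: good_def)
  have "(z \<otimes>\<^bsub>Rg X\<^esub> w) \<otimes>\<^bsub>Rg X\<^esub> (z \<otimes>\<^bsub>Rg X\<^esub> w) = (z \<otimes>\<^bsub>Rg X\<^esub> z) \<otimes>\<^bsub>Rg X\<^esub> (w \<otimes>\<^bsub>Rg X\<^esub> w)"
    using z(1) w(1) by (simp only: m_ac m_closed)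
  moreover have "nm (cover X) X psnd (rs (cover X) X psnd (z \<otimes>\<^bsub>Rg X\<^esub> w)) = z \<otimes>\<^bsub>Rg X\<^esub> w"
    using up z(1) w(1) rs_mult[OF p, of z w] nm_mult[OF p rs_closed[OF p] rs_closed[OF p], of z w] by simp
  ultimately show ?thesis
    using z w m_closed[OF z(1) w(1)] by (simp add: good_def)
qed

lemma good_zero: "fin_gset G X \<Longrightarrow> good X \<zero>\<^bsub>Rg X\<^esub>"
proof -
  assume X: "fin_gset G X"
  interpret cring "Rg X" using cring_Rg[OF X] .
  note p = gset_map_cover[OF X]
  have "nm (cover X) X psnd \<zero>\<^bsub>Rg (cover X)\<^esub> = \<zero>\<^bsub>Rg X\<^esub>"
  proof (rule nm_zero[OF p])
    fix x assume "x \<in> pts X"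
    then show "\<exists>w\<in>pts (cover X). psnd w = x"
      by (intro bexI[of _ "Tup (Elt \<one>) x"]) auto
  qed
  then show ?thesis
    using rs_zero[OF p] zero_closed by (simp add: good_def)
qed

text \<open>On \<open>G/e \<times> X\<close> all idempotents are good, since the norm multiplies equal germs there.\<close>

lemma good_on_cover:
  assumes X: "fin_gset G X" and y: "y \<in> obj R (cover X)" "y \<otimes>\<^bsub>Rg (cover X)\<^esub> y = y"
  shows "good (cover X) y"
proof -
  let ?C = "cover X"
  have C: "fin_gset G ?C" using fin_gset_cover X by blast
  note p = gset_map_cover[OF C]
  interpret o: cring "Rg Fr" using cring_Rg[OF fin_gset_free_orbit] .
  have "nm (cover ?C) ?C psnd (rs (cover ?C) ?C psnd y) = y"
  proof (rule free_eqI[OF X nm_closed[OF p rs_closed[OF p y(1)]] y(1)])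
    fix x assume x: "x \<in> pts X"
    let ?t = "Tup (Elt \<one>) x"
    have t: "?t \<in> pts ?C" using x by simp
    let ?I = "{q \<in> pts (cover ?C). psnd q = ?t}"
    have "germ ?C (nm (cover ?C) ?C psnd (rs (cover ?C) ?C psnd y)) ?t =
        finprod (Rg Fr) (germ (cover ?C) (rs (cover ?C) ?C psnd y)) ?I"
      by (rule germ_nm[OF p rs_closed[OF p y(1)] t])
    also have "\<dots> = germ ?C y ?t"
    proof (rule o.finprod_idempotent)
      show "finite ?I" using fin_gset_finite[OF fin_gset_cover[OF C]] by simp
      have "Tup (Elt \<one>) ?t \<in> ?I" using x by simp
      then show "?I \<noteq> {}" by blast
      show "germ ?C y ?t \<in> carrier (Rg Fr)" using germ_closed[OF C t y(1)] by simp
      show "germ ?C y ?t \<otimes>\<^bsub>Rg Fr\<^esub> germ ?C y ?t = germ ?C y ?t"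
        using germ_mult[OF C t y(1) y(1)] y(2) by simp
      show "germ (cover ?C) (rs (cover ?C) ?C psnd y) q = germ ?C y ?t" if "q \<in> ?I" for q
        using germ_rs[OF p _ y(1), of q] that by simp
    qed
    finally show "germ ?C (nm (cover ?C) ?C psnd (rs (cover ?C) ?C psnd y)) ?t = germ ?C y ?t" .
  qed
  then show ?thesis using y by (simp add: good_def)
qed


section \<open>Realising a complete system of orthogonal idempotents\<close>

text \<open>
  Let the elements of a \<open>G\<close>-set \<open>T\<close> label a complete system of orthogonal idempotents of \<open>R(G/e)\<close>
  which \<open>G\<close> permutes compatibly. Collect them in an element \<open>y\<close> of \<open>R(G/e \<times> T)\<close>, whose transfer to
  \<open>G/e\<close> is \<open>1\<close>. The norm from \<open>G/e\<close> to a point sends \<open>1\<close> to \<open>1\<close>; on the other hand the exponential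
  diagram writes the norm of the transfer of \<open>y\<close> as a transfer from the \<open>G\<close>-set of all functions
  \<open>G \<rightarrow> T\<close>. The summand at a function is a product of the idempotents that the function selects; it
  is good, and vanishes for every non-constant function by orthogonality. What remains is the
  transfer of a good idempotent on the constant functions, that is, on \<open>T\<close>.
\<close>

lemma idempotent_realisation:
  assumes T: "fin_gset G T"
    and d: "\<And>t. t \<in> pts T \<Longrightarrow> d t \<in> obj R Fr"
    and idem: "\<And>t. t \<in> pts T \<Longrightarrow> d t \<otimes>\<^bsub>Rg Fr\<^esub> d t = d t"
    and orth: "\<And>s t. s \<in> pts T \<Longrightarrow> t \<in> pts T \<Longrightarrow> s \<noteq> t \<Longrightarrow> d s \<otimes>\<^bsub>Rg Fr\<^esub> d t = \<zero>\<^bsub>Rg Fr\<^esub>"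
    and complete: "finsum (Rg Fr) d (pts T) = \<one>\<^bsub>Rg Fr\<^esub>"
    and equivariant: "\<And>g t. g \<in> carrier G \<Longrightarrow> t \<in> pts T \<Longrightarrow> d (act T g t) = orbit_action G R g (d t)"
  shows "\<exists>D. good T D \<and> (\<forall>t\<in>pts T. germ T D t = d t) \<and> tr T point to_point D = \<one>\<^bsub>Rg point\<^esub>"
proof -
  let ?C = "cover T"
  note O = fin_gset_free_orbit and C = fin_gset_cover[OF T]
  interpret o: cring "Rg Fr" using cring_Rg[OF O] .
  obtain y where y: "y \<in> obj R ?C" "\<And>t. t \<in> pts T \<Longrightarrow> germ ?C y (Tup (Elt \<one>) t) = d t"
    using free_ex[OF T, of d] d by blast
  have germ_y: "germ ?C y (Tup (Elt g) t) = d t" if g: "g \<in> carrier G" and t: "t \<in> pts T" for g t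
  proof -
    let ?t' = "act T (inv g) t"
    have t': "?t' \<in> pts T" using act_closed T g t by simp
    have "germ ?C y (Tup (Elt g) t) = germ ?C y (act ?C g (Tup (Elt \<one>) ?t'))"
      using g t t' T by (simp add: act_inv2)
    also have "\<dots> = orbit_action G R g (d ?t')"
      using germ_act[OF C g _ y(1), of "Tup (Elt \<one>) ?t'"] t' y(2) by simp
    also have "\<dots> = d (act T g ?t')" using equivariant[OF g t'] by simp
    finally show ?thesis using act_inv2[OF T g t] by simp
  qed
  have "y \<otimes>\<^bsub>Rg ?C\<^esub> y = y"
  proof (rule free_eqI[OF T _ y(1)])
    interpret c: cring "Rg ?C" using cring_Rg[OF C] .
    show "y \<otimes>\<^bsub>Rg ?C\<^esub> y \<in> obj R ?C" using c.m_closed[of y y] y by simp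
    fix t assume "t \<in> pts T"
    then show "germ ?C (y \<otimes>\<^bsub>Rg ?C\<^esub> y) (Tup (Elt \<one>) t) = germ ?C y (Tup (Elt \<one>) t)"
      using germ_mult[OF C _ y(1) y(1)] y(2) idem by simp
  qed
  then have good_y: "good ?C y" using good_on_cover[OF T y(1)] by blast
  note pr = gset_map_prod_projections(1)[OF O T]
  have tr_y: "tr ?C Fr pfst y = \<one>\<^bsub>Rg Fr\<^esub>"
  proof -
    let ?I = "{q \<in> pts ?C. pfst q = Elt \<one>}"
    have "germ Fr (tr ?C Fr pfst y) (Elt \<one>) = finsum (Rg Fr) (germ ?C y) ?I"
      by (rule germ_tr[OF pr y(1)]) simp
    also have "?I = Tup (Elt \<one>) ` pts T"
      by (auto elim!: prod_gsetE)
    also have "finsum (Rg Fr) (germ ?C y) \<dots> = finsum (Rg Fr) (\<lambda>t. germ ?C y (Tup (Elt \<one>) t)) (pts T)"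
      by (rule o.finsum_reindex) (use y(2) d in \<open>auto simp: inj_on_def\<close>)
    also have "\<dots> = finsum (Rg Fr) d (pts T)"
      by (rule o.finsum_cong') (use y(2) d in auto)
    finally show ?thesis
      using germ_free_orbit[OF tr_closed[OF pr y(1)]] complete by simp
  qed
  note pt = gset_map_to_point[OF O]
  have "is_bispan G (tr_bispan ?C Fr pfst)" "is_bispan G (norm_bispan Fr point to_point)"
    using pr pt by simp_all
  then obtain S base ev argA argC where
    comp: "composite G (tr_bispan ?C Fr pfst) (norm_bispan Fr point to_point) S base ev argA argC"
    using composite_exists by (metis bispan_sel(8) bispan_sel(18))
  interpret c: composite G "tr_bispan ?C Fr pfst" "norm_bispan Fr point to_point" S base ev argA argC
    by (rule comp)
  define A where "A = bA S"
  define B where "B = bB S"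
  have bX: "bX S = ?C" "bY S = point" using c.objs by simp_all
  have base: "base b = Graph {||}" if "b \<in> pts B" for b
    using gset_map_in[OF c.base] that by (simp add: B_def)
  have maps: "gset_map G A ?C (bres S)" "gset_map G A B (bnorm S)" "gset_map G B point (btr S)"
    using c.maps(7-9) bX by (simp_all add: A_def B_def)
  have B: "fin_gset G B" using maps gset_map_dom by blast
  define z where "z = nm A B (bnorm S) (rs A ?C (bres S) y)"
  have ry: "rs A ?C (bres S) y \<in> obj R A" using rs_closed[OF maps(1) y(1)] .
  have good_z: "good B z"
    unfolding z_def by (rule good_nm[OF maps(2) good_rs[OF maps(1) good_y]])
  have z: "z \<in> obj R B" using good_closed[OF good_z] .
  have "tr B point (btr S) z = \<one>\<^bsub>Rg point\<^esub>"
    using mor_composite[OF comp, of y] mor_bispan[OF c.S, of y] y(1) tr_y nm_one[OF pt] bX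
    by (simp add: z_def A_def B_def)
  moreover have "tr B point to_point z = tr B point (btr S) z"
    by (rule add.F_cong[OF maps(3) _ z]) (use gset_map_in[OF maps(3)] in auto)
  ultimately have tr_z: "tr B point to_point z = \<one>\<^bsub>Rg point\<^esub>" by simp
  \<comment> \<open>A point \<open>b\<close> of \<open>B\<close> is the function \<open>g \<mapsto> sel b g\<close>.\<close>
  define sel where "sel b g = psnd (ev b (Elt g))" for b g
  have ev: "ev b (Elt g) = Tup (Elt g) (sel b g)" "sel b g \<in> pts T"
    if b: "b \<in> pts B" and g: "g \<in> carrier G" for b g
  proof -
    have "ev b (Elt g) \<in> pts ?C" "pfst (ev b (Elt g)) = Elt g"
      using c.ev_in[of b "Elt g"] c.ev_over[of b "Elt g"] b g base[OF b] by (auto simp: B_def)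
    then show "ev b (Elt g) = Tup (Elt g) (sel b g)" "sel b g \<in> pts T"
      by (auto simp: sel_def elim!: prod_gsetE)
  qed
  have argG: "\<exists>g\<in>carrier G. argC a = Elt g" if "a \<in> pts A" for a
    using gset_map_in[OF c.argC] that by (auto simp: A_def)
  have germ_A: "germ A (rs A ?C (bres S) y) a = d (sel (bnorm S a) g)"
    if a: "a \<in> pts A" and g: "g \<in> carrier G" "argC a = Elt g" for a g
  proof -
    have nB: "bnorm S a \<in> pts B" using gset_map_in[OF maps(2) a] .
    have "bres S a = Tup (Elt g) (sel (bnorm S a) g)"
      using c.res_eq[of a] c.arg_ev[of a] a g ev[OF nB g(1)] by (simp add: A_def)
    then show ?thesis
      using germ_rs[OF maps(1) a y(1)] germ_y[OF g(1) ev(2)[OF nB g(1)]] by simp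
  qed
  have arg: "\<exists>a\<in>pts A. argC a = Elt g \<and> bnorm S a = b" if b: "b \<in> pts B" and g: "g \<in> carrier G" for b g
    using c.arg_ex[of "ev b (Elt g)" b "Elt g"] ev[OF b g] b g base[OF b] by (auto simp: A_def B_def)
  have fibre: "finite {a \<in> pts A. bnorm S a = b}" for b
    using fin_gset_finite[OF gset_map_dom[OF maps(2)]] by simp
  have germ_z: "germ B z b = finprod (Rg Fr) (germ A (rs A ?C (bres S) y)) {a \<in> pts A. bnorm S a = b}"
    if "b \<in> pts B" for b
    unfolding z_def by (rule germ_nm[OF maps(2) ry that])
  have germ_const: "germ B z b = d t"
    if b: "b \<in> pts B" and t: "t \<in> pts T" "\<And>g. g \<in> carrier G \<Longrightarrow> sel b g = t" for b t
    unfolding germ_z[OF b]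
  proof (rule o.finprod_idempotent[OF fibre])
    obtain a where "a \<in> pts A" "bnorm S a = b" using arg[OF b one_closed] by blast
    then show "{a \<in> pts A. bnorm S a = b} \<noteq> {}" by blast
    fix a assume "a \<in> {a \<in> pts A. bnorm S a = b}"
    then show "germ A (rs A ?C (bres S) y) a = d t"
      using argG[of a] germ_A[of a] t(2) by auto
  qed (use d[OF t(1)] idem[OF t(1)] in auto)
  have germ_nonconst: "germ B z b = \<zero>\<^bsub>Rg Fr\<^esub>"
    if b: "b \<in> pts B" and g: "g \<in> carrier G" "h \<in> carrier G" "sel b g \<noteq> sel b h" for b g h
  proof -
    obtain a where a: "a \<in> pts A" "argC a = Elt g" "bnorm S a = b" using arg[OF b g(1)] by blast
    obtain a' where a': "a' \<in> pts A" "argC a' = Elt h" "bnorm S a' = b" using arg[OF b g(2)] by blast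
    show ?thesis
      unfolding germ_z[OF b]
    proof (rule o.finprod_eq_zero[OF fibre, of a _ a'])
      show "germ A (rs A ?C (bres S) y) a \<otimes>\<^bsub>Rg Fr\<^esub> germ A (rs A ?C (bres S) y) a' = \<zero>\<^bsub>Rg Fr\<^esub>"
        using germ_A[OF a(1) g(1) a(2)] germ_A[OF a'(1) g(2) a'(2)] a(3) a'(3)
          orth[OF ev(2)[OF b g(1)] ev(2)[OF b g(2)] g(3)] by simp
      show "germ A (rs A ?C (bres S) y) \<in> {a \<in> pts A. bnorm S a = b} \<rightarrow> carrier (Rg Fr)"
        using germ_closed[OF gset_map_dom[OF maps(2)] _ ry] by auto
      show "a \<noteq> a'" using a a' g(3) by auto
    qed (use a a' in auto)
  qed
  \<comment> \<open>The constant functions form a copy \<open>k T\<close> of \<open>T\<close> in \<open>B\<close>.\<close>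
  have "\<exists>b\<in>pts B. \<forall>g\<in>carrier G. sel b g = t" if t: "t \<in> pts T" for t
  proof -
    have "\<exists>b\<in>pts (bB S). base b = Graph {||} \<and> (\<forall>c\<in>pts Fr. ev b c = Tup c t)"
      using c.section_ex[of "Graph {||}" "\<lambda>w. Tup w t"] t by simp
    then obtain b where "b \<in> pts (bB S)" "\<forall>c\<in>pts Fr. ev b c = Tup c t" by blast
    then show ?thesis by (intro bexI[of _ b]) (simp_all add: B_def sel_def)
  qed
  then obtain k where k: "\<And>t. t \<in> pts T \<Longrightarrow> k t \<in> pts B"
    "\<And>t g. t \<in> pts T \<Longrightarrow> g \<in> carrier G \<Longrightarrow> sel (k t) g = t"
    by metis
  have B_eqI: "b = b'" if b: "b \<in> pts B" "b' \<in> pts B" "\<And>g. g \<in> carrier G \<Longrightarrow> sel b g = sel b' g" for b b'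
  proof (rule c.section_unique)
    fix w assume "w \<in> pts (bA (norm_bispan Fr point to_point))"
    then obtain g where "w = Elt g" "g \<in> carrier G" by auto
    then show "ev b w = ev b' w" using ev(1)[OF b(1)] ev(1)[OF b(2)] b(3) by simp
  qed (use b base in \<open>auto simp: B_def\<close>)
  have sel_act: "sel (act B g b) h = act T g (sel b (inv g \<otimes> h))"
    if b: "b \<in> pts B" and gh: "g \<in> carrier G" "h \<in> carrier G" for b g h
  proof -
    have gh': "inv g \<otimes> h \<in> carrier G" using gh by simp
    have "g \<otimes> (inv g \<otimes> h) = h" using gh by (simp add: m_assoc[symmetric])
    then have "ev (act B g b) (Elt h) = act ?C g (ev b (Elt (inv g \<otimes> h)))"
      using c.ev_act[of g b "Elt (inv g \<otimes> h)"] b gh base[OF b] by (simp add: B_def)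
    then show ?thesis
      using ev[OF b gh'] gh by (simp add: sel_def[of "act B g b"])
  qed
  have kmap: "gset_map G T B k"
  proof (rule gset_mapI[OF T B])
    fix g t assume gt: "g \<in> carrier G" "t \<in> pts T"
    show "k (act T g t) = act B g (k t)"
      by (rule B_eqI) (use gt k T B act_closed sel_act in auto)
  qed (use k in auto)
  have k_inj: "inj_on k (pts T)"
    using k(2)[OF _ one_closed] by (metis inj_onI)
  let ?N = "sub_gset B (pts B - k ` pts T)"
  have N: "fin_gset G ?N"
  proof (rule fin_gset_sub_gset[OF B])
    fix g b assume g: "g \<in> carrier G" and b: "b \<in> pts B - k ` pts T"
    have "act B g b \<noteq> k t" if t: "t \<in> pts T" for t
    proof
      assume e: "act B g b = k t"
      have "b = act B (inv g) (k t)" using e b g B act_inv1 by force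
      also have "\<dots> = k (act T (inv g) t)" using gset_map_act[OF kmap _ t, of "inv g"] g by simp
      finally show False using b act_closed[OF T _ t] g by blast
    qed
    then show "act B g b \<in> pts B - k ` pts T" using act_closed[OF B g] b by blast
  qed blast
  have Nmap: "gset_map G ?N B (\<lambda>b. b)"
    by (rule gset_mapI[OF N B]) auto
  have cop: "is_coproduct G T ?N B k (\<lambda>b. b)"
    unfolding is_coproduct_def using kmap Nmap k_inj k(1) by auto
  have "rs ?N B (\<lambda>b. b) z = \<zero>\<^bsub>Rg ?N\<^esub>"
  proof (rule good_eqI[OF N good_rs[OF Nmap good_z] good_zero[OF N]])
    fix b assume b: "b \<in> pts ?N"
    then have bB: "b \<in> pts B" "b \<notin> k ` pts T" by auto
    have "\<exists>g\<in>carrier G. sel b g \<noteq> sel b \<one>"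
    proof (rule ccontr)
      assume "\<not> ?thesis"
      then have const: "sel b g = sel b \<one>" if "g \<in> carrier G" for g
        using that by blast
      note t = ev(2)[OF bB(1) one_closed]
      have "b = k (sel b \<one>)"
      proof (rule B_eqI[OF bB(1) k(1)[OF t]])
        fix g assume g: "g \<in> carrier G"
        show "sel b g = sel (k (sel b \<one>)) g" unfolding k(2)[OF t g] by (rule const[OF g])
      qed
      then show False using bB ev(2)[OF bB(1)] by blast
    qed
    then have "germ B z b = \<zero>\<^bsub>Rg Fr\<^esub>" using germ_nonconst[OF bB(1)] by blast
    then show "germ ?N (rs ?N B (\<lambda>b. b) z) b = germ ?N \<zero>\<^bsub>Rg ?N\<^esub> b"
      using germ_rs[OF Nmap b z] germ_zero[OF N b] by simp
  qed
  then have "tr T point to_point (rs T B k z) \<oplus>\<^bsub>Rg point\<^esub> tr ?N point to_point \<zero>\<^bsub>Rg ?N\<^esub> = \<one>\<^bsub>Rg point\<^esub>"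
    using tr_coproduct[OF cop gset_map_to_point[OF B] z] tr_z by simp
  then have sum: "tr T point to_point (rs T B k z) \<oplus>\<^bsub>Rg point\<^esub> \<zero>\<^bsub>Rg point\<^esub> = \<one>\<^bsub>Rg point\<^esub>"
    using tr_zero[OF gset_map_to_point[OF N]] by simp
  interpret p: cring "Rg point" using cring_Rg[OF fin_gset_point] .
  have "tr T point to_point (rs T B k z) \<in> carrier (Rg point)"
    using tr_closed[OF gset_map_to_point[OF T] rs_closed[OF kmap z]] by simp
  from p.r_zero[OF this] sum have "tr T point to_point (rs T B k z) = \<one>\<^bsub>Rg point\<^esub>"
    by simp
  moreover have "germ T (rs T B k z) t = d t" if "t \<in> pts T" for t
    using germ_rs[OF kmap that z] germ_const[OF k(1) that k(2)] that by simp
  ultimately show ?thesis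
    using good_rs[OF kmap good_z] by blast
qed

end


section \<open>Idempotents of a Noetherian ring with a group action\<close>

context cring begin

definition idem :: "'a \<Rightarrow> bool" where
  "idem e \<longleftrightarrow> e \<in> carrier R \<and> e \<otimes> e = e"

definition atom :: "'a \<Rightarrow> bool" where
  "atom a \<longleftrightarrow> idem a \<and> a \<noteq> \<zero> \<and> (\<forall>f. idem f \<longrightarrow> f \<otimes> a = f \<longrightarrow> f = \<zero> \<or> f = a)"

lemma idem_mult: "idem e \<Longrightarrow> idem f \<Longrightarrow> idem (e \<otimes> f)"
proof -
  assume ef: "idem e" "idem f"
  then have "e \<in> carrier R" "f \<in> carrier R" by (simp_all add: idem_def)
  then have "(e \<otimes> f) \<otimes> (e \<otimes> f) = (e \<otimes> e) \<otimes> (f \<otimes> f)"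
    by (simp only: m_ac m_closed)
  then show ?thesis using ef by (simp add: idem_def)
qed

lemma idem_complement:
  assumes "idem e"
  shows "idem (\<one> \<ominus> e)" and "e \<otimes> (\<one> \<ominus> e) = \<zero>" and "e \<oplus> (\<one> \<ominus> e) = \<one>"
proof -
  have e: "e \<in> carrier R" "e \<otimes> e = e" using assms by (auto simp: idem_def)
  have 1: "e \<otimes> (\<one> \<ominus> e) = e \<ominus> e \<otimes> e" using e(1) by algebra
  then show 2: "e \<otimes> (\<one> \<ominus> e) = \<zero>" using e by (simp add: r_right_minus_eq)
  have "(\<one> \<ominus> e) \<otimes> (\<one> \<ominus> e) = (\<one> \<ominus> e) \<ominus> e \<otimes> (\<one> \<ominus> e)" using e(1) by algebra
  then show "idem (\<one> \<ominus> e)" using 2 e(1) by (simp add: idem_def minus_eq)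
  show "e \<oplus> (\<one> \<ominus> e) = \<one>" using e(1) by algebra
qed

lemma idem_sum_orthogonal:
  assumes "idem e" and "idem f" and "e \<otimes> f = \<zero>"
  shows "idem (e \<oplus> f)" and "e \<otimes> (e \<oplus> f) = e" and "f \<otimes> (e \<oplus> f) = f"
proof -
  have ef: "e \<in> carrier R" "f \<in> carrier R" "e \<otimes> e = e" "f \<otimes> f = f"
    using assms by (auto simp: idem_def)
  have fe: "f \<otimes> e = \<zero>" using assms(3) ef m_comm by simp
  show 1: "e \<otimes> (e \<oplus> f) = e" "f \<otimes> (e \<oplus> f) = f"
    using ef assms(3) fe by (simp_all add: r_distr)
  show "idem (e \<oplus> f)"
    using 1 ef by (simp add: idem_def l_distr)
qed

lemma atoms_orthogonal:
  assumes "atom a" and "atom b" and "a \<noteq> b"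
  shows "a \<otimes> b = \<zero>"
proof (rule ccontr)
  assume n: "a \<otimes> b \<noteq> \<zero>"
  have ab: "a \<in> carrier R" "b \<in> carrier R" "a \<otimes> a = a" "b \<otimes> b = b" "idem a" "idem b"
    using assms by (auto simp: atom_def idem_def)
  have i: "idem (a \<otimes> b)" using idem_mult ab by blast
  have "(a \<otimes> b) \<otimes> a = (a \<otimes> a) \<otimes> b" using ab(1,2) by (simp only: m_ac m_closed)
  moreover have "(a \<otimes> b) \<otimes> b = a \<otimes> b" using ab by (simp add: m_assoc)
  ultimately have "a \<otimes> b = a" "a \<otimes> b = b"
    using assms i n ab unfolding atom_def by auto
  then show False using assms(3) by simp
qed

lemma atom_mult_idem:
  assumes "atom a" and "idem f"
  shows "f \<otimes> a = \<zero> \<or> f \<otimes> a = a"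
proof -
  have a: "idem a" "a \<in> carrier R" "a \<otimes> a = a" "f \<in> carrier R"
    using assms by (auto simp: atom_def idem_def)
  have "(f \<otimes> a) \<otimes> a = f \<otimes> a" using a by (simp add: m_assoc)
  then show ?thesis using assms idem_mult a unfolding atom_def by blast
qed

text \<open>
  The order of idempotents by divisibility is the order of principal ideals, so chain conditions on
  ideals become chain conditions on idempotents.
\<close>

lemma PIdl_idem: "idem e \<Longrightarrow> idem f \<Longrightarrow> PIdl e \<subseteq> PIdl f \<longleftrightarrow> e \<otimes> f = e"
proof
  assume ef: "idem e" "idem f"
  then have c: "e \<in> carrier R" "f \<in> carrier R" "f \<otimes> f = f" by (auto simp: idem_def)
  {
    assume "PIdl e \<subseteq> PIdl f"
    then have "e \<in> PIdl f" using cgenideal_self[OF c(1)] by blast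
    then obtain x where x: "x \<in> carrier R" "e = x \<otimes> f" by (auto simp: cgenideal_def)
    then show "e \<otimes> f = e" using c by (simp add: m_assoc)
  next
    assume e: "e \<otimes> f = e"
    show "PIdl e \<subseteq> PIdl f"
    proof
      fix y assume "y \<in> PIdl e"
      then obtain x where x: "x \<in> carrier R" "y = x \<otimes> e" by (auto simp: cgenideal_def)
      then have "y = (x \<otimes> e) \<otimes> f" using e c by (simp add: m_assoc)
      then show "y \<in> PIdl f" using x c unfolding cgenideal_def by blast
    qed
  }
qed

context
  assumes noetherian: "noetherian_ring R"
begin

lemma idem_maximal:
  assumes "E \<noteq> {}" and E: "\<And>e. e \<in> E \<Longrightarrow> idem e"
  shows "\<exists>m\<in>E. \<forall>e\<in>E. m \<otimes> e = m \<longrightarrow> e = m"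
proof -
  interpret noetherian_ring R by (rule noetherian)
  have ideal: "ideal (PIdl e) R" if "e \<in> E" for e
    using E[OF that] cgenideal_ideal by (simp add: idem_def)
  have "\<exists>M\<in>cgenideal R ` E. \<forall>X\<in>cgenideal R ` E. M \<subseteq> X \<longrightarrow> X = M"
  proof (rule subset_Zorn_nonempty)
    fix C assume C: "C \<noteq> {}" "subset.chain (cgenideal R ` E) C"
    then have "subset.chain {I. ideal I R} C"
      using ideal by (auto simp: subset.chain_def)
    then have "\<Union>C \<in> C" using ideal_chain_is_trivial C by blast
    then show "\<Union>C \<in> cgenideal R ` E" using C by (auto simp: subset.chain_def)
  qed (use assms in simp)
  then obtain m where m: "m \<in> E" "\<And>e. e \<in> E \<Longrightarrow> PIdl m \<subseteq> PIdl e \<Longrightarrow> PIdl e = PIdl m" by blast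
  have "e = m" if e: "e \<in> E" "m \<otimes> e = m" for e
  proof -
    have "PIdl m \<subseteq> PIdl e" using PIdl_idem[OF E[OF m(1)] E[OF e(1)]] e by simp
    then have "PIdl e \<subseteq> PIdl m" using m(2)[OF e(1)] by simp
    then have "e \<otimes> m = e" using PIdl_idem[OF E[OF e(1)] E[OF m(1)]] by simp
    then show ?thesis
      using e E[OF e(1)] E[OF m(1)] m_comm[of e m] by (simp add: idem_def)
  qed
  then show ?thesis using m by blast
qed

text \<open>Passing to complements reverses the order of idempotents.\<close>

lemma idem_minimal:
  assumes "E \<noteq> {}" and E: "\<And>e. e \<in> E \<Longrightarrow> idem e"
  shows "\<exists>m\<in>E. \<forall>e\<in>E. e \<otimes> m = e \<longrightarrow> e = m"
proof -
  have "\<exists>m\<in>(\<lambda>e. \<one> \<ominus> e) ` E. \<forall>e\<in>(\<lambda>e. \<one> \<ominus> e) ` E. m \<otimes> e = m \<longrightarrow> e = m"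
    by (rule idem_maximal) (use assms idem_complement in auto)
  then obtain m where m: "m \<in> E"
    "\<And>e. e \<in> E \<Longrightarrow> (\<one> \<ominus> m) \<otimes> (\<one> \<ominus> e) = \<one> \<ominus> m \<Longrightarrow> \<one> \<ominus> e = \<one> \<ominus> m"
    by auto
  have "e = m" if e: "e \<in> E" "e \<otimes> m = e" for e
  proof -
    have c: "e \<in> carrier R" "m \<in> carrier R" using E e m by (auto simp: idem_def)
    have "(\<one> \<ominus> m) \<otimes> (\<one> \<ominus> e) = (\<one> \<ominus> m) \<ominus> e \<oplus> e \<otimes> m" using c by algebra
    also have "\<dots> = \<one> \<ominus> m" unfolding e(2) using c by algebra
    finally have "\<one> \<ominus> e = \<one> \<ominus> m" using m(2)[OF e(1)] by simp
    then have "\<one> \<ominus> (\<one> \<ominus> e) = \<one> \<ominus> (\<one> \<ominus> m)" by simp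
    moreover have "\<one> \<ominus> (\<one> \<ominus> e) = e" "\<one> \<ominus> (\<one> \<ominus> m) = m" using c by algebra+
    ultimately show ?thesis by simp
  qed
  then show ?thesis using m by blast
qed

lemma atom_below:
  assumes "idem e" and "e \<noteq> \<zero>"
  shows "\<exists>a. atom a \<and> a \<otimes> e = a"
proof -
  let ?E = "{f. idem f \<and> f \<noteq> \<zero> \<and> f \<otimes> e = f}"
  have "e \<in> ?E" using assms by (simp add: idem_def)
  then obtain a where a: "a \<in> ?E" "\<And>f. f \<in> ?E \<Longrightarrow> f \<otimes> a = f \<Longrightarrow> f = a"
    using idem_minimal[of ?E] by blast
  have "f = \<zero> \<or> f = a" if f: "idem f" "f \<otimes> a = f" for f
  proof -
    have c: "f \<in> carrier R" "a \<in> carrier R" "e \<in> carrier R"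
      using f a assms by (auto simp: idem_def)
    have "f \<otimes> e = (f \<otimes> a) \<otimes> e" using f by simp
    also have "\<dots> = f \<otimes> (a \<otimes> e)" using c by (simp add: m_assoc)
    also have "\<dots> = f" using a f by simp
    finally show ?thesis using a(2)[of f] f by blast
  qed
  then have "atom a" using a by (simp add: atom_def)
  then show ?thesis using a by blast
qed

lemma sum_atoms:
  assumes "finite A" and "\<And>a. a \<in> A \<Longrightarrow> atom a"
  shows "idem (finsum R (\<lambda>a. a) A)"
    and "atom b \<Longrightarrow> b \<otimes> finsum R (\<lambda>a. a) A = (if b \<in> A then b else \<zero>)"
proof -
  have A: "(\<lambda>a. a) \<in> A \<rightarrow> carrier R" using assms(2) by (auto simp: atom_def idem_def)
  have mult: "b \<otimes> finsum R (\<lambda>a. a) A = (if b \<in> A then b else \<zero>)" if b: "atom b" for b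
  proof -
    have bc: "b \<in> carrier R" "b \<otimes> b = b" using b by (auto simp: atom_def idem_def)
    have "b \<otimes> finsum R (\<lambda>a. a) A = finsum R (\<lambda>a. b \<otimes> a) A"
      by (rule finsum_rdistr[OF assms(1) bc(1) A])
    also have "\<dots> = finsum R (\<lambda>a. if b = a then b else \<zero>) A"
      by (rule finsum_cong') (use bc b assms(2) atoms_orthogonal in auto)
    also have "\<dots> = (if b \<in> A then b else \<zero>)"
      using add.finprod_singleton[of b A "\<lambda>_. b"] assms(1) bc
      by (auto intro: add.finprod_one_eqI)
    finally show ?thesis .
  qed
  show "b \<otimes> finsum R (\<lambda>a. a) A = (if b \<in> A then b else \<zero>)" if "atom b"
    using mult[OF that] .
  have c: "finsum R (\<lambda>a. a) A \<in> carrier R" using finsum_closed A by blast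
  have "finsum R (\<lambda>a. a) A \<otimes> finsum R (\<lambda>a. a) A = finsum R (\<lambda>a. a \<otimes> finsum R (\<lambda>a. a) A) A"
    by (rule finsum_ldistr[OF assms(1) c A])
  also have "\<dots> = finsum R (\<lambda>a. a) A"
    by (rule finsum_cong') (use A mult assms(2) in auto)
  finally show "idem (finsum R (\<lambda>a. a) A)" using c by (simp add: idem_def)
qed

text \<open>
  A finite sum of distinct atoms that is maximal among such sums is \<open>1\<close>: an atom below its
  complement could be added to it.
\<close>

lemma finite_atoms: "finite {a. atom a}"
  and sum_all_atoms: "finsum R (\<lambda>a. a) {a. atom a} = \<one>"
proof -
  let ?s = "finsum R (\<lambda>a. a)"
  let ?F = "{A. finite A \<and> (\<forall>a\<in>A. atom a)}"
  have "\<exists>m\<in>?s ` ?F. \<forall>e\<in>?s ` ?F. m \<otimes> e = m \<longrightarrow> e = m"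
    by (rule idem_maximal) (use sum_atoms in auto)
  then obtain A where A: "finite A" "\<And>a. a \<in> A \<Longrightarrow> atom a"
    "\<And>B. B \<in> ?F \<Longrightarrow> ?s A \<otimes> ?s B = ?s A \<Longrightarrow> ?s B = ?s A"
    by auto
  have m: "idem (?s A)" using sum_atoms A by blast
  then have mc: "?s A \<in> carrier R" by (simp add: idem_def)
  have "\<one> \<ominus> ?s A = \<zero>"
  proof (rule ccontr)
    assume "\<one> \<ominus> ?s A \<noteq> \<zero>"
    then obtain a where a: "atom a" "a \<otimes> (\<one> \<ominus> ?s A) = a"
      using atom_below idem_complement(1)[OF m] by blast
    have ac: "a \<in> carrier R" "idem a" "a \<noteq> \<zero>" using a by (auto simp: atom_def idem_def)
    have "?s A \<otimes> a = (?s A \<otimes> (\<one> \<ominus> ?s A)) \<otimes> a"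
      using a(2) ac mc by (metis m_assoc m_comm minus_closed one_closed)
    then have ma: "?s A \<otimes> a = \<zero>" using idem_complement(2)[OF m] ac by simp
    then have am: "a \<otimes> ?s A = \<zero>" using ac mc m_comm by simp
    then have "a \<notin> A" using sum_atoms(2)[OF A(1,2) a(1)] ac by auto
    then have ins: "?s (insert a A) = a \<oplus> ?s A"
      using A ac by (intro finsum_insert) (auto simp: atom_def idem_def)
    have "?s A \<otimes> (a \<oplus> ?s A) = ?s A"
      using idem_sum_orthogonal(3)[OF ac(2) m am] .
    then have "a \<oplus> ?s A = ?s A" using A(3)[of "insert a A"] A a ins by auto
    then have "a \<otimes> (a \<oplus> ?s A) = a \<otimes> ?s A" by simp
    then show False using idem_sum_orthogonal(2)[OF ac(2) m am] am ac by simp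
  qed
  then have one: "?s A = \<one>" using idem_complement(3)[OF m] mc by simp
  have "b \<in> A" if b: "atom b" for b
    using sum_atoms(2)[OF A(1,2) b] one b by (auto simp: atom_def idem_def split: if_splits)
  then have "{a. atom a} = A" using A by blast
  then show "finite {a. atom a}" "?s {a. atom a} = \<one>" using A one by simp_all
qed

end

end


text \<open>
  The unit represents the coset \<open>H\<close>, so that the first component of the base point of \<open>G \<times>\<^sub>H H/e\<close> is
  the unit, and the idempotent attached to this coset is \<open>d H\<close> and not a translate of it.
\<close>

definition coset_rep :: "('g, 'b) monoid_scheme \<Rightarrow> 'g set \<Rightarrow> 'g \<Rightarrow> 'g" where
  "coset_rep G H g = (if g \<in> H then one G else (SOME x. x \<in> l_coset G g H))"

definition coset_reps :: "('g, 'b) monoid_scheme \<Rightarrow> 'g set \<Rightarrow> 'g set" where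
  "coset_reps G H = coset_rep G H ` carrier G"

context group begin

lemma coset_rep:
  assumes H: "subgroup H G" and g: "g \<in> carrier G"
  shows "coset_rep G H g \<in> carrier G" and "inv (coset_rep G H g) \<otimes> g \<in> H"
    and "h \<in> H \<Longrightarrow> coset_rep G H (g \<otimes> h) = coset_rep G H g"
proof -
  interpret H: subgroup H G by (rule H)
  have ne: "g \<in> g <# H" using g H.one_closed by (force simp: l_coset_def)
  have mem: "coset_rep G H g \<in> g <# H"
  proof (cases "g \<in> H")
    case True
    then have "\<one> \<in> g <# H" using g by (force simp: l_coset_def intro: bexI[of _ "inv g"])
    then show ?thesis using True by (simp add: coset_rep_def)
  next
    case False then show ?thesis using someI[of "\<lambda>x. x \<in> g <# H", OF ne] by (simp add: coset_rep_def)
  qed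
  then obtain k where k: "k \<in> H" "coset_rep G H g = g \<otimes> k" by (auto simp: l_coset_def)
  then have kc: "k \<in> carrier G" by simp
  show "coset_rep G H g \<in> carrier G" using k g kc by simp
  have "inv (g \<otimes> k) \<otimes> g = inv k" using g kc by (simp add: inv_mult_group m_assoc)
  then show "inv (coset_rep G H g) \<otimes> g \<in> H" using k by simp
  assume h: "h \<in> H"
  then have hc: "h \<in> carrier G" by simp
  have "(g \<otimes> h) <# H = g <# H"
  proof -
    have "(g \<otimes> h) <# H = g <# (h <# H)" using g hc H.subset by (simp add: lcos_m_assoc)
    also have "h <# H = H"
    proof
      show "h <# H \<subseteq> H" using h by (auto simp: l_coset_def)
      show "H \<subseteq> h <# H"
      proof
        fix x assume x: "x \<in> H"
        then have "x = h \<otimes> (inv h \<otimes> x)" using hc by (simp add: m_assoc[symmetric])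
        then show "x \<in> h <# H" using x h by (auto simp: l_coset_def)
      qed
    qed
    finally show ?thesis .
  qed
  moreover have "g \<otimes> h \<in> H \<longleftrightarrow> g \<in> H"
  proof
    assume "g \<otimes> h \<in> H"
    then have "(g \<otimes> h) \<otimes> inv h \<in> H" using h by simp
    then show "g \<in> H" using g hc by (simp add: m_assoc)
  qed (use h in simp)
  ultimately show "coset_rep G H (g \<otimes> h) = coset_rep G H g" by (simp add: coset_rep_def)
qed

lemma coset_rep_eqI:
  assumes H: "subgroup H G" and "g \<in> carrier G" "k \<in> carrier G" and "inv g \<otimes> k \<in> H"
  shows "coset_rep G H g = coset_rep G H k"
proof -
  have "k = g \<otimes> (inv g \<otimes> k)" using assms by (simp add: m_assoc[symmetric])
  then show ?thesis using coset_rep(3)[OF H assms(2,4)] by simp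
qed

lemma coset_reps:
  assumes H: "subgroup H G" and r: "r \<in> coset_reps G H"
  shows "r \<in> carrier G" and "coset_rep G H r = r"
proof -
  obtain g where g: "g \<in> carrier G" "r = coset_rep G H g" using r by (auto simp: coset_reps_def)
  then show "r \<in> carrier G" using coset_rep(1)[OF H] by simp
  then show "coset_rep G H r = r"
    using coset_rep_eqI[OF H _ g(1)] coset_rep(2)[OF H g(1)] g by simp
qed

lemma coset_rep_in_reps: "g \<in> carrier G \<Longrightarrow> coset_rep G H g \<in> coset_reps G H"
  by (simp add: coset_reps_def)

lemma finite_coset_reps: "finite (carrier G) \<Longrightarrow> finite (coset_reps G H)"
  by (simp add: coset_reps_def)

text \<open>
  The action permutes the atoms. Choose a representative of each orbit, and let \<open>d H\<close> be the sum of
  the representatives with stabilizer \<open>H\<close>. An idempotent below \<open>d H\<close> is a sum of such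
  representatives, hence fixed by \<open>H\<close>.
\<close>

lemma equivariant_idempotents:
  fixes S :: "('r, 'c) ring_scheme" and \<phi> :: "'a \<Rightarrow> 'r \<Rightarrow> 'r"
  assumes fin: "finite (carrier G)" and S: "cring S" and noeth: "noetherian_ring S"
    and cl: "\<And>g x. g \<in> carrier G \<Longrightarrow> x \<in> carrier S \<Longrightarrow> \<phi> g x \<in> carrier S"
    and one: "\<And>x. x \<in> carrier S \<Longrightarrow> \<phi> \<one> x = x"
    and act: "\<And>g h x. g \<in> carrier G \<Longrightarrow> h \<in> carrier G \<Longrightarrow> x \<in> carrier S \<Longrightarrow> \<phi> (g \<otimes> h) x = \<phi> g (\<phi> h x)"
    and mult: "\<And>g x y. g \<in> carrier G \<Longrightarrow> x \<in> carrier S \<Longrightarrow> y \<in> carrier S \<Longrightarrow>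
        \<phi> g (x \<otimes>\<^bsub>S\<^esub> y) = \<phi> g x \<otimes>\<^bsub>S\<^esub> \<phi> g y"
    and add: "\<And>g x y. g \<in> carrier G \<Longrightarrow> x \<in> carrier S \<Longrightarrow> y \<in> carrier S \<Longrightarrow>
        \<phi> g (x \<oplus>\<^bsub>S\<^esub> y) = \<phi> g x \<oplus>\<^bsub>S\<^esub> \<phi> g y"
    and zero: "\<And>g. g \<in> carrier G \<Longrightarrow> \<phi> g \<zero>\<^bsub>S\<^esub> = \<zero>\<^bsub>S\<^esub>"
  obtains d where "\<And>H. subgroup H G \<Longrightarrow> d H \<in> carrier S"
    and "\<And>H. subgroup H G \<Longrightarrow> d H \<otimes>\<^bsub>S\<^esub> d H = d H"
    and "\<And>H h. subgroup H G \<Longrightarrow> h \<in> H \<Longrightarrow> \<phi> h (d H) = d H"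
    and "\<And>H K g. subgroup H G \<Longrightarrow> subgroup K G \<Longrightarrow> g \<in> carrier G \<Longrightarrow> H \<noteq> K \<or> g \<notin> H \<Longrightarrow>
      d H \<otimes>\<^bsub>S\<^esub> \<phi> g (d K) = \<zero>\<^bsub>S\<^esub>"
    and "finsum S (\<lambda>(H, r). \<phi> r (d H)) (SIGMA H:{H. subgroup H G}. coset_reps G H) = \<one>\<^bsub>S\<^esub>"
    and "\<And>H f h. subgroup H G \<Longrightarrow> f \<in> carrier S \<Longrightarrow> f \<otimes>\<^bsub>S\<^esub> f = f \<Longrightarrow> d H \<otimes>\<^bsub>S\<^esub> f = f \<Longrightarrow>
      h \<in> H \<Longrightarrow> \<phi> h f = f"
proof -
  interpret S: cring S by (rule S)
  let ?At = "{a. S.atom a}"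
  have finAt: "finite ?At" and sumAt: "finsum S (\<lambda>a. a) ?At = \<one>\<^bsub>S\<^esub>"
    using S.finite_atoms S.sum_all_atoms noeth by blast+
  have atc: "a \<in> carrier S" if "S.atom a" for a using that by (simp add: S.atom_def S.idem_def)
  have inv1: "\<phi> (inv g) (\<phi> g x) = x" "\<phi> g (\<phi> (inv g) x) = x" if "g \<in> carrier G" "x \<in> carrier S" for g x
    using that act[of "inv g" g x] act[of g "inv g" x] one by simp_all
  have idem_act: "S.idem (\<phi> g e)" if "g \<in> carrier G" "S.idem e" for g e
    using that mult[of g e e] cl by (simp add: S.idem_def)
  have atom_act: "S.atom (\<phi> g a)" if g: "g \<in> carrier G" and a: "S.atom a" for g a
    unfolding S.atom_def
  proof (intro conjI allI impI)
    note ac = atc[OF a]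
    show "S.idem (\<phi> g a)" using idem_act g a by (simp add: S.atom_def)
    show "\<phi> g a \<noteq> \<zero>\<^bsub>S\<^esub>"
    proof
      assume "\<phi> g a = \<zero>\<^bsub>S\<^esub>"
      then have "a = \<phi> (inv g) \<zero>\<^bsub>S\<^esub>" using inv1(1)[OF g ac] by simp
      then show False using zero g a by (simp add: S.atom_def)
    qed
    fix f assume f: "S.idem f" "f \<otimes>\<^bsub>S\<^esub> \<phi> g a = f"
    then have fc: "f \<in> carrier S" by (simp add: S.idem_def)
    have "\<phi> (inv g) f \<otimes>\<^bsub>S\<^esub> a = \<phi> (inv g) (f \<otimes>\<^bsub>S\<^esub> \<phi> g a)"
      using mult[of "inv g" f "\<phi> g a"] inv1(1)[OF g ac] g fc ac cl by simp
    then have "\<phi> (inv g) f = \<zero>\<^bsub>S\<^esub> \<or> \<phi> (inv g) f = a"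
      using a f idem_act[of "inv g" f] g by (simp add: S.atom_def)
    then show "f = \<zero>\<^bsub>S\<^esub> \<or> f = \<phi> g a"
      using inv1(2)[OF g fc] zero[OF g] by auto
  qed
  have sum_act: "\<phi> g (finsum S (\<lambda>a. a) A) = finsum S (\<phi> g) A"
    if g: "g \<in> carrier G" and A: "finite A" "A \<subseteq> carrier S" for g A
    using A
  proof (induction A rule: finite_induct)
    case (insert a A)
    then have "finsum S (\<lambda>a. a) A \<in> carrier S" by (intro S.finsum_closed) auto
    moreover have "finsum S (\<phi> g) (insert a A) = \<phi> g a \<oplus>\<^bsub>S\<^esub> finsum S (\<phi> g) A"
      using insert cl g by (intro S.finsum_insert) auto
    moreover have "finsum S (\<lambda>a. a) (insert a A) = a \<oplus>\<^bsub>S\<^esub> finsum S (\<lambda>a. a) A"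
      using insert by (intro S.finsum_insert) auto
    ultimately show ?case using insert add[OF g] by simp
  qed (simp add: zero[OF g])
  define orb where "orb a = (\<lambda>g. \<phi> g a) ` carrier G" for a
  define \<rho> where "\<rho> a = (SOME b. b \<in> orb a)" for a
  have orb_act: "orb (\<phi> g a) = orb a" if g: "g \<in> carrier G" and a: "a \<in> carrier S" for g a
  proof
    show "orb (\<phi> g a) \<subseteq> orb a"
      unfolding orb_def using act[OF _ g a, symmetric] g by auto
    show "orb a \<subseteq> orb (\<phi> g a)"
    proof
      fix b assume "b \<in> orb a"
      then obtain h where h: "h \<in> carrier G" "b = \<phi> h a" by (auto simp: orb_def)
      have "b = \<phi> (h \<otimes> inv g) (\<phi> g a)"
        using h g a act[of h "inv g" "\<phi> g a"] inv1(1) cl by simp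
      then show "b \<in> orb (\<phi> g a)" using h g by (auto simp: orb_def)
    qed
  qed
  have \<rho>: "\<exists>g\<in>carrier G. \<rho> a = \<phi> g a" if a: "a \<in> carrier S" for a
  proof -
    have "\<phi> \<one> a \<in> orb a" by (auto simp: orb_def)
    then have "\<rho> a \<in> orb a" unfolding \<rho>_def by (rule someI)
    then show ?thesis by (auto simp: orb_def)
  qed
  have \<rho>_act: "\<rho> (\<phi> g a) = \<rho> a" if "g \<in> carrier G" "a \<in> carrier S" for g a
    using orb_act[OF that] by (simp add: \<rho>_def)
  define stab where "stab a = {g \<in> carrier G. \<phi> g a = a}" for a
  have stab: "subgroup (stab a) G" if a: "a \<in> carrier S" for a
  proof (rule subgroupI)
    show "stab a \<noteq> {}" using one[OF a] by (auto simp: stab_def)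
    show "inv g \<in> stab a" if "g \<in> stab a" for g
      using that inv1(1)[of g a] a by (simp add: stab_def)
    show "g \<otimes> h \<in> stab a" if "g \<in> stab a" "h \<in> stab a" for g h
      using that act[of g h a] a by (simp add: stab_def)
  qed (auto simp: stab_def)
  define B where "B H = {a. S.atom a \<and> \<rho> a = a \<and> stab a = H}" for H
  have B: "finite (B H)" "B H \<subseteq> carrier S" "\<And>a. a \<in> B H \<Longrightarrow> S.atom a" for H
    using finAt atc by (auto simp: B_def)
  define d where "d H = finsum S (\<lambda>a. a) (B H)" for H
  have d_idem: "S.idem (d H)" for H unfolding d_def by (rule S.sum_atoms[OF noeth B(1,3)])
  then have dc: "d H \<in> carrier S" for H by (simp add: S.idem_def)
  have rep_eq: "a = b \<and> H = K \<and> inv g \<otimes> h \<in> H"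
    if a: "a \<in> B H" and b: "b \<in> B K" and gh: "g \<in> carrier G" "h \<in> carrier G" and e: "\<phi> g a = \<phi> h b"
    for a b g h H K
  proof -
    have c: "a \<in> carrier S" "b \<in> carrier S" using a b B(2) by auto
    have "\<rho> a = \<rho> b" using \<rho>_act[OF gh(1) c(1)] \<rho>_act[OF gh(2) c(2)] e by simp
    then have ab: "a = b" using a b by (simp add: B_def)
    have "\<phi> (inv g \<otimes> h) a = a"
      using act[of "inv g" h b] e inv1(1)[OF gh(1) c(1)] gh c ab by simp
    then show ?thesis using ab a b gh by (auto simp: B_def stab_def)
  qed
  have fixed: "\<phi> h a = a" if "a \<in> B H" "h \<in> H" for a h H
    using that by (auto simp: B_def stab_def)
  have 1: "\<phi> h (d H) = d H" if H: "subgroup H G" and h: "h \<in> H" for H h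
  proof -
    have hc: "h \<in> carrier G" using subgroup.mem_carrier[OF H h] .
    have "\<phi> h (d H) = finsum S (\<phi> h) (B H)" unfolding d_def by (rule sum_act[OF hc B(1,2)])
    also have "\<dots> = d H"
      unfolding d_def by (rule S.finsum_cong') (use B(2) fixed[OF _ h] in auto)
    finally show ?thesis .
  qed
  have 2: "d H \<otimes>\<^bsub>S\<^esub> \<phi> g (d K) = \<zero>\<^bsub>S\<^esub>"
    if H: "subgroup H G" and g: "g \<in> carrier G" and n: "H \<noteq> K \<or> g \<notin> H" for H K g
  proof -
    have z: "a \<otimes>\<^bsub>S\<^esub> \<phi> g b = \<zero>\<^bsub>S\<^esub>" if a: "a \<in> B H" and b: "b \<in> B K" for a b
    proof (rule S.atoms_orthogonal)
      show "a \<noteq> \<phi> g b"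
      proof
        assume "a = \<phi> g b"
        then have "\<phi> \<one> a = \<phi> g b" using one B(2) a by auto
        from rep_eq[OF a b one_closed g this] show False using n g by auto
      qed
    qed (use B(3) a b atom_act[OF g] in auto)
    have gb: "\<phi> g b \<in> carrier S" if "b \<in> B K" for b using that B(2) cl[OF g] by auto
    have z': "d H \<otimes>\<^bsub>S\<^esub> \<phi> g b = \<zero>\<^bsub>S\<^esub>" if b: "b \<in> B K" for b
    proof -
      have "d H \<otimes>\<^bsub>S\<^esub> \<phi> g b = finsum S (\<lambda>a. a \<otimes>\<^bsub>S\<^esub> \<phi> g b) (B H)"
        unfolding d_def by (rule S.finsum_ldistr) (use B gb[OF b] in auto)
      also have "\<dots> = \<zero>\<^bsub>S\<^esub>" using z[OF _ b] by (simp add: S.add.finprod_one_eqI)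
      finally show ?thesis .
    qed
    have "d H \<otimes>\<^bsub>S\<^esub> \<phi> g (d K) = d H \<otimes>\<^bsub>S\<^esub> finsum S (\<phi> g) (B K)"
      using sum_act[OF g B(1,2)] by (simp add: d_def[of K])
    also have "\<dots> = finsum S (\<lambda>b. d H \<otimes>\<^bsub>S\<^esub> \<phi> g b) (B K)"
      by (rule S.finsum_rdistr) (use B dc gb in auto)
    also have "\<dots> = \<zero>\<^bsub>S\<^esub>" using z' by (simp add: S.add.finprod_one_eqI)
    finally show ?thesis .
  qed
  let ?I = "SIGMA H:{H. subgroup H G}. coset_reps G H"
  have finI: "finite ?I"
  proof (rule finite_SigmaI)
    have "{H. subgroup H G} \<subseteq> Pow (carrier G)" using subgroup.subset by blast
    then show "finite {H. subgroup H G}" using fin finite_subset by blast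
  qed (use fin finite_coset_reps in blast)
  have 3: "finsum S (\<lambda>(H, r). \<phi> r (d H)) ?I = \<one>\<^bsub>S\<^esub>"
  proof -
    define C where "C p = \<phi> (snd p) ` B (fst p)" for p
    have mem: "subgroup (fst p) G \<and> snd p \<in> carrier G \<and> coset_rep G (fst p) (snd p) = snd p" if "p \<in> ?I" for p
      using that coset_reps by auto
    have part: "\<phi> (snd p) (d (fst p)) = finsum S (\<lambda>a. a) (C p)" if p: "p \<in> ?I" for p
    proof -
      have g: "snd p \<in> carrier G" using mem[OF p] by blast
      have inj: "inj_on (\<phi> (snd p)) (B (fst p))"
        by (rule inj_onI) (use rep_eq[OF _ _ g g] in blast)
      have "\<phi> (snd p) (d (fst p)) = finsum S (\<phi> (snd p)) (B (fst p))"
        unfolding d_def by (rule sum_act[OF g B(1,2)])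
      also have "\<dots> = finsum S (\<lambda>a. a) (C p)"
        unfolding C_def by (rule S.finsum_reindex[symmetric]) (use inj B(2) cl[OF g] in auto)
      finally show ?thesis .
    qed
    have disj: "p = q" if p: "p \<in> ?I" and q: "q \<in> ?I" and x: "x \<in> C p" "x \<in> C q" for p q x
    proof -
      obtain a where a: "a \<in> B (fst p)" "x = \<phi> (snd p) a" using x(1) by (auto simp: C_def)
      obtain b where b: "b \<in> B (fst q)" "x = \<phi> (snd q) b" using x(2) by (auto simp: C_def)
      have g: "snd p \<in> carrier G" "snd q \<in> carrier G" using mem p q by blast+
      have e: "fst p = fst q" "inv (snd p) \<otimes> snd q \<in> fst p"
        using rep_eq[OF a(1) b(1) g trans[OF a(2)[symmetric] b(2)]] by blast+
      have "coset_rep G (fst p) (snd p) = coset_rep G (fst p) (snd q)"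
        by (rule coset_rep_eqI) (use mem[OF p] g e in auto)
      then show "p = q" using mem[OF p] mem[OF q] e by (simp add: prod_eq_iff)
    qed
    have cover: "(\<Union>p\<in>?I. C p) = ?At"
    proof (intro equalityI subsetI)
      fix x assume "x \<in> (\<Union>p\<in>?I. C p)"
      then obtain p where p: "p \<in> ?I" "x \<in> C p" by blast
      then show "x \<in> ?At" using atom_act B(3) mem[OF p(1)] by (auto simp: C_def)
    next
      fix x assume "x \<in> ?At"
      then have x: "S.atom x" "x \<in> carrier S" using atc by auto
      obtain g where g: "g \<in> carrier G" "\<rho> x = \<phi> g x" using \<rho>[OF x(2)] by blast
      define a where "a = \<rho> x"
      have a: "S.atom a" "\<rho> a = a" "a \<in> carrier S"
        using g x atom_act cl \<rho>_act by (auto simp: a_def)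
      have H: "subgroup (stab a) G" using stab a by blast
      have aB: "a \<in> B (stab a)" using a by (simp add: B_def)
      let ?r = "coset_rep G (stab a) (inv g)"
      have r: "?r \<in> carrier G" "inv ?r \<otimes> inv g \<in> stab a" using coset_rep[OF H, of "inv g"] g by simp_all
      have "x = \<phi> (inv g) a" using g inv1(1) x by (simp add: a_def)
      also have "\<dots> = \<phi> (?r \<otimes> (inv ?r \<otimes> inv g)) a" using r(1) g by (simp add: m_assoc[symmetric])
      also have "\<dots> = \<phi> ?r a"
        using act[of ?r "inv ?r \<otimes> inv g" a] fixed[OF aB r(2)] r(1) g a by simp
      finally have "x \<in> C (stab a, ?r)" using aB by (simp add: C_def)
      moreover have "(stab a, ?r) \<in> ?I" using H g coset_rep_in_reps by simp
      ultimately show "x \<in> (\<Union>p\<in>?I. C p)" by blast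
    qed
    have C_closed: "x \<in> carrier S" if "p \<in> ?I" "x \<in> C p" for p x
      using that cover atc by blast
    have finC: "finite (C p)" for p
      using B(1) by (simp add: C_def)
    have pw: "pairwise (\<lambda>p q. disjnt (C p) (C q)) ?I"
    proof (rule pairwiseI)
      fix p q assume "p \<in> ?I" "q \<in> ?I" "p \<noteq> q"
      then have "\<not> (x \<in> C p \<and> x \<in> C q)" for x using disj[of p q x] by blast
      then show "disjnt (C p) (C q)" by (auto simp: disjnt_def)
    qed
    have "finsum S (\<lambda>(H, r). \<phi> r (d H)) ?I = finsum S (\<lambda>p. finsum S (\<lambda>a. a) (C p)) ?I"
    proof (rule S.finsum_cong')
      show "(\<lambda>p. finsum S (\<lambda>a. a) (C p)) \<in> ?I \<rightarrow> carrier S"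
        by (intro Pi_I S.finsum_closed) (use C_closed in blast)
      show "(case p of (H, r) \<Rightarrow> \<phi> r (d H)) = finsum S (\<lambda>a. a) (C p)" if "p \<in> ?I" for p
        using part[OF that] by (simp add: split_beta)
    qed simp
    also have "\<dots> = finsum S (\<lambda>a. a) (\<Union>p\<in>?I. C p)"
      by (rule S.add.finprod_UN_disjoint[OF finI finC pw C_closed, symmetric])
    finally show ?thesis using cover sumAt by simp
  qed
  have 4: "\<phi> h f = f"
    if H: "subgroup H G" and f: "f \<in> carrier S" "f \<otimes>\<^bsub>S\<^esub> f = f" "d H \<otimes>\<^bsub>S\<^esub> f = f" and h: "h \<in> H" for H f h
  proof -
    have hc: "h \<in> carrier G" using subgroup.mem_carrier[OF H h] .
    have fi: "S.idem f" using f by (simp add: S.idem_def)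
    define A where "A = {a \<in> B H. f \<otimes>\<^bsub>S\<^esub> a = a}"
    have A: "finite A" "A \<subseteq> carrier S" using B by (auto simp: A_def)
    have "f = f \<otimes>\<^bsub>S\<^esub> d H" using f dc S.m_comm by simp
    also have "\<dots> = finsum S (\<lambda>a. f \<otimes>\<^bsub>S\<^esub> a) (B H)"
      unfolding d_def by (rule S.finsum_rdistr) (use B f in auto)
    also have "\<dots> = finsum S (\<lambda>a. a) A"
      unfolding A_def
    proof (rule S.add.finprod_mono_neutral_cong_right)
      show "f \<otimes>\<^bsub>S\<^esub> a = \<zero>\<^bsub>S\<^esub>" if "a \<in> B H - {a \<in> B H. f \<otimes>\<^bsub>S\<^esub> a = a}" for a
        using S.atom_mult_idem[OF B(3) fi, of a H] that by blast
    qed (use B f in auto)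
    finally have fA: "f = finsum S (\<lambda>a. a) A" .
    have "\<phi> h f = finsum S (\<phi> h) A" unfolding fA by (rule sum_act[OF hc A])
    also have "\<dots> = finsum S (\<lambda>a. a) A"
      by (rule S.finsum_cong') (use A fixed h in \<open>auto simp: A_def\<close>)
    finally show ?thesis using fA by simp
  qed
  show ?thesis
  proof (rule that[of d])
    show "d H \<otimes>\<^bsub>S\<^esub> d H = d H" for H using d_idem by (simp add: S.idem_def)
  qed (rule dc 3 | (rule 1; assumption) | (rule 2; assumption) | (rule 4; assumption))+
qed

end


section \<open>Induction of bispans\<close>

text \<open>
  The induced \<open>G\<close>-set \<open>G \<times>\<^sub>H X\<close> consists of pairs of a coset representative \<open>r\<close> and a point \<open>x\<close>,
  standing for the class of \<open>(r, x)\<close>.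
\<close>

definition ind_gset :: "('g, 'b) monoid_scheme \<Rightarrow> 'g set \<Rightarrow> 'g gset \<Rightarrow> 'g gset" where
  "ind_gset G H X = mk_gset ((\<lambda>(r, x). Tup (Elt r) x) ` (coset_reps G H \<times> pts X))
     (\<lambda>g z. case pfst z of
        Elt r \<Rightarrow> (let s = coset_rep G H (g \<otimes>\<^bsub>G\<^esub> r)
                  in Tup (Elt s) (act X (inv\<^bsub>G\<^esub> s \<otimes>\<^bsub>G\<^esub> (g \<otimes>\<^bsub>G\<^esub> r)) (psnd z)))
      | _ \<Rightarrow> z)"

definition ind_map :: "('g pt \<Rightarrow> 'g pt) \<Rightarrow> 'g pt \<Rightarrow> 'g pt" where
  "ind_map f z = Tup (pfst z) (f (psnd z))"

definition ind_bispan :: "('g, 'b) monoid_scheme \<Rightarrow> 'g set \<Rightarrow> 'g bispan \<Rightarrow> 'g bispan" where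
  "ind_bispan G H P = \<lparr>bX = ind_gset G H (bX P), bA = ind_gset G H (bA P), bB = ind_gset G H (bB P),
     bY = ind_gset G H (bY P), bres = ind_map (bres P), bnorm = ind_map (bnorm P), btr = ind_map (btr P)\<rparr>"

definition counit :: "'g gset \<Rightarrow> 'g pt \<Rightarrow> 'g pt" where
  "counit X z = (case pfst z of Elt r \<Rightarrow> act X r (psnd z) | _ \<Rightarrow> z)"

lemma ind_bispan_sel [simp]:
  "bX (ind_bispan G H P) = ind_gset G H (bX P)" "bA (ind_bispan G H P) = ind_gset G H (bA P)"
  "bB (ind_bispan G H P) = ind_gset G H (bB P)" "bY (ind_bispan G H P) = ind_gset G H (bY P)"
  "bres (ind_bispan G H P) = ind_map (bres P)" "bnorm (ind_bispan G H P) = ind_map (bnorm P)"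
  "btr (ind_bispan G H P) = ind_map (btr P)"
  by (simp_all add: ind_bispan_def)

lemma ind_map_Tup [simp]: "ind_map f (Tup a x) = Tup a (f x)"
  by (simp add: ind_map_def)

lemma Tup_in_ind_gset [simp]:
  "Tup (Elt r) x \<in> pts (ind_gset G H X) \<longleftrightarrow> r \<in> coset_reps G H \<and> x \<in> pts X"
  by (auto simp: ind_gset_def)

lemma ind_gsetE:
  assumes "z \<in> pts (ind_gset G H X)"
  obtains r x where "z = Tup (Elt r) x" "r \<in> coset_reps G H" "x \<in> pts X"
  using assms by (auto simp: ind_gset_def)

lemma act_ind_gset:
  assumes "r \<in> coset_reps G H" and "x \<in> pts X"
  shows "act (ind_gset G H X) g (Tup (Elt r) x) =
    Tup (Elt (coset_rep G H (g \<otimes>\<^bsub>G\<^esub> r)))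
      (act X (inv\<^bsub>G\<^esub> (coset_rep G H (g \<otimes>\<^bsub>G\<^esub> r)) \<otimes>\<^bsub>G\<^esub> (g \<otimes>\<^bsub>G\<^esub> r)) x)"
proof -
  have "Tup (Elt r) x \<in> (\<lambda>(r, x). Tup (Elt r) x) ` (coset_reps G H \<times> pts X)"
    using assms by auto
  then show ?thesis by (simp add: ind_gset_def Let_def)
qed

locale subgroup_of_finite = group G for G :: "('g, 'b) monoid_scheme" (structure) +
  fixes H :: "'g set"
  assumes finite_carrier: "finite (carrier G)" and H: "subgroup H G"
begin

sublocale h: group "G\<lparr>carrier := H\<rparr>"
  using H subgroup.subgroup_is_group is_group by blast

abbreviation "GH \<equiv> G\<lparr>carrier := H\<rparr>"
abbreviation "ind \<equiv> ind_gset G H"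
abbreviation "rep \<equiv> coset_rep G H"
abbreviation "reps \<equiv> coset_reps G H"

lemma H_mem: "h \<in> H \<Longrightarrow> h \<in> carrier G"
  using subgroup.mem_carrier[OF H] .

lemma reps_mem: "r \<in> reps \<Longrightarrow> r \<in> carrier G"
  using coset_reps(1)[OF H] .

lemma rep_act:
  assumes "g \<in> carrier G" and "r \<in> reps"
  shows "rep (g \<otimes> r) \<in> reps" and "rep (g \<otimes> r) \<in> carrier G"
    and "inv (rep (g \<otimes> r)) \<otimes> (g \<otimes> r) \<in> H"
proof -
  have gr: "g \<otimes> r \<in> carrier G" using assms reps_mem by simp
  then show "rep (g \<otimes> r) \<in> reps" "rep (g \<otimes> r) \<in> carrier G"
    "inv (rep (g \<otimes> r)) \<otimes> (g \<otimes> r) \<in> H"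
    using coset_rep[OF H gr] coset_rep_in_reps by blast+
qed

lemma fin_gset_restrict:
  assumes "fin_gset G X" shows "fin_gset GH X"
proof -
  have "group_action G (pts X) (act X)" and fin: "finite (pts X)"
    using assms by (auto simp: fin_gset_def)
  then have hom: "act X \<in> hom G (BijGroup (pts X))"
    by (simp add: group_action_def group_hom_def group_hom_axioms_def)
  have "act X \<in> hom GH (BijGroup (pts X))"
    using hom H_mem by (auto simp: hom_def)
  then show ?thesis
    using fin h.is_group group_BijGroup
    by (simp add: fin_gset_def group_action_def group_hom_def group_hom_axioms_def)
qed

lemma gset_map_restrict: "gset_map G X Y f \<Longrightarrow> gset_map GH X Y f"
  unfolding gset_map_def using fin_gset_restrict H_mem by (auto simp: gmap_def)

lemma is_bispan_restrict: "is_bispan G P \<Longrightarrow> is_bispan GH P"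
  unfolding is_bispan_iff using gset_map_restrict by blast

lemma res_class_bclass:
  assumes P: "is_bispan G P" shows "res_class G H (bclass G P) = bclass GH P"
proof -
  have "bclass GH Q = bclass GH P" if Q: "Q \<in> bclass G P" for Q
  proof -
    obtain \<alpha> \<beta> where "bispan_isos G P Q \<alpha> \<beta>" and bQ: "is_bispan G Q"
      using Q by (auto simp: in_bclass)
    then have "bispan_isos GH P Q \<alpha> \<beta>"
      unfolding bispan_isos_def using gset_map_restrict by blast
    then show ?thesis
      using h.bclass_eq_iff[OF is_bispan_restrict[OF P] is_bispan_restrict[OF bQ]] by blast
  qed
  then show ?thesis
    unfolding res_class_def using bclass_self[OF P] by blast
qed

lemma fin_gset_ind:
  assumes X: "fin_gset GH X"
  shows "fin_gset G (ind X)"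
proof -
  let ?S = "(\<lambda>(r, x). Tup (Elt r) x) ` (reps \<times> pts X)"
  have S: "pts (ind X) = ?S" by (simp add: ind_gset_def)
  have actH: "act X h x \<in> pts X" if "h \<in> H" "x \<in> pts X" for h x
    using h.act_closed[OF X, of h x] that by simp
  have "fin_gset G (mk_gset (pts (ind X)) (act (ind X)))"
  proof (rule fin_gset_mk_gset)
    show "finite (pts (ind X))"
      unfolding S using finite_coset_reps[OF finite_carrier] h.fin_gset_finite[OF X] by simp
  next
    fix g z assume g: "g \<in> carrier G" and "z \<in> pts (ind X)"
    then obtain r x where z: "z = Tup (Elt r) x" "r \<in> reps" "x \<in> pts X" by (elim ind_gsetE)
    then show "act (ind X) g z \<in> pts (ind X)"
      using rep_act[OF g z(2)] actH by (simp add: act_ind_gset)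
  next
    fix z assume "z \<in> pts (ind X)"
    then obtain r x where z: "z = Tup (Elt r) x" "r \<in> reps" "x \<in> pts X" by (elim ind_gsetE)
    have r: "r \<in> carrier G" "rep r = r" using coset_reps[OF H z(2)] .
    then show "act (ind X) \<one> z = z"
      using z h.act_one[OF X, of x] by (simp add: act_ind_gset)
  next
    fix g k z assume g: "g \<in> carrier G" and k: "k \<in> carrier G" and "z \<in> pts (ind X)"
    then obtain r x where z: "z = Tup (Elt r) x" "r \<in> reps" "x \<in> pts X" by (elim ind_gsetE)
    have r: "r \<in> carrier G" using reps_mem z by blast
    define s where "s = rep (k \<otimes> r)"
    define c where "c = inv s \<otimes> (k \<otimes> r)"
    define t where "t = rep (g \<otimes> s)"
    define e where "e = inv t \<otimes> (g \<otimes> s)"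
    have s: "s \<in> reps" "s \<in> carrier G" "c \<in> H" using rep_act[OF k z(2)] by (simp_all add: s_def c_def)
    have t: "t \<in> reps" "t \<in> carrier G" "e \<in> H" using rep_act[OF g s(1)] by (simp_all add: t_def e_def)
    have sc: "s \<otimes> c = k \<otimes> r" using s(2) k r by (simp add: c_def m_assoc[symmetric])
    have gk: "g \<otimes> k \<otimes> r = g \<otimes> s \<otimes> c" using sc g k r s H_mem[OF s(3)] by (simp add: m_assoc)
    have rgk: "rep (g \<otimes> k \<otimes> r) = t"
      unfolding gk t_def using coset_rep(3)[OF H _ s(3)] g s by simp
    have "inv t \<otimes> (g \<otimes> k \<otimes> r) = e \<otimes> c"
      unfolding gk e_def using g s t H_mem[OF s(3)] by (simp add: m_assoc)
    moreover have "act X (e \<otimes> c) x = act X e (act X c x)"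
      using h.act_mult[OF X, of e c x] t(3) s(3) z(3) by simp
    ultimately have "act (ind X) (g \<otimes> k) z = Tup (Elt t) (act X e (act X c x))"
      using z rgk by (simp add: act_ind_gset)
    moreover have "act (ind X) k z = Tup (Elt s) (act X c x)"
      using z by (simp add: act_ind_gset s_def c_def)
    moreover have "act (ind X) g (Tup (Elt s) (act X c x)) = Tup (Elt t) (act X e (act X c x))"
      using s z actH by (simp add: act_ind_gset t_def e_def)
    ultimately show "act (ind X) (g \<otimes> k) z = act (ind X) g (act (ind X) k z)" by simp
  qed
  moreover have "mk_gset (pts (ind X)) (act (ind X)) = ind X"
    by (auto simp: mk_gset_def ind_gset_def restrict_def fun_eq_iff)
  ultimately show ?thesis by simp
qed

lemma gset_map_ind:
  assumes f: "gset_map GH X Y f"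
  shows "gset_map G (ind X) (ind Y) (ind_map f)"
proof (rule gset_mapI)
  show "fin_gset G (ind X)" "fin_gset G (ind Y)"
    using fin_gset_ind f gset_map_dom gset_map_cod by blast+
  fix z assume "z \<in> pts (ind X)"
  then obtain r x where z: "z = Tup (Elt r) x" "r \<in> reps" "x \<in> pts X" by (elim ind_gsetE)
  then show "ind_map f z \<in> pts (ind Y)" using gset_map_in[OF f] by simp
  fix g assume g: "g \<in> carrier G"
  show "ind_map f (act (ind X) g z) = act (ind Y) g (ind_map f z)"
    using z gset_map_act[OF f, of "inv (rep (g \<otimes> r)) \<otimes> (g \<otimes> r)" x] rep_act[OF g z(2)] gset_map_in[OF f z(3)]
    by (simp add: act_ind_gset)
qed

lemma is_bispan_ind: "is_bispan GH P \<Longrightarrow> is_bispan G (ind_bispan G H P)"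
  by (simp add: is_bispan_iff gset_map_ind)

lemma bij_betw_ind: "bij_betw f (pts X) (pts Y) \<Longrightarrow> bij_betw (ind_map f) (pts (ind X)) (pts (ind Y))"
proof -
  assume f: "bij_betw f (pts X) (pts Y)"
  have "inj_on (ind_map f) (pts (ind X))"
  proof (rule inj_onI)
    fix z w assume "z \<in> pts (ind X)" "w \<in> pts (ind X)" "ind_map f z = ind_map f w"
    then show "z = w"
      using bij_betw_imp_inj_on[OF f] by (auto elim!: ind_gsetE dest: inj_onD)
  qed
  moreover have "ind_map f ` pts (ind X) = pts (ind Y)"
  proof (intro equalityI subsetI)
    fix w assume "w \<in> pts (ind Y)"
    then obtain r y where w: "w = Tup (Elt r) y" "r \<in> reps" "y \<in> pts Y" by (elim ind_gsetE)
    then obtain x where "x \<in> pts X" "y = f x" using bij_betw_imp_surj_on[OF f] by blast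
    then show "w \<in> ind_map f ` pts (ind X)" using w by (intro image_eqI[of _ _ "Tup (Elt r) x"]) simp_all
  next
    fix w assume "w \<in> ind_map f ` pts (ind X)"
    then obtain z where z: "z \<in> pts (ind X)" "w = ind_map f z" by blast
    then obtain r x where "z = Tup (Elt r) x" "r \<in> reps" "x \<in> pts X" by (elim ind_gsetE)
    then show "w \<in> pts (ind Y)" using z bij_betw_imp_surj_on[OF f] by auto
  qed
  ultimately show ?thesis by (simp add: bij_betw_def)
qed

lemma bclass_ind:
  assumes P: "is_bispan GH P" and Q: "Q \<in> bclass GH P"
  shows "bclass G (ind_bispan G H Q) = bclass G (ind_bispan G H P)"
proof -
  obtain \<alpha> \<beta> where i: "bispan_isos GH P Q \<alpha> \<beta>" and bQ: "is_bispan GH Q"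
    using Q by (auto simp: h.in_bclass)
  have "bispan_isos G (ind_bispan G H P) (ind_bispan G H Q) (ind_map \<alpha>) (ind_map \<beta>)"
    unfolding bispan_isos_def
  proof (intro conjI ballI)
    fix a assume "a \<in> pts (bA (ind_bispan G H P))"
    then obtain r x where a: "a = Tup (Elt r) x" "r \<in> reps" "x \<in> pts (bA P)" by (auto elim: ind_gsetE)
    then show "bres (ind_bispan G H Q) (ind_map \<alpha> a) = bres (ind_bispan G H P) a"
      "bnorm (ind_bispan G H Q) (ind_map \<alpha> a) = ind_map \<beta> (bnorm (ind_bispan G H P) a)"
      using i by (simp_all add: bispan_isos_def)
  next
    fix b assume "b \<in> pts (bB (ind_bispan G H P))"
    then obtain r x where b: "b = Tup (Elt r) x" "r \<in> reps" "x \<in> pts (bB P)" by (auto elim: ind_gsetE)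
    then show "btr (ind_bispan G H Q) (ind_map \<beta> b) = btr (ind_bispan G H P) b"
      using i by (simp add: bispan_isos_def)
  qed (use i in \<open>simp_all add: bispan_isos_def gset_map_ind bij_betw_ind\<close>)
  then show ?thesis
    using bclass_eq_iff is_bispan_ind P bQ by metis
qed

text \<open>
  Induction is compatible with composition because a point of an induced set and all points in a
  fibre over it have the same first component.
\<close>

lemma composite_ind:
  assumes "composite GH P Q S base ev argA argC"
  shows "composite G (ind_bispan G H P) (ind_bispan G H Q) (ind_bispan G H S) (ind_map base)
    (\<lambda>b c. Tup (pfst b) (ev (psnd b) (psnd c))) (ind_map argA) (ind_map argC)"
proof -
  interpret c: composite GH P Q S base ev argA argC by fact
  show ?thesis
  proof (rule composite.intro, rule is_group, rule composite_axioms.intro, unfold ind_bispan_sel, goal_cases)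
    case 7 show ?case using gset_map_ind[OF c.base] .
  next
    case (8 b c) then show ?case by (auto elim!: ind_gsetE simp: c.ev_in)
  next
    case (9 b c) then show ?case by (auto elim!: ind_gsetE simp: c.ev_over)
  next
    case (10 g b c)
    obtain r x where b: "b = Tup (Elt r) x" "r \<in> reps" "x \<in> pts (bB S)" using 10 by (elim ind_gsetE)
    obtain s y where c: "c = Tup (Elt s) y" "s \<in> reps" "y \<in> pts (bA Q)" using 10 by (elim ind_gsetE)
    have e: "s = r" "bnorm Q y = base x" using 10(4) b c by simp_all
    have k: "inv (rep (g \<otimes> r)) \<otimes> (g \<otimes> r) \<in> carrier GH" using rep_act[OF 10(1) b(2)] by simp
    show ?case
      using b c e c.ev_act[OF k b(3) c(3) e(2)] c.ev_in[OF b(3) c(3) e(2)] by (simp add: act_ind_gset)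
  next
    case (11 d \<sigma>)
    obtain r x where d: "d = Tup (Elt r) x" "r \<in> reps" "x \<in> pts (bB Q)" using 11(1) by (elim ind_gsetE)
    have s: "\<exists>b\<in>pts (bB P). \<sigma> (Tup (Elt r) c) = Tup (Elt r) b \<and> btr P b = bres Q c"
      if c: "c \<in> pts (bA Q)" "bnorm Q c = x" for c
    proof -
      have "\<sigma> (Tup (Elt r) c) \<in> pts (ind (bB P))" "ind_map (btr P) (\<sigma> (Tup (Elt r) c)) = Tup (Elt r) (bres Q c)"
        using 11(2)[of "Tup (Elt r) c"] c d by simp_all
      then show ?thesis by (auto elim!: ind_gsetE)
    qed
    have "\<exists>b\<in>pts (bB S). base b = x \<and> (\<forall>c\<in>pts (bA Q). bnorm Q c = x \<longrightarrow> ev b c = psnd (\<sigma> (Tup (Elt r) c)))"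
    proof (rule c.section_ex[OF d(3)])
      fix c assume c: "c \<in> pts (bA Q)" "bnorm Q c = x"
      show "psnd (\<sigma> (Tup (Elt r) c)) \<in> pts (bB P) \<and> btr P (psnd (\<sigma> (Tup (Elt r) c))) = bres Q c"
        using s[OF c] by auto
    qed
    then obtain b where b: "b \<in> pts (bB S)" "base b = x"
      "\<And>c. c \<in> pts (bA Q) \<Longrightarrow> bnorm Q c = x \<Longrightarrow> ev b c = psnd (\<sigma> (Tup (Elt r) c))" by blast
    show ?case
    proof (intro bexI[of _ "Tup (Elt r) b"] conjI ballI impI)
      fix c assume "c \<in> pts (ind (bA Q))" "ind_map (bnorm Q) c = d"
      then obtain y where c: "c = Tup (Elt r) y" "y \<in> pts (bA Q)" "bnorm Q y = x"
        using d by (auto elim!: ind_gsetE)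
      obtain b' where "\<sigma> c = Tup (Elt r) b'" using s[OF c(2,3)] c(1) by auto
      then show "Tup (pfst (Tup (Elt r) b)) (ev (psnd (Tup (Elt r) b)) (psnd c)) = \<sigma> c"
        using b(3)[OF c(2,3)] c(1) by simp
    qed (use b d in simp_all)
  next
    case (12 b b')
    obtain r x where b: "b = Tup (Elt r) x" "r \<in> reps" "x \<in> pts (bB S)" using 12 by (elim ind_gsetE)
    obtain s y where b': "b' = Tup (Elt s) y" "s \<in> reps" "y \<in> pts (bB S)" using 12 by (elim ind_gsetE)
    have e: "s = r" "base x = base y" using 12(3) b b' by simp_all
    have "x = y"
    proof (rule c.section_unique[OF b(3) b'(3) e(2)])
      fix c assume "c \<in> pts (bA Q)" "bnorm Q c = base x"
      then show "ev x c = ev y c" using 12(4)[of "Tup (Elt r) c"] b b' e by simp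
    qed
    then show ?case using b b' e by simp
  next
    case 13 show ?case using gset_map_ind[OF c.argA] .
  next
    case 14 show ?case using gset_map_ind[OF c.argC] .
  next
    case (15 a) then show ?case by (auto elim!: ind_gsetE simp: c.arg_base)
  next
    case (16 a) then show ?case by (auto elim!: ind_gsetE simp: c.arg_ev)
  next
    case (17 a b c)
    obtain r x where b: "b = Tup (Elt r) x" "r \<in> reps" "x \<in> pts (bB S)" using 17 by (elim ind_gsetE)
    obtain s y where c: "c = Tup (Elt s) y" "s \<in> reps" "y \<in> pts (bA Q)" using 17 by (elim ind_gsetE)
    obtain t w where a: "a = Tup (Elt t) w" "t \<in> reps" "w \<in> pts (bA P)" using 17 by (elim ind_gsetE)
    have e: "s = r" "t = r" "bnorm Q y = base x" "bnorm P w = ev x y" using 17(4,5) a b c by simp_all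
    obtain v where "v \<in> pts (bA S)" "argA v = w" "argC v = y" "bnorm S v = x"
      using c.arg_ex[OF a(3) b(3) c(3) e(3,4)] by blast
    then show ?case using a b c e by (intro bexI[of _ "Tup (Elt r) v"]) simp_all
  next
    case (18 a a')
    obtain r x where a: "a = Tup (Elt r) x" "r \<in> reps" "x \<in> pts (bA S)" using 18 by (elim ind_gsetE)
    obtain s y where a': "a' = Tup (Elt s) y" "s \<in> reps" "y \<in> pts (bA S)" using 18 by (elim ind_gsetE)
    have "x = y" by (rule c.arg_unique) (use 18 a a' in simp_all)
    then show ?case using 18(3) a a' by simp
  next
    case (19 a) then show ?case by (auto elim!: ind_gsetE simp: c.res_eq)
  next
    case (20 b) then show ?case by (auto elim!: ind_gsetE simp: c.tr_eq)
  qed (use c.P c.Q c.S c.objs is_bispan_ind in simp_all)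
qed

text \<open>
  This turns the disjoint unions of \<open>H\<close>-sets, which define the products and the sums of a functor on
  \<open>H\<close>-sets, into disjoint unions of \<open>G\<close>-sets.
\<close>

lemma coproduct_ind:
  assumes X: "fin_gset GH X" and Y: "fin_gset GH Y"
  shows "is_coproduct G (ind X) (ind Y) (ind (sum_gset X Y)) (ind_map In1) (ind_map In2)"
proof -
  note s = h.coproduct_sum_gset[OF X Y]
  show ?thesis
    unfolding is_coproduct_def
  proof (intro conjI)
    show "inj_on (ind_map In1) (pts (ind X))" "inj_on (ind_map In2) (pts (ind Y))"
      by (auto simp: inj_on_def elim!: ind_gsetE)
    show "ind_map In1 ` pts (ind X) \<inter> ind_map In2 ` pts (ind Y) = {}"
      by (auto elim!: ind_gsetE)
    show "ind_map In1 ` pts (ind X) \<union> ind_map In2 ` pts (ind Y) = pts (ind (sum_gset X Y))"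
    proof (intro equalityI subsetI)
      fix w assume "w \<in> pts (ind (sum_gset X Y))"
      then obtain r v where w: "w = Tup (Elt r) v" "r \<in> reps" "v \<in> pts (sum_gset X Y)" by (elim ind_gsetE)
      from w(3) show "w \<in> ind_map In1 ` pts (ind X) \<union> ind_map In2 ` pts (ind Y)"
      proof (cases rule: sum_gsetE)
        case (1 x)
        then have "w = ind_map In1 (Tup (Elt r) x)" "Tup (Elt r) x \<in> pts (ind X)" using w by simp_all
        then show ?thesis by blast
      next
        case (2 x)
        then have "w = ind_map In2 (Tup (Elt r) x)" "Tup (Elt r) x \<in> pts (ind Y)" using w by simp_all
        then show ?thesis by blast
      qed
    qed (auto elim!: ind_gsetE)
  qed (use gset_map_ind coproductD(1,2)[OF s] in simp_all)
qed


subsection \<open>The counit of induction and restriction\<close>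

lemma gset_map_counit:
  assumes X: "fin_gset G X"
  shows "gset_map G (ind X) X (counit X)"
proof (rule gset_mapI[OF fin_gset_ind[OF fin_gset_restrict[OF X]] X])
  fix z assume "z \<in> pts (ind X)"
  then obtain r x where z: "z = Tup (Elt r) x" "r \<in> reps" "x \<in> pts X" by (elim ind_gsetE)
  have r: "r \<in> carrier G" using reps_mem z by blast
  then show "counit X z \<in> pts X" using z X by (simp add: counit_def act_closed)
  fix g assume g: "g \<in> carrier G"
  let ?s = "rep (g \<otimes> r)"
  note s = rep_act[OF g z(2)]
  have "act X ?s (act X (inv ?s \<otimes> (g \<otimes> r)) x) = act X (?s \<otimes> (inv ?s \<otimes> (g \<otimes> r))) x"
    using X s(2) H_mem[OF s(3)] z(3) by (simp add: act_mult)
  also have "?s \<otimes> (inv ?s \<otimes> (g \<otimes> r)) = g \<otimes> r" using s(2) g r by (simp add: m_assoc[symmetric])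
  finally show "counit X (act (ind X) g z) = act X g (counit X z)"
    using z X g r by (simp add: counit_def act_ind_gset act_mult)
qed

text \<open>
  As \<open>G \<times>\<^sub>H X\<close> is \<open>G/H \<times> X\<close> when \<open>X\<close> is a \<open>G\<close>-set, the counit is the projection to \<open>X\<close>. These squares
  are what makes restriction along the counit natural for norms and transfers.
\<close>

lemma counit_pullback:
  assumes f: "gset_map G X Y f"
  shows "is_pullback G (ind X) X (ind Y) Y (counit X) (ind_map f) f (counit Y)"
proof -
  have X: "fin_gset G X" and Y: "fin_gset G Y" using f gset_map_dom gset_map_cod by blast+
  show ?thesis
  proof (rule is_pullbackI[OF gset_map_counit[OF X] gset_map_ind[OF gset_map_restrict[OF f]] f gset_map_counit[OF Y]])
    fix z assume "z \<in> pts (ind X)"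
    then show "f (counit X z) = counit Y (ind_map f z)"
      by (auto elim!: ind_gsetE simp: counit_def gset_map_act[OF f] reps_mem)
  next
    fix x w assume x: "x \<in> pts X" and "w \<in> pts (ind Y)" and e: "f x = counit Y w"
    then obtain r y where w: "w = Tup (Elt r) y" "r \<in> reps" "y \<in> pts Y" by (elim ind_gsetE)
    have r: "r \<in> carrier G" using reps_mem w by blast
    have "f (act X (inv r) x) = y"
      using e w x r Y by (simp add: counit_def gset_map_act[OF f] act_inv1)
    then show "\<exists>a\<in>pts (ind X). counit X a = x \<and> ind_map f a = w"
      using w x r X by (intro bexI[of _ "Tup (Elt r) (act X (inv r) x)"]) (simp_all add: counit_def act_closed act_inv2)
  next
    fix a b assume a: "a \<in> pts (ind X)" "b \<in> pts (ind X)" and e: "counit X a = counit X b" "ind_map f a = ind_map f b"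
    obtain r x where ax: "a = Tup (Elt r) x" "r \<in> reps" "x \<in> pts X" using a(1) by (elim ind_gsetE)
    obtain s y where by': "b = Tup (Elt s) y" "s \<in> reps" "y \<in> pts X" using a(2) by (elim ind_gsetE)
    have "s = r" using e(2) ax by' by simp
    have r: "r \<in> carrier G" using reps_mem ax by blast
    have "act X r x = act X r y" using e(1) ax by' \<open>s = r\<close> by (simp add: counit_def)
    then have "act X (inv r) (act X r x) = act X (inv r) (act X r y)" by (rule arg_cong)
    then have "x = y" unfolding act_inv1[OF X r ax(3)] act_inv1[OF X r by'(3)] .
    then show "a = b" using ax by' \<open>s = r\<close> by simp
  qed
qed

end


section \<open>The set of cosets of all subgroups\<close>

text \<open>
  Subgroups have to be encoded as points. The graph of the identity map on \<open>H\<close> serves this purpose,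
  since \<open>H\<close> is finite and can be read off from it.
\<close>

definition subgroup_code :: "'g set \<Rightarrow> 'g pt" where
  "subgroup_code H = Graph (Abs_fset ((\<lambda>h. (Elt h, Elt h)) ` H))"

definition subgroup_decode :: "'g pt \<Rightarrow> 'g set" where
  "subgroup_decode c = {h. (Elt h, Elt h) |\<in>| edges c}"

definition all_cosets :: "('g, 'b) monoid_scheme \<Rightarrow> 'g gset" where
  "all_cosets G = mk_gset
     ((\<lambda>(H, r). Tup (subgroup_code H) (Elt r)) ` (SIGMA H:{H. subgroup H G}. coset_reps G H))
     (\<lambda>g z. case psnd z of
        Elt r \<Rightarrow> Tup (pfst z) (Elt (coset_rep G (subgroup_decode (pfst z)) (g \<otimes>\<^bsub>G\<^esub> r)))
      | _ \<Rightarrow> z)"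

definition coset_label :: "'g set \<Rightarrow> 'g pt \<Rightarrow> 'g pt" where
  "coset_label H z = Tup (subgroup_code H) (pfst z)"

lemma decode_code: "finite H \<Longrightarrow> subgroup_decode (subgroup_code H) = H"
  by (auto simp: subgroup_code_def subgroup_decode_def Abs_fset_inverse)

context group begin

lemma finite_subgroups: "finite (carrier G) \<Longrightarrow> finite {H. subgroup H G}"
  using subgroup.subset finite_subset[of "{H. subgroup H G}" "Pow (carrier G)"] by blast

lemma finite_subgroup: "finite (carrier G) \<Longrightarrow> subgroup H G \<Longrightarrow> finite H"
  using subgroup.subset finite_subset by blast

lemma Tup_in_all_cosets:
  assumes "finite (carrier G)" and "subgroup H G"
  shows "Tup (subgroup_code H) (Elt r) \<in> pts (all_cosets G) \<longleftrightarrow> r \<in> coset_reps G H"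
proof
  assume "Tup (subgroup_code H) (Elt r) \<in> pts (all_cosets G)"
  then obtain K where K: "subgroup K G" "r \<in> coset_reps G K" "subgroup_code H = subgroup_code K"
    by (auto simp: all_cosets_def)
  then have "H = K" using decode_code finite_subgroup assms by metis
  then show "r \<in> coset_reps G H" using K by simp
qed (use assms in \<open>force simp: all_cosets_def\<close>)

lemma all_cosetsE:
  assumes "z \<in> pts (all_cosets G)"
  obtains H r where "z = Tup (subgroup_code H) (Elt r)" "subgroup H G" "r \<in> coset_reps G H"
  using assms by (auto simp: all_cosets_def)

lemma act_all_cosets:
  assumes "finite (carrier G)" and "subgroup H G" and "r \<in> coset_reps G H"
  shows "act (all_cosets G) g (Tup (subgroup_code H) (Elt r)) =
    Tup (subgroup_code H) (Elt (coset_rep G H (g \<otimes> r)))"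
proof -
  have "Tup (subgroup_code H) (Elt r) \<in>
      (\<lambda>(H, r). Tup (subgroup_code H) (Elt r)) ` (SIGMA H:{H. subgroup H G}. coset_reps G H)"
    using assms by force
  then show ?thesis
    using assms by (simp add: all_cosets_def decode_code finite_subgroup)
qed

lemma fin_gset_all_cosets:
  assumes fin: "finite (carrier G)"
  shows "fin_gset G (all_cosets G)"
proof -
  let ?T = "all_cosets G"
  have "fin_gset G (mk_gset (pts ?T) (act ?T))"
  proof (rule fin_gset_mk_gset)
    have "finite (SIGMA H:{H. subgroup H G}. coset_reps G H)"
      using finite_subgroups[OF fin] finite_coset_reps[OF fin] by blast
    then show "finite (pts ?T)" by (simp add: all_cosets_def)
  next
    fix g z assume g: "g \<in> carrier G" and "z \<in> pts ?T"
    then obtain H r where z: "z = Tup (subgroup_code H) (Elt r)" "subgroup H G" "r \<in> coset_reps G H"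
      by (elim all_cosetsE)
    have "g \<otimes> r \<in> carrier G" using coset_reps[OF z(2,3)] g by simp
    then show "act ?T g z \<in> pts ?T"
      using z fin by (simp add: act_all_cosets Tup_in_all_cosets coset_rep_in_reps)
  next
    fix z assume "z \<in> pts ?T"
    then obtain H r where z: "z = Tup (subgroup_code H) (Elt r)" "subgroup H G" "r \<in> coset_reps G H"
      by (elim all_cosetsE)
    then show "act ?T \<one> z = z"
      using fin coset_reps[OF z(2,3)] by (simp add: act_all_cosets)
  next
    fix g k z assume g: "g \<in> carrier G" and k: "k \<in> carrier G" and "z \<in> pts ?T"
    then obtain H r where z: "z = Tup (subgroup_code H) (Elt r)" "subgroup H G" "r \<in> coset_reps G H"
      by (elim all_cosetsE)
    have r: "r \<in> carrier G" using coset_reps[OF z(2,3)] by blast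
    define s where "s = coset_rep G H (k \<otimes> r)"
    have s: "s \<in> carrier G" "inv s \<otimes> (k \<otimes> r) \<in> H" "s \<in> coset_reps G H"
      using coset_rep[OF z(2), of "k \<otimes> r"] coset_rep_in_reps k r by (simp_all add: s_def)
    have "inv (g \<otimes> s) \<otimes> (g \<otimes> k \<otimes> r) = inv s \<otimes> (k \<otimes> r)"
    proof -
      have "inv (g \<otimes> s) \<otimes> (g \<otimes> k \<otimes> r) = inv s \<otimes> (inv g \<otimes> (g \<otimes> (k \<otimes> r)))"
        using g k r s(1) by (simp add: inv_mult_group m_assoc)
      also have "inv g \<otimes> (g \<otimes> (k \<otimes> r)) = k \<otimes> r"
        using g k r by (simp add: m_assoc[symmetric])
      finally show ?thesis .
    qed
    then have "coset_rep G H (g \<otimes> s) = coset_rep G H (g \<otimes> k \<otimes> r)"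
      using g k r s by (intro coset_rep_eqI[OF z(2)]) simp_all
    then show "act ?T (g \<otimes> k) z = act ?T g (act ?T k z)"
      using z s fin by (simp add: act_all_cosets s_def[symmetric])
  qed
  moreover have "mk_gset (pts ?T) (act ?T) = ?T"
    by (auto simp: mk_gset_def all_cosets_def restrict_def fun_eq_iff)
  ultimately show ?thesis by simp
qed

end

context subgroup_of_finite begin

lemma gset_map_coset_label:
  assumes X: "fin_gset GH X"
  shows "gset_map G (ind X) (all_cosets G) (coset_label H)"
proof (rule gset_mapI[OF fin_gset_ind[OF X] fin_gset_all_cosets[OF finite_carrier]])
  fix z assume "z \<in> pts (ind X)"
  then obtain r x where z: "z = Tup (Elt r) x" "r \<in> reps" "x \<in> pts X" by (elim ind_gsetE)
  then show "coset_label H z \<in> pts (all_cosets G)"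
    using H finite_carrier by (simp add: coset_label_def Tup_in_all_cosets)
  fix g assume "g \<in> carrier G"
  then show "coset_label H (act (ind X) g z) = act (all_cosets G) g (coset_label H z)"
    using z H finite_carrier by (simp add: coset_label_def act_ind_gset act_all_cosets)
qed

lemma coset_label_ind_map [simp]: "coset_label H (ind_map f z) = coset_label H z"
  by (simp add: coset_label_def ind_map_def)

end

text \<open>The pair of a coset \<open>r H\<close> and a point \<open>x\<close> corresponds to the class of \<open>(r, r\<^sup>-\<^sup>1 x)\<close> in \<open>G \<times>\<^sub>H X\<close>.\<close>

lemma (in group) all_cosets_partition:
  assumes fin: "finite (carrier G)" and X: "fin_gset G X"
  shows "is_partition G {H. subgroup H G} (\<lambda>H. ind_gset G H X) (prod_gset (all_cosets G) X)
    (\<lambda>H z. Tup (coset_label H z) (counit X z))"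
proof -
  let ?T = "all_cosets G"
  have T: "fin_gset G ?T" using fin_gset_all_cosets[OF fin] .
  have TX: "fin_gset G (prod_gset ?T X)" using fin_gset_prod_gset[OF T X] .
  let ?j = "\<lambda>H z. Tup (coset_label H z) (counit X z)"
  have j: "gset_map G (ind_gset G H X) (prod_gset ?T X) (?j H)" if H: "subgroup H G" for H
  proof -
    interpret subgroup_of_finite G H
      by (intro subgroup_of_finite.intro subgroup_of_finite_axioms.intro is_group fin H)
    have m: "gset_map G (ind X) ?T (coset_label H)" "gset_map G (ind X) X (counit X)"
      using gset_map_coset_label[OF fin_gset_restrict[OF X]] gset_map_counit[OF X] .
    show ?thesis
      by (rule gset_mapI[OF gset_map_dom[OF m(1)] TX])
        (use gset_map_in[OF m(1)] gset_map_in[OF m(2)] gset_map_act[OF m(1)] gset_map_act[OF m(2)] in simp_all)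
  qed
  have inj: "H = K \<and> z = w"
    if H: "subgroup H G" "subgroup K G" and z: "z \<in> pts (ind_gset G H X)" "w \<in> pts (ind_gset G K X)"
      and e: "?j H z = ?j K w" for H K z w
  proof -
    obtain r x where z': "z = Tup (Elt r) x" "r \<in> coset_reps G H" "x \<in> pts X" using z(1) by (elim ind_gsetE)
    obtain s y where w': "w = Tup (Elt s) y" "s \<in> coset_reps G K" "y \<in> pts X" using z(2) by (elim ind_gsetE)
    have eq: "subgroup_code H = subgroup_code K \<and> r = s \<and> act X r x = act X s y"
      using e unfolding z'(1) w'(1) by (auto simp: coset_label_def counit_def)
    note c = conjunct1[OF eq] conjunct1[OF conjunct2[OF eq]] conjunct2[OF conjunct2[OF eq]]
    have "H = K" using c(1) decode_code finite_subgroup[OF fin] H by metis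
    moreover have "r \<in> carrier G" using coset_reps[OF H(1) z'(2)] by blast
    then have "act X (inv r) (act X r x) = x" "act X (inv r) (act X r y) = y"
      using act_inv1[OF X] z'(3) w'(3) by blast+
    then have "x = y" using c(2,3) by metis
    ultimately show ?thesis using z' w' c by simp
  qed
  show ?thesis
    unfolding is_partition_def
  proof (intro conjI ballI impI)
    show "finite {H. subgroup H G}" using finite_subgroups[OF fin] .
    show "inj_on (?j H) (pts (ind_gset G H X))" if "H \<in> {H. subgroup H G}" for H
      using inj that by (intro inj_onI) blast
    show "?j H ` pts (ind_gset G H X) \<inter> ?j K ` pts (ind_gset G K X) = {}"
      if "H \<in> {H. subgroup H G}" "K \<in> {H. subgroup H G}" "H \<noteq> K" for H K
    proof (rule equals0I)
      fix v assume "v \<in> ?j H ` pts (ind_gset G H X) \<inter> ?j K ` pts (ind_gset G K X)"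
      then obtain z w where "z \<in> pts (ind_gset G H X)" "w \<in> pts (ind_gset G K X)" "?j H z = ?j K w"
        by (elim IntE imageE) simp
      then show False using inj that by blast
    qed
    show "pts (prod_gset ?T X) = (\<Union>H\<in>{H. subgroup H G}. ?j H ` pts (ind_gset G H X))"
    proof (intro equalityI subsetI)
      fix v assume "v \<in> pts (prod_gset ?T X)"
      then obtain t x where v: "v = Tup t x" "t \<in> pts ?T" "x \<in> pts X" by (elim prod_gsetE)
      obtain H r where t: "t = Tup (subgroup_code H) (Elt r)" "subgroup H G" "r \<in> coset_reps G H"
        using v(2) by (elim all_cosetsE)
      have r: "r \<in> carrier G" using coset_reps[OF t(2,3)] by blast
      let ?z = "Tup (Elt r) (act X (inv r) x)"
      have "?z \<in> pts (ind_gset G H X)" "v = ?j H ?z"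
        using v t r X by (simp_all add: coset_label_def counit_def act_closed act_inv2)
      then show "v \<in> (\<Union>H\<in>{H. subgroup H G}. ?j H ` pts (ind_gset G H X))"
        using t(2) by blast
    next
      fix v assume "v \<in> (\<Union>H\<in>{H. subgroup H G}. ?j H ` pts (ind_gset G H X))"
      then obtain H z where "subgroup H G" "z \<in> pts (ind_gset G H X)" "v = ?j H z" by blast
      then show "v \<in> pts (prod_gset ?T X)" using gset_map_in[OF j] by blast
    qed
  qed (use TX j in auto)
qed


section \<open>The summands\<close>

text \<open>
  Let \<open>D\<close> be a good idempotent on the set \<open>T\<close> of all cosets with orthogonal germs and transfer \<open>1\<close>.
  Restricting it along a label \<open>l : A \<rightarrow> T\<close> gives an idempotent on every \<open>G\<close>-set over \<open>T\<close>. That \<open>H\<close>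
  fixes the idempotents below the germ of \<open>D\<close> at the coset \<open>H\<close> will make the summand of \<open>H\<close> clarified.
\<close>

locale decomposition = tambara G R for G :: "('g, 'b) monoid_scheme" (structure)
    and R :: "('g, 'r) bifunctor" +
  fixes D :: 'r
  assumes good_D: "good (all_cosets G) D"
    and orth_D: "\<And>s t. s \<in> pts (all_cosets G) \<Longrightarrow> t \<in> pts (all_cosets G) \<Longrightarrow> s \<noteq> t \<Longrightarrow>
        germ (all_cosets G) D s \<otimes>\<^bsub>Rg Fr\<^esub> germ (all_cosets G) D t = \<zero>\<^bsub>Rg Fr\<^esub>"
    and complete_D: "tr (all_cosets G) point to_point D = \<one>\<^bsub>Rg point\<^esub>"
    and fixed_D: "\<And>H f h. subgroup H G \<Longrightarrow> f \<in> obj R Fr \<Longrightarrow> f \<otimes>\<^bsub>Rg Fr\<^esub> f = f \<Longrightarrow>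
        germ (all_cosets G) D (Tup (subgroup_code H) (Elt \<one>)) \<otimes>\<^bsub>Rg Fr\<^esub> f = f \<Longrightarrow> h \<in> H \<Longrightarrow>
        orbit_action G R h f = f"
begin

abbreviation "T \<equiv> all_cosets G"

definition DD :: "'g gset \<Rightarrow> ('g pt \<Rightarrow> 'g pt) \<Rightarrow> 'r" where
  "DD A l = rs A T l D"

lemma D_closed: "D \<in> obj R T"
  using good_closed[OF good_D] .

lemma DD_good: "gset_map G A T l \<Longrightarrow> good A (DD A l)"
  unfolding DD_def using good_rs good_D by blast

lemma DD_closed: "gset_map G A T l \<Longrightarrow> DD A l \<in> obj R A"
  using DD_good good_closed by blast

lemma DD_idem: "gset_map G A T l \<Longrightarrow> DD A l \<otimes>\<^bsub>Rg A\<^esub> DD A l = DD A l"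
  using DD_good by (simp add: good_def)

lemma rs_DD:
  "gset_map G A B f \<Longrightarrow> gset_map G B T l \<Longrightarrow> (\<And>a. a \<in> pts A \<Longrightarrow> k a = l (f a)) \<Longrightarrow>
    rs A B f (DD B l) = DD A k"
  unfolding DD_def using rs_rs D_closed by blast

lemma germ_DD: "gset_map G A T l \<Longrightarrow> a \<in> pts A \<Longrightarrow> germ A (DD A l) a = germ T D (l a)"
  unfolding DD_def using germ_rs D_closed by blast

text \<open>
  The norm of the idempotent on \<open>A\<close> agrees with the idempotent on \<open>B\<close> wherever the fibres are not
  empty. Both sides being good, this is checked on germs.
\<close>

lemma DD_absorbs_norm:
  assumes f: "gset_map G A B f" and l: "gset_map G B T l"
    and k: "gset_map G A T k" "\<And>a. a \<in> pts A \<Longrightarrow> k a = l (f a)"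
  shows "DD B l \<otimes>\<^bsub>Rg B\<^esub> nm A B f (DD A k) = DD B l"
proof -
  have A: "fin_gset G A" and B: "fin_gset G B" using f gset_map_dom gset_map_cod by blast+
  interpret o: cring "Rg Fr" using cring_Rg[OF fin_gset_free_orbit] .
  have g: "good B (nm A B f (DD A k))" using good_nm[OF f DD_good[OF k(1)]] .
  show ?thesis
  proof (rule good_eqI[OF B good_mult[OF B DD_good[OF l] g] DD_good[OF l]])
    fix b assume b: "b \<in> pts B"
    let ?e = "germ T D (l b)"
    have lb: "l b \<in> pts T" using gset_map_in[OF l b] .
    have e: "?e \<in> carrier (Rg Fr)" using germ_closed[OF gset_map_cod[OF l] lb D_closed] by simp
    have ee: "?e \<otimes>\<^bsub>Rg Fr\<^esub> ?e = ?e"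
      using germ_mult[OF gset_map_cod[OF l] lb D_closed D_closed] good_D by (simp add: good_def)
    let ?I = "{a \<in> pts A. f a = b}"
    have n: "germ B (nm A B f (DD A k)) b = finprod (Rg Fr) (germ A (DD A k)) ?I"
      by (rule germ_nm[OF f DD_closed[OF k(1)] b])
    have "?e \<otimes>\<^bsub>Rg Fr\<^esub> finprod (Rg Fr) (germ A (DD A k)) ?I = ?e"
    proof (cases "?I = {}")
      case True
      have "finprod (Rg Fr) (germ A (DD A k)) ?I = \<one>\<^bsub>Rg Fr\<^esub>" unfolding True by simp
      then show ?thesis using e by simp
    next
      case False
      have "finprod (Rg Fr) (germ A (DD A k)) ?I = ?e"
      proof (rule o.finprod_idempotent[OF _ False e ee])
        show "finite ?I" using fin_gset_finite[OF A] by simp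
        show "germ A (DD A k) a = ?e" if "a \<in> ?I" for a
          using germ_DD[OF k(1)] k(2) that by simp
      qed
      then show ?thesis using ee by simp
    qed
    then show "germ B (DD B l \<otimes>\<^bsub>Rg B\<^esub> nm A B f (DD A k)) b = germ B (DD B l) b"
      using germ_mult[OF B b DD_closed[OF l] good_closed[OF g]] germ_DD[OF l b] n by simp
  qed
qed

text \<open>
  Multiplication with the idempotents does not commute with norms along maps that are not surjective.
  It does so after a further multiplication at the target, by the Frobenius formula for the transfer
  and by the previous lemma for the norm. This is what functoriality of the summands requires.
\<close>

lemma DD_absorbs:
  assumes P: "is_bispan G P"
    and lX: "gset_map G (bX P) T lX" and lB: "gset_map G (bB P) T lB" and lY: "gset_map G (bY P) T lY"
    and eA: "\<And>a. a \<in> pts (bA P) \<Longrightarrow> lX (bres P a) = lB (bnorm P a)"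
    and eB: "\<And>b. b \<in> pts (bB P) \<Longrightarrow> lY (btr P b) = lB b"
    and x: "x \<in> obj R (bX P)"
  shows "DD (bY P) lY \<otimes>\<^bsub>Rg (bY P)\<^esub> mor R (bclass G P) (DD (bX P) lX \<otimes>\<^bsub>Rg (bX P)\<^esub> x) =
    DD (bY P) lY \<otimes>\<^bsub>Rg (bY P)\<^esub> mor R (bclass G P) x"
proof -
  let ?A = "bA P" and ?B = "bB P" and ?X = "bX P" and ?Y = "bY P"
  have m: "gset_map G ?A ?X (bres P)" "gset_map G ?A ?B (bnorm P)" "gset_map G ?B ?Y (btr P)"
    using P by (auto simp: is_bispan_iff)
  interpret X: cring "Rg ?X" using cring_Rg[OF gset_map_cod[OF m(1)]] .
  interpret B: cring "Rg ?B" using cring_Rg[OF gset_map_cod[OF m(2)]] .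
  let ?lA = "\<lambda>a. lB (bnorm P a)"
  have lA: "gset_map G ?A T ?lA" using gset_map_comp[OF m(2) lB] .
  have dX: "DD ?X lX \<in> obj R ?X" and dB: "DD ?B lB \<in> obj R ?B" and dA: "DD ?A ?lA \<in> obj R ?A"
    and dY: "DD ?Y lY \<in> obj R ?Y"
    using DD_closed lX lB lA lY by blast+
  have rx: "rs ?A ?X (bres P) x \<in> obj R ?A" using rs_closed[OF m(1) x] .
  have dx: "DD ?X lX \<otimes>\<^bsub>Rg ?X\<^esub> x \<in> obj R ?X" using X.m_closed dX x by simp
  let ?v = "nm ?A ?B (bnorm P) (rs ?A ?X (bres P) x)" and ?e = "nm ?A ?B (bnorm P) (DD ?A ?lA)"
  have v: "?v \<in> obj R ?B" and e: "?e \<in> obj R ?B" using nm_closed[OF m(2)] rx dA by blast+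
  have rY: "rs ?B ?Y (btr P) (DD ?Y lY) = DD ?B lB" by (rule rs_DD[OF m(3) lY]) (simp add: eB)
  have rX: "rs ?A ?X (bres P) (DD ?X lX) = DD ?A ?lA" by (rule rs_DD[OF m(1) lX]) (simp add: eA)
  have ev: "?e \<otimes>\<^bsub>Rg ?B\<^esub> ?v \<in> obj R ?B" using B.m_closed e v by simp
  have "DD ?Y lY \<otimes>\<^bsub>Rg ?Y\<^esub> mor R (bclass G P) (DD ?X lX \<otimes>\<^bsub>Rg ?X\<^esub> x) =
      DD ?Y lY \<otimes>\<^bsub>Rg ?Y\<^esub> tr ?B ?Y (btr P) (?e \<otimes>\<^bsub>Rg ?B\<^esub> ?v)"
    unfolding mor_bispan[OF P dx] rs_mult[OF m(1) dX x] rX nm_mult[OF m(2) dA rx] ..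
  also have "\<dots> = tr ?B ?Y (btr P) (DD ?B lB \<otimes>\<^bsub>Rg ?B\<^esub> (?e \<otimes>\<^bsub>Rg ?B\<^esub> ?v))"
    unfolding frobenius[OF m(3) dY ev] rY ..
  also have "DD ?B lB \<otimes>\<^bsub>Rg ?B\<^esub> (?e \<otimes>\<^bsub>Rg ?B\<^esub> ?v) = DD ?B lB \<otimes>\<^bsub>Rg ?B\<^esub> ?v"
    using B.m_assoc[of "DD ?B lB" ?e ?v] DD_absorbs_norm[OF m(2) lB lA] dB e v by simp
  also have "tr ?B ?Y (btr P) (DD ?B lB \<otimes>\<^bsub>Rg ?B\<^esub> ?v) = DD ?Y lY \<otimes>\<^bsub>Rg ?Y\<^esub> mor R (bclass G P) x"
    unfolding mor_bispan[OF P x] frobenius[OF m(3) dY v] rY ..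
  finally show ?thesis .
qed

definition summand :: "'g set \<Rightarrow> ('g, 'r) bifunctor" where
  "summand H = \<lparr>obj = (\<lambda>X. {y \<in> obj R (ind_gset G H X).
       DD (ind_gset G H X) (coset_label H) \<otimes>\<^bsub>Rg (ind_gset G H X)\<^esub> y = y}),
     mor = (\<lambda>m x. let P = SOME P. P \<in> m in
       DD (ind_gset G H (bY P)) (coset_label H) \<otimes>\<^bsub>Rg (ind_gset G H (bY P))\<^esub>
         mor R (bclass G (ind_bispan G H P)) x)\<rparr>"

end

locale decomposition_at = decomposition G R D + subgroup_of_finite G H
  for G :: "('g, 'b) monoid_scheme" (structure) and R :: "('g, 'r) bifunctor" and D :: 'r and H :: "'g set"
begin

abbreviation "S \<equiv> summand H"
abbreviation "E X \<equiv> DD (ind X) (coset_label H)"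
abbreviation "Q X \<equiv> Rg (ind X)"

lemma obj_S: "y \<in> obj S X \<longleftrightarrow> y \<in> obj R (ind X) \<and> E X \<otimes>\<^bsub>Q X\<^esub> y = y"
  by (simp add: summand_def)

lemma cring_Q: "fin_gset GH X \<Longrightarrow> cring (Q X)"
  using cring_Rg fin_gset_ind by blast

lemma E_closed: "fin_gset GH X \<Longrightarrow> E X \<in> obj R (ind X)"
  and E_idem: "fin_gset GH X \<Longrightarrow> E X \<otimes>\<^bsub>Q X\<^esub> E X = E X"
  using DD_closed DD_idem gset_map_coset_label by blast+

lemma E_mult_in_S:
  assumes X: "fin_gset GH X" and y: "y \<in> obj R (ind X)"
  shows "E X \<otimes>\<^bsub>Q X\<^esub> y \<in> obj S X"
proof -
  interpret cring "Q X" using cring_Q[OF X] .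
  show ?thesis
    unfolding obj_S using m_assoc[of "E X" "E X" y] m_closed[of "E X" y] E_closed[OF X] E_idem[OF X] y by simp
qed

lemma mor_S:
  assumes P: "is_bispan GH P"
  shows "mor S (bclass GH P) x = E (bY P) \<otimes>\<^bsub>Q (bY P)\<^esub> mor R (bclass G (ind_bispan G H P)) x"
proof -
  define P' where "P' = (SOME P'. P' \<in> bclass GH P)"
  have P': "P' \<in> bclass GH P"
    unfolding P'_def using h.bclass_self[OF P] by (rule someI)
  then have "bY P' = bY P" by (auto simp: h.in_bclass bispan_isos_def)
  then show ?thesis
    using bclass_ind[OF P P'] by (simp add: summand_def Let_def P'_def[symmetric])
qed

lemma ind_mor_closed:
  "is_bispan GH P \<Longrightarrow> x \<in> obj R (ind (bX P)) \<Longrightarrow> mor R (bclass G (ind_bispan G H P)) x \<in> obj R (ind (bY P))"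
  using mor_closed[OF is_bispan_ind] by simp

lemma E_absorbs:
  assumes P: "is_bispan GH P" and x: "x \<in> obj R (ind (bX P))"
  shows "E (bY P) \<otimes>\<^bsub>Q (bY P)\<^esub> mor R (bclass G (ind_bispan G H P)) (E (bX P) \<otimes>\<^bsub>Q (bX P)\<^esub> x) =
    E (bY P) \<otimes>\<^bsub>Q (bY P)\<^esub> mor R (bclass G (ind_bispan G H P)) x"
proof -
  have fins: "fin_gset GH (bX P)" "fin_gset GH (bB P)" "fin_gset GH (bY P)"
    using P by (auto simp: is_bispan_def)
  show ?thesis
    using DD_absorbs[OF is_bispan_ind[OF P], of "coset_label H" "coset_label H" "coset_label H" x]
      gset_map_coset_label fins x by simp
qed

lemma ind_map_id: "z \<in> pts (ind X) \<Longrightarrow> ind_map (\<lambda>x. x) z = z"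
  by (auto elim: ind_gsetE)

lemma bclass_ind_simps:
  "gset_map GH X Y f \<Longrightarrow> bclass G (ind_bispan G H (res_bispan X Y f)) = bclass G (res_bispan (ind X) (ind Y) (ind_map f))"
  "gset_map GH X Y f \<Longrightarrow> bclass G (ind_bispan G H (norm_bispan X Y f)) = bclass G (norm_bispan (ind X) (ind Y) (ind_map f))"
  "gset_map GH X Y f \<Longrightarrow> bclass G (ind_bispan G H (tr_bispan X Y f)) = bclass G (tr_bispan (ind X) (ind Y) (ind_map f))"
  "fin_gset GH X \<Longrightarrow> bclass G (ind_bispan G H (id_bispan X)) = bclass G (id_bispan (ind X))"
proof -
  have id: "bA (id_bispan X) = X" "bB (id_bispan X) = X" "bres (id_bispan X) = (\<lambda>x. x)"
    "bnorm (id_bispan X) = (\<lambda>x. x)" "btr (id_bispan X) = (\<lambda>x. x)" for X :: "'g gset"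
    by (simp_all add: id_bispan_def)
  show "gset_map GH X Y f \<Longrightarrow> bclass G (ind_bispan G H (res_bispan X Y f)) = bclass G (res_bispan (ind X) (ind Y) (ind_map f))"
    "gset_map GH X Y f \<Longrightarrow> bclass G (ind_bispan G H (norm_bispan X Y f)) = bclass G (norm_bispan (ind X) (ind Y) (ind_map f))"
    "gset_map GH X Y f \<Longrightarrow> bclass G (ind_bispan G H (tr_bispan X Y f)) = bclass G (tr_bispan (ind X) (ind Y) (ind_map f))"
    "fin_gset GH X \<Longrightarrow> bclass G (ind_bispan G H (id_bispan X)) = bclass G (id_bispan (ind X))"
    by (rule bclass_cong; simp add: is_bispan_ind ind_map_id id)+
qed

lemma functor_S: "is_functor GH S"
  unfolding is_functor_def
proof (intro conjI allI impI ballI)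
  fix X Y m assume m: "fin_gset GH X \<and> fin_gset GH Y \<and> m \<in> bhom GH X Y"
  then obtain P where P: "is_bispan GH P" "bX P = X" "bY P = Y" "m = bclass GH P"
    by (auto simp: h.bhom_iff)
  show "mor S m \<in> obj S X \<rightarrow> obj S Y"
  proof
    fix x assume "x \<in> obj S X"
    then have "x \<in> obj R (ind X)" by (simp add: obj_S)
    then show "mor S m x \<in> obj S Y"
      using mor_S[OF P(1)] ind_mor_closed[OF P(1)] E_mult_in_S P m by simp
  qed
next
  fix X x assume X: "fin_gset GH X" and x: "x \<in> obj S X"
  then have "mor R (bclass G (id_bispan (ind X))) x = x"
    using mor_id[OF fin_gset_ind[OF X]] by (simp add: obj_S)
  then show "mor S (bclass GH (id_bispan X)) x = x"
    using mor_S[of "id_bispan X"] X x bclass_ind_simps(4)[OF X] by (simp add: obj_S)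
next
  fix X Y Z m n x
  assume a: "fin_gset GH X \<and> fin_gset GH Y \<and> fin_gset GH Z \<and> m \<in> bhom GH X Y \<and> n \<in> bhom GH Y Z"
    and x: "x \<in> obj S X"
  obtain P where P: "is_bispan GH P" "bX P = X" "bY P = Y" "m = bclass GH P"
    using a by (auto simp: h.bhom_iff)
  obtain P' where P': "is_bispan GH P'" "bX P' = Y" "bY P' = Z" "n = bclass GH P'"
    using a by (auto simp: h.bhom_iff)
  have "bY P = bX P'" using P P' by simp
  then obtain W base ev argA argC where c: "composite GH P P' W base ev argA argC"
    using h.composite_exists[OF P(1) P'(1)] by blast
  have W: "is_bispan GH W" "bX W = X" "bY W = Z"
    using composite.S[OF c] composite.objs[OF c] P P' by simp_all
  have xR: "x \<in> obj R (ind X)" using x by (simp add: obj_S)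
  have "mor S n (mor S m x) = E Z \<otimes>\<^bsub>Q Z\<^esub> mor R (bclass G (ind_bispan G H P'))
      (E Y \<otimes>\<^bsub>Q Y\<^esub> mor R (bclass G (ind_bispan G H P)) x)"
    using mor_S[OF P(1)] mor_S[OF P'(1)] P P' by simp
  also have "\<dots> = E Z \<otimes>\<^bsub>Q Z\<^esub> mor R (bclass G (ind_bispan G H P')) (mor R (bclass G (ind_bispan G H P)) x)"
    using E_absorbs[OF P'(1)] ind_mor_closed[OF P(1)] xR P P' by simp
  also have "\<dots> = E Z \<otimes>\<^bsub>Q Z\<^esub> mor R (bclass G (ind_bispan G H W)) x"
    using mor_composite[OF composite_ind[OF c]] xR P by simp
  also have "\<dots> = mor S (bcomp GH n m) x"
    using mor_S[OF W(1)] h.bcomp_composite[OF c] W P P' by simp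
  finally show "mor S (bcomp GH n m) x = mor S n (mor S m x)" by simp
qed

lemma S_res:
  assumes f: "gset_map GH X Y f" and y: "y \<in> obj S Y"
  shows "mor S (bclass GH (res_bispan X Y f)) y = rs (ind X) (ind Y) (ind_map f) y"
proof -
  have X: "fin_gset GH X" and Y: "fin_gset GH Y" using f gset_map_dom gset_map_cod by blast+
  note i = gset_map_ind[OF f]
  have "rs (ind X) (ind Y) (ind_map f) (E Y \<otimes>\<^bsub>Q Y\<^esub> y) = E X \<otimes>\<^bsub>Q X\<^esub> rs (ind X) (ind Y) (ind_map f) y"
    using rs_mult[OF i E_closed[OF Y], of y] rs_DD[OF i gset_map_coset_label[OF Y], of "coset_label H"] y
    by (simp only: obj_S coset_label_ind_map)
  then show ?thesis
    using mor_S[of "res_bispan X Y f"] f bclass_ind_simps(1)[OF f] y by (simp add: obj_S)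
qed

lemma S_tr:
  assumes f: "gset_map GH X Y f" and x: "x \<in> obj S X"
  shows "mor S (bclass GH (tr_bispan X Y f)) x = tr (ind X) (ind Y) (ind_map f) x"
proof -
  have X: "fin_gset GH X" and Y: "fin_gset GH Y" using f gset_map_dom gset_map_cod by blast+
  note i = gset_map_ind[OF f]
  have "E Y \<otimes>\<^bsub>Q Y\<^esub> tr (ind X) (ind Y) (ind_map f) x = tr (ind X) (ind Y) (ind_map f) (E X \<otimes>\<^bsub>Q X\<^esub> x)"
    using frobenius[OF i E_closed[OF Y]] rs_DD[OF i gset_map_coset_label[OF Y], of "coset_label H"] x
    by (simp add: obj_S)
  then show ?thesis
    using mor_S[of "tr_bispan X Y f"] f bclass_ind_simps(3)[OF f] x by (simp add: obj_S)
qed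

lemma S_nm:
  assumes f: "gset_map GH X Y f"
  shows "mor S (bclass GH (norm_bispan X Y f)) x = E Y \<otimes>\<^bsub>Q Y\<^esub> nm (ind X) (ind Y) (ind_map f) x"
  using mor_S[of "norm_bispan X Y f"] f bclass_ind_simps(2)[OF f] by simp

lemma S_of_empty:
  assumes Z: "fin_gset GH Z" "pts Z = {}"
  shows "\<exists>x. obj S Z = {x}"
proof -
  have e: "pts (ind Z) = {}" using Z by (auto elim: ind_gsetE)
  then obtain x where x: "obj R (ind Z) = {x}" using obj_of_empty[OF fin_gset_ind[OF Z(1)]] by blast
  have "E Z \<otimes>\<^bsub>Q Z\<^esub> x \<in> obj S Z" using E_mult_in_S[OF Z(1)] x by simp
  then have "obj S Z \<noteq> {}" by blast
  moreover have "obj S Z \<subseteq> {x}"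
    unfolding x[symmetric] using obj_S by blast
  ultimately show ?thesis by blast
qed

lemma S_sum:
  assumes X: "fin_gset GH X" and Y: "fin_gset GH Y"
  shows "bij_betw (\<lambda>z. (mor S (bclass GH (res_bispan X (sum_gset X Y) In1)) z,
      mor S (bclass GH (res_bispan Y (sum_gset X Y) In2)) z))
      (obj S (sum_gset X Y)) (obj S X \<times> obj S Y)"
proof -
  let ?Z = "sum_gset X Y"
  note s = h.coproduct_sum_gset[OF X Y]
  note i = coproductD(1)[OF s] and j = coproductD(2)[OF s]
  have Z: "fin_gset GH ?Z" using gset_map_cod[OF i] .
  note c = coproduct_ind[OF X Y]
  note i' = coproductD(1)[OF c] and j' = coproductD(2)[OF c]
  let ?r = "rs (ind X) (ind ?Z) (ind_map In1)" and ?s = "rs (ind Y) (ind ?Z) (ind_map In2)"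
  have rE: "?r (E ?Z \<otimes>\<^bsub>Q ?Z\<^esub> z) = E X \<otimes>\<^bsub>Q X\<^esub> ?r z" "?s (E ?Z \<otimes>\<^bsub>Q ?Z\<^esub> z) = E Y \<otimes>\<^bsub>Q Y\<^esub> ?s z"
    if "z \<in> obj R (ind ?Z)" for z
    using that rs_mult[OF i' E_closed[OF Z]] rs_mult[OF j' E_closed[OF Z]]
      rs_DD[OF i' gset_map_coset_label[OF Z], of "coset_label H"]
      rs_DD[OF j' gset_map_coset_label[OF Z], of "coset_label H"] by simp_all
  have eq: "(mor S (bclass GH (res_bispan X ?Z In1)) z, mor S (bclass GH (res_bispan Y ?Z In2)) z) = (?r z, ?s z)"
    if "z \<in> obj S ?Z" for z
    using S_res[OF i that] S_res[OF j that] by simp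
  have "bij_betw (\<lambda>z. (?r z, ?s z)) (obj S ?Z) (obj S X \<times> obj S Y)"
    unfolding bij_betw_def
  proof (intro conjI inj_onI equalityI subsetI)
    fix z w assume "z \<in> obj S ?Z" "w \<in> obj S ?Z" "(?r z, ?s z) = (?r w, ?s w)"
    then show "z = w" using coproduct_eqI[OF c] by (simp add: obj_S)
  next
    fix p assume "p \<in> (\<lambda>z. (?r z, ?s z)) ` obj S ?Z"
    then obtain z where z: "z \<in> obj R (ind ?Z)" "E ?Z \<otimes>\<^bsub>Q ?Z\<^esub> z = z" "p = (?r z, ?s z)" by (auto simp: obj_S)
    then have "?r z = E X \<otimes>\<^bsub>Q X\<^esub> ?r z" "?s z = E Y \<otimes>\<^bsub>Q Y\<^esub> ?s z" using rE[OF z(1)] by simp_all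
    then show "p \<in> obj S X \<times> obj S Y"
      using z rs_closed[OF i' z(1)] rs_closed[OF j' z(1)] by (simp add: obj_S)
  next
    fix p assume "p \<in> obj S X \<times> obj S Y"
    then obtain a b where p: "p = (a, b)" "a \<in> obj R (ind X)" "E X \<otimes>\<^bsub>Q X\<^esub> a = a"
      "b \<in> obj R (ind Y)" "E Y \<otimes>\<^bsub>Q Y\<^esub> b = b" by (auto simp: obj_S)
    obtain z where z: "z \<in> obj R (ind ?Z)" "?r z = a" "?s z = b" using coproduct_ex[OF c p(2,4)] by blast
    have Ez: "E ?Z \<otimes>\<^bsub>Q ?Z\<^esub> z \<in> obj S ?Z" using E_mult_in_S[OF Z z(1)] .
    have "E ?Z \<otimes>\<^bsub>Q ?Z\<^esub> z = z"
      by (rule coproduct_eqI[OF c _ z(1)]) (use Ez rE[OF z(1)] z p in \<open>simp_all add: obj_S\<close>)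
    then show "p \<in> (\<lambda>z. (?r z, ?s z)) ` obj S ?Z"
      using z p by (intro image_eqI[of _ _ z]) (simp_all add: obj_S)
  qed
  then show ?thesis
    by (subst bij_betw_cong[OF eq])
qed

lemma product_preserving_S: "product_preserving GH S"
  by (rule h.product_preservingI[OF functor_S S_of_empty S_sum])

lemma copair_S:
  assumes X: "fin_gset GH X" and a: "a \<in> obj S X" and b: "b \<in> obj S X"
  shows "copair GH S X a b \<in> obj S (sum_gset X X)"
    and "rs (ind X) (ind (sum_gset X X)) (ind_map In1) (copair GH S X a b) = a"
    and "rs (ind X) (ind (sum_gset X X)) (ind_map In2) (copair GH S X a b) = b"
proof -
  let ?Z = "sum_gset X X"
  let ?f = "\<lambda>z. (mor S (bclass GH (res_bispan X ?Z In1)) z, mor S (bclass GH (res_bispan X ?Z In2)) z)"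
  note bij = S_sum[OF X X] and s = h.coproduct_sum_gset[OF X X]
  have "(a, b) \<in> ?f ` obj S ?Z" using bij_betw_imp_surj_on[OF bij] a b by simp
  then obtain z where z: "z \<in> obj S ?Z" "?f z = (a, b)" by auto
  have un: "w = z" if "w \<in> obj S ?Z" "?f w = (a, b)" for w
    by (rule inj_onD[OF bij_betw_imp_inj_on[OF bij] _ that(1) z(1)]) (simp only: that(2) z(2))
  have "copair GH S X a b = z"
    unfolding copair_def
  proof (rule the_equality)
    show "z \<in> obj S ?Z \<and> mor S (bclass GH (res_bispan X ?Z In1)) z = a \<and>
        mor S (bclass GH (res_bispan X ?Z In2)) z = b"
      using z by simp
    fix w assume "w \<in> obj S ?Z \<and> mor S (bclass GH (res_bispan X ?Z In1)) w = a \<and>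
        mor S (bclass GH (res_bispan X ?Z In2)) w = b"
    then show "w = z" by (intro un) simp_all
  qed
  then show "copair GH S X a b \<in> obj S ?Z"
    "rs (ind X) (ind ?Z) (ind_map In1) (copair GH S X a b) = a"
    "rs (ind X) (ind ?Z) (ind_map In2) (copair GH S X a b) = b"
    using z S_res[OF coproductD(1)[OF s] z(1)] S_res[OF coproductD(2)[OF s] z(1)] by simp_all
qed

text \<open>
  Addition is the transfer along the fold map, and induction turns the fold map of \<open>X\<close> into the fold
  map of \<open>G \<times>\<^sub>H X\<close>. So sums and products in a summand are those of \<open>R\<close>, and the summand is an ideal.
\<close>

lemma ring_S:
  assumes X: "fin_gset GH X"
  shows "carrier (tambara_ring GH S X) = obj S X"
    and "\<zero>\<^bsub>tambara_ring GH S X\<^esub> = \<zero>\<^bsub>Q X\<^esub>"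
    and "a \<in> obj S X \<Longrightarrow> b \<in> obj S X \<Longrightarrow> a \<oplus>\<^bsub>tambara_ring GH S X\<^esub> b = a \<oplus>\<^bsub>Q X\<^esub> b"
    and "a \<in> obj S X \<Longrightarrow> b \<in> obj S X \<Longrightarrow> a \<otimes>\<^bsub>tambara_ring GH S X\<^esub> b = a \<otimes>\<^bsub>Q X\<^esub> b"
proof -
  let ?Z = "sum_gset X X"
  interpret q: cring "Q X" using cring_Q[OF X] .
  note iX = fin_gset_ind[OF X]
  show "carrier (tambara_ring GH S X) = obj S X" by (simp add: tambara_ring_def)
  have e: "gset_map GH empty_gset X (\<lambda>x. x)"
    by (rule gset_mapI) (use h.fin_gset_empty X in auto)
  obtain x where x: "obj S empty_gset = {x}"
    using S_of_empty[OF h.fin_gset_empty] by auto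
  then have b: "base_pt S \<in> obj S empty_gset" by (simp add: base_pt_def)
  have "pts (ind empty_gset) = {}" by (auto elim: ind_gsetE)
  then show "\<zero>\<^bsub>tambara_ring GH S X\<^esub> = \<zero>\<^bsub>Q X\<^esub>"
    using S_tr[OF e b] tr_of_empty[OF fin_gset_ind[OF h.fin_gset_empty] _ iX] b
    by (simp add: tambara_ring_def obj_S)
  note c = coproduct_ind[OF X X] and fold = h.gset_map_fold[OF X]
  note fold' = gset_map_ind[OF fold]
  assume ab: "a \<in> obj S X" "b \<in> obj S X"
  then have abR: "a \<in> obj R (ind X)" "b \<in> obj R (ind X)" by (simp_all add: obj_S)
  note cp = copair_S[OF X ab]
  have cpR: "copair GH S X a b \<in> obj R (ind ?Z)" using cp(1) by (simp add: obj_S)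
  have id: "ind_map fold_map (ind_map In1 z) = z" "ind_map fold_map (ind_map In2 z) = z" if "z \<in> pts (ind X)" for z
    using that by (auto elim: ind_gsetE)
  have id': "tr (ind X) (ind X) (\<lambda>z. ind_map fold_map (ind_map In1 z)) a = a"
    "tr (ind X) (ind X) (\<lambda>z. ind_map fold_map (ind_map In2 z)) b = b"
    "nm (ind X) (ind X) (\<lambda>z. ind_map fold_map (ind_map In1 z)) a = a"
    "nm (ind X) (ind X) (\<lambda>z. ind_map fold_map (ind_map In2 z)) b = b"
    using add.F_cong[OF gset_map_id[OF iX] id(1) abR(1)] add.F_cong[OF gset_map_id[OF iX] id(2) abR(2)]
      mul.F_cong[OF gset_map_id[OF iX] id(1) abR(1)] mul.F_cong[OF gset_map_id[OF iX] id(2) abR(2)]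
      tr_id[OF iX] nm_id[OF iX] abR by simp_all
  show "a \<oplus>\<^bsub>tambara_ring GH S X\<^esub> b = a \<oplus>\<^bsub>Q X\<^esub> b"
    using S_tr[OF fold cp(1)] tr_coproduct[OF c fold' cpR] cp id' by (simp add: tambara_ring_def[of GH])
  have "E X \<otimes>\<^bsub>Q X\<^esub> (a \<otimes>\<^bsub>Q X\<^esub> b) = a \<otimes>\<^bsub>Q X\<^esub> b"
    using q.m_assoc[of "E X" a b] ab abR E_closed[OF X] by (simp add: obj_S)
  then show "a \<otimes>\<^bsub>tambara_ring GH S X\<^esub> b = a \<otimes>\<^bsub>Q X\<^esub> b"
    using S_nm[OF fold] mul.F_coproduct[OF c fold' cpR] cp id' by (simp add: tambara_ring_def[of GH])
qed

lemma tambara_functor_S: "tambara_functor GH S"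
  unfolding tambara_functor_def
proof (intro conjI allI impI functor_S product_preserving_S)
  fix X assume X: "fin_gset GH X"
  interpret q: cring "Q X" using cring_Q[OF X] .
  note r = ring_S[OF X] and EX = E_closed[OF X]
  have cl: "a \<oplus>\<^bsub>Q X\<^esub> b \<in> obj S X" if "a \<in> obj S X" "b \<in> obj S X" for a b
    using that EX q.r_distr[of a b "E X"] q.a_closed[of a b] by (simp add: obj_S)
  have inv: "\<ominus>\<^bsub>Q X\<^esub> a \<in> obj S X" if "a \<in> obj S X" for a
    using that EX q.r_minus[of "E X" a] q.a_inv_closed[of a] by (simp add: obj_S)
  have z: "\<zero>\<^bsub>Q X\<^esub> \<in> obj S X" using EX q.zero_closed by (simp add: obj_S)
  have R: "a \<in> carrier (Q X)" if "a \<in> obj S X" for a using that by (simp add: obj_S)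
  show "group (add_monoid (tambara_ring GH S X))"
  proof (rule groupI)
    fix a b c assume "a \<in> carrier (add_monoid (tambara_ring GH S X))"
      "b \<in> carrier (add_monoid (tambara_ring GH S X))" "c \<in> carrier (add_monoid (tambara_ring GH S X))"
    then have abc: "a \<in> obj S X" "b \<in> obj S X" "c \<in> obj S X" using r(1) by simp_all
    show "a \<otimes>\<^bsub>add_monoid (tambara_ring GH S X)\<^esub> b \<otimes>\<^bsub>add_monoid (tambara_ring GH S X)\<^esub> c =
        a \<otimes>\<^bsub>add_monoid (tambara_ring GH S X)\<^esub> (b \<otimes>\<^bsub>add_monoid (tambara_ring GH S X)\<^esub> c)"
      using abc r(3) cl R q.a_assoc by simp
  next
    fix a assume "a \<in> carrier (add_monoid (tambara_ring GH S X))"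
    then have a: "a \<in> obj S X" using r(1) by simp
    show "\<exists>b\<in>carrier (add_monoid (tambara_ring GH S X)).
        b \<otimes>\<^bsub>add_monoid (tambara_ring GH S X)\<^esub> a = \<one>\<^bsub>add_monoid (tambara_ring GH S X)\<^esub>"
      using a inv[OF a] r R q.l_neg[of a] by (intro bexI[of _ "\<ominus>\<^bsub>Q X\<^esub> a"]) simp_all
  qed (use r cl z R in simp_all)
qed

text \<open>
  The \<open>G\<close>-set \<open>G \<times>\<^sub>H H/e\<close> is \<open>G/e\<close>, and an idempotent of the summand there is an idempotent of
  \<open>R(G/e)\<close> below the germ of \<open>D\<close> at the coset \<open>H\<close>.
\<close>

lemma clarified_S: "clarified GH S"
proof -
  define F where "F = free_orbit GH"
  have ptsF: "pts F = Elt ` H" and actF: "\<And>g x. x \<in> H \<Longrightarrow> act F g (Elt x) = Elt (g \<otimes> x)"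
    by (simp_all add: F_def free_orbit_def)
  interpret Hs: subgroup H G by (rule H)
  have F: "fin_gset GH F"
    unfolding F_def free_orbit_def
    by (rule h.fin_gset_mk_gset)
      (use finite_subgroup[OF finite_carrier H] H_mem in \<open>auto simp: m_assoc\<close>)
  note iF = fin_gset_ind[OF F]
  let ?p = "Tup (Elt \<one>) (Elt \<one>)"
  have one: "\<one> \<in> reps" using coset_rep_in_reps[OF one_closed, of H] by (simp add: coset_rep_def)
  have p: "?p \<in> pts (ind F)" using one ptsF by simp
  have act_p: "act (ind F) g ?p = Tup (Elt (rep g)) (Elt (inv (rep g) \<otimes> g))" if g: "g \<in> carrier G" for g
    using act_ind_gset[OF one, of "Elt \<one>" F g] ptsF actF[OF Hs.one_closed] g coset_rep[OF H g] by simp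
  let ?o = "orbit_map (ind F) ?p"
  have o: "gset_map G Fr (ind F) ?o" using gset_map_orbit_map[OF iF p] .
  have bij: "bij_betw ?o (pts Fr) (pts (ind F))"
  proof -
    have "inj_on ?o (pts Fr)"
    proof (rule inj_onI)
      fix z w assume "z \<in> pts Fr" "w \<in> pts Fr" and e: "?o z = ?o w"
      then obtain g k where gk: "z = Elt g" "g \<in> carrier G" "w = Elt k" "k \<in> carrier G" by auto
      have "rep g = rep k \<and> inv (rep g) \<otimes> g = inv (rep k) \<otimes> k"
        using e unfolding gk(1,3) by (auto simp: orbit_map_def act_p gk(2,4))
      then have "inv (rep k) \<otimes> g = inv (rep k) \<otimes> k" by (elim conjE) (erule subst)
      then have "g = k" using gk coset_rep(1)[OF H gk(4)] by simp
      then show "z = w" using gk by simp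
    qed
    moreover have "pts (ind F) \<subseteq> ?o ` pts Fr"
    proof
      fix w assume "w \<in> pts (ind F)"
      then obtain r x where "w = Tup (Elt r) x" "r \<in> reps" "x \<in> pts F" by (elim ind_gsetE)
      then obtain k where w: "w = Tup (Elt r) (Elt k)" "r \<in> reps" "k \<in> H" using ptsF by auto
      have r: "r \<in> carrier G" "rep r = r" using coset_reps[OF H w(2)] .
      have "rep (r \<otimes> k) = r" using coset_rep(3)[OF H r(1) w(3)] r by simp
      moreover have "inv r \<otimes> (r \<otimes> k) = k" using r w(3) by (simp add: m_assoc[symmetric])
      ultimately have "?o (Elt (r \<otimes> k)) = w" using act_p[of "r \<otimes> k"] r w by (simp add: orbit_map_def)
      then show "w \<in> ?o ` pts Fr" using r w by (intro image_eqI[of _ _ "Elt (r \<otimes> k)"]) simp_all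
    qed
    ultimately show ?thesis
      using gset_map_in[OF o] unfolding bij_betw_def by blast
  qed
  have germ_eqI: "z = w" if "z \<in> obj R (ind F)" "w \<in> obj R (ind F)" "germ (ind F) z ?p = germ (ind F) w ?p" for z w
  proof -
    have "tr Fr (ind F) ?o (rs Fr (ind F) ?o z) = tr Fr (ind F) ?o (rs Fr (ind F) ?o w)"
      using that(3) unfolding germ_def by (rule arg_cong)
    then show ?thesis
      unfolding add.F_rs_iso[OF o bij that(1)] add.F_rs_iso[OF o bij that(2)] .
  qed
  have fixed: "orbit_action GH S k d = d"
    if d: "d \<in> obj S F" "d \<otimes>\<^bsub>Q F\<^esub> d = d" and k: "k \<in> H" for d k
  proof -
    have dR: "d \<in> obj R (ind F)" and Ed: "E F \<otimes>\<^bsub>Q F\<^esub> d = d" using d by (simp_all add: obj_S)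
    have kG: "k \<in> carrier G" using H_mem k by blast
    define e where "e = germ (ind F) d ?p"
    have e: "e \<in> obj R Fr" "e \<otimes>\<^bsub>Rg Fr\<^esub> e = e"
      using germ_closed[OF iF p dR] germ_mult[OF iF p dR dR] d(2) by (simp_all add: e_def)
    have "germ (ind F) (E F) ?p = germ T D (Tup (subgroup_code H) (Elt \<one>))"
      using germ_DD[OF gset_map_coset_label[OF F] p] by (simp add: coset_label_def)
    then have "germ T D (Tup (subgroup_code H) (Elt \<one>)) \<otimes>\<^bsub>Rg Fr\<^esub> e = e"
      using germ_mult[OF iF p E_closed[OF F] dR] Ed by (simp add: e_def)
    then have ke: "orbit_action G R k e = e" using fixed_D[OF H e _ k] by blast
    have rm: "gset_map GH F F (right_mult GH k)"
      by (rule gset_mapI) (use F k H_mem in \<open>auto simp: ptsF actF right_mult_def m_assoc\<close>)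
    note rm' = gset_map_ind[OF rm]
    have a: "orbit_action GH S k d = rs (ind F) (ind F) (ind_map (right_mult GH k)) d"
      using S_res[OF rm d(1)] by (simp add: orbit_action_def F_def)
    have "act (ind F) k ?p = ind_map (right_mult GH k) ?p"
      using act_p[OF kG] k kG by (simp add: coset_rep_def right_mult_def)
    then have "germ (ind F) (rs (ind F) (ind F) (ind_map (right_mult GH k)) d) ?p = germ (ind F) d ?p"
      using germ_rs[OF rm' p dR] germ_act[OF iF kG p dR] ke by (simp add: e_def)
    then show ?thesis
      unfolding a using germ_eqI rs_closed[OF rm' dR] dR by blast
  qed
  show ?thesis
    unfolding clarified_def clarified_gring_def
  proof (rule notI, elim exE conjE)
    fix K d assume K: "K \<noteq> carrier GH"
      and d: "idempotent_of_type GH (tambara_ring GH S (free_orbit GH)) (orbit_action GH S) K d"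
    have dS: "d \<in> obj S F" and dd: "d \<otimes>\<^bsub>tambara_ring GH S F\<^esub> d = d"
      and st: "stabilizer GH (orbit_action GH S) d = K"
      using d ring_S(1)[OF F] unfolding idempotent_of_type_def F_def by blast+
    have "d \<otimes>\<^bsub>Q F\<^esub> d = d"
      using dd ring_S(4)[OF F dS dS] by simp
    then have "stabilizer GH (orbit_action GH S) d = H"
      using fixed[OF dS] by (auto simp: stabilizer_def)
    then show False using K st by simp
  qed
qed

end


section \<open>The decomposition\<close>

context decomposition begin

lemma decomposition_at: "subgroup H G \<Longrightarrow> decomposition_at G R D H"
  by (intro decomposition_at.intro decomposition_axioms subgroup_of_finite.intro
      subgroup_of_finite_axioms.intro is_group finite_G)

lemma fin_gset_T: "fin_gset G T"
  using fin_gset_all_cosets finite_G by blast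

lemma gset_map_TX:
  assumes "fin_gset G X"
  shows "gset_map G (prod_gset T X) T pfst" and "gset_map G (prod_gset T X) X psnd"
  using gset_map_prod_projections[OF fin_gset_T assms] .

text \<open>
  Restriction along \<open>T \<times> X \<rightarrow> X\<close> followed by multiplication with \<open>D\<close> is inverse to the transfer of the
  elements that \<open>D\<close> fixes. One composite is multiplication by the transfer of \<open>D\<close>, by the Frobenius
  formula.
\<close>

lemma tr_DD_rs:
  assumes X: "fin_gset G X" and x: "x \<in> obj R X"
  shows "tr (prod_gset T X) X psnd
    (DD (prod_gset T X) pfst \<otimes>\<^bsub>Rg (prod_gset T X)\<^esub> rs (prod_gset T X) X psnd x) = x"
proof -
  let ?P = "prod_gset T X"
  note l = gset_map_TX(1)[OF X] and q = gset_map_TX(2)[OF X]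
  interpret p: cring "Rg ?P" using cring_Rg[OF gset_map_dom[OF q]] .
  interpret X: cring "Rg X" using cring_Rg[OF X] .
  note d = DD_closed[OF l] and r = rs_closed[OF q x]
  have "is_pullback G ?P T X point pfst psnd to_point to_point"
  proof (rule is_pullbackI[OF l q gset_map_to_point[OF fin_gset_T] gset_map_to_point[OF X]])
    fix t x assume "t \<in> pts T" "x \<in> pts X"
    then show "\<exists>a\<in>pts ?P. pfst a = t \<and> psnd a = x" by (intro bexI[of _ "Tup t x"]) simp_all
  next
    fix a b assume "a \<in> pts ?P" "b \<in> pts ?P" "pfst a = pfst b" "psnd a = psnd b"
    then show "a = b" by (auto elim!: prod_gsetE)
  qed simp
  from rs_tr[OF this D_closed] have 1: "tr ?P X psnd (DD ?P pfst) = \<one>\<^bsub>Rg X\<^esub>"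
    using complete_D rs_one[OF gset_map_to_point[OF X]] by (simp add: DD_def)
  have "DD ?P pfst \<otimes>\<^bsub>Rg ?P\<^esub> rs ?P X psnd x = rs ?P X psnd x \<otimes>\<^bsub>Rg ?P\<^esub> DD ?P pfst"
    using p.m_comm d r by simp
  then show ?thesis
    using frobenius[OF q x d] 1 X.r_one[of x] x by simp
qed

text \<open>
  For the other composite, the product of the two restrictions of \<open>D\<close> to \<open>T \<times> T\<close> is good, and by
  orthogonality of the germs it is supported on the diagonal.
\<close>

lemma DD_rs_tr:
  assumes X: "fin_gset G X" and y: "y \<in> obj R (prod_gset T X)"
    and Dy: "DD (prod_gset T X) pfst \<otimes>\<^bsub>Rg (prod_gset T X)\<^esub> y = y"
  shows "DD (prod_gset T X) pfst \<otimes>\<^bsub>Rg (prod_gset T X)\<^esub>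
    rs (prod_gset T X) X psnd (tr (prod_gset T X) X psnd y) = y"
proof -
  let ?P = "prod_gset T X" and ?W = "prod_gset T (prod_gset T X)"
  note l = gset_map_TX(1)[OF X] and q = gset_map_TX(2)[OF X]
  have P: "fin_gset G ?P" using gset_map_dom[OF q] .
  note w1 = gset_map_TX(1)[OF P] and w2 = gset_map_TX(2)[OF P]
  have W: "fin_gset G ?W" using gset_map_dom[OF w1] .
  define s where "s w = pfst (psnd w)" for w :: "'g pt"
  define r where "r w = Tup (pfst w) (psnd (psnd w))" for w :: "'g pt"
  have s: "gset_map G ?W T s" unfolding s_def using gset_map_comp[OF w2 l] .
  have r: "gset_map G ?W ?P r"
    unfolding r_def using gset_map_prod_map[OF gset_map_id[OF fin_gset_T] q] .
  interpret p: cring "Rg ?P" using cring_Rg[OF P] .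
  interpret w: cring "Rg ?W" using cring_Rg[OF W] .
  have "is_pullback G ?W ?P ?P X psnd r psnd psnd"
  proof (rule is_pullbackI[OF w2 r q q])
    fix u v assume "u \<in> pts ?P" "v \<in> pts ?P" "psnd u = psnd v"
    then show "\<exists>a\<in>pts ?W. psnd a = u \<and> r a = v"
      by (intro bexI[of _ "Tup (pfst v) u"]) (auto simp: r_def elim!: prod_gsetE)
  qed (auto simp: r_def elim!: prod_gsetE)
  from rs_tr[OF this y] have 1: "rs ?P X psnd (tr ?P X psnd y) = tr ?W ?P r (rs ?W ?P psnd y)" .
  let ?d = "DD ?P pfst" and ?y = "rs ?W ?P psnd y"
  note d = DD_closed[OF l] and y' = rs_closed[OF w2 y]
  have d1: "rs ?W ?P r ?d = DD ?W pfst" by (rule rs_DD[OF r l]) (simp add: r_def)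
  have d2: "rs ?W ?P psnd ?d = DD ?W s" by (rule rs_DD[OF w2 l]) (simp add: s_def)
  have dd: "DD ?W pfst \<in> obj R ?W" "DD ?W s \<in> obj R ?W" using DD_closed w1 s by blast+
  have y2: "DD ?W s \<otimes>\<^bsub>Rg ?W\<^esub> ?y = ?y" using rs_mult[OF w2 d y] Dy d2 by simp
  define e where "e = DD ?W pfst \<otimes>\<^bsub>Rg ?W\<^esub> DD ?W s"
  have e: "good ?W e" unfolding e_def using good_mult[OF W DD_good[OF w1] DD_good[OF s]] .
  have eR: "e \<in> obj R ?W" using good_closed[OF e] .
  have ey: "e \<otimes>\<^bsub>Rg ?W\<^esub> ?y \<in> obj R ?W" using w.m_closed[of e ?y] eR y' by simp
  have "?d \<otimes>\<^bsub>Rg ?P\<^esub> rs ?P X psnd (tr ?P X psnd y) = tr ?W ?P r (DD ?W pfst \<otimes>\<^bsub>Rg ?W\<^esub> ?y)"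
    unfolding 1 using frobenius[OF r d y'] d1 by simp
  also have "DD ?W pfst \<otimes>\<^bsub>Rg ?W\<^esub> ?y = e \<otimes>\<^bsub>Rg ?W\<^esub> ?y"
    unfolding e_def using w.m_assoc[of "DD ?W pfst" "DD ?W s" ?y] dd y' y2 by simp
  finally have 2: "?d \<otimes>\<^bsub>Rg ?P\<^esub> rs ?P X psnd (tr ?P X psnd y) = tr ?W ?P r (e \<otimes>\<^bsub>Rg ?W\<^esub> ?y)" .
  \<comment> \<open>The product \<open>e\<close> vanishes off the diagonal of \<open>T \<times> T\<close>, which the map \<open>i\<close> parametrises.\<close>
  define i where "i u = Tup (pfst u) u" for u :: "'g pt"
  have i: "gset_map G ?P ?W i"
    by (rule gset_mapI[OF P W]) (auto simp: i_def elim!: prod_gsetE)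
  let ?N = "sub_gset ?W {w \<in> pts ?W. pfst w \<noteq> s w}"
  have N: "fin_gset G ?N"
  proof (rule fin_gset_sub_gset[OF W])
    fix g w assume g: "g \<in> carrier G" and w: "w \<in> {w \<in> pts ?W. pfst w \<noteq> s w}"
    have "act T g (pfst w) \<noteq> act T g (s w)"
    proof
      assume "act T g (pfst w) = act T g (s w)"
      then have "act T (inv g) (act T g (pfst w)) = act T (inv g) (act T g (s w))" by (rule arg_cong)
      then show False
        using w act_inv1[OF fin_gset_T g] gset_map_in[OF w1] gset_map_in[OF s] by auto
    qed
    then show "act ?W g w \<in> {w \<in> pts ?W. pfst w \<noteq> s w}"
      using w g gset_map_act[OF w1 g] gset_map_act[OF s g] act_closed[OF W g] by simp
  qed simp
  have Nm: "gset_map G ?N ?W (\<lambda>w. w)"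
    by (rule gset_mapI[OF N W]) auto
  have cop: "is_coproduct G ?P ?N ?W i (\<lambda>w. w)"
    unfolding is_coproduct_def
  proof (intro conjI i Nm)
    show "i ` pts ?P \<union> (\<lambda>w. w) ` pts ?N = pts ?W"
    proof (intro equalityI subsetI)
      fix w assume w: "w \<in> pts ?W"
      then have "w = i (psnd w) \<and> psnd w \<in> pts ?P \<or> pfst w \<noteq> s w"
        by (auto simp: i_def s_def elim!: prod_gsetE)
      then show "w \<in> i ` pts ?P \<union> (\<lambda>w. w) ` pts ?N" using w by auto
    qed (use gset_map_in[OF i] in auto)
  qed (auto simp: i_def s_def inj_on_def)
  have z: "rs ?N ?W (\<lambda>w. w) e = \<zero>\<^bsub>Rg ?N\<^esub>"
  proof (rule good_eqI[OF N good_rs[OF Nm e] good_zero[OF N]])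
    fix w assume w: "w \<in> pts ?N"
    then have wW: "w \<in> pts ?W" "pfst w \<noteq> s w" by auto
    have "germ ?W e w = germ T D (pfst w) \<otimes>\<^bsub>Rg Fr\<^esub> germ T D (s w)"
      unfolding e_def using germ_mult[OF W wW(1) dd] germ_DD[OF w1 wW(1)] germ_DD[OF s wW(1)] by simp
    also have "\<dots> = \<zero>\<^bsub>Rg Fr\<^esub>"
      using orth_D gset_map_in[OF w1 wW(1)] gset_map_in[OF s wW(1)] wW(2) by blast
    finally show "germ ?N (rs ?N ?W (\<lambda>w. w) e) w = germ ?N \<zero>\<^bsub>Rg ?N\<^esub> w"
      using germ_rs[OF Nm w eR] germ_zero[OF N w] by simp
  qed
  interpret n: cring "Rg ?N" using cring_Rg[OF N] .
  have ri: "rs ?P ?W i (e \<otimes>\<^bsub>Rg ?W\<^esub> ?y) = y"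
  proof -
    have a: "rs ?P ?W i (DD ?W pfst) = ?d" "rs ?P ?W i (DD ?W s) = ?d"
      by (rule rs_DD[OF i w1], simp add: i_def, rule rs_DD[OF i s], simp add: i_def s_def)
    have b: "rs ?P ?W i ?y = y"
      using rs_rs[OF i w2 _ y, of "\<lambda>u. u"] rs_id[OF P y] by (simp add: i_def)
    have "rs ?P ?W i e = ?d" unfolding e_def rs_mult[OF i dd] a by (rule DD_idem[OF l])
    then show ?thesis unfolding rs_mult[OF i eR y'] b using Dy by simp
  qed
  have rn: "rs ?N ?W (\<lambda>w. w) (e \<otimes>\<^bsub>Rg ?W\<^esub> ?y) = \<zero>\<^bsub>Rg ?N\<^esub>"
    using rs_mult[OF Nm eR y'] z rs_closed[OF Nm y'] by simp
  have "tr ?P ?P (\<lambda>u. r (i u)) y = y"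
  proof (rule trans[OF add.F_cong[OF gset_map_id[OF P] _ y] tr_id[OF P y]])
    show "r (i u) = u" if "u \<in> pts ?P" for u
      using that by (auto simp: r_def i_def elim!: prod_gsetE)
  qed
  then have "tr ?W ?P r (e \<otimes>\<^bsub>Rg ?W\<^esub> ?y) = y \<oplus>\<^bsub>Rg ?P\<^esub> \<zero>\<^bsub>Rg ?P\<^esub>"
    using tr_coproduct[OF cop r ey] ri rn tr_zero[OF gset_map_comp[OF Nm r]] by simp
  then show ?thesis
    using 2 p.r_zero[of y] y by simp
qed

definition \<eta> :: "'g gset \<Rightarrow> 'r \<Rightarrow> 'g set \<Rightarrow> 'r" where
  "\<eta> X x = (\<lambda>H\<in>{H. subgroup H G}. DD (ind_gset G H X) (coset_label H) \<otimes>\<^bsub>Rg (ind_gset G H X)\<^esub>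
     rs (ind_gset G H X) X (counit X) x)"

abbreviation "product \<equiv> tambara_prod {H. subgroup H G} (\<lambda>H. coind G H (summand H))"

lemma obj_product: "obj product X = (\<Pi>\<^sub>E H\<in>{H. subgroup H G}. obj (summand H) X)"
  by (simp add: tambara_prod_def coind_def)

lemma \<eta>_closed:
  assumes X: "fin_gset G X" and x: "x \<in> obj R X" and H: "subgroup H G"
  shows "\<eta> X x H \<in> obj (summand H) X"
proof -
  interpret decomposition_at G R D H using decomposition_at[OF H] .
  show ?thesis
    using E_mult_in_S[OF fin_gset_restrict[OF X] rs_closed[OF gset_map_counit[OF X] x]] H
    by (simp add: \<eta>_def)
qed

text \<open>
  The squares formed by the counit and the maps of a bispan of \<open>G\<close>-sets are pullbacks, so base change
  applies to its norm and its transfer.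
\<close>

lemma \<eta>_natural:
  assumes P: "is_bispan G P" and x: "x \<in> obj R (bX P)" and H: "subgroup H G"
  shows "\<eta> (bY P) (mor R (bclass G P) x) H = mor (coind G H (summand H)) (bclass G P) (\<eta> (bX P) x H)"
proof -
  interpret decomposition_at G R D H using decomposition_at[OF H] .
  let ?X = "bX P" and ?A = "bA P" and ?B = "bB P" and ?Y = "bY P"
  have m: "gset_map G ?A ?X (bres P)" "gset_map G ?A ?B (bnorm P)" "gset_map G ?B ?Y (btr P)"
    using P by (auto simp: is_bispan_iff)
  note X = gset_map_cod[OF m(1)] and A = gset_map_dom[OF m(1)]
  have mH: "gset_map G (ind ?A) (ind ?X) (ind_map (bres P))"
    using gset_map_ind[OF gset_map_restrict[OF m(1)]] .
  have PH: "is_bispan GH P" using is_bispan_restrict[OF P] .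
  note cX = gset_map_counit[OF X] and cA = gset_map_counit[OF A]
  note rx = rs_closed[OF m(1) x]
  have com: "counit ?X (ind_map (bres P) z) = bres P (counit ?A z)" if "z \<in> pts (ind ?A)" for z
    using counit_pullback[OF m(1)] that by (simp add: is_pullback_def)
  have "rs (ind ?A) ?A (counit ?A) (rs ?A ?X (bres P) x) = rs (ind ?A) ?X (\<lambda>z. bres P (counit ?A z)) x"
    by (rule rs_rs[OF cA m(1) _ x]) simp
  also have "\<dots> = rs (ind ?A) (ind ?X) (ind_map (bres P)) (rs (ind ?X) ?X (counit ?X) x)"
    by (rule rs_rs[OF mH cX _ x, symmetric]) (simp add: com)
  finally have "rs (ind ?Y) ?Y (counit ?Y) (mor R (bclass G P) x) =
      mor R (bclass G (ind_bispan G H P)) (rs (ind ?X) ?X (counit ?X) x)"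
    using mor_bispan[OF P x] mor_bispan[OF is_bispan_ind[OF PH], of "rs (ind ?X) ?X (counit ?X) x"]
      rs_closed[OF cX x] rs_tr[OF counit_pullback[OF m(3)] nm_closed[OF m(2) rx]]
      rs_nm[OF counit_pullback[OF m(2)] rx] by simp
  then have "\<eta> ?Y (mor R (bclass G P) x) H =
      E ?Y \<otimes>\<^bsub>Q ?Y\<^esub> mor R (bclass G (ind_bispan G H P)) (rs (ind ?X) ?X (counit ?X) x)"
    using H by (simp add: \<eta>_def)
  also have "\<dots> = E ?Y \<otimes>\<^bsub>Q ?Y\<^esub> mor R (bclass G (ind_bispan G H P)) (\<eta> ?X x H)"
    using E_absorbs[OF PH rs_closed[OF cX x]] H by (simp add: \<eta>_def)
  also have "\<dots> = mor (coind G H S) (bclass G P) (\<eta> ?X x H)"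
    using mor_S[OF PH] res_class_bclass[OF P] by (simp add: coind_def)
  finally show ?thesis .
qed

text \<open>
  An element of the product is a family of elements on the parts \<open>G \<times>\<^sub>H X\<close> of \<open>T \<times> X\<close>, that is, an
  element of \<open>R(T \<times> X)\<close>; the transfer of this element is its preimage.
\<close>

lemma \<eta>_bij:
  assumes X: "fin_gset G X"
  shows "bij_betw (\<eta> X) (obj R X) (obj product X)"
proof -
  let ?P = "prod_gset T X" and ?I = "{H. subgroup H G}"
  let ?j = "\<lambda>H z. Tup (coset_label H z) (counit X z)"
  note part = all_cosets_partition[OF finite_G X]
  note l = gset_map_TX(1)[OF X] and q = gset_map_TX(2)[OF X]
  interpret p: cring "Rg ?P" using cring_Rg[OF gset_map_dom[OF q]] .
  have j: "gset_map G (ind_gset G H X) ?P (?j H)" if "H \<in> ?I" for H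
    using part that by (simp add: is_partition_def)
  let ?f = "\<lambda>x. DD ?P pfst \<otimes>\<^bsub>Rg ?P\<^esub> rs ?P X psnd x"
  have f: "?f x \<in> obj R ?P" if "x \<in> obj R X" for x
    using p.m_closed[of "DD ?P pfst" "rs ?P X psnd x"] DD_closed[OF l] rs_closed[OF q that] by simp
  have jD: "rs (ind_gset G H X) ?P (?j H) (DD ?P pfst) = DD (ind_gset G H X) (coset_label H)"
    if "H \<in> ?I" for H
    by (rule rs_DD[OF j[OF that] l]) simp
  have jf: "rs (ind_gset G H X) ?P (?j H) (?f x) = \<eta> X x H" if H: "H \<in> ?I" and x: "x \<in> obj R X" for H x
  proof -
    have "rs (ind_gset G H X) ?P (?j H) (rs ?P X psnd x) = rs (ind_gset G H X) X (counit X) x"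
      by (rule rs_rs[OF j[OF H] q _ x]) simp
    then show ?thesis
      using rs_mult[OF j[OF H] DD_closed[OF l] rs_closed[OF q x]] jD[OF H] H by (simp add: \<eta>_def)
  qed
  have inj: "inj_on (\<eta> X) (obj R X)"
  proof (rule inj_onI)
    fix x x' assume x: "x \<in> obj R X" "x' \<in> obj R X" "\<eta> X x = \<eta> X x'"
    have "?f x = ?f x'"
      by (rule partition_eqI[OF part f[OF x(1)] f[OF x(2)]]) (simp only: jf x)
    then have "tr ?P X psnd (?f x) = tr ?P X psnd (?f x')" by (rule arg_cong)
    then show "x = x'" unfolding tr_DD_rs[OF X x(1)] tr_DD_rs[OF X x(2)] .
  qed
  have surj: "y \<in> \<eta> X ` obj R X" if y: "y \<in> obj product X" for y
  proof -
    have yH: "y H \<in> obj (summand H) X" if "H \<in> ?I" for H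
      using y that unfolding obj_product by (rule PiE_mem)
    have yR: "y H \<in> obj R (ind_gset G H X)"
      "DD (ind_gset G H X) (coset_label H) \<otimes>\<^bsub>Rg (ind_gset G H X)\<^esub> y H = y H" if "H \<in> ?I" for H
      using yH[OF that] by (simp_all add: summand_def)
    obtain z where z: "z \<in> obj R ?P" "\<And>H. H \<in> ?I \<Longrightarrow> rs (ind_gset G H X) ?P (?j H) z = y H"
      using partition_ex[OF part, of y] yR(1) by blast
    have dz: "DD ?P pfst \<otimes>\<^bsub>Rg ?P\<^esub> z \<in> obj R ?P"
      using p.m_closed[of "DD ?P pfst" z] DD_closed[OF l] z(1) by simp
    have "DD ?P pfst \<otimes>\<^bsub>Rg ?P\<^esub> z = z"
    proof (rule partition_eqI[OF part dz z(1)])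
      fix H assume H: "H \<in> ?I"
      show "rs (ind_gset G H X) ?P (?j H) (DD ?P pfst \<otimes>\<^bsub>Rg ?P\<^esub> z) = rs (ind_gset G H X) ?P (?j H) z"
        unfolding rs_mult[OF j[OF H] DD_closed[OF l] z(1)] jD[OF H] z(2)[OF H] by (rule yR(2)[OF H])
    qed
    from DD_rs_tr[OF X z(1) this] have fz: "?f (tr ?P X psnd z) = z" .
    have x: "tr ?P X psnd z \<in> obj R X" using tr_closed[OF q z(1)] .
    have "\<eta> X (tr ?P X psnd z) = y"
    proof (rule extensionalityI)
      show "\<eta> X (tr ?P X psnd z) \<in> extensional ?I" by (simp add: \<eta>_def)
      show "y \<in> extensional ?I" using y unfolding obj_product by (auto simp: PiE_def)
      fix H assume H: "H \<in> ?I"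
      show "\<eta> X (tr ?P X psnd z) H = y H" using jf[OF H x] fz z(2)[OF H] by simp
    qed
    then show ?thesis using x by blast
  qed
  have "\<eta> X x \<in> obj product X" if "x \<in> obj R X" for x
    unfolding obj_product
  proof (rule PiE_I)
    show "\<eta> X x H \<in> obj (summand H) X" if "H \<in> ?I" for H
      using \<eta>_closed[OF X \<open>x \<in> obj R X\<close>] that by blast
    show "\<eta> X x H = undefined" if "H \<notin> ?I" for H using that by (simp add: \<eta>_def)
  qed
  then show ?thesis
    using inj surj unfolding bij_betw_def by blast
qed

lemma natural_\<eta>: "natural_trans G R product \<eta>"
  unfolding natural_trans_def
proof (intro conjI allI impI ballI)
  fix X assume "fin_gset G X"
  then show "\<eta> X \<in> obj R X \<rightarrow> obj product X"
    using bij_betw_imp_funcset[OF \<eta>_bij] by blast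
next
  fix X Y m x assume m: "fin_gset G X \<and> fin_gset G Y \<and> m \<in> bhom G X Y" and x: "x \<in> obj R X"
  then obtain P where P: "is_bispan G P" "bX P = X" "bY P = Y" "m = bclass G P"
    by (auto simp: bhom_iff)
  show "\<eta> Y (mor R m x) = mor product m (\<eta> X x)"
  proof (rule extensionalityI)
    show "\<eta> Y (mor R m x) \<in> extensional {H. subgroup H G}" by (simp add: \<eta>_def)
    show "mor product m (\<eta> X x) \<in> extensional {H. subgroup H G}" by (simp add: tambara_prod_def)
    fix H assume "H \<in> {H. subgroup H G}"
    then show "\<eta> Y (mor R m x) H = mor product m (\<eta> X x) H"
      using \<eta>_natural[OF P(1), of x H] x P by (simp add: tambara_prod_def)
  qed
qed

lemma iso_product: "tambara_iso G R product"
proof -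
  define \<theta> where "\<theta> X = inv_into (obj R X) (\<eta> X)" for X
  have \<theta>: "\<theta> X y \<in> obj R X" "\<eta> X (\<theta> X y) = y" if "fin_gset G X" "y \<in> obj product X" for X y
    using bij_betw_imp_surj_on[OF \<eta>_bij[OF that(1)]] that(2)
    by (auto simp: \<theta>_def intro: inv_into_into f_inv_into_f)
  have \<theta>\<eta>: "\<theta> X (\<eta> X x) = x" if "fin_gset G X" "x \<in> obj R X" for X x
    using bij_betw_inv_into_left[OF \<eta>_bij[OF that(1)] that(2)] by (simp add: \<theta>_def)
  have "natural_trans G product R \<theta>"
    unfolding natural_trans_def
  proof (intro conjI allI impI ballI)
    fix X assume "fin_gset G X"
    then show "\<theta> X \<in> obj product X \<rightarrow> obj R X" using \<theta>(1) by blast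
  next
    fix X Y m y assume m: "fin_gset G X \<and> fin_gset G Y \<and> m \<in> bhom G X Y" and y: "y \<in> obj product X"
    have X: "fin_gset G X" and Y: "fin_gset G Y" and mm: "m \<in> bhom G X Y" using m by blast+
    have "mor R m \<in> obj R X \<rightarrow> obj R Y"
      using tambara_functor X Y mm unfolding tambara_functor_def is_functor_def by blast
    then have mx: "mor R m (\<theta> X y) \<in> obj R Y" using \<theta>(1)[OF X y] by blast
    have "\<eta> Y (mor R m (\<theta> X y)) = mor product m (\<eta> X (\<theta> X y))"
      using natural_\<eta> m \<theta>(1)[OF X y] unfolding natural_trans_def by blast
    then have "\<theta> Y (mor product m y) = \<theta> Y (\<eta> Y (mor R m (\<theta> X y)))"
      using \<theta>(2)[OF X y] by simp
    then show "\<theta> Y (mor product m y) = mor R m (\<theta> X y)"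
      using \<theta>\<eta>[OF Y mx] by simp
  qed
  then show ?thesis
    unfolding tambara_iso_def using natural_\<eta> \<theta>(2) \<theta>\<eta> by blast
qed

end

text \<open>
  The idempotent of the coset \<open>r H\<close> is the translate \<open>r d\<^sub>H\<close>; it depends only on the coset because \<open>H\<close>
  fixes \<open>d\<^sub>H\<close>. These idempotents are realised as the germs of a good idempotent on the set of all
  cosets.
\<close>

lemma (in tambara) exists_decomposition:
  assumes "noetherian_ring (Rg Fr)"
  shows "\<exists>D. decomposition G R D"
proof -
  let ?T = "all_cosets G" and ?\<phi> = "orbit_action G R"
  note O = fin_gset_free_orbit
  interpret o: cring "Rg Fr" using cring_Rg[OF O] .
  have rm: "gset_map G Fr Fr (right_mult G g)" if "g \<in> carrier G" for g
    by (rule gset_mapI) (use that in \<open>auto simp: O right_mult_def m_assoc\<close>)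
  have cl: "?\<phi> g x \<in> obj R Fr" if "g \<in> carrier G" "x \<in> obj R Fr" for g x
    unfolding orbit_action_def using rs_closed[OF rm] that by blast
  have one: "?\<phi> \<one> x = x" if "x \<in> obj R Fr" for x
    unfolding orbit_action_def
  proof (rule trans[OF rs_cong[OF gset_map_id[OF O] _ that] rs_id[OF O that]])
    show "right_mult G \<one> z = z" if "z \<in> pts Fr" for z
      using that by (auto simp: right_mult_def)
  qed
  have act: "?\<phi> (g \<otimes> h) x = ?\<phi> g (?\<phi> h x)" if "g \<in> carrier G" "h \<in> carrier G" "x \<in> obj R Fr" for g h x
    unfolding orbit_action_def
    by (rule rs_rs[OF rm[OF that(1)] rm[OF that(2)] _ that(3), symmetric])
      (use that in \<open>auto simp: right_mult_def m_assoc\<close>)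
  have add: "?\<phi> g (x \<oplus>\<^bsub>Rg Fr\<^esub> y) = ?\<phi> g x \<oplus>\<^bsub>Rg Fr\<^esub> ?\<phi> g y"
    if "g \<in> carrier G" "x \<in> obj R Fr" "y \<in> obj R Fr" for g x y
    unfolding orbit_action_def using rs_add[OF rm] that by blast
  have mult: "?\<phi> g (x \<otimes>\<^bsub>Rg Fr\<^esub> y) = ?\<phi> g x \<otimes>\<^bsub>Rg Fr\<^esub> ?\<phi> g y"
    if "g \<in> carrier G" "x \<in> obj R Fr" "y \<in> obj R Fr" for g x y
    unfolding orbit_action_def using rs_mult[OF rm] that by blast
  have zero: "?\<phi> g \<zero>\<^bsub>Rg Fr\<^esub> = \<zero>\<^bsub>Rg Fr\<^esub>" if "g \<in> carrier G" for g
    unfolding orbit_action_def by (rule rs_zero[OF rm[OF that]])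
  obtain d where d: "\<And>H. subgroup H G \<Longrightarrow> d H \<in> obj R Fr"
    "\<And>H. subgroup H G \<Longrightarrow> d H \<otimes>\<^bsub>Rg Fr\<^esub> d H = d H"
    "\<And>H h. subgroup H G \<Longrightarrow> h \<in> H \<Longrightarrow> ?\<phi> h (d H) = d H"
    and orth: "\<And>H K g. subgroup H G \<Longrightarrow> subgroup K G \<Longrightarrow> g \<in> carrier G \<Longrightarrow> H \<noteq> K \<or> g \<notin> H \<Longrightarrow>
      d H \<otimes>\<^bsub>Rg Fr\<^esub> ?\<phi> g (d K) = \<zero>\<^bsub>Rg Fr\<^esub>"
    and sum: "finsum (Rg Fr) (\<lambda>(H, r). ?\<phi> r (d H)) (SIGMA H:{H. subgroup H G}. coset_reps G H) = \<one>\<^bsub>Rg Fr\<^esub>"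
    and fixed: "\<And>H f h. subgroup H G \<Longrightarrow> f \<in> obj R Fr \<Longrightarrow> f \<otimes>\<^bsub>Rg Fr\<^esub> f = f \<Longrightarrow>
      d H \<otimes>\<^bsub>Rg Fr\<^esub> f = f \<Longrightarrow> h \<in> H \<Longrightarrow> ?\<phi> h f = f"
  proof (rule equivariant_idempotents[where S = "Rg Fr" and \<phi> = ?\<phi>, unfolded carrier_Rg,
        OF finite_G o.is_cring assms], goal_cases)
    case prems: (7 d)
    show ?thesis by (rule that[of d]) (fact prems)+
  qed (rule cl one act mult add zero; assumption)+
  define \<delta> where "\<delta> t = (case psnd t of Elt r \<Rightarrow> ?\<phi> r (d (subgroup_decode (pfst t))) | _ \<Rightarrow> \<zero>\<^bsub>Rg Fr\<^esub>)" for t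
  have \<delta>: "\<delta> (Tup (subgroup_code H) (Elt r)) = ?\<phi> r (d H)" if "subgroup H G" for H r
    using decode_code[OF finite_subgroup[OF finite_G that]] by (simp add: \<delta>_def)
  have orth_\<delta>: "\<delta> t \<otimes>\<^bsub>Rg Fr\<^esub> \<delta> s = \<zero>\<^bsub>Rg Fr\<^esub>" if ts: "t \<in> pts ?T" "s \<in> pts ?T" "t \<noteq> s" for t s
  proof -
    obtain H r where t: "t = Tup (subgroup_code H) (Elt r)" "subgroup H G" "r \<in> coset_reps G H"
      using ts(1) by (elim all_cosetsE)
    have r: "r \<in> carrier G" using coset_reps[OF t(2,3)] by blast
    obtain K k where s: "s = Tup (subgroup_code K) (Elt k)" "subgroup K G" "k \<in> coset_reps G K"
      using ts(2) by (elim all_cosetsE)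
    have k: "k \<in> carrier G" using coset_reps[OF s(2,3)] by blast
    have rk: "inv r \<otimes> k \<in> carrier G" using r k by simp
    have "H \<noteq> K \<or> inv r \<otimes> k \<notin> H"
    proof (rule ccontr)
      assume "\<not> ?thesis"
      then have HK: "H = K" "inv r \<otimes> k \<in> H" by blast+
      then have "coset_rep G H r = coset_rep G H k" using coset_rep_eqI[OF t(2) r k] by blast
      then have "r = k" using coset_reps(2)[OF t(2,3)] coset_reps(2)[OF s(2,3)] HK(1) by simp
      then show False using ts(3) t(1) s(1) HK by simp
    qed
    then have 0: "d H \<otimes>\<^bsub>Rg Fr\<^esub> ?\<phi> (inv r \<otimes> k) (d K) = \<zero>\<^bsub>Rg Fr\<^esub>"
      using orth[OF t(2) s(2) rk] by blast
    have "r \<otimes> (inv r \<otimes> k) = k" using r k by (simp add: m_assoc[symmetric])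
    then have "?\<phi> k (d K) = ?\<phi> r (?\<phi> (inv r \<otimes> k) (d K))" using act[OF r rk d(1)[OF s(2)]] by simp
    then have "\<delta> t \<otimes>\<^bsub>Rg Fr\<^esub> \<delta> s = ?\<phi> r (d H \<otimes>\<^bsub>Rg Fr\<^esub> ?\<phi> (inv r \<otimes> k) (d K))"
      using mult[OF r d(1)[OF t(2)] cl[OF rk d(1)[OF s(2)]]] \<delta>[OF t(2)] \<delta>[OF s(2)] t(1) s(1) by simp
    also have "\<dots> = \<zero>\<^bsub>Rg Fr\<^esub>"
      unfolding 0 by (rule zero[OF r])
    finally show ?thesis .
  qed
  have "\<exists>D. good ?T D \<and> (\<forall>t\<in>pts ?T. germ ?T D t = \<delta> t) \<and> tr ?T point to_point D = \<one>\<^bsub>Rg point\<^esub>"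
  proof (rule idempotent_realisation[OF fin_gset_all_cosets[OF finite_G] _ _ orth_\<delta>])
    fix t assume "t \<in> pts ?T"
    then obtain H r where t: "t = Tup (subgroup_code H) (Elt r)" "subgroup H G" "r \<in> coset_reps G H"
      by (elim all_cosetsE)
    have r: "r \<in> carrier G" using coset_reps[OF t(2,3)] by blast
    show "\<delta> t \<in> obj R Fr" using cl[OF r d(1)[OF t(2)]] \<delta>[OF t(2)] t(1) by simp
    show "\<delta> t \<otimes>\<^bsub>Rg Fr\<^esub> \<delta> t = \<delta> t"
      using mult[OF r d(1)[OF t(2)] d(1)[OF t(2)]] d(2)[OF t(2)] \<delta>[OF t(2)] t(1) by simp
    {
      fix g assume g: "g \<in> carrier G"
      let ?s = "coset_rep G H (g \<otimes> r)"
      have gr: "g \<otimes> r \<in> carrier G" using g r by simp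
      have s: "?s \<in> carrier G" "inv ?s \<otimes> (g \<otimes> r) \<in> H" using coset_rep[OF t(2) gr] by blast+
      have hG: "inv ?s \<otimes> (g \<otimes> r) \<in> carrier G" using s gr by simp
      have "?\<phi> (g \<otimes> r) (d H) = ?\<phi> (?s \<otimes> (inv ?s \<otimes> (g \<otimes> r))) (d H)"
        using s(1) gr by (simp add: m_assoc[symmetric])
      also have "\<dots> = ?\<phi> ?s (d H)"
        using act[OF s(1) hG d(1)[OF t(2)]] d(3)[OF t(2) s(2)] by simp
      finally show "\<delta> (act ?T g t) = ?\<phi> g (\<delta> t)"
        using act[OF g r d(1)[OF t(2)]] act_all_cosets[OF finite_G t(2,3)] \<delta>[OF t(2)] t(1) by simp
    }
  next
    let ?I = "SIGMA H:{H. subgroup H G}. coset_reps G H" and ?c = "\<lambda>(H, r). Tup (subgroup_code H) (Elt r)"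
    have I: "subgroup (fst p) G \<and> snd p \<in> carrier G" if "p \<in> ?I" for p using that coset_reps by auto
    have \<delta>c: "\<delta> (?c p) = (case p of (H, r) \<Rightarrow> ?\<phi> r (d H))" if "p \<in> ?I" for p
      using \<delta> I[OF that] by (simp add: split_beta)
    have cc: "\<delta> (?c p) \<in> obj R Fr" if "p \<in> ?I" for p
      using \<delta>c[OF that] I[OF that] cl d(1) by (simp add: split_beta)
    have "inj_on ?c ?I"
    proof (rule inj_onI)
      fix p q assume "p \<in> ?I" "q \<in> ?I" and e: "?c p = ?c q"
      then have "finite (fst p)" "finite (fst q)" using I finite_subgroup[OF finite_G] by blast+
      moreover have "subgroup_code (fst p) = subgroup_code (fst q)" "snd p = snd q"
        using e by (auto simp: split_beta)
      ultimately show "p = q" using decode_code by (metis prod_eqI)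
    qed
    then have "finsum (Rg Fr) \<delta> (?c ` ?I) = finsum (Rg Fr) (\<lambda>p. \<delta> (?c p)) ?I"
      by (intro o.finsum_reindex) (use cc in auto)
    also have "\<dots> = finsum (Rg Fr) (\<lambda>(H, r). ?\<phi> r (d H)) ?I"
    proof (rule o.finsum_cong')
      show "(\<lambda>(H, r). ?\<phi> r (d H)) \<in> ?I \<rightarrow> carrier (Rg Fr)" using cl d(1) I by auto
    qed (use \<delta>c in auto)
    finally show "finsum (Rg Fr) \<delta> (pts ?T) = \<one>\<^bsub>Rg Fr\<^esub>"
      using sum by (simp add: all_cosets_def)
  qed
  then obtain D where D: "good ?T D" "\<And>t. t \<in> pts ?T \<Longrightarrow> germ ?T D t = \<delta> t"
    "tr ?T point to_point D = \<one>\<^bsub>Rg point\<^esub>"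
    by blast
  have "decomposition G R D"
  proof (intro decomposition.intro tambara_axioms decomposition_axioms.intro)
    show "germ ?T D s \<otimes>\<^bsub>Rg Fr\<^esub> germ ?T D t = \<zero>\<^bsub>Rg Fr\<^esub>"
      if "s \<in> pts ?T" "t \<in> pts ?T" "s \<noteq> t" for s t
      using D(2) orth_\<delta> that by simp
    fix H f h assume H: "subgroup H G" and f: "f \<in> obj R Fr" "f \<otimes>\<^bsub>Rg Fr\<^esub> f = f"
      "germ ?T D (Tup (subgroup_code H) (Elt \<one>)) \<otimes>\<^bsub>Rg Fr\<^esub> f = f" and h: "h \<in> H"
    have "\<one> \<in> coset_reps G H"
      using coset_rep_in_reps[OF one_closed, of H] subgroup.one_closed[OF H] by (simp add: coset_rep_def)
    then have "germ ?T D (Tup (subgroup_code H) (Elt \<one>)) = d H"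
      using D(2) Tup_in_all_cosets[OF finite_G H] \<delta>[OF H] one[OF d(1)[OF H]] by simp
    then show "?\<phi> h f = f" using fixed[OF H f(1,2) _ h] f(3) by simp
  qed (use D in auto)
  then show ?thesis by blast
qed

theorem theorem4:
  fixes G :: "('g, 'b) monoid_scheme" and R :: "('g, 'r) bifunctor"
  assumes "group G" and "finite (carrier G)"
    and "tambara_functor G R"
    and "noetherian_ring (tambara_ring G R (free_orbit G))"
  shows "\<exists>RH :: 'g set \<Rightarrow> ('g, 'r) bifunctor.
    (\<forall>H. subgroup H G \<longrightarrow>
       tambara_functor (G\<lparr>carrier := H\<rparr>) (RH H) \<and> clarified (G\<lparr>carrier := H\<rparr>) (RH H)) \<and>
    tambara_iso G R (tambara_prod {H. subgroup H G} (\<lambda>H. coind G H (RH H)))"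
proof -
  interpret tambara G R
    using assms by (intro tambara.intro tambara_axioms.intro)
  obtain D where "decomposition G R D"
    using exists_decomposition[OF assms(4)] by blast
  then interpret decomposition G R D .
  have "tambara_functor (G\<lparr>carrier := H\<rparr>) (summand H)" "clarified (G\<lparr>carrier := H\<rparr>) (summand H)"
    if "subgroup H G" for H
    using decomposition_at.tambara_functor_S[OF decomposition_at[OF that]]
      decomposition_at.clarified_S[OF decomposition_at[OF that]] .
  then show ?thesis
    using iso_product by blast
qed

end
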